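(* In each of the types $E_6^{(1)}$, $E_7^{(1)}$ and $E_8^{(1)}$, the maps $\tilde e_i,\tilde f_i:\mathcal Z(\Lambda_0)\to\mathcal Z(\Lambda_0)\sqcup\{0\}$, $\varepsilon_i,\varphi_i:\mathcal Z(\Lambda_0)\to\mathbb Z\cup\{-\infty\}$ ($i\in I$) and $\mathrm{wt}:\mathcal Z(\Lambda_0)\to P$ defined by the signature rule endow $\mathcal Z(\Lambda_0)$ with the structure of an affine crystal, where $\mathcal Z(\Lambda_0)$ is the set of Young walls $(z^{n_r}y_r)_{r\ge0}$ with $H_{\mathrm{aff}}(z^{n_{r+1}}y_{r+1}\otimes z^{n_r}y_r)>0$ for all $r\geq 0$.
   Context: **Notation.** $\hat{\mathfrak g}$ is the untwisted affine Kac–Moody algebra of type $E_6^{(1)},E_7^{(1)}$ or $E_8^{(1)}$, with index set $I=\{0,\dots,n\}$ ($n=6,7,8$), simple roots $\alpha_i$, simple coroots $h_i$, fundamental weights $\Lambda_i$, null root $\delta$, $P=\bigoplus_i\mathbb Z\Lambda_i\oplus\mathbb Z\delta$, $\overline P=\bigoplus_i\mathbb Z\Lambda_i=P/\mathbb Z\delta$. Dynkin diagrams (Bourbaki): $E_6^{(1)}$: chain $1-3-4-5-6$ together with $4-2-0$; $E_7^{(1)}$: chain $0-1-3-4-5-6-7$ together with $4-2$; $E_8^{(1)}$: chain $0-8-7-6-5-4-3-1$ together with $4-2$. **Crystals.** An affine (resp. classical) crystal is a set $B$ with maps $\tilde e_i,\tilde f_i:B\to B\sqcup\{0\}$, $\varepsilon_i,\varphi_i:B\to\mathbb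 Z\cup\{-\infty\}$ ($i\in I$) and $\mathrm{wt}:B\to P$ (resp. $\overline P$) such that $\varphi_i(b)-\varepsilon_i(b)=\langle h_i,\mathrm{wt}(b)\rangle$; if $\tilde e_ib\in B$ then $\mathrm{wt},\varepsilon_i,\varphi_i$ change by $+\alpha_i,-1,+1$; if $\tilde f_ib\in B$ they change by $-\alpha_i,+1,-1$; $\tilde f_ib=b'$ iff $b=\tilde e_ib'$; and $\varphi_i(b)=-\infty$ implies $\tilde e_ib=\tilde f_ib=0$. On $B\otimes B'$ (underlying set $B\times B'$): $\tilde f_i(b\otimes b')=\tilde f_ib\otimes b'$ if $\varphi_i(b)>\varepsilon_i(b')$ and $b\otimes\tilde f_ib'$ otherwise; $\tilde e_i(b\otimes b')=\tilde e_ib\otimes b'$ if $\varphi_i(b)\ge\varepsilon_i(b')$ and $b\otimes\tilde e_ib'$ otherwise. The affinization of a classical crystal $C$ is $C_{\mathrm{aff}}=\{z^mc:m\in\mathbb Z,c\in C\}$ with $\mathrm{wt}(z^mc)=\mathrm{wt}(c)+m\delta$, $\varepsilon_i,\varphi_i$ as for $c$, $\tilde e_i(z^mc)=z^{m+\delta_{i0}}\tilde e_ic$, $\tilde f_i(z^mc)=z^{m-\delta_{i0}}\tilde f_ic$. **Young column patterns.** A Young column pattern is an infinite vertical strip of unit cubes indexed by $k\in\mathbb Z$ (height increasing with $k$), each cut by vertical cuts into blocks coloured by $I$. The horizontal cross-section of every cube is a grid with $w$ columns of cells (numbered $1,\dots,w$ from left to right) and two rows (upper, lower), $w=2,3,6$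 in types $E_6^{(1)},E_7^{(1)},E_8^{(1)}$. A block is the full-height prism over a union of cells. Write $u/l$ for a cross-section whose upper row has colours $u$ and lower row has colours $l$ (just $u$ if both rows agree); equally coloured cells of one cube form a single block, except that in type $E_8^{(1)}$ a cube $444444$ consists of two $4$-blocks, one over cell columns $1$–$3$ and one over cell columns $4$–$6$. Rotation by $180^\circ$ sends $u/l$ to $\mathrm{rev}(l)/\mathrm{rev}(u)$, where rev reverses a word. - $E_6^{(1)}$ (period 12): cubes $1,\dots,6$ are $44/04$; $25$; $46/44$; $35$; $44/14$; $32$; cube $k+6$ is the rotation of cube $k$ for all $k$. - $E_7^{(1)}$ (period 8): cubes $1,\dots,8$ are $332/032$; $144$; $355/335$; $446$; $257/255$; $446$; $355/335$; $144$. - $E_8^{(1)}$ (period 20): cubes $1,\dots,10$ are $775522/075552$; $866444$; $755533/775533$; $664441$; $552233/555233$; $444444$; $332555/332255$; $144466$; $335577/335557$; $444668$; cube $k+10$ is the rotation of cube $k$ for all $k$. **Young columns.** A Young column is a nonempty collection of blocks of the pattern of bounded height with no empty space below any block: if a block of cube $k$ belongs to it, so does every block of cube $k-1$ lying below at least one of its cells. Young columns are equivalent if obtained from one another by vertical translation and/or rotation by $180^\circ$ about the vertical axis. In type $E_8^{(1)}$ two further equivalence classes of collections also count as Young columns, those of: (S1) all blocks of cubes $k\le4$, the $5$- and $3$-blocks of cube 5, and the $4$-block over cell columns 4–6 of cube 6; (S2) all blocks of cubes $k\le5$, the $4$-block over cell columns 4–6 of cube 6, and the $2$-block of cube 7.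 An $i$-block of a Young column is removable if removing it leaves a Young column; an $i$-block not in it is addable if adding it gives a Young column. $\tilde f_i$ adds an addable $i$-block if one exists and gives $0$ otherwise; $\tilde e_i$ removes a removable $i$-block if one exists and gives $0$ otherwise; in type $E_8^{(1)}$ with these rules: (a) if there are two addable $i$-blocks, $\tilde f_i$ adds the higher one if $i\ne4$ and the one lying on top of a $5$-block if $i=4$; if there are two removable $i$-blocks, $\tilde e_i$ removes the lower one if $i\neq4$ and the one lying on top of a $3$-block if $i=4$; (b) if a Young column $y$ is obtained by adding (resp. removing) an $i$-block to (from) another Young column by these rules and $y$ itself has an addable (resp. removable) $i$-block, then $\tilde f_j(y)=\tilde e_j(y)=0$ for all $j\neq i$. Put $\varphi_i(y)=\max\{m:\tilde f_i^my\ne0\}$, $\varepsilon_i(y)=\max\{m:\tilde e_i^my\neq0\}$. The set $C$ of equivalence classes becomes a classical crystal with $\mathrm{wt}(y)=\sum_i(\varphi_i(y)-\varepsilon_i(y))\Lambda_i$. **Energy functions.** $H:C\otimes C\to\mathbb Z$ is the function with $H(\tilde f_i(b\otimes b'))=H(b\otimes b')$ for $i\ne0$, and, when $\tilde f_0(b\otimes b')\neq0$, $H(\tilde f_0(b\otimes b'))=H(b\otimes b')+1$ if $\tilde f_0(b\otimes b')=\tilde f_0b\otimes b'$ and $H(b\otimes b')-1$ if $\tilde f_0(b\otimes b')=b\otimes\tilde f_0b'$; normalised by $H(c\otimes c)=0$ for extremal $c$ (all $c$ in types $E_6^{(1)},E_7^{(1)}$; all $c$ of nonzero weight in type $E_8^{(1)}$).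 $H_{\mathrm{aff}}(z^ma\otimes z^nb)=H(a\otimes b)+m-n$. **Young walls.** The Young wall pattern has columns indexed $r=0,1,2,\dots$ from right to left. In type $E_6^{(1)}$, cube $k$ of column $r$ is cube $k+8r$ of the Young column pattern; in type $E_7^{(1)}$, column $r$ is the Young column pattern for $r$ even, and for $r$ odd its cube $k$ is the rotation of cube $k+4$ of the Young column pattern; in type $E_8^{(1)}$ every column is the Young column pattern. Each column pattern is thus a translated/rotated copy of the Young column pattern, so Young columns in column $r$, their classes in $C$ and the operators $\tilde e_i,\tilde f_i$ make sense. The ground state wall consists in every column $r$ of all blocks of cubes $k\le0$ together with: ($E_6^{(1)}$) the three-cell block of cube 1, the block over cell column 2 of cube 2, the one-cell block of cube 3; ($E_7^{(1)}$) all blocks of cube 1 except the one-cell block, the block over cell columns 2–3 of cube 2, the block of cube 3 containing cell column 3, the block over cell column 3 of cube 4, the one-cell block of cube 5; ($E_8^{(1)}$) the blocks of colours $7,5,2$ in cube 1; $6,4$ in cube 2; $5,3$ in cube 3; $4,1$ in cube 4; $2,3$ in cube 5; the $4$-block over cell columns 4–6 in cube 6; and the blocks of colours $5,6,7,8,0$ in cubes $7,8,9,10,11$ respectively. Let $b_r\in C$ be the class of column $r$ of the ground state wall, and let $m_r\in\mathbb Z$ be given by $m_0=0$ and $H_{\mathrm{aff}}(z^{m_{r+1}}b_{r+1}\otimes z^{m_r}b_r)=1$ for all $r\ge0$. A Young wall is a collection of blocks of the Young wall pattern which differs from the ground state wall in finitely many blocks and each of whose columns is a Young column. The Young columns in column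 $r$ are identified with the elements $z^my$ of $C_{\mathrm{aff}}$ by the bijection commuting with all $\tilde e_i,\tilde f_i$ which sends column $r$ of the ground state wall to $z^{m_r}b_r$; so a Young wall is written $(z^{n_r}y_r)_{r\ge0}$. **The maps.** Let $\mathrm{sign}_i(y)$ be $\varepsilon_i(y)$ signs $-$ followed by $\varphi_i(y)$ signs $+$. For a Young wall $Y=(z^{n_r}y_r)_{r\ge0}$, cancelling all $+-$ pairs in $\cdots\mathrm{sign}_i(y_2)\,\mathrm{sign}_i(y_1)\,\mathrm{sign}_i(y_0)$ leaves finitely many $-$'s followed by finitely many $+$'s, denoted $\mathrm{sign}_i(Y)$. $\tilde e_i(Y)$ is obtained by applying $\tilde e_i$ to the column containing the rightmost $-$ of $\mathrm{sign}_i(Y)$ ($0$ if there is none); $\tilde f_i(Y)$ by applying $\tilde f_i$ to the column containing the leftmost $+$ ($0$ if there is none); $\varepsilon_i(Y)$, $\varphi_i(Y)$ are the numbers of $-$'s and $+$'s in $\mathrm{sign}_i(Y)$; $\mathrm{wt}(Y)=\Lambda_0-\sum_ik_i\alpha_i$ where $k_i$ is the difference in the number of $i$-blocks between $Y$ and the ground state wall. *)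

theory Defs
  imports
    "HOL-Library.Extended"
    "HOL-Library.Function_Algebras"
    "HOL-Library.Product_Plus"
begin

section \<open>Affine types and weights\<close>

datatype affine_type = E6 | E7 | E8

fun rank :: "affine_type \<Rightarrow> nat" where
  "rank E6 = 6"
| "rank E7 = 7"
| "rank E8 = 8"

definition index_set :: "affine_type \<Rightarrow> nat set" where
  "index_set t = {0..rank t}"

fun dynkin_edges :: "affine_type \<Rightarrow> nat set set" where
  "dynkin_edges E6 = {{1,3}, {3,4}, {4,5}, {5,6}, {4,2}, {2,0}}"
| "dynkin_edges E7 = {{0,1}, {1,3}, {3,4}, {4,5}, {5,6}, {6,7}, {4,2}}"
| "dynkin_edges E8 = {{0,8}, {8,7}, {7,6}, {6,5}, {5,4}, {4,3}, {3,1}, {4,2}}"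

definition cartan :: "affine_type \<Rightarrow> nat \<Rightarrow> nat \<Rightarrow> int" where
  "cartan t i j = (if i = j then 2 else if {i, j} \<in> dynkin_edges t then -1 else 0)"

text \<open>The pair \<open>(l, d)\<close> stands for \<open>(\<Sum>i. l i \<cdot> \<Lambda>\<^sub>i) + d \<cdot> \<delta>\<close>.\<close>
type_synonym weight = "(nat \<Rightarrow> int) \<times> int"

definition weight_lattice :: "affine_type \<Rightarrow> weight set" where
  "weight_lattice t = {(l, d). \<forall>i. i \<notin> index_set t \<longrightarrow> l i = 0}"

definition scale :: "int \<Rightarrow> weight \<Rightarrow> weight" where
  "scale k = (\<lambda>(l, d). (\<lambda>i. k * l i, k * d))"

definition fundamental_weight :: "nat \<Rightarrow> weight" where
  "fundamental_weight i = ((\<lambda>j. if j = i then 1 else 0), 0)"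

definition null_root :: weight where
  "null_root = (0, 1)"

text \<open>The coefficient of \<open>\<delta>\<close> is normalised so that it is 1 in \<open>\<alpha>\<^sub>0\<close> and 0 in the other
  simple roots; as the mark of the node 0 is 1, \<open>\<delta>\<close> is then the null root
  \<open>\<Sum>i. a\<^sub>i \<cdot> \<alpha>\<^sub>i\<close>.\<close>
definition simple_root :: "affine_type \<Rightarrow> nat \<Rightarrow> weight" where
  "simple_root t i = (\<Sum>j\<in>index_set t. scale (cartan t j i) (fundamental_weight j))
     + (if i = 0 then null_root else 0)"

definition coroot_pairing :: "nat \<Rightarrow> weight \<Rightarrow> int" where
  "coroot_pairing i = (\<lambda>(l, d). l i)"


section \<open>Affine crystals\<close>

text \<open>The element 0 is \<^const>\<open>None\<close>. The equation \<open>\<phi>\<^sub>i - \<epsilon>\<^sub>i = \<langle>h\<^sub>i, wt\<rangle>\<close> is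
  written additively, so that it also makes sense at \<open>-\<infinity>\<close>.\<close>
definition affine_crystal ::
  "affine_type \<Rightarrow> 'b set \<Rightarrow> (nat \<Rightarrow> 'b \<Rightarrow> 'b option) \<Rightarrow> (nat \<Rightarrow> 'b \<Rightarrow> 'b option)
    \<Rightarrow> (nat \<Rightarrow> 'b \<Rightarrow> int extended) \<Rightarrow> (nat \<Rightarrow> 'b \<Rightarrow> int extended) \<Rightarrow> ('b \<Rightarrow> weight) \<Rightarrow> bool"
where
  "affine_crystal t B e f \<epsilon> \<phi> wt \<longleftrightarrow>
     (\<forall>b\<in>B. wt b \<in> weight_lattice t) \<and>
     (\<forall>i\<in>index_set t. \<forall>b\<in>B.
        e i b \<in> insert None (Some ` B) \<and> f i b \<in> insert None (Some ` B) \<and>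
        \<epsilon> i b \<noteq> Pinf \<and> \<phi> i b \<noteq> Pinf \<and>
        \<phi> i b = \<epsilon> i b + Fin (coroot_pairing i (wt b)) \<and>
        (\<forall>b'. e i b = Some b' \<longrightarrow>
           wt b' = wt b + simple_root t i \<and> \<epsilon> i b' = \<epsilon> i b - Fin 1 \<and> \<phi> i b' = \<phi> i b + Fin 1) \<and>
        (\<forall>b'. f i b = Some b' \<longrightarrow>
           wt b' = wt b - simple_root t i \<and> \<epsilon> i b' = \<epsilon> i b + Fin 1 \<and> \<phi> i b' = \<phi> i b - Fin 1) \<and>
        (\<forall>b'\<in>B. f i b = Some b' \<longleftrightarrow> e i b' = Some b) \<and>
        (\<phi> i b = Minf \<longrightarrow> e i b = None \<and> f i b = None))"


section \<open>Column patterns\<close>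

datatype row = Upper | Lower

text \<open>A cell is a row together with a cell column, the latter numbered from 1.\<close>
type_synonym cell = "row \<times> nat"

text \<open>The colours of the upper and of the lower row.\<close>
type_synonym cross_section = "nat list \<times> nat list"

type_synonym pattern = "int \<Rightarrow> cross_section"

fun width :: "affine_type \<Rightarrow> nat" where
  "width E6 = 2"
| "width E7 = 3"
| "width E8 = 6"

definition cells :: "cross_section \<Rightarrow> cell set" where
  "cells s = UNIV \<times> {1..length (fst s)}"

fun cell_colour :: "cross_section \<Rightarrow> cell \<Rightarrow> nat" where
  "cell_colour (u, l) (Upper, c) = u ! (c - 1)"
| "cell_colour (u, l) (Lower, c) = l ! (c - 1)"

definition rotate_section :: "cross_section \<Rightarrow> cross_section" where
  "rotate_section = (\<lambda>(u, l). (rev l, rev u))"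

fun base_cubes :: "affine_type \<Rightarrow> cross_section list" where
  "base_cubes E6 =
    [([4,4], [0,4]), ([2,5], [2,5]), ([4,6], [4,4]),
     ([3,5], [3,5]), ([4,4], [1,4]), ([3,2], [3,2])]"
| "base_cubes E7 =
    [([3,3,2], [0,3,2]), ([1,4,4], [1,4,4]), ([3,5,5], [3,3,5]), ([4,4,6], [4,4,6]),
     ([2,5,7], [2,5,5]), ([4,4,6], [4,4,6]), ([3,5,5], [3,3,5]), ([1,4,4], [1,4,4])]"
| "base_cubes E8 =
    [([7,7,5,5,2,2], [0,7,5,5,5,2]), ([8,6,6,4,4,4], [8,6,6,4,4,4]),
     ([7,5,5,5,3,3], [7,7,5,5,3,3]), ([6,6,4,4,4,1], [6,6,4,4,4,1]),
     ([5,5,2,2,3,3], [5,5,5,2,3,3]), ([4,4,4,4,4,4], [4,4,4,4,4,4]),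
     ([3,3,2,5,5,5], [3,3,2,2,5,5]), ([1,4,4,4,6,6], [1,4,4,4,6,6]),
     ([3,3,5,5,7,7], [3,3,5,5,5,7]), ([4,4,4,6,6,8], [4,4,4,6,6,8])]"

text \<open>In type E7 the listed cubes form a full period; in types E6 and E8 they form half a
  period, the other half consisting of their rotations.\<close>
definition column_pattern :: "affine_type \<Rightarrow> pattern" where
  "column_pattern t k =
     (let h = int (length (base_cubes t));
          s = base_cubes t ! nat ((k - 1) mod h)
      in if t \<noteq> E7 \<and> odd ((k - 1) div h) then rotate_section s else s)"

text \<open>Column \<open>r\<close>, counted from right to left, of the Young wall pattern.\<close>
fun wall_pattern :: "affine_type \<Rightarrow> nat \<Rightarrow> pattern" where
  "wall_pattern E6 r k = column_pattern E6 (k + 8 * int r)"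
| "wall_pattern E7 r k =
     (if even r then column_pattern E7 k else rotate_section (column_pattern E7 (k + 4)))"
| "wall_pattern E8 r k = column_pattern E8 k"


section \<open>Blocks\<close>

text \<open>\<open>Block k i S\<close> is the block of colour \<open>i\<close> in cube \<open>k\<close> over the cells in \<open>S\<close>. Keeping the
  colour as a component makes a translate or a rotation of a collection of blocks a collection
  of \<^emph>\<open>coloured\<close> blocks, independently of any pattern.\<close>
datatype block = Block (height: int) (colour: nat) (base: "cell set")

definition cube_blocks :: "int \<Rightarrow> cross_section \<Rightarrow> block set" where
  "cube_blocks k s =
     (if s = (replicate 6 4, replicate 6 4)
      then {Block k 4 (UNIV \<times> {1..3}), Block k 4 (UNIV \<times> {4..6})}
      else {Block k i S |i S. S = {x \<in> cells s. cell_colour s x = i} \<and> S \<noteq> {}})"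

definition blocks :: "pattern \<Rightarrow> block set" where
  "blocks p = (\<Union>k. cube_blocks k (p k))"

definition lies_below :: "block \<Rightarrow> block \<Rightarrow> bool" where
  "lies_below b' b \<longleftrightarrow> height b' = height b - 1 \<and> base b' \<inter> base b \<noteq> {}"

definition translate_block :: "int \<Rightarrow> block \<Rightarrow> block" where
  "translate_block n b = Block (height b + n) (colour b) (base b)"

fun rotate_cell :: "nat \<Rightarrow> cell \<Rightarrow> cell" where
  "rotate_cell w (Upper, c) = (Lower, w + 1 - c)"
| "rotate_cell w (Lower, c) = (Upper, w + 1 - c)"

definition rotate_block :: "nat \<Rightarrow> block \<Rightarrow> block" where
  "rotate_block w b = Block (height b) (colour b) (rotate_cell w ` base b)"

definition column_equiv :: "affine_type \<Rightarrow> block set \<Rightarrow> block set \<Rightarrow> bool" where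
  "column_equiv t y y' \<longleftrightarrow>
     (\<exists>n. y' = translate_block n ` y \<or> y' = translate_block n ` rotate_block (width t) ` y)"

definition column_class :: "affine_type \<Rightarrow> block set \<Rightarrow> block set set" where
  "column_class t y = {y'. column_equiv t y y'}"


section \<open>Young columns\<close>

definition proper_column :: "pattern \<Rightarrow> block set \<Rightarrow> bool" where
  "proper_column p y \<longleftrightarrow>
     y \<noteq> {} \<and> y \<subseteq> blocks p \<and> (\<exists>K. \<forall>b\<in>y. height b \<le> K) \<and>
     (\<forall>b\<in>y. \<forall>b'\<in>blocks p. lies_below b' b \<longrightarrow> b' \<in> y)"

text \<open>The two exceptional shapes of type E8; each has a block with empty space below it.\<close>

definition special_column1 :: "block set" where
  "special_column1 = {b \<in> blocks (column_pattern E8).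
     height b \<le> 4 \<or> height b = 5 \<and> colour b \<in> {5, 3} \<or>
     height b = 6 \<and> base b = UNIV \<times> {4..6}}"

definition special_column2 :: "block set" where
  "special_column2 = {b \<in> blocks (column_pattern E8).
     height b \<le> 5 \<or> height b = 6 \<and> base b = UNIV \<times> {4..6} \<or>
     height b = 7 \<and> colour b = 2}"

definition young_column :: "affine_type \<Rightarrow> pattern \<Rightarrow> block set \<Rightarrow> bool" where
  "young_column t p y \<longleftrightarrow> proper_column p y \<or>
     (t = E8 \<and> y \<subseteq> blocks p \<and>
       (column_equiv t special_column1 y \<or> column_equiv t special_column2 y))"

definition addable :: "affine_type \<Rightarrow> pattern \<Rightarrow> nat \<Rightarrow> block set \<Rightarrow> block set" where
  "addable t p i y = {b \<in> blocks p. colour b = i \<and> b \<notin> y \<and> young_column t p (insert b y)}"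

definition removable :: "affine_type \<Rightarrow> pattern \<Rightarrow> nat \<Rightarrow> block set \<Rightarrow> block set" where
  "removable t p i y = {b \<in> y. colour b = i \<and> young_column t p (y - {b})}"

definition on_top_of_colour :: "block set \<Rightarrow> nat \<Rightarrow> block \<Rightarrow> bool" where
  "on_top_of_colour y j b \<longleftrightarrow> (\<exists>b'\<in>y. colour b' = j \<and> lies_below b' b)"

definition block_to_add :: "affine_type \<Rightarrow> pattern \<Rightarrow> nat \<Rightarrow> block set \<Rightarrow> block" where
  "block_to_add t p i y =
     (let A = addable t p i y in
      if t = E8 \<and> card A = 2
      then (if i \<noteq> 4 then arg_max height (\<lambda>b. b \<in> A)
            else (THE b. b \<in> A \<and> on_top_of_colour y 5 b))
      else (SOME b. b \<in> A))"

definition block_to_remove :: "affine_type \<Rightarrow> pattern \<Rightarrow> nat \<Rightarrow> block set \<Rightarrow> block" where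
  "block_to_remove t p i y =
     (let A = removable t p i y in
      if t = E8 \<and> card A = 2
      then (if i \<noteq> 4 then arg_min height (\<lambda>b. b \<in> A)
            else (THE b. b \<in> A \<and> on_top_of_colour y 3 b))
      else (SOME b. b \<in> A))"

definition add_block :: "affine_type \<Rightarrow> pattern \<Rightarrow> nat \<Rightarrow> block set \<Rightarrow> block set option" where
  "add_block t p i y =
     (if addable t p i y = {} then None else Some (insert (block_to_add t p i y) y))"

definition remove_block :: "affine_type \<Rightarrow> pattern \<Rightarrow> nat \<Rightarrow> block set \<Rightarrow> block set option" where
  "remove_block t p i y =
     (if removable t p i y = {} then None else Some (y - {block_to_remove t p i y}))"

text \<open>The Young columns of type E8 that lie in the interior of an \<open>i\<close>-string of length two;
  on these, the operators of colour other than \<open>i\<close> vanish.\<close>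
definition string_interior :: "affine_type \<Rightarrow> pattern \<Rightarrow> nat \<Rightarrow> block set \<Rightarrow> bool" where
  "string_interior t p i y \<longleftrightarrow> t = E8 \<and>
     ((\<exists>y'. young_column t p y' \<and> add_block t p i y' = Some y \<and> addable t p i y \<noteq> {}) \<or>
      (\<exists>y'. young_column t p y' \<and> remove_block t p i y' = Some y \<and> removable t p i y \<noteq> {}))"

definition column_f :: "affine_type \<Rightarrow> pattern \<Rightarrow> nat \<Rightarrow> block set \<Rightarrow> block set option" where
  "column_f t p i y =
     (if \<exists>j. j \<noteq> i \<and> string_interior t p j y then None else add_block t p i y)"

definition column_e :: "affine_type \<Rightarrow> pattern \<Rightarrow> nat \<Rightarrow> block set \<Rightarrow> block set option" where
  "column_e t p i y =
     (if \<exists>j. j \<noteq> i \<and> string_interior t p j y then None else remove_block t p i y)"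


section \<open>The classical crystal of classes of Young columns\<close>

definition C_carrier :: "affine_type \<Rightarrow> block set set set" where
  "C_carrier t = column_class t ` {y. young_column t (column_pattern t) y}"

text \<open>A class also contains translates and rotations that are not collections of blocks of the
  Young column pattern, hence the restriction on the representative.\<close>
definition C_rep :: "affine_type \<Rightarrow> block set set \<Rightarrow> block set" where
  "C_rep t c = (SOME y. y \<in> c \<and> young_column t (column_pattern t) y)"

definition C_f :: "affine_type \<Rightarrow> nat \<Rightarrow> block set set \<Rightarrow> block set set option" where
  "C_f t i c = map_option (column_class t) (column_f t (column_pattern t) i (C_rep t c))"

definition C_e :: "affine_type \<Rightarrow> nat \<Rightarrow> block set set \<Rightarrow> block set set option" where
  "C_e t i c = map_option (column_class t) (column_e t (column_pattern t) i (C_rep t c))"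

primrec iterate :: "('a \<Rightarrow> 'a option) \<Rightarrow> nat \<Rightarrow> 'a \<Rightarrow> 'a option" where
  "iterate g 0 x = Some x"
| "iterate g (Suc m) x = Option.bind (iterate g m x) g"

definition C_phi :: "affine_type \<Rightarrow> nat \<Rightarrow> block set set \<Rightarrow> nat" where
  "C_phi t i c = Max {m. iterate (C_f t i) m c \<noteq> None}"

definition C_eps :: "affine_type \<Rightarrow> nat \<Rightarrow> block set set \<Rightarrow> nat" where
  "C_eps t i c = Max {m. iterate (C_e t i) m c \<noteq> None}"

text \<open>The coefficients of the classical weight with respect to the fundamental weights.\<close>
definition C_wt :: "affine_type \<Rightarrow> block set set \<Rightarrow> nat \<Rightarrow> int" where
  "C_wt t c = (\<lambda>i. if i \<in> index_set t then int (C_phi t i c) - int (C_eps t i c) else 0)"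

text \<open>The affinization: \<open>(m, c)\<close> stands for \<open>z\<^sup>m c\<close>.\<close>

definition Caff_carrier :: "affine_type \<Rightarrow> (int \<times> block set set) set" where
  "Caff_carrier t = UNIV \<times> C_carrier t"

definition Caff_e ::
  "affine_type \<Rightarrow> nat \<Rightarrow> int \<times> block set set \<Rightarrow> (int \<times> block set set) option" where
  "Caff_e t i = (\<lambda>(m, c). map_option (Pair (m + (if i = 0 then 1 else 0))) (C_e t i c))"

definition Caff_f ::
  "affine_type \<Rightarrow> nat \<Rightarrow> int \<times> block set set \<Rightarrow> (int \<times> block set set) option" where
  "Caff_f t i = (\<lambda>(m, c). map_option (Pair (m - (if i = 0 then 1 else 0))) (C_f t i c))"


section \<open>Energy functions\<close>

definition tensor_f :: "affine_type \<Rightarrow> nat \<Rightarrow> block set set \<times> block set set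
    \<Rightarrow> (block set set \<times> block set set) option" where
  "tensor_f t i = (\<lambda>(b, b').
     if C_phi t i b > C_eps t i b'
     then map_option (\<lambda>x. (x, b')) (C_f t i b)
     else map_option (\<lambda>x. (b, x)) (C_f t i b'))"

definition extremal :: "affine_type \<Rightarrow> block set set \<Rightarrow> bool" where
  "extremal t c \<longleftrightarrow> (t = E8 \<longrightarrow> C_wt t c \<noteq> (\<lambda>_. 0))"

definition energy_function ::
  "affine_type \<Rightarrow> (block set set \<times> block set set \<Rightarrow> int) \<Rightarrow> bool" where
  "energy_function t H \<longleftrightarrow>
     (\<forall>b\<in>C_carrier t. \<forall>b'\<in>C_carrier t.
        (\<forall>i\<in>index_set t. \<forall>x. i \<noteq> 0 \<longrightarrow> tensor_f t i (b, b') = Some x \<longrightarrow> H x = H (b, b')) \<and>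
        (\<forall>x. C_f t 0 b = Some x \<longrightarrow> tensor_f t 0 (b, b') = Some (x, b') \<longrightarrow>
           H (x, b') = H (b, b') + 1) \<and>
        (\<forall>x. C_f t 0 b' = Some x \<longrightarrow> tensor_f t 0 (b, b') = Some (b, x) \<longrightarrow>
           H (b, x) = H (b, b') - 1)) \<and>
     (\<forall>c\<in>C_carrier t. extremal t c \<longrightarrow> H (c, c) = 0)"

definition H_aff :: "(block set set \<times> block set set \<Rightarrow> int)
    \<Rightarrow> int \<times> block set set \<Rightarrow> int \<times> block set set \<Rightarrow> int" where
  "H_aff H = (\<lambda>(m, a) (n, b). H (a, b) + m - n)"


section \<open>Young walls\<close>

fun ground_extra :: "affine_type \<Rightarrow> block \<Rightarrow> bool" where
  "ground_extra E6 b \<longleftrightarrow>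
     height b = 1 \<and> card (base b) = 3 \<or>
     height b = 2 \<and> base b = UNIV \<times> {2} \<or>
     height b = 3 \<and> card (base b) = 1"
| "ground_extra E7 b \<longleftrightarrow>
     height b = 1 \<and> card (base b) \<noteq> 1 \<or>
     height b = 2 \<and> base b = UNIV \<times> {2..3} \<or>
     height b = 3 \<and> UNIV \<times> {3} \<subseteq> base b \<or>
     height b = 4 \<and> base b = UNIV \<times> {3} \<or>
     height b = 5 \<and> card (base b) = 1"
| "ground_extra E8 b \<longleftrightarrow>
     height b = 1 \<and> colour b \<in> {7, 5, 2} \<or>
     height b = 2 \<and> colour b \<in> {6, 4} \<or>
     height b = 3 \<and> colour b \<in> {5, 3} \<or>
     height b = 4 \<and> colour b \<in> {4, 1} \<or>
     height b = 5 \<and> colour b \<in> {2, 3} \<or>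
     height b = 6 \<and> base b = UNIV \<times> {4..6} \<or>
     height b = 7 \<and> colour b = 5 \<or>
     height b = 8 \<and> colour b = 6 \<or>
     height b = 9 \<and> colour b = 7 \<or>
     height b = 10 \<and> colour b = 8 \<or>
     height b = 11 \<and> colour b = 0"

definition ground_column :: "affine_type \<Rightarrow> nat \<Rightarrow> block set" where
  "ground_column t r = {b \<in> blocks (wall_pattern t r). height b \<le> 0 \<or> ground_extra t b}"

definition young_wall :: "affine_type \<Rightarrow> (nat \<Rightarrow> block set) \<Rightarrow> bool" where
  "young_wall t Y \<longleftrightarrow>
     finite {(r, b). (b \<in> Y r) \<noteq> (b \<in> ground_column t r)} \<and>
     (\<forall>r. young_column t (wall_pattern t r) (Y r))"

definition ground_exponents :: "affine_type \<Rightarrow> (block set set \<times> block set set \<Rightarrow> int)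
    \<Rightarrow> (nat \<Rightarrow> int) \<Rightarrow> bool" where
  "ground_exponents t H m \<longleftrightarrow> m 0 = 0 \<and>
     (\<forall>r. H_aff H (m (Suc r), column_class t (ground_column t (Suc r)))
                  (m r, column_class t (ground_column t r)) = 1)"

text \<open>\<open>\<iota> r\<close> identifies the Young columns in column \<open>r\<close> with the elements of the affinization.\<close>
definition column_identification :: "affine_type \<Rightarrow> (nat \<Rightarrow> int)
    \<Rightarrow> (nat \<Rightarrow> block set \<Rightarrow> int \<times> block set set) \<Rightarrow> bool" where
  "column_identification t m \<iota> \<longleftrightarrow>
     (\<forall>r. bij_betw (\<iota> r) {y. young_column t (wall_pattern t r) y} (Caff_carrier t) \<and>
        (\<forall>i\<in>index_set t. \<forall>y. young_column t (wall_pattern t r) y \<longrightarrow>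
           map_option (\<iota> r) (column_e t (wall_pattern t r) i y) = Caff_e t i (\<iota> r y) \<and>
           map_option (\<iota> r) (column_f t (wall_pattern t r) i y) = Caff_f t i (\<iota> r y)) \<and>
        \<iota> r (ground_column t r) = (m r, column_class t (ground_column t r)))"

definition Z_Lambda0 :: "affine_type \<Rightarrow> (block set set \<times> block set set \<Rightarrow> int)
    \<Rightarrow> (nat \<Rightarrow> block set \<Rightarrow> int \<times> block set set) \<Rightarrow> (nat \<Rightarrow> block set) set" where
  "Z_Lambda0 t H \<iota> =
     {Y. young_wall t Y \<and> (\<forall>r. H_aff H (\<iota> (Suc r) (Y (Suc r))) (\<iota> r (Y r)) > 0)}"


section \<open>The signature rule\<close>

datatype sign = Minus | Plus

definition column_signs :: "affine_type \<Rightarrow> (nat \<Rightarrow> block set \<Rightarrow> int \<times> block set set)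
    \<Rightarrow> nat \<Rightarrow> (nat \<Rightarrow> block set) \<Rightarrow> nat \<Rightarrow> sign list" where
  "column_signs t \<iota> i Y r =
     (let y = snd (\<iota> r (Y r)) in replicate (C_eps t i y) Minus @ replicate (C_phi t i y) Plus)"

text \<open>Given the sign words \<open>s r\<close> of the columns, the word \<open>\<dots> s 2 @ s 1 @ s 0\<close> is infinite to the
  left, so cancellation is expressed through its positions: \<open>(r, j)\<close> is entry \<open>j\<close> of column
  \<open>r\<close>. A \<^const>\<open>Plus\<close> and a \<^const>\<open>Minus\<close> to the right of it cancel each other iff the finite
  word strictly between them cancels completely. The two can be taken in different columns,
  since within one column every \<^const>\<open>Minus\<close> precedes every \<^const>\<open>Plus\<close>.\<close>

inductive cancels_completely :: "sign list \<Rightarrow> bool" where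
  "cancels_completely []"
| "cancels_completely (u @ v) \<Longrightarrow> cancels_completely (u @ [Plus, Minus] @ v)"

definition word_between :: "(nat \<Rightarrow> sign list) \<Rightarrow> nat \<times> nat \<Rightarrow> nat \<times> nat \<Rightarrow> sign list" where
  "word_between s = (\<lambda>(r, j) (r', j').
     drop (Suc j) (s r) @ concat (map s (rev [Suc r'..<r])) @ take j' (s r'))"

definition sign_at :: "(nat \<Rightarrow> sign list) \<Rightarrow> sign \<Rightarrow> nat \<times> nat \<Rightarrow> bool" where
  "sign_at s x = (\<lambda>(r, j). j < length (s r) \<and> s r ! j = x)"

definition cancelling_pair :: "(nat \<Rightarrow> sign list) \<Rightarrow> nat \<times> nat \<Rightarrow> nat \<times> nat \<Rightarrow> bool" where
  "cancelling_pair s p q \<longleftrightarrow>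
     fst p > fst q \<and> sign_at s Plus p \<and> sign_at s Minus q \<and> cancels_completely (word_between s p q)"

definition surviving :: "(nat \<Rightarrow> sign list) \<Rightarrow> sign \<Rightarrow> (nat \<times> nat) set" where
  "surviving s x =
     {p. sign_at s x p \<and> \<not> (\<exists>q. cancelling_pair s p q \<or> cancelling_pair s q p)}"

text \<open>Columns are numbered from right to left: the rightmost sign lies in the column of least
  index, the leftmost one in the column of greatest index.\<close>

definition wall_e :: "affine_type \<Rightarrow> (nat \<Rightarrow> block set \<Rightarrow> int \<times> block set set)
    \<Rightarrow> nat \<Rightarrow> (nat \<Rightarrow> block set) \<Rightarrow> (nat \<Rightarrow> block set) option" where
  "wall_e t \<iota> i Y =
     (let M = surviving (column_signs t \<iota> i Y) Minus; r = Min (fst ` M) in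
      if M = {} then None
      else map_option (\<lambda>y. Y(r := y)) (column_e t (wall_pattern t r) i (Y r)))"

definition wall_f :: "affine_type \<Rightarrow> (nat \<Rightarrow> block set \<Rightarrow> int \<times> block set set)
    \<Rightarrow> nat \<Rightarrow> (nat \<Rightarrow> block set) \<Rightarrow> (nat \<Rightarrow> block set) option" where
  "wall_f t \<iota> i Y =
     (let M = surviving (column_signs t \<iota> i Y) Plus; r = Max (fst ` M) in
      if M = {} then None
      else map_option (\<lambda>y. Y(r := y)) (column_f t (wall_pattern t r) i (Y r)))"

definition wall_eps :: "affine_type \<Rightarrow> (nat \<Rightarrow> block set \<Rightarrow> int \<times> block set set)
    \<Rightarrow> nat \<Rightarrow> (nat \<Rightarrow> block set) \<Rightarrow> int extended" where
  "wall_eps t \<iota> i Y = Fin (int (card (surviving (column_signs t \<iota> i Y) Minus)))"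

definition wall_phi :: "affine_type \<Rightarrow> (nat \<Rightarrow> block set \<Rightarrow> int \<times> block set set)
    \<Rightarrow> nat \<Rightarrow> (nat \<Rightarrow> block set) \<Rightarrow> int extended" where
  "wall_phi t \<iota> i Y = Fin (int (card (surviving (column_signs t \<iota> i Y) Plus)))"

definition block_difference :: "affine_type \<Rightarrow> nat \<Rightarrow> (nat \<Rightarrow> block set) \<Rightarrow> int" where
  "block_difference t i Y =
     int (card {(r, b). colour b = i \<and> b \<in> Y r - ground_column t r})
     - int (card {(r, b). colour b = i \<and> b \<in> ground_column t r - Y r})"

definition wall_wt :: "affine_type \<Rightarrow> (nat \<Rightarrow> block set) \<Rightarrow> weight" where
  "wall_wt t Y = fundamental_weight 0
     - (\<Sum>i\<in>index_set t. scale (block_difference t i Y) (simple_root t i))"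

end

theory Submission
  imports Defs
begin

text \<open>The tensor rule changes the energy \<open>H\<close> by \<open>\<plusminus>1\<close> exactly when a \<open>0\<close>-arrow acts, which the exponent
  of \<open>z\<close> compensates; hence the operators of the signature rule do not change the values of \<open>H\<^sub>a\<^sub>f\<^sub>f\<close> on
  adjacent columns, so they preserve the set of Young walls in question. What remains are properties of single columns.
  Up to translation and rotation a Young column is determined by the phase of its lowest incomplete
  cube and by finitely many rows above it, so that these properties amount to a check of finitely many shapes.
  Weights are computed relative to a fixed column, from which they change by \<open>- \<alpha>\<^sub>i\<close> with each added \<open>i\<close>-block.\<close>

text \<open>For each colour the weight of a column lies between -2 and 2, and a nonzero weight
  already dictates how many arrows of that colour leave and enter. The obstacle is weight 0, which
  occurs both off all strings and in the middle of a string of length two. In types E6 and E7 no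
  Young column has all its weights 0. In type E8 some have, and there the choice between two blocks
  and the suppression of the other colours must single out exactly one colour. For such columns the
  finite check therefore records not only which blocks can be added or removed, but also which
  choice the rules make on the neighbouring columns. The ground state enters through two facts:
  column r + 1 has as many plus signs as column r has minus signs, so that far to the left
  everything cancels, and column 0 has a plus sign for colour 0 only. Together they make the weights
  of the ground columns telescope to \<open>\<Lambda>\<^sub>0\<close>, which turns the count of
  surviving signs into the pairing with the affine weight.\<close>

section \<open>Cancellation of signs in a word that is infinite to the left\<close>

text \<open>Bracket counting: \<open>n\<close> is the number of \<open>Plus\<close> still open on
  the left. This gives \<open>cancels_completely\<close> a deterministic recursion, which also makes
  sense for a word cut off at its left end.\<close>

fun balanced_from :: "nat \<Rightarrow> sign list \<Rightarrow> bool" where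
  "balanced_from n [] = (n = 0)"
| "balanced_from n (Plus # w) = balanced_from (Suc n) w"
| "balanced_from n (Minus # w) = (0 < n \<and> balanced_from (n - 1) w)"

lemma balanced_from_append_plus_minus:
  "balanced_from n (u @ Plus # Minus # v) = balanced_from n (u @ v)"
  by (induction n u rule: balanced_from.induct) auto

text \<open>The open brackets counted by \<open>n\<close> are put back as letters; only with an
  arbitrary number of them does the recursion of \<open>balanced_from\<close> become an
  induction.\<close>

lemma cancels_completely_replicate_Plus:
  "balanced_from n w \<Longrightarrow> cancels_completely (replicate n Plus @ w)"
proof (induction n w rule: balanced_from.induct)
  case (1 n) then show ?case by (simp add: cancels_completely.intros)
next
  case (2 n w)
  have "replicate n Plus @ Plus # w = replicate (Suc n) Plus @ w"
    by (induction n) auto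
  with 2 show ?case by (metis balanced_from.simps(2))
next
  case (3 n w)
  then obtain k where n: "n = Suc k" by (cases n) auto
  with 3 have "cancels_completely (replicate k Plus @ w)" by simp
  moreover have "replicate n Plus @ Minus # w = replicate k Plus @ [Plus, Minus] @ w"
    unfolding n by (induction k) auto
  ultimately show ?case by (metis cancels_completely.intros(2))
qed

lemma cancels_completely_iff: "cancels_completely w \<longleftrightarrow> balanced_from 0 w"
proof
  show "cancels_completely w \<Longrightarrow> balanced_from 0 w"
    by (induction rule: cancels_completely.induct) (auto simp: balanced_from_append_plus_minus)
  show "balanced_from 0 w \<Longrightarrow> cancels_completely w"
    using cancels_completely_replicate_Plus[of 0 w] by simp
qed

lemma balanced_from_replicate_Plus [simp]:
  "balanced_from n (replicate a Plus @ w) = balanced_from (n + a) w"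
  by (induction a arbitrary: n) auto

lemma balanced_from_replicate_Minus [simp]:
  "balanced_from n (replicate b Minus @ w) \<longleftrightarrow> b \<le> n \<and> balanced_from (n - b) w"
proof (induction b arbitrary: n)
  case (Suc b)
  show ?case using Suc.IH[of "n - 1"] by (cases n) simp_all
qed simp

lemma balanced_from_replicate_Minus' [simp]: "balanced_from n (replicate b Minus) \<longleftrightarrow> b = n"
  using balanced_from_replicate_Minus[of n b "[]"] by auto

text \<open>Cancellation at the right end of a word, where \<open>balanced_from\<close> does not
  compute. The search for the partner of a minus sign needs it: there the word grows on the left
  while the known signs stay on the right.\<close>

lemma balanced_from_append_Plus_Minus:
  "balanced_from n (w @ replicate a Plus @ replicate b Minus)
     \<longleftrightarrow> a \<le> b \<and> balanced_from n (w @ replicate (b - a) Minus)"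
proof (induction n w rule: balanced_from.induct)
  case (1 n)
  show ?case by auto
qed auto

text \<open>Only the numbers of signs matter. The assumption \<open>tail\<close> is what the ground
  state wall supplies: from column \<open>R\<close> on, the minus signs of a column are exactly
  matched in number by the plus signs of the column to its left, which makes all sums
  finite.\<close>

locale signature =
  fixes \<epsilon> \<phi> :: "nat \<Rightarrow> nat" and R :: nat and s :: "nat \<Rightarrow> sign list"
  assumes signs: "s r = replicate (\<epsilon> r) Minus @ replicate (\<phi> r) Plus"
    and tail: "r \<ge> R \<Longrightarrow> \<phi> (Suc r) = \<epsilon> r"
begin

text \<open>The number of minus signs left after reducing the columns to the right of column \<open>r\<close>.\<close>
primrec right_minus :: "nat \<Rightarrow> nat" where
  "right_minus 0 = 0"
| "right_minus (Suc r) = \<epsilon> r + (right_minus r - \<phi> r)"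

text \<open>Columns are numbered from the right, so a recursion coming from the left has to count
  down from \<open>R\<close>; the argument is the distance to column \<open>Suc R\<close>.\<close>

primrec left_plus_aux :: "nat \<Rightarrow> nat" where
  "left_plus_aux 0 = \<phi> (Suc R)"
| "left_plus_aux (Suc d) = \<phi> (R - d) + (left_plus_aux d - \<epsilon> (R - d))"

text \<open>The number of plus signs left after reducing column \<open>r\<close> and the columns to its left.\<close>
definition left_plus :: "nat \<Rightarrow> nat" where
  "left_plus r = (if r > R then \<phi> r else left_plus_aux (Suc R - r))"

text \<open>From \<open>R\<close> on the recursion persists because \<open>left_plus (Suc r)\<close>
  equals \<open>\<epsilon> r\<close> there, so nothing passes through column
  \<open>r\<close>.\<close>

lemma left_plus_rec: "left_plus r = \<phi> r + (left_plus (Suc r) - \<epsilon> r)"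
proof (cases r R rule: linorder_cases)
  case less
  then have "Suc R - r = Suc (R - r)" "R - (R - r) = r" by auto
  with less show ?thesis by (auto simp: left_plus_def)
next
  case equal
  show ?thesis by (simp add: \<open>r = R\<close> left_plus_def tail)
next
  case greater
  then show ?thesis by (simp add: left_plus_def tail)
qed

lemma left_plus_tail: "r > R \<Longrightarrow> left_plus r = \<phi> r"
  by (simp add: left_plus_def)

lemma sign_at_iff:
  "sign_at s Minus (r, j) \<longleftrightarrow> j < \<epsilon> r"
  "sign_at s Plus (r, j) \<longleftrightarrow> \<epsilon> r \<le> j \<and> j < \<epsilon> r + \<phi> r"
  by (auto simp: sign_at_def signs nth_append split: if_splits)

text \<open>The plus signs that follow the given one in its own column become the initial counter;
  the minus signs that precede the other one in its column end the word.\<close>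

lemma cancelling_pair_iff:
  "cancelling_pair s (r, i) (r', j) \<longleftrightarrow> r' < r \<and> \<epsilon> r \<le> i \<and> i < \<epsilon> r + \<phi> r \<and> j < \<epsilon> r' \<and>
     balanced_from (\<epsilon> r + \<phi> r - Suc i) (concat (map s (rev [Suc r'..<r])) @ replicate j Minus)"
proof -
  have "take j (s r') = replicate j Minus" if "j < \<epsilon> r'"
    using that by (simp add: signs)
  moreover have "drop (Suc i) (s r) = replicate (\<epsilon> r + \<phi> r - Suc i) Plus"
    if "\<epsilon> r \<le> i" "i < \<epsilon> r + \<phi> r"
    using that by (simp add: signs Suc_diff_le)
  ultimately show ?thesis
    by (auto simp: cancelling_pair_def sign_at_iff word_between_def cancels_completely_iff)
qed

text \<open>Here \<open>x\<close> is the position of a plus sign counted from the right end of its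
  column. The induction moves one column to the right: the sign finds its partner among the
  \<open>\<epsilon> r\<close> minus signs there, or it continues with position
  \<open>x - \<epsilon> r + \<phi> r\<close>.\<close>

lemma plus_cancelled_iff:
  "0 < x \<Longrightarrow> (\<exists>r' j. r' < r \<and> j < \<epsilon> r' \<and>
     balanced_from (x - 1) (concat (map s (rev [Suc r'..<r])) @ replicate j Minus))
   \<longleftrightarrow> x \<le> right_minus r"
proof (induction r arbitrary: x)
  case 0
  then show ?case by simp
next
  case (Suc r)
  define P where "P x r r' j \<longleftrightarrow> r' < r \<and> j < \<epsilon> r' \<and>
     balanced_from (x - 1) (concat (map s (rev [Suc r'..<r])) @ replicate j Minus)" for x r r' j
  have last: "(\<exists>j. P x (Suc r) r j) \<longleftrightarrow> x \<le> \<epsilon> r"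
    using Suc.prems by (auto simp: P_def)
  have step: "P x (Suc r) r' j \<longleftrightarrow> \<epsilon> r < x \<and> P (x - \<epsilon> r + \<phi> r) r r' j" if "r' \<noteq> r" for r' j
  proof (cases "r' < r")
    case True
    have "x - Suc 0 - \<epsilon> r + \<phi> r = x - \<epsilon> r + \<phi> r - Suc 0" if "\<epsilon> r < x" using that by simp
    then show ?thesis using True Suc.prems
      by (cases "\<epsilon> r < x") (auto simp: P_def signs[of r])
  next
    case False
    then show ?thesis using that by (auto simp: P_def)
  qed
  have "(\<exists>r' j. P x (Suc r) r' j) \<longleftrightarrow> x \<le> \<epsilon> r \<or> \<epsilon> r < x \<and> (\<exists>r' j. P (x - \<epsilon> r + \<phi> r) r r' j)"
  proof -
    have "P y r r' j \<Longrightarrow> r' \<noteq> r" for y r' j by (simp add: P_def)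
    with last step show ?thesis by metis
  qed
  also have "\<dots> \<longleftrightarrow> x \<le> right_minus (Suc r)"
    using Suc.IH[of "x - \<epsilon> r + \<phi> r"] by (auto simp: P_def)
  finally show ?case by (simp add: P_def)
qed

text \<open>The next column on the left is split off. If it has more than \<open>j\<close> plus
  signs, the partner lies in it; otherwise its plus signs use up some of the \<open>j\<close>
  preceding minus signs, and its own minus signs join the remaining ones.\<close>

lemma minus_cancelled_from:
  "r' > r \<Longrightarrow> (\<exists>i. \<epsilon> r' \<le> i \<and> i < \<epsilon> r' + \<phi> r' \<and> balanced_from (\<epsilon> r' + \<phi> r' - Suc i)
        (concat (map s (rev [Suc r..<r'])) @ replicate j Minus)) \<longleftrightarrow>
     (if r' = Suc r then j < \<phi> (Suc r)
      else \<phi> (Suc r) \<le> j \<and> (\<exists>i. \<epsilon> r' \<le> i \<and> i < \<epsilon> r' + \<phi> r' \<and> balanced_from (\<epsilon> r' + \<phi> r' - Suc i)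
        (concat (map s (rev [Suc (Suc r)..<r'])) @ replicate (\<epsilon> (Suc r) + j - \<phi> (Suc r)) Minus)))"
proof (cases "r' = Suc r")
  case True
  then show ?thesis
    \<comment> \<open>The partner is the plus sign with exactly \<open>j\<close> plus signs to its
      right in the column.\<close>
    by (auto intro!: exI[of _ "\<epsilon> (Suc r) + \<phi> (Suc r) - Suc j"])
next
  case False
  assume "r' > r"
  with False have *: "[Suc r..<r'] = Suc r # [Suc (Suc r)..<r']"
    by (simp add: upt_conv_Cons)
  have "balanced_from n (concat (map s (rev [Suc r..<r'])) @ replicate j Minus) \<longleftrightarrow>
     \<phi> (Suc r) \<le> j \<and> balanced_from n (concat (map s (rev [Suc (Suc r)..<r'])) @
        replicate (\<epsilon> (Suc r) + j - \<phi> (Suc r)) Minus)" for n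
    using balanced_from_append_Plus_Minus[of n
        "concat (map s (rev [Suc (Suc r)..<r'])) @ replicate (\<epsilon> (Suc r)) Minus" "\<phi> (Suc r)" j]
    by (cases "\<phi> (Suc r) \<le> j") (simp_all add: * signs[of "Suc r"] flip: replicate_add)
  then show ?thesis using False by auto
qed

lemma minus_cancelled_iff:
  "(\<exists>r' i. r < r' \<and> \<epsilon> r' \<le> i \<and> i < \<epsilon> r' + \<phi> r' \<and> balanced_from (\<epsilon> r' + \<phi> r' - Suc i)
        (concat (map s (rev [Suc r..<r'])) @ replicate j Minus)) \<longleftrightarrow> j < left_plus (Suc r)"
proof -
  define P where "P r' r j \<longleftrightarrow> r < r' \<and> (\<exists>i. \<epsilon> r' \<le> i \<and> i < \<epsilon> r' + \<phi> r' \<and>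
    balanced_from (\<epsilon> r' + \<phi> r' - Suc i) (concat (map s (rev [Suc r..<r'])) @ replicate j Minus))"
    for r' r j
  have step: "P r' r j \<longleftrightarrow> r' = Suc r \<and> j < \<phi> (Suc r) \<or>
      r' \<noteq> Suc r \<and> \<phi> (Suc r) \<le> j \<and> P r' (Suc r) (\<epsilon> (Suc r) + j - \<phi> (Suc r))" for r' r j
    using minus_cancelled_from[of r r' j] unfolding P_def by (cases "r < r'") auto
  \<comment> \<open>Only positions below \<open>\<epsilon> r\<close> exist in column
    \<open>r\<close>. A position at or above that bound stays so when followed to the left, since
    \<open>\<phi> (Suc r) = \<epsilon> r\<close>, and hence never finds a partner.\<close>
  have tail_False: "\<not> P r' r j" if "R \<le> r" "\<epsilon> r \<le> j" for r' r j
    using that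
  proof (induction "r' - r" arbitrary: r j)
    case 0
    then show ?case by (simp add: P_def)
  next
    case (Suc d)
    have "\<phi> (Suc r) = \<epsilon> r" by (rule tail[OF Suc.prems(1)])
    moreover have "\<not> P r' (Suc r) (\<epsilon> (Suc r) + j - \<phi> (Suc r))"
      using Suc by (intro Suc.hyps(1)) (auto simp: calculation)
    ultimately show ?case using step[of r' r j] Suc.prems by simp
  qed
  have ex: "(\<exists>r'. P r' r j) \<longleftrightarrow> j < \<phi> (Suc r) \<or> \<phi> (Suc r) \<le> j \<and>
      (\<exists>r'. P r' (Suc r) (\<epsilon> (Suc r) + j - \<phi> (Suc r)))" for r j
  proof (cases "j < \<phi> (Suc r)")
    case True
    with step[of "Suc r" r j] show ?thesis by auto
  next
    case False
    have "P r' r j \<longleftrightarrow> P r' (Suc r) (\<epsilon> (Suc r) + j - \<phi> (Suc r))" for r'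
      using step[of r' r j] False by (auto simp: P_def)
    with False show ?thesis by auto
  qed
  have "(\<exists>r'. P r' r j) \<longleftrightarrow> j < left_plus (Suc r)"
  proof (induction "R - r" arbitrary: r j)
    case 0
    then have "\<phi> (Suc r) = \<epsilon> r" "left_plus (Suc r) = \<epsilon> r"
      by (simp_all add: tail left_plus_tail)
    then show ?case using ex[of r j] tail_False[of r j] 0 by (auto simp: not_less)
  next
    case (Suc d)
    then have "(\<exists>r'. P r' (Suc r) k) \<longleftrightarrow> k < left_plus (Suc (Suc r))" for k by simp
    then show ?case using ex[of r j] left_plus_rec[of "Suc r"] by auto
  qed
  then show ?thesis by (auto simp: P_def)
qed

text \<open>Minus signs coming from the right take the rightmost plus signs of a column first, so
  the survivors form an initial segment of its plus signs.\<close>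

lemma surviving_Plus:
  "surviving s Plus = {(r, j). \<epsilon> r \<le> j \<and> j < \<epsilon> r + (\<phi> r - right_minus r)}"
proof -
  have "(\<exists>q. cancelling_pair s (r, j) q) \<longleftrightarrow> \<epsilon> r + \<phi> r - j \<le> right_minus r"
    if "\<epsilon> r \<le> j" "j < \<epsilon> r + \<phi> r" for r j
    using plus_cancelled_iff[of "\<epsilon> r + \<phi> r - j" r] that by (auto simp: cancelling_pair_iff)
  moreover have "\<not> cancelling_pair s q (r, j)" if "\<epsilon> r \<le> j" for r j q
    using that by (cases q) (auto simp: cancelling_pair_iff)
  ultimately have *: "(\<exists>q. cancelling_pair s (r, j) q \<or> cancelling_pair s q (r, j)) \<longleftrightarrow>
      \<epsilon> r + \<phi> r - j \<le> right_minus r" if "\<epsilon> r \<le> j" "j < \<epsilon> r + \<phi> r" for r j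
    using that by blast
  have "(r, j) \<in> surviving s Plus \<longleftrightarrow> \<epsilon> r \<le> j \<and> j < \<epsilon> r + (\<phi> r - right_minus r)" for r j
    unfolding surviving_def mem_Collect_eq sign_at_iff case_prod_conv using *[of r j]
    by (cases "\<epsilon> r \<le> j \<and> j < \<epsilon> r + \<phi> r") (simp del: split_paired_Ex, linarith)+
  then show ?thesis by auto
qed

lemma surviving_Minus:
  "surviving s Minus = {(r, j). left_plus (Suc r) \<le> j \<and> j < \<epsilon> r}"
proof -
  have "(\<exists>q. cancelling_pair s q (r, j)) \<longleftrightarrow> j < left_plus (Suc r)" if "j < \<epsilon> r" for r j
    using minus_cancelled_iff[of r j] that by (auto simp: cancelling_pair_iff)
  moreover have "\<not> cancelling_pair s (r, j) q" if "j < \<epsilon> r" for r j q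
    using that by (cases q) (auto simp: cancelling_pair_iff)
  ultimately have *: "(\<exists>q. cancelling_pair s (r, j) q \<or> cancelling_pair s q (r, j)) \<longleftrightarrow>
      j < left_plus (Suc r)" if "j < \<epsilon> r" for r j
    using that by blast
  have "(r, j) \<in> surviving s Minus \<longleftrightarrow> left_plus (Suc r) \<le> j \<and> j < \<epsilon> r" for r j
    unfolding surviving_def mem_Collect_eq sign_at_iff using *[of j r]
    by (cases "j < \<epsilon> r") (auto simp del: split_paired_Ex)
  then show ?thesis by auto
qed

lemma right_minus_ge: "\<epsilon> r \<le> right_minus (Suc r)"
  by simp

lemma left_plus_ge: "\<phi> r \<le> left_plus r"
  by (subst left_plus_rec) simp

lemma plus_tail: "r > R \<Longrightarrow> \<phi> r - right_minus r = 0"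
  using right_minus_ge[of "r - 1"] tail[of "r - 1"] by (cases r) auto

lemma minus_tail: "r \<ge> R \<Longrightarrow> \<epsilon> r - left_plus (Suc r) = 0"
  using left_plus_ge[of "Suc r"] tail[of "r"] by simp

text \<open>Cut the word to the right of column \<open>r\<close>: the right part is left with
  \<open>right_minus r\<close> minus signs, of which the \<open>left_plus r\<close> plus signs of
  the left part cancel as many as possible. Truncated subtraction covers both outcomes.\<close>

lemma sum_minus: "(\<Sum>q<r. \<epsilon> q - left_plus (Suc q)) = right_minus r - left_plus r"
proof (induction r)
  case (Suc r)
  then show ?case using left_plus_rec[of r] by simp
qed simp

lemma sum_plus: "r \<le> Suc R \<Longrightarrow> (\<Sum>q=r..R. \<phi> q - right_minus q) = left_plus r - right_minus r"
proof (induction rule: inc_induct)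
  case base
  then show ?case using plus_tail[of "Suc R"] by (simp add: left_plus_tail)
next
  case (step r)
  then show ?case using left_plus_rec[of r] sum.atLeast_Suc_atMost[of r R "\<lambda>q. \<phi> q - right_minus q"]
    by (simp, arith)
qed

text \<open>Gives finiteness and the cardinality, which the description over all columns
  hides.\<close>

lemma surviving_Plus_Sigma: 
  "surviving s Plus = (SIGMA r:{..R}. {\<epsilon> r..<\<epsilon> r + (\<phi> r - right_minus r)})"
proof -
  have "\<not> (\<epsilon> r \<le> j \<and> j < \<epsilon> r + (\<phi> r - right_minus r))" if "r > R" for r j
    unfolding plus_tail[OF that] by simp
  then show ?thesis unfolding surviving_Plus by (auto simp: not_le[symmetric])
qed

lemma surviving_Minus_Sigma:
  "surviving s Minus = (SIGMA r:{..<R}. {left_plus (Suc r)..<\<epsilon> r})"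
proof -
  have "\<not> (left_plus (Suc r) \<le> j \<and> j < \<epsilon> r)" if "r \<ge> R" for r j
    using minus_tail[OF that] by simp
  then show ?thesis unfolding surviving_Minus by (auto simp: not_less[symmetric])
qed

lemma finite_surviving: "finite (surviving s x)"
  by (cases x) (auto simp: surviving_Plus_Sigma surviving_Minus_Sigma)

lemma card_surviving_Plus: "card (surviving s Plus) = (\<Sum>r\<le>R. \<phi> r - right_minus r)"
  by (subst surviving_Plus_Sigma, subst card_SigmaI) auto

lemma card_surviving_Minus: "card (surviving s Minus) = (\<Sum>r<R. \<epsilon> r - left_plus (Suc r))"
  by (subst surviving_Minus_Sigma, subst card_SigmaI) auto

text \<open>An exact identity in the integers: what the truncated subtraction cuts off in one column
  is what \<open>right_minus\<close> carries on to the next.\<close>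

lemma sum_right_minus:
  "(\<Sum>q<r. int (\<phi> q - right_minus q)) = (\<Sum>q<r. int (\<phi> q) - int (\<epsilon> q)) + int (right_minus r)"
  by (induction r) auto

text \<open>Cancellation removes equally many signs of both kinds, so the difference is that of the
  unreduced word cut off at column \<open>R\<close>. Of that column only the plus signs count,
  because its minus signs are absorbed by the column to its left.\<close>

lemma card_surviving_diff:
  "int (card (surviving s Plus)) - int (card (surviving s Minus))
    = (\<Sum>r<R. int (\<phi> r) - int (\<epsilon> r)) + int (\<phi> R)"
proof -
  have "card (surviving s Minus) = (\<Sum>r<Suc R. \<epsilon> r - left_plus (Suc r))"
    using minus_tail[of R] by (simp add: card_surviving_Minus)
  also have "\<dots> = right_minus (Suc R) - \<epsilon> R"
    using sum_minus[of "Suc R"] left_plus_tail[of "Suc R"] tail[of R] by simp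
  finally have "int (card (surviving s Minus)) = int (right_minus (Suc R)) - int (\<epsilon> R)"
    using right_minus_ge[of R] by linarith
  moreover have "int (card (surviving s Plus))
      = (\<Sum>q<Suc R. int (\<phi> q) - int (\<epsilon> q)) + int (right_minus (Suc R))"
    using sum_right_minus[of "Suc R"] card_surviving_Plus lessThan_Suc_atMost[of R] by simp
  ultimately show ?thesis by simp
qed

lemma in_columns_Plus: "r \<in> fst ` surviving s Plus \<longleftrightarrow> right_minus r < \<phi> r"
  by (auto simp: surviving_Plus image_iff intro!: exI[of _ "\<epsilon> r"])

lemma in_columns_Minus: "r \<in> fst ` surviving s Minus \<longleftrightarrow> left_plus (Suc r) < \<epsilon> r"
  by (auto simp: surviving_Minus image_iff)

text \<open>Turns a maximum over all columns into two inequalities at column \<open>r\<close>: some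
  plus sign survives there, and whatever comes from the left is stopped by the minus signs of this
  column. In this form the words before and after a change of column \<open>r\<close> can be
  compared.\<close>

lemma leftmost_Plus_iff:
  "surviving s Plus \<noteq> {} \<and> Max (fst ` surviving s Plus) = r \<longleftrightarrow>
     right_minus r < \<phi> r \<and> left_plus (Suc r) \<le> \<epsilon> r"
proof (cases "r \<le> R \<and> right_minus r < \<phi> r")
  case True
  have "(\<forall>q>r. \<not> right_minus q < \<phi> q) \<longleftrightarrow> (\<forall>q\<in>{Suc r..R}. \<phi> q - right_minus q = 0)"
  proof (intro iffI allI impI)
    fix q assume *: "\<forall>q\<in>{Suc r..R}. \<phi> q - right_minus q = 0" and "q > r"
    show "\<not> right_minus q < \<phi> q"
    proof (cases "q \<le> R")
      case True
      with \<open>q > r\<close> have "q \<in> {Suc r..R}" by simp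
      with * have "\<phi> q - right_minus q = 0" by blast
      then show ?thesis by simp
    qed (use plus_tail[of q] in simp)
  qed (auto simp: not_less Suc_le_eq)
  also have "\<dots> \<longleftrightarrow> (\<Sum>q=Suc r..R. \<phi> q - right_minus q) = 0"
    by (rule sum_eq_0_iff[symmetric]) simp
  \<comment> \<open>Since \<open>right_minus r < \<phi> r\<close>, no minus sign passes column
    \<open>r\<close>, and \<open>right_minus (Suc r)\<close> is just
    \<open>\<epsilon> r\<close>.\<close>
  also have "\<dots> \<longleftrightarrow> left_plus (Suc r) \<le> \<epsilon> r"
    using sum_plus[of "Suc r"] True by simp
  finally have *: "(\<forall>q>r. \<not> right_minus q < \<phi> q) \<longleftrightarrow> left_plus (Suc r) \<le> \<epsilon> r" .
  have "r \<in> fst ` surviving s Plus" using True by (simp add: in_columns_Plus)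
  then have "surviving s Plus \<noteq> {} \<and> Max (fst ` surviving s Plus) = r \<longleftrightarrow>
      (\<forall>q\<in>fst ` surviving s Plus. q \<le> r)"
    using finite_surviving[of Plus]
    by (metis Max_eqI Max_ge empty_iff finite_imageI image_empty)
  also have "\<dots> \<longleftrightarrow> (\<forall>q>r. \<not> right_minus q < \<phi> q)"
    unfolding Ball_def in_columns_Plus by (auto simp: not_less)
  finally show ?thesis using True * by simp
next
  case False
  then have "\<not> right_minus r < \<phi> r" using plus_tail[of r] by auto
  moreover from this have "r \<notin> fst ` surviving s Plus" by (simp add: in_columns_Plus)
  then have "\<not> (surviving s Plus \<noteq> {} \<and> Max (fst ` surviving s Plus) = r)"
    using Max_in[of "fst ` surviving s Plus"] finite_surviving[of Plus] by (metis finite_imageI image_is_empty)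
  ultimately show ?thesis by simp
qed

lemma rightmost_Minus_iff:
  "surviving s Minus \<noteq> {} \<and> Min (fst ` surviving s Minus) = r \<longleftrightarrow>
     left_plus (Suc r) < \<epsilon> r \<and> right_minus r \<le> \<phi> r"
proof (cases "left_plus (Suc r) < \<epsilon> r")
  case True
  have "(\<forall>q<r. \<not> left_plus (Suc q) < \<epsilon> q) \<longleftrightarrow> (\<Sum>q<r. \<epsilon> q - left_plus (Suc q)) = 0"
    by (auto simp: not_less)
  also have "\<dots> \<longleftrightarrow> right_minus r \<le> \<phi> r"
    using sum_minus[of r] left_plus_rec[of r] True by simp
  finally have *: "(\<forall>q<r. \<not> left_plus (Suc q) < \<epsilon> q) \<longleftrightarrow> right_minus r \<le> \<phi> r" .
  have "r \<in> fst ` surviving s Minus" using True by (simp add: in_columns_Minus)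
  then have "surviving s Minus \<noteq> {} \<and> Min (fst ` surviving s Minus) = r \<longleftrightarrow>
      (\<forall>q\<in>fst ` surviving s Minus. r \<le> q)"
    using finite_surviving[of Minus]
    by (metis Min_eqI Min_le empty_iff finite_imageI image_empty)
  also have "\<dots> \<longleftrightarrow> (\<forall>q<r. \<not> left_plus (Suc q) < \<epsilon> q)"
    unfolding Ball_def in_columns_Minus by (auto simp: not_less[symmetric])
  finally show ?thesis using True * by simp
next
  case False
  then have "r \<notin> fst ` surviving s Minus" by (simp add: in_columns_Minus)
  then have "\<not> (surviving s Minus \<noteq> {} \<and> Min (fst ` surviving s Minus) = r)"
    using Min_in[of "fst ` surviving s Minus"] finite_surviving[of Minus] by (metis finite_imageI image_is_empty)
  with False show ?thesis by simp
qed

end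

lemma right_minus_cong:
  assumes "signature \<epsilon> \<phi> R s" "signature \<epsilon>' \<phi>' R s'"
    and "\<And>q. q < r \<Longrightarrow> \<epsilon> q = \<epsilon>' q" "\<And>q. q < r \<Longrightarrow> \<phi> q = \<phi>' q"
  shows "signature.right_minus \<epsilon> \<phi> r = signature.right_minus \<epsilon>' \<phi>' r"
  using assms(3,4)
proof (induction r)
  case 0
  then show ?case using assms(1,2) by (simp add: signature.right_minus.simps)
next
  case (Suc r)
  then show ?case using assms(1,2) by (simp add: signature.right_minus.simps)
qed

lemma left_plus_cong:
  assumes "signature \<epsilon> \<phi> R s" "signature \<epsilon>' \<phi>' R s'"
    and "\<And>q. q \<ge> r \<Longrightarrow> \<epsilon> q = \<epsilon>' q" "\<And>q. q \<ge> r \<Longrightarrow> \<phi> q = \<phi>' q"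
  shows "signature.left_plus \<epsilon> \<phi> R r = signature.left_plus \<epsilon>' \<phi>' R r"
  using assms(3,4)
proof (induction "Suc R - r" arbitrary: r)
  case 0
  then show ?case using assms(1,2) by (simp add: signature.left_plus_tail)
next
  case (Suc d)
  then have "signature.left_plus \<epsilon> \<phi> R (Suc r) = signature.left_plus \<epsilon>' \<phi>' R (Suc r)"
    by simp
  then show ?case using Suc.prems
      signature.left_plus_rec[OF assms(1), of r] signature.left_plus_rec[OF assms(2), of r] by simp
qed

text \<open>Both signature rules select column \<open>r\<close> precisely when the signs of column \<open>r\<close> that are
  involved survive, and the change in column \<open>r\<close> turns the one surviving sign into the other.\<close>
lemma signature_change:
  assumes sig: "signature \<epsilon> \<phi> R s" and sig': "signature \<epsilon>' \<phi>' R s'"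
    and eq: "\<And>q. q \<noteq> r \<Longrightarrow> \<epsilon>' q = \<epsilon> q" "\<And>q. q \<noteq> r \<Longrightarrow> \<phi>' q = \<phi> q"
    and r: "\<epsilon>' r = Suc (\<epsilon> r)" "\<phi> r = Suc (\<phi>' r)"
  shows "surviving s Plus \<noteq> {} \<and> Max (fst ` surviving s Plus) = r \<longleftrightarrow>
      surviving s' Minus \<noteq> {} \<and> Min (fst ` surviving s' Minus) = r" (is ?A)
    and "surviving s Plus \<noteq> {} \<Longrightarrow> Max (fst ` surviving s Plus) = r \<Longrightarrow>
      card (surviving s Plus) = Suc (card (surviving s' Plus))" (is "_ \<Longrightarrow> _ \<Longrightarrow> ?B")
    and "surviving s Plus \<noteq> {} \<Longrightarrow> Max (fst ` surviving s Plus) = r \<Longrightarrow>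
      card (surviving s' Minus) = Suc (card (surviving s Minus))" (is "_ \<Longrightarrow> _ \<Longrightarrow> ?C")
proof -
  interpret a: signature \<epsilon> \<phi> R s by (rule sig)
  interpret b: signature \<epsilon>' \<phi>' R s' by (rule sig')
  have M: "b.right_minus q = a.right_minus q" if "q \<le> r" for q
    using right_minus_cong[OF sig sig', of q] eq that by simp
  have K: "b.left_plus q = a.left_plus q" if "q > r" for q
    using left_plus_cong[OF sig sig', of q] eq that by simp
  show ?A
    unfolding a.leftmost_Plus_iff b.rightmost_Minus_iff using r M[of r] K[of "Suc r"] by auto
  assume "surviving s Plus \<noteq> {}" "Max (fst ` surviving s Plus) = r"
  then have *: "a.right_minus r < \<phi> r" "a.left_plus (Suc r) \<le> \<epsilon> r"
    using a.leftmost_Plus_iff by auto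
  then have rR: "r \<le> R" using a.plus_tail[of r] by (meson diff_is_0_eq not_le)
  have split_sum: "(\<Sum>q\<le>R. f q) = (\<Sum>q<r. f q) + f r + (\<Sum>q=Suc r..R. f q)" for f :: "nat \<Rightarrow> nat"
  proof -
    have "{..R} = {..<r} \<union> {r..R}" "{..<r} \<inter> {r..R} = {}" using rR by auto
    then show ?thesis using rR by (simp add: sum.union_disjoint sum.atLeast_Suc_atMost)
  qed
  \<comment> \<open>No plus sign survives to the left of the selected column, and to its right both
    words have the same survivors, so the two counts differ only in column \<open>r\<close>.\<close>
  have "(\<Sum>q=Suc r..R. \<phi> q - a.right_minus q) = 0" "(\<Sum>q=Suc r..R. \<phi>' q - b.right_minus q) = 0"
    using a.sum_plus[of "Suc r"] b.sum_plus[of "Suc r"] rR * K[of "Suc r"] r by auto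
  moreover have "(\<Sum>q<r. \<phi>' q - b.right_minus q) = (\<Sum>q<r. \<phi> q - a.right_minus q)"
    using eq M by (intro sum.cong) auto
  ultimately show ?B
    unfolding a.card_surviving_Plus b.card_surviving_Plus split_sum using * r M[of r] by simp
  have "card (surviving s Minus) = (\<Sum>q\<le>R. \<epsilon> q - a.left_plus (Suc q))"
    using a.minus_tail[of R] by (simp add: a.card_surviving_Minus flip: lessThan_Suc_atMost)
  moreover have "card (surviving s' Minus) = (\<Sum>q\<le>R. \<epsilon>' q - b.left_plus (Suc q))"
    using b.minus_tail[of R] by (simp add: b.card_surviving_Minus flip: lessThan_Suc_atMost)
  moreover have "(\<Sum>q=Suc r..R. \<epsilon>' q - b.left_plus (Suc q)) = (\<Sum>q=Suc r..R. \<epsilon> q - a.left_plus (Suc q))"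
    using eq K by (intro sum.cong) auto
  moreover have "(\<Sum>q<r. \<epsilon> q - a.left_plus (Suc q)) = 0" "(\<Sum>q<r. \<epsilon>' q - b.left_plus (Suc q)) = 0"
    using a.sum_minus[of r] b.sum_minus[of r] a.left_plus_rec[of r] b.left_plus_rec[of r] M[of r] * r K[of "Suc r"]
    by auto
  ultimately show ?C
    unfolding split_sum using * r K[of "Suc r"] by simp
qed

section \<open>Strings of partial operators\<close>

lemma iterate_Suc_left: "iterate g (Suc n) x = Option.bind (g x) (iterate g n)"
  by (induction n) (auto split: bind_split)

text \<open>\<open>Max\<close> of an infinite set is unspecified, so each use owes a bound on the
  length of the string; on columns the weight provides it.\<close>

lemma Max_iterate_Suc:
  assumes "g x = Some y" and "finite {n. iterate g n y \<noteq> None}"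
  shows "Max {n. iterate g n x \<noteq> None} = Suc (Max {n. iterate g n y \<noteq> None})"
proof -
  have "{n. iterate g n x \<noteq> None} = insert 0 (Suc ` {n. iterate g n y \<noteq> None})"
  proof (rule set_eqI)
    fix n
    show "n \<in> {n. iterate g n x \<noteq> None} \<longleftrightarrow> n \<in> insert 0 (Suc ` {n. iterate g n y \<noteq> None})"
      using assms(1) by (cases n) (auto simp: iterate_Suc_left simp del: iterate.simps(2))
  qed
  moreover have "Max (insert 0 (Suc ` S)) = Suc (Max S)" if "finite S" "S \<noteq> {}" for S
    using that by (intro Max_eqI) (auto intro: Max_ge Max_in)
  moreover have "0 \<in> {n. iterate g n y \<noteq> None}" by simp
  ultimately show ?thesis using assms(2) by (metis (no_types, lifting) empty_iff)
qed

lemma Max_iterate_None: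
  assumes "g x = None"
  shows "Max {n. iterate g n x \<noteq> None} = 0"
proof -
  have "{n. iterate g n x \<noteq> None} = {0}"
  proof (rule set_eqI)
    fix n
    show "n \<in> {n. iterate g n x \<noteq> None} \<longleftrightarrow> n \<in> {0}"
      using assms by (cases n) (auto simp: iterate_Suc_left simp del: iterate.simps(2))
  qed
  then show ?thesis by simp
qed

text \<open>Transport of strings along \<open>h\<close>, restricted to a set that the operator
  preserves: the identification of columns is controlled on Young columns only.\<close>

lemma iterate_map_option:
  assumes "\<And>x. x \<in> A \<Longrightarrow> g' (h x) = map_option h (g x)"
    and "\<And>x y. x \<in> A \<Longrightarrow> g x = Some y \<Longrightarrow> y \<in> A" and "x \<in> A"
  shows "iterate g' n (h x) = map_option h (iterate g n x)
    \<and> (\<forall>y. iterate g n x = Some y \<longrightarrow> y \<in> A)"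
proof (induction n)
  case 0
  then show ?case using assms(3) by simp
next
  case (Suc n)
  show ?case
  proof (cases "iterate g n x")
    case None
    with Suc show ?thesis by simp
  next
    case (Some y)
    with Suc assms(1)[of y] assms(2)[of y] show ?thesis by simp
  qed
qed

text \<open>A Young column has infinitely many blocks, so the simple roots of all its blocks cannot
  be summed. The weight is taken relative to a reference column \<open>g\<close>, from which it
  differs in finitely many blocks.\<close>

definition relative_weight :: "affine_type \<Rightarrow> nat \<Rightarrow> block set \<Rightarrow> block set \<Rightarrow> int" where
  "relative_weight t i g y =
     (\<Sum>b\<in>g - y. cartan t i (colour b)) - (\<Sum>b\<in>y - g. cartan t i (colour b))"

lemma relative_weight_insert:
  assumes "b \<notin> y" "finite (y - g)" "finite (g - y)"
  shows "relative_weight t i g (insert b y) = relative_weight t i g y - cartan t i (colour b)"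
proof (cases "b \<in> g")
  case True
  then have *: "g - y = insert b (g - insert b y)" "insert b y - g = y - g"
    using assms(1) by auto
  have "finite (g - insert b y)" by (rule finite_subset[OF _ assms(3)]) auto
  then have "(\<Sum>b\<in>g - y. cartan t i (colour b))
      = cartan t i (colour b) + (\<Sum>b\<in>g - insert b y. cartan t i (colour b))"
    by (subst *(1), subst sum.insert) auto
  then show ?thesis by (simp add: relative_weight_def *(2))
next
  case False
  then have *: "g - insert b y = g - y" "insert b y - g = insert b (y - g)" "b \<notin> y - g"
    using assms(1) by auto
  then show ?thesis unfolding relative_weight_def * using assms(2) by simp
qed

text \<open>The integer \<open>wt r i y\<close> is the coefficient of \<open>\<Lambda>\<^sub>i\<close> in the classical weight of the Young
  column \<open>y\<close> of column \<open>r\<close>.\<close>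
locale column_crystals =
  fixes t :: affine_type and wt :: "nat \<Rightarrow> nat \<Rightarrow> block set \<Rightarrow> int"
  assumes wt_relative: "young_column t (wall_pattern t r) y \<Longrightarrow>
      wt r i y = wt r i (ground_column t r) + relative_weight t i (ground_column t r) y"
    and finite_difference: "young_column t (wall_pattern t r) y \<Longrightarrow>
      finite (y - ground_column t r) \<and> finite (ground_column t r - y)"
    and young_ground: "young_column t (wall_pattern t r) (ground_column t r)"
    and colour_index: "young_column t (wall_pattern t r) y \<Longrightarrow> b \<in> y \<Longrightarrow> colour b \<in> index_set t"
    and column_f_block: "young_column t (wall_pattern t r) y \<Longrightarrow>
      column_f t (wall_pattern t r) i y = Some y' \<Longrightarrow>
      young_column t (wall_pattern t r) y' \<and> (\<exists>b. b \<notin> y \<and> colour b = i \<and> y' = insert b y)"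
    and column_e_young: "young_column t (wall_pattern t r) y \<Longrightarrow>
      column_e t (wall_pattern t r) i y = Some y' \<Longrightarrow> young_column t (wall_pattern t r) y'"
    and column_f_iff_e: "i \<in> index_set t \<Longrightarrow>
      young_column t (wall_pattern t r) y \<Longrightarrow> young_column t (wall_pattern t r) y' \<Longrightarrow>
      column_f t (wall_pattern t r) i y = Some y' \<longleftrightarrow> column_e t (wall_pattern t r) i y' = Some y"
    and wt_bound: "i \<in> index_set t \<Longrightarrow> young_column t (wall_pattern t r) y \<Longrightarrow> \<bar>wt r i y\<bar> \<le> 2"
    and column_f_None_iff: "i \<in> index_set t \<Longrightarrow> young_column t (wall_pattern t r) y \<Longrightarrow>
      column_f t (wall_pattern t r) i y = None \<longleftrightarrow>
      wt r i y < 0 \<or> wt r i y = 0 \<and> column_e t (wall_pattern t r) i y = None"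
    and column_e_None_iff: "i \<in> index_set t \<Longrightarrow> young_column t (wall_pattern t r) y \<Longrightarrow>
      column_e t (wall_pattern t r) i y = None \<longleftrightarrow>
      wt r i y > 0 \<or> wt r i y = 0 \<and> column_f t (wall_pattern t r) i y = None"
    and ground_wt_0: "i \<in> index_set t \<Longrightarrow>
      wt 0 i (ground_column t 0) \<le> 0 \<or> i = 0 \<and> wt 0 i (ground_column t 0) = 1"
    and ground_f_0: "i \<in> index_set t \<Longrightarrow>
      column_f t (wall_pattern t 0) i (ground_column t 0) \<noteq> None \<longleftrightarrow> i = 0"
    and ground_wt_Suc: "i \<in> index_set t \<Longrightarrow>
      max 0 (wt (Suc r) i (ground_column t (Suc r))) = max 0 (- wt r i (ground_column t r))"
    and ground_f_Suc: "i \<in> index_set t \<Longrightarrow>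
      column_f t (wall_pattern t (Suc r)) i (ground_column t (Suc r)) \<noteq> None \<longleftrightarrow>
      column_e t (wall_pattern t r) i (ground_column t r) \<noteq> None"
begin

abbreviation young :: "nat \<Rightarrow> block set \<Rightarrow> bool" where
  "young r \<equiv> young_column t (wall_pattern t r)"
abbreviation f :: "nat \<Rightarrow> nat \<Rightarrow> block set \<Rightarrow> block set option" where
  "f r \<equiv> column_f t (wall_pattern t r)"
abbreviation e :: "nat \<Rightarrow> nat \<Rightarrow> block set \<Rightarrow> block set option" where
  "e r \<equiv> column_e t (wall_pattern t r)"

definition phi :: "nat \<Rightarrow> nat \<Rightarrow> block set \<Rightarrow> nat" where
  "phi r i y = Max {n. iterate (f r i) n y \<noteq> None}"
definition eps :: "nat \<Rightarrow> nat \<Rightarrow> block set \<Rightarrow> nat" where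
  "eps r i y = Max {n. iterate (e r i) n y \<noteq> None}"

lemma wt_insert:
  assumes "young r y" "young r (insert b y)" "b \<notin> y"
  shows "wt r i (insert b y) = wt r i y - cartan t i (colour b)"
  using relative_weight_insert[of b y "ground_column t r"] wt_relative assms finite_difference by auto

lemma wt_f:
  assumes "young r y" "f r i y = Some y'"
  shows "wt r j y' = wt r j y - cartan t j i"
  using column_f_block[OF assms] wt_insert[OF assms(1)] by auto

lemma wt_e:
  assumes "i \<in> index_set t" "young r y" "e r i y = Some y'"
  shows "wt r j y' = wt r j y + cartan t j i"
  using wt_f[of r y' i y j] column_f_iff_e[of i r y' y] column_e_young[OF assms(2,3)] assms by simp

lemma iterate_f:
  assumes "young r y" "iterate (f r i) n y = Some z"
  shows "young r z \<and> wt r i z = wt r i y - 2 * int n"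
  using assms(2)
proof (induction n arbitrary: z)
  case 0
  then show ?case using assms(1) by simp
next
  case (Suc n)
  then obtain x where x: "iterate (f r i) n y = Some x" "f r i x = Some z"
    by (auto simp: bind_eq_Some_conv)
  with Suc.IH[OF x(1)] wt_f[of r x i z i] column_f_block[of r x i z] show ?case
    by (auto simp: cartan_def)
qed

lemma iterate_e:
  assumes "i \<in> index_set t" "young r y" "iterate (e r i) n y = Some z"
  shows "young r z \<and> wt r i z = wt r i y + 2 * int n"
  using assms(3)
proof (induction n arbitrary: z)
  case 0
  then show ?case using assms(2) by simp
next
  case (Suc n)
  then obtain x where x: "iterate (e r i) n y = Some x" "e r i x = Some z"
    by (auto simp: bind_eq_Some_conv)
  with Suc.IH[OF x(1)] wt_e[of i r x z i] column_e_young[of r x i z] assms(1) show ?case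
    by (auto simp: cartan_def)
qed

text \<open>Each step lowers the weight by 2 inside the interval from -2 to 2, so a string has at
  most two steps.\<close>

lemma finite_iterate_f:
  assumes "i \<in> index_set t" "young r y"
  shows "finite {n. iterate (f r i) n y \<noteq> None}"
proof -
  have "n \<le> 2" if "iterate (f r i) n y = Some z" for n z
  proof -
    from iterate_f[OF assms(2) that] have z: "young r z" and w: "wt r i z = wt r i y - 2 * int n" by auto
    from wt_bound[OF assms] wt_bound[OF assms(1) z] w show ?thesis by (simp add: abs_le_iff)
  qed
  then have "{n. iterate (f r i) n y \<noteq> None} \<subseteq> {..2}" by auto
  then show ?thesis by (rule finite_subset) simp
qed

lemma finite_iterate_e:
  assumes "i \<in> index_set t" "young r y"
  shows "finite {n. iterate (e r i) n y \<noteq> None}"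
proof -
  have "n \<le> 2" if "iterate (e r i) n y = Some z" for n z
  proof -
    from iterate_e[OF assms that] have z: "young r z" and w: "wt r i z = wt r i y + 2 * int n" by auto
    from wt_bound[OF assms] wt_bound[OF assms(1) z] w show ?thesis by (simp add: abs_le_iff)
  qed
  then have "{n. iterate (e r i) n y \<noteq> None} \<subseteq> {..2}" by auto
  then show ?thesis by (rule finite_subset) simp
qed

lemma phi_Some: "i \<in> index_set t \<Longrightarrow> young r y \<Longrightarrow> f r i y = Some y' \<Longrightarrow> phi r i y = Suc (phi r i y')"
  unfolding phi_def using column_f_block[of r y i y'] by (intro Max_iterate_Suc finite_iterate_f) auto

lemma eps_Some: "i \<in> index_set t \<Longrightarrow> young r y \<Longrightarrow> e r i y = Some y' \<Longrightarrow> eps r i y = Suc (eps r i y')"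
  unfolding eps_def using column_e_young[of r y i y'] by (intro Max_iterate_Suc finite_iterate_e) auto

lemma phi_None: "f r i y = None \<Longrightarrow> phi r i y = 0"
  unfolding phi_def by (rule Max_iterate_None)

lemma eps_None: "e r i y = None \<Longrightarrow> eps r i y = 0"
  unfolding eps_def by (rule Max_iterate_None)

lemma f_Some_eps:
  assumes "i \<in> index_set t" "young r y" "f r i y = Some y'"
  shows "eps r i y' = Suc (eps r i y)"
  using eps_Some[of i r y' y] column_f_iff_e[of i r y y'] column_f_block[OF assms(2,3)] assms by auto

text \<open>The weight determines the position in the string except at 0, where an isolated element
  and the middle of a string of length two look alike; hence the extra condition on
  \<open>f\<close>. The measure decreases because \<open>f\<close> lowers the weight by 2 and
  weights are at least -2.\<close>

lemma phi_bound_aux: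
  assumes "i \<in> index_set t"
  shows "young r y \<Longrightarrow> int (phi r i y) = (if wt r i y > 0 then wt r i y
     else if wt r i y = 0 \<and> f r i y \<noteq> None then 1 else 0)"
proof (induction "nat (wt r i y + 2)" arbitrary: y rule: less_induct)
  case less
  show ?case
  proof (cases "f r i y")
    case None
    then show ?thesis using phi_None column_f_None_iff[OF assms less.prems] by auto
  next
    case (Some y')
    have y': "young r y'" "wt r i y' = wt r i y - 2"
      using column_f_block[OF less.prems Some] wt_f[OF less.prems Some, of i] by (auto simp: cartan_def)
    have e': "e r i y' \<noteq> None" using column_f_iff_e[OF assms less.prems y'(1)] Some by auto
    have "\<not> wt r i y < 0" using column_f_None_iff[OF assms less.prems] Some by auto
    moreover have "\<bar>wt r i y\<bar> \<le> 2" using wt_bound[OF assms less.prems] .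
    moreover have "\<not> 0 < wt r i y'" using column_e_None_iff[OF assms y'(1)] e' by auto
    \<comment> \<open>\<open>e\<close> acts on \<open>y'\<close>, so at weight 0 it is the middle of
      a string and \<open>f\<close> acts as well.\<close>
    moreover have "wt r i y' = 0 \<Longrightarrow> f r i y' \<noteq> None"
      using column_f_None_iff[OF assms y'(1)] e' by auto
    moreover have "int (phi r i y') = (if wt r i y' > 0 then wt r i y'
       else if wt r i y' = 0 \<and> f r i y' \<noteq> None then 1 else 0)"
      using less.hyps[of y'] y' calculation by auto
    moreover have "wt r i y = 0 \<or> wt r i y = 1 \<or> wt r i y = 2"
      using calculation(1,2) by linarith
    ultimately show ?thesis using phi_Some[OF assms less.prems Some] Some y'(2) by auto
  qed
qed

lemma eps_bound_aux:
  assumes "i \<in> index_set t"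
  shows "young r y \<Longrightarrow> int (eps r i y) = (if wt r i y < 0 then - wt r i y
     else if wt r i y = 0 \<and> e r i y \<noteq> None then 1 else 0)"
proof (induction "nat (2 - wt r i y)" arbitrary: y rule: less_induct)
  case less
  show ?case
  proof (cases "e r i y")
    case None
    then show ?thesis using eps_None column_e_None_iff[OF assms less.prems] by auto
  next
    case (Some y')
    have y': "young r y'" "wt r i y' = wt r i y + 2"
      using column_e_young[OF less.prems Some] wt_e[OF assms less.prems Some, of i]
      by (auto simp: cartan_def)
    have f': "f r i y' \<noteq> None" using column_f_iff_e[OF assms y'(1) less.prems] Some by auto
    have "\<not> 0 < wt r i y" using column_e_None_iff[OF assms less.prems] Some by auto
    moreover have "\<bar>wt r i y\<bar> \<le> 2" using wt_bound[OF assms less.prems] .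
    moreover have "\<not> wt r i y' < 0" using column_f_None_iff[OF assms y'(1)] f' by auto
    moreover have "wt r i y' = 0 \<Longrightarrow> e r i y' \<noteq> None"
      using column_e_None_iff[OF assms y'(1)] f' by auto
    moreover have "int (eps r i y') = (if wt r i y' < 0 then - wt r i y'
       else if wt r i y' = 0 \<and> e r i y' \<noteq> None then 1 else 0)"
      using less.hyps[of y'] y' calculation by auto
    moreover have "wt r i y = 0 \<or> wt r i y = -1 \<or> wt r i y = -2"
      using calculation(1,2) by linarith
    ultimately show ?thesis using eps_Some[OF assms less.prems Some] Some y'(2) by auto
  qed
qed

lemma phi_minus_eps: "i \<in> index_set t \<Longrightarrow> young r y \<Longrightarrow> int (phi r i y) - int (eps r i y) = wt r i y"
  using phi_bound_aux[of i r y] eps_bound_aux[of i r y] column_f_None_iff[of i r y]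
    column_e_None_iff[of i r y] by auto

text \<open>The condition of a ground state path, which provides the assumption \<open>tail\<close>
  of \<open>signature\<close>. Weights settle the matter where they are nonzero; at weight 0 the
  operators themselves have to be compared.\<close>

lemma phi_ground_Suc:
  assumes "i \<in> index_set t"
  shows "phi (Suc r) i (ground_column t (Suc r)) = eps r i (ground_column t r)"
proof -
  have "int (phi (Suc r) i (ground_column t (Suc r))) = int (eps r i (ground_column t r))"
    using phi_bound_aux[OF assms young_ground, of "Suc r"] eps_bound_aux[OF assms young_ground, of r]
      ground_wt_Suc[OF assms, of r] ground_f_Suc[OF assms, of r]
      column_f_None_iff[OF assms young_ground, of "Suc r"] column_e_None_iff[OF assms young_ground, of r]
    by (auto simp: max_def split: if_splits)
  then show ?thesis by simp
qed

lemma phi_ground_0: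
  assumes "i \<in> index_set t"
  shows "phi 0 i (ground_column t 0) = (if i = 0 then 1 else 0)"
  using phi_bound_aux[OF assms young_ground, of 0] ground_wt_0[OF assms] ground_f_0[OF assms]
    column_f_None_iff[OF assms young_ground, of 0] by (auto split: if_splits)

end

section \<open>The affine weight of a Young wall\<close>

lemma coroot_pairing_simps [simp]:
  "coroot_pairing i (v + w) = coroot_pairing i v + coroot_pairing i w"
  "coroot_pairing i (v - w) = coroot_pairing i v - coroot_pairing i w"
  "coroot_pairing i (scale k w) = k * coroot_pairing i w"
  "coroot_pairing i 0 = 0"
  "coroot_pairing i null_root = 0"
  "coroot_pairing i (fundamental_weight j) = (if i = j then 1 else 0)"
  by (cases v; cases w; simp add: coroot_pairing_def scale_def null_root_def fundamental_weight_def
      zero_prod_def)+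

lemma coroot_pairing_sum [simp]: "coroot_pairing i (sum g A) = (\<Sum>a\<in>A. coroot_pairing i (g a))"
  by (induction A rule: infinite_finite_induct) auto

lemma weight_lattice_iff: "w \<in> weight_lattice t \<longleftrightarrow> (\<forall>i. i \<notin> index_set t \<longrightarrow> coroot_pairing i w = 0)"
  by (cases w) (simp add: weight_lattice_def coroot_pairing_def)

lemma finite_index_set [simp]: "finite (index_set t)"
  by (simp add: index_set_def)

lemma coroot_pairing_simple_root:
  "coroot_pairing i (simple_root t j) = (if i \<in> index_set t then cartan t i j else 0)"
  by (auto simp: simple_root_def if_distrib[of "\<lambda>x. _ * x"] cong: if_cong)

lemma scale_simps:
  "scale (j + k) w = scale j w + scale k w" "scale 0 w = 0" "scale 1 w = w"
  by (cases w; simp add: scale_def algebra_simps zero_prod_def zero_fun_def plus_fun_def)+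

lemma wall_wt_in_lattice: "wall_wt t Y \<in> weight_lattice t"
  by (simp add: weight_lattice_iff wall_wt_def coroot_pairing_simple_root)
     (auto simp: index_set_def)

lemma wall_wt_change:
  assumes "\<And>j. block_difference t j Y' = block_difference t j Y + (if j = i then 1 else 0)"
    and "i \<in> index_set t"
  shows "wall_wt t Y' = wall_wt t Y - simple_root t i"
proof -
  have *: "scale (if j = i then 1 else 0) (simple_root t j) = (if j = i then simple_root t i else 0)" for j
    by (simp add: scale_simps)
  show ?thesis
    using assms(2) by (simp add: wall_wt_def assms(1) scale_simps(1) sum.distrib * diff_diff_eq)
qed

text \<open>Adding a block outside the ground state enlarges the first of the two counted sets,
  adding a missing ground state block shrinks the second; finiteness makes both changes visible to
  \<open>card\<close>.\<close>

lemma block_difference_insert: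
  assumes "finite {(r, b). (b \<in> Y r) \<noteq> (b \<in> ground_column t r)}" and "b \<notin> Y r"
  shows "block_difference t j (Y(r := insert b (Y r))) =
    block_difference t j Y + (if j = colour b then 1 else 0)"
proof -
  let ?Y' = "Y(r := insert b (Y r))"
  define P where "P Y = {(r, b). colour b = j \<and> b \<in> Y r - ground_column t r}" for Y
  define N where "N Y = {(r, b). colour b = j \<and> b \<in> ground_column t r - Y r}" for Y
  have fin: "finite (P Y)" "finite (N Y)"
    by (rule finite_subset[OF _ assms(1)], auto simp: P_def N_def)+
  have bd: "block_difference t j Z = int (card (P Z)) - int (card (N Z))" for Z
    by (simp add: block_difference_def P_def N_def)
  consider "j \<noteq> colour b" | "j = colour b" "b \<in> ground_column t r" | "j = colour b" "b \<notin> ground_column t r"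
    by blast
  then show ?thesis
  proof cases
    case 1
    then have "P ?Y' = P Y" "N ?Y' = N Y"
      by (auto simp: P_def N_def split: if_splits)
    with 1 show ?thesis by (simp add: bd)
  next
    case 2
    then have "P ?Y' = P Y" "N Y = insert (r, b) (N ?Y')" "(r, b) \<notin> N ?Y'"
      using assms(2) by (auto simp: P_def N_def split: if_splits)
    moreover from this have "finite (N ?Y')" using fin(2) by simp
    ultimately show ?thesis using 2 bd[of Y] bd[of ?Y'] by simp
  next
    case 3
    then have "N ?Y' = N Y" "P ?Y' = insert (r, b) (P Y)" "(r, b) \<notin> P Y"
      using assms(2) by (auto simp: P_def N_def split: if_splits)
    then show ?thesis using 3 fin(1) bd[of Y] bd[of ?Y'] by simp
  qed
qed

context column_crystals
begin

text \<open>The blocks in which the wall deviates from the ground state, sorted by colour instead of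
  by column.\<close>

lemma sum_relative_weight:
  assumes "young_wall t Y" and "\<And>r. r \<ge> R \<Longrightarrow> Y r = ground_column t r"
  shows "(\<Sum>r<R. relative_weight t i (ground_column t r) (Y r))
    = - (\<Sum>j\<in>index_set t. block_difference t j Y * cartan t i j)"
proof -
  have y: "young r (Y r)" for r using assms(1) by (simp add: young_wall_def)
  define D1 where "D1 = (SIGMA r:{..<R}. Y r - ground_column t r)"
  define D2 where "D2 = (SIGMA r:{..<R}. ground_column t r - Y r)"
  have fin: "finite D1" "finite D2"
    unfolding D1_def D2_def using finite_difference[OF y] by (auto intro!: finite_SigmaI)
  have less: "r < R" if "Y r \<noteq> ground_column t r" for r
    using assms(2)[of r] that by (meson not_le)
  have c1: "(\<Sum>p\<in>D. cartan t i (colour (snd p)))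
      = (\<Sum>j\<in>index_set t. int (card {p\<in>D. colour (snd p) = j}) * cartan t i j)"
    if "D = D1 \<or> D = D2" for D
  proof -
    have "finite D" "(\<lambda>p. colour (snd p)) ` D \<subseteq> index_set t"
      using that fin colour_index[OF y] colour_index[OF young_ground] by (auto simp: D1_def D2_def)
    from sum.group[OF this(1) _ this(2), of "\<lambda>p. cartan t i (colour (snd p))", symmetric]
    show ?thesis by simp
  qed
  have "(\<Sum>r<R. relative_weight t i (ground_column t r) (Y r))
      = (\<Sum>p\<in>D2. cartan t i (colour (snd p))) - (\<Sum>p\<in>D1. cartan t i (colour (snd p)))"
    unfolding relative_weight_def sum_subtractf D1_def D2_def
    using finite_difference[OF y] by (subst (1 2) sum.Sigma) (auto simp: case_prod_beta)
  also have "\<dots> = - (\<Sum>j\<in>index_set t. block_difference t j Y * cartan t i j)"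
  proof -
    have "{p\<in>D1. colour (snd p) = j} = {(r, b). colour b = j \<and> b \<in> Y r - ground_column t r}"
      "{p\<in>D2. colour (snd p) = j} = {(r, b). colour b = j \<and> b \<in> ground_column t r - Y r}" for j
      using less by (auto simp: D1_def D2_def)
    then show ?thesis
      by (simp add: c1 block_difference_def left_diff_distrib sum_subtractf)
  qed
  finally show ?thesis .
qed

text \<open>A telescoping sum: the weight of column \<open>r\<close> is its \<open>phi\<close> minus
  its \<open>eps\<close>, and the latter is the \<open>phi\<close> of column \<open>Suc r\<close>.
  What remains is the \<open>phi\<close> of column 0, which is the pairing with
  \<open>\<Lambda>\<^sub>0\<close>.\<close>

lemma sum_wt_ground:
  assumes "i \<in> index_set t"
  shows "(\<Sum>r<R. wt r i (ground_column t r)) + int (phi R i (ground_column t R)) = (if i = 0 then 1 else 0)"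
proof (induction R)
  case 0
  then show ?case using phi_ground_0[OF assms] by simp
next
  case (Suc R)
  then show ?case
    using phi_ground_Suc[OF assms, of R] phi_minus_eps[OF assms young_ground, of R] by simp
qed

end

section \<open>The signature rule on Young walls\<close>

locale wall_crystal = column_crystals +
  fixes H :: "block set set \<times> block set set \<Rightarrow> int"
    and m :: "nat \<Rightarrow> int"
    and \<iota> :: "nat \<Rightarrow> block set \<Rightarrow> int \<times> block set set"
  assumes energy: "energy_function t H" and identification: "column_identification t m \<iota>"
begin

lemma
  assumes "i \<in> index_set t" "young r y"
  shows Caff_e_eq: "Caff_e t i (\<iota> r y) = map_option (\<iota> r) (e r i y)"
    and Caff_f_eq: "Caff_f t i (\<iota> r y) = map_option (\<iota> r) (f r i y)"
  using identification assms unfolding column_identification_def by auto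

lemma in_C_carrier: "young r y \<Longrightarrow> snd (\<iota> r y) \<in> C_carrier t"
proof -
  assume "young r y"
  moreover have "bij_betw (\<iota> r) {y. young r y} (Caff_carrier t)"
    using identification by (simp add: column_identification_def)
  ultimately have "\<iota> r y \<in> Caff_carrier t" by (auto simp: bij_betw_def)
  then show ?thesis by (auto simp: Caff_carrier_def)
qed

text \<open>The operators on \<open>C\<close> are defined through a chosen representative of the
  class. The identification lets them be computed on the given column instead, so that this choice
  is never examined.\<close>

lemma C_f_eq:
  assumes "i \<in> index_set t" "young r y"
  shows "C_f t i (snd (\<iota> r y)) = map_option (snd \<circ> \<iota> r) (f r i y)"
proof -
  have "map_option snd (Caff_f t i (\<iota> r y)) = C_f t i (snd (\<iota> r y))"
    by (simp add: Caff_f_def case_prod_beta option.map_comp comp_def option.map_ident)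
  then show ?thesis using Caff_f_eq[OF assms] by (simp add: option.map_comp)
qed

lemma C_e_eq:
  assumes "i \<in> index_set t" "young r y"
  shows "C_e t i (snd (\<iota> r y)) = map_option (snd \<circ> \<iota> r) (e r i y)"
proof -
  have "map_option snd (Caff_e t i (\<iota> r y)) = C_e t i (snd (\<iota> r y))"
    by (simp add: Caff_e_def case_prod_beta option.map_comp comp_def option.map_ident)
  then show ?thesis using Caff_e_eq[OF assms] by (simp add: option.map_comp)
qed

lemma f_exponent:
  assumes "i \<in> index_set t" "young r y" "f r i y = Some y'"
  shows "fst (\<iota> r y') = fst (\<iota> r y) - (if i = 0 then 1 else 0)"
  using Caff_f_eq[OF assms(1,2)] assms(3) by (auto simp: Caff_f_def case_prod_beta) (metis fst_conv)+

lemma C_phi_eq: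
  assumes "i \<in> index_set t" "young r y"
  shows "C_phi t i (snd (\<iota> r y)) = phi r i y"
proof -
  have "iterate (C_f t i) n ((snd \<circ> \<iota> r) y) = map_option (snd \<circ> \<iota> r) (iterate (f r i) n y)" for n
    using iterate_map_option[of "{y. young r y}" "C_f t i" "snd \<circ> \<iota> r" "f r i" y n]
      assms C_f_eq column_f_block by auto
  then show ?thesis by (simp add: C_phi_def phi_def)
qed

lemma C_eps_eq:
  assumes "i \<in> index_set t" "young r y"
  shows "C_eps t i (snd (\<iota> r y)) = eps r i y"
proof -
  have "iterate (C_e t i) n ((snd \<circ> \<iota> r) y) = map_option (snd \<circ> \<iota> r) (iterate (e r i) n y)" for n
    using iterate_map_option[of "{y. young r y}" "C_e t i" "snd \<circ> \<iota> r" "e r i" y n]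
      assms C_e_eq column_e_young by auto
  then show ?thesis by (simp add: C_eps_def eps_def)
qed

lemma young_wall_columns: "young_wall t Y \<Longrightarrow> young r (Y r)"
  by (simp add: young_wall_def)

lemma eventually_ground:
  assumes "young_wall t Y"
  obtains R where "\<And>r. r \<ge> R \<Longrightarrow> Y r = ground_column t r"
proof -
  have "finite (fst ` {(r, b). (b \<in> Y r) \<noteq> (b \<in> ground_column t r)})"
    using assms by (auto simp: young_wall_def)
  then obtain R where R: "\<forall>r\<in>fst ` {(r, b). (b \<in> Y r) \<noteq> (b \<in> ground_column t r)}. r < R"
    using finite_nat_set_iff_bounded by blast
  have "Y r = ground_column t r" if "r \<ge> R" for r
  proof (rule set_eqI, rule ccontr)
    fix b assume "(b \<in> Y r) \<noteq> (b \<in> ground_column t r)"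
    then have "(r, b) \<in> {(r, b). (b \<in> Y r) \<noteq> (b \<in> ground_column t r)}" by simp
    with R have "r < R" by force
    with that show False by simp
  qed
  then show ?thesis by (rule that)
qed

lemma wall_signature:
  assumes "i \<in> index_set t" "young_wall t Y" "\<And>r. r \<ge> R \<Longrightarrow> Y r = ground_column t r"
  shows "signature (\<lambda>r. eps r i (Y r)) (\<lambda>r. phi r i (Y r)) R (column_signs t \<iota> i Y)"
proof
  show "column_signs t \<iota> i Y r = replicate (eps r i (Y r)) Minus @ replicate (phi r i (Y r)) Plus" for r
    using C_phi_eq[OF assms(1)] C_eps_eq[OF assms(1)] young_wall_columns[OF assms(2)]
    by (simp add: column_signs_def Let_def)
  show "phi (Suc r) i (Y (Suc r)) = eps r i (Y r)" if "r \<ge> R" for r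
    using phi_ground_Suc[OF assms(1), of r] assms(3) that by simp
qed

text \<open>Nonemptiness is included because \<open>Max\<close> and \<open>Min\<close> of the empty
  set would name an arbitrary column.\<close>

definition plus_column :: "nat \<Rightarrow> (nat \<Rightarrow> block set) \<Rightarrow> nat \<Rightarrow> bool" where
  "plus_column i Y r \<longleftrightarrow> surviving (column_signs t \<iota> i Y) Plus \<noteq> {} \<and>
     Max (fst ` surviving (column_signs t \<iota> i Y) Plus) = r"

definition minus_column :: "nat \<Rightarrow> (nat \<Rightarrow> block set) \<Rightarrow> nat \<Rightarrow> bool" where
  "minus_column i Y r \<longleftrightarrow> surviving (column_signs t \<iota> i Y) Minus \<noteq> {} \<and>
     Min (fst ` surviving (column_signs t \<iota> i Y) Minus) = r"

lemma wall_f_Some_iff: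
  "wall_f t \<iota> i Y = Some Y' \<longleftrightarrow>
     (\<exists>r y'. plus_column i Y r \<and> f r i (Y r) = Some y' \<and> Y' = Y(r := y'))"
  by (auto simp: wall_f_def plus_column_def Let_def)

lemma wall_e_Some_iff:
  "wall_e t \<iota> i Y = Some Y' \<longleftrightarrow>
     (\<exists>r y'. minus_column i Y r \<and> e r i (Y r) = Some y' \<and> Y' = Y(r := y'))"
  by (auto simp: wall_e_def minus_column_def Let_def)

lemma young_wall_update:
  assumes "young_wall t Y" "young r y"
  shows "young_wall t (Y(r := y))"
proof -
  let ?D = "\<lambda>Y. {(r, b). (b \<in> Y r) \<noteq> (b \<in> ground_column t r)}"
  have "?D (Y(r := y)) \<subseteq> ?D Y \<union> Pair r ` ((y - ground_column t r) \<union> (ground_column t r - y))"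
    by (auto split: if_splits)
  moreover have "finite \<dots>"
    using assms finite_difference[of r y] by (auto simp: young_wall_def)
  ultimately have "finite (?D (Y(r := y)))" by (rule finite_subset)
  then show ?thesis using assms by (auto simp: young_wall_def)
qed

context
  fixes i r Y y'
  assumes i: "i \<in> index_set t" and Y: "young_wall t Y" and fY: "f r i (Y r) = Some y'"
begin

lemma young_y': "young r y'"
  using column_f_block[OF young_wall_columns[OF Y] fY] by simp

lemma Y'_wall: "young_wall t (Y(r := y'))"
  by (rule young_wall_update[OF Y young_y'])

lemma common_signature:
  obtains R where "signature (\<lambda>r. eps r i (Y r)) (\<lambda>r. phi r i (Y r)) R (column_signs t \<iota> i Y)"
    and "signature (\<lambda>q. eps q i ((Y(r := y')) q)) (\<lambda>q. phi q i ((Y(r := y')) q)) R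
      (column_signs t \<iota> i (Y(r := y')))"
proof -
  obtain R0 where R0: "\<And>r. r \<ge> R0 \<Longrightarrow> Y r = ground_column t r"
    by (rule eventually_ground[OF Y]) blast
  \<comment> \<open>Both walls have to agree with the ground state from \<open>R\<close> on, and
    column \<open>r\<close> may deviate from it; hence \<open>Suc r\<close>.\<close>
  define R where "R = max R0 (Suc r)"
  have "Y q = ground_column t q" "(Y(r := y')) q = ground_column t q" if "q \<ge> R" for q
    using that R0[of q] by (auto simp: R_def)
  from wall_signature[OF i Y this(1)] wall_signature[OF i Y'_wall this(2)] that
  show ?thesis by blast
qed

lemma change:
  shows "plus_column i Y r \<longleftrightarrow> minus_column i (Y(r := y')) r"
    and "plus_column i Y r \<Longrightarrow> card (surviving (column_signs t \<iota> i Y) Plus)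
      = Suc (card (surviving (column_signs t \<iota> i (Y(r := y'))) Plus))"
    and "plus_column i Y r \<Longrightarrow> card (surviving (column_signs t \<iota> i (Y(r := y'))) Minus)
      = Suc (card (surviving (column_signs t \<iota> i Y) Minus))"
proof -
  obtain R where R: "signature (\<lambda>r. eps r i (Y r)) (\<lambda>r. phi r i (Y r)) R (column_signs t \<iota> i Y)"
    "signature (\<lambda>q. eps q i ((Y(r := y')) q)) (\<lambda>q. phi q i ((Y(r := y')) q)) R
      (column_signs t \<iota> i (Y(r := y')))"
    by (rule common_signature)
  note * = signature_change[OF R, of r]
  have "eps r i y' = Suc (eps r i (Y r))" "phi r i (Y r) = Suc (phi r i y')"
    using f_Some_eps[OF i young_wall_columns[OF Y] fY] phi_Some[OF i young_wall_columns[OF Y] fY] by auto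
  then show "plus_column i Y r \<longleftrightarrow> minus_column i (Y(r := y')) r"
    and "plus_column i Y r \<Longrightarrow> card (surviving (column_signs t \<iota> i Y) Plus)
      = Suc (card (surviving (column_signs t \<iota> i (Y(r := y'))) Plus))"
    and "plus_column i Y r \<Longrightarrow> card (surviving (column_signs t \<iota> i (Y(r := y'))) Minus)
      = Suc (card (surviving (column_signs t \<iota> i Y) Minus))"
    using * unfolding plus_column_def minus_column_def by auto
qed

lemma change_wt: "wall_wt t (Y(r := y')) = wall_wt t Y - simple_root t i"
proof -
  obtain b where b: "b \<notin> Y r" "colour b = i" "y' = insert b (Y r)"
    using column_f_block[OF young_wall_columns[OF Y] fY] by blast
  have "finite {(r, b). (b \<in> Y r) \<noteq> (b \<in> ground_column t r)}"
    using Y by (simp add: young_wall_def)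
  from block_difference_insert[OF this b(1)] b i show ?thesis
    by (intro wall_wt_change) auto
qed

text \<open>The two inequalities are the cases of the tensor product rule: \<open>f\<close> acts on
  the right factor of columns \<open>Suc r\<close> and \<open>r\<close>, and on the left factor of
  columns \<open>r\<close> and \<open>r - 1\<close>.\<close>

lemma change_phi_eps:
  assumes "plus_column i Y r"
  shows "phi (Suc r) i (Y (Suc r)) \<le> eps r i (Y r)"
    and "r = Suc q \<Longrightarrow> eps q i (Y q) < phi r i (Y r)"
proof -
  obtain R where R: "signature (\<lambda>r. eps r i (Y r)) (\<lambda>r. phi r i (Y r)) R (column_signs t \<iota> i Y)"
    by (rule common_signature)
  interpret signature "\<lambda>r. eps r i (Y r)" "\<lambda>r. phi r i (Y r)" R "column_signs t \<iota> i Y"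
    by (rule R)
  have *: "right_minus r < phi r i (Y r)" "left_plus (Suc r) \<le> eps r i (Y r)"
    using assms leftmost_Plus_iff[of r] by (auto simp: plus_column_def)
  show "phi (Suc r) i (Y (Suc r)) \<le> eps r i (Y r)"
    using *(2) left_plus_ge[of "Suc r"] by simp
  show "eps q i (Y q) < phi r i (Y r)" if "r = Suc q"
    using *(1) right_minus_ge[of q] that by simp
qed

text \<open>The signs fit because the exponent of the left factor enters \<open>H_aff\<close>
  positively and that of the right factor negatively.\<close>

lemma change_H_aff:
  assumes "plus_column i Y r"
  shows "H_aff H (\<iota> (Suc q) ((Y(r := y')) (Suc q))) (\<iota> q ((Y(r := y')) q))
    = H_aff H (\<iota> (Suc q) (Y (Suc q))) (\<iota> q (Y q))"
proof -
  note y = young_wall_columns[OF Y]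
  have e1: "H x = H (b, b')"
    if "b \<in> C_carrier t" "b' \<in> C_carrier t" "i \<noteq> 0" "tensor_f t i (b, b') = Some x" for b b' x
    using energy i that unfolding energy_function_def by blast
  have e2: "H (x, b') = H (b, b') + 1"
    if "b \<in> C_carrier t" "b' \<in> C_carrier t" "C_f t 0 b = Some x" "tensor_f t 0 (b, b') = Some (x, b')"
    for b b' x
    using energy that unfolding energy_function_def by blast
  have e3: "H (b, x) = H (b, b') - 1"
    if "b \<in> C_carrier t" "b' \<in> C_carrier t" "C_f t 0 b' = Some x" "tensor_f t 0 (b, b') = Some (b, x)"
    for b b' x
    using energy that unfolding energy_function_def by blast
  have cf: "C_f t i (snd (\<iota> r (Y r))) = Some (snd (\<iota> r y'))"
    using C_f_eq[OF i y] fY by simp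
  consider "q = r" | "r = Suc q" | "q \<noteq> r" "r \<noteq> Suc q" by blast
  then show ?thesis
  proof cases
    case 1
    have "tensor_f t i (snd (\<iota> (Suc r) (Y (Suc r))), snd (\<iota> r (Y r)))
        = Some (snd (\<iota> (Suc r) (Y (Suc r))), snd (\<iota> r y'))"
      using change_phi_eps(1)[OF assms] cf C_phi_eq[OF i y] C_eps_eq[OF i y]
      by (simp add: tensor_f_def)
    then have "H (snd (\<iota> (Suc r) (Y (Suc r))), snd (\<iota> r y'))
        = H (snd (\<iota> (Suc r) (Y (Suc r))), snd (\<iota> r (Y r))) - (if i = 0 then 1 else 0)"
      using e1 e3 in_C_carrier[OF y] cf by (cases "i = 0") auto
    then show ?thesis
      using 1 f_exponent[OF i y fY] by (simp add: H_aff_def case_prod_beta)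
  next
    case 2
    have "tensor_f t i (snd (\<iota> r (Y r)), snd (\<iota> q (Y q))) = Some (snd (\<iota> r y'), snd (\<iota> q (Y q)))"
      using change_phi_eps(2)[OF assms 2] cf C_phi_eq[OF i y] C_eps_eq[OF i y]
      by (simp add: tensor_f_def)
    then have "H (snd (\<iota> r y'), snd (\<iota> q (Y q)))
        = H (snd (\<iota> r (Y r)), snd (\<iota> q (Y q))) + (if i = 0 then 1 else 0)"
      using e1 e2 in_C_carrier[OF y] cf by (cases "i = 0") auto
    then show ?thesis
      using 2 f_exponent[OF i y fY] by (simp add: H_aff_def case_prod_beta)
  next
    case 3
    then show ?thesis by simp
  qed
qed

text \<open>An equivalence, so that it also serves \<open>wall_e\<close>, read from the result
  backwards.\<close>

lemma change_Z_Lambda0: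
  "plus_column i Y r \<Longrightarrow> Y(r := y') \<in> Z_Lambda0 t H \<iota> \<longleftrightarrow> Y \<in> Z_Lambda0 t H \<iota>"
  unfolding Z_Lambda0_def mem_Collect_eq change_H_aff using Y Y'_wall by simp

end

lemma wall_f_SomeD:
  assumes "i \<in> index_set t" "young_wall t Y" "wall_f t \<iota> i Y = Some Y'"
  shows "wall_e t \<iota> i Y' = Some Y" and "Y' \<in> Z_Lambda0 t H \<iota> \<longleftrightarrow> Y \<in> Z_Lambda0 t H \<iota>"
    and "wall_wt t Y' = wall_wt t Y - simple_root t i"
    and "card (surviving (column_signs t \<iota> i Y) Plus)
      = Suc (card (surviving (column_signs t \<iota> i Y') Plus))"
    and "card (surviving (column_signs t \<iota> i Y') Minus)
      = Suc (card (surviving (column_signs t \<iota> i Y) Minus))"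
proof -
  obtain r y' where *: "plus_column i Y r" "f r i (Y r) = Some y'" and Y': "Y' = Y(r := y')"
    using assms(3) by (auto simp: wall_f_Some_iff)
  note y = young_wall_columns[OF assms(2)]
  have "e r i y' = Some (Y r)"
    using column_f_iff_e[OF assms(1) y young_y'[OF assms(1,2) *(2)]] *(2) by simp
  then have "minus_column i Y' r \<and> e r i (Y' r) = Some (Y r) \<and> Y = Y'(r := Y r)"
    using change(1)[OF assms(1,2) *(2)] *(1) Y' by auto
  then show "wall_e t \<iota> i Y' = Some Y" unfolding wall_e_Some_iff by blast
  show "Y' \<in> Z_Lambda0 t H \<iota> \<longleftrightarrow> Y \<in> Z_Lambda0 t H \<iota>"
    unfolding Y' by (rule change_Z_Lambda0[OF assms(1,2) *(2,1)])
  show "wall_wt t Y' = wall_wt t Y - simple_root t i"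
    unfolding Y' by (rule change_wt[OF assms(1,2) *(2)])
  show "card (surviving (column_signs t \<iota> i Y) Plus)
      = Suc (card (surviving (column_signs t \<iota> i Y') Plus))"
    unfolding Y' by (rule change(2)[OF assms(1,2) *(2,1)])
  show "card (surviving (column_signs t \<iota> i Y') Minus)
      = Suc (card (surviving (column_signs t \<iota> i Y) Minus))"
    unfolding Y' by (rule change(3)[OF assms(1,2) *(2,1)])
qed

text \<open>Everything about \<open>wall_e\<close> is deduced from \<open>wall_f\<close> on its
  result, so that the change of a column is analysed only once.\<close>

lemma wall_e_SomeD:
  assumes "i \<in> index_set t" "young_wall t Y" "wall_e t \<iota> i Y = Some Y'"
  shows "young_wall t Y'" and "wall_f t \<iota> i Y' = Some Y"
proof -
  obtain r y' where *: "minus_column i Y r" "e r i (Y r) = Some y'" and Y': "Y' = Y(r := y')"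
    using assms(3) by (auto simp: wall_e_Some_iff)
  note y = young_wall_columns[OF assms(2)]
  have y': "young r y'" by (rule column_e_young[OF y *(2)])
  show w: "young_wall t Y'" unfolding Y' by (rule young_wall_update[OF assms(2) y'])
  have f: "f r i (Y' r) = Some (Y r)"
    using column_f_iff_e[OF assms(1) y' y] *(2) by (simp add: Y')
  moreover have eq: "Y = Y'(r := Y r)" by (simp add: Y')
  moreover have "plus_column i Y' r"
    using change(1)[OF assms(1) w f] *(1) eq by simp
  ultimately show "wall_f t \<iota> i Y' = Some Y" unfolding wall_f_Some_iff by blast
qed

text \<open>The difference of the counts is a sum of weights of columns. It splits into the
  telescoping sum over the ground state, giving the pairing with \<open>\<Lambda>\<^sub>0\<close>,
  and the added blocks, giving minus the pairing with their simple roots.\<close>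

lemma card_surviving_pairing:
  assumes i: "i \<in> index_set t" and Y: "young_wall t Y"
  shows "int (card (surviving (column_signs t \<iota> i Y) Plus))
    = int (card (surviving (column_signs t \<iota> i Y) Minus)) + coroot_pairing i (wall_wt t Y)"
proof -
  obtain R where R: "\<And>r. r \<ge> R \<Longrightarrow> Y r = ground_column t r"
    by (rule eventually_ground[OF Y]) blast
  note y = young_wall_columns[OF Y]
  from signature.card_surviving_diff[OF wall_signature[OF i Y R]]
  have "int (card (surviving (column_signs t \<iota> i Y) Plus)) - int (card (surviving (column_signs t \<iota> i Y) Minus))
      = (\<Sum>r<R. wt r i (Y r)) + int (phi R i (ground_column t R))"
    using phi_minus_eps[OF i y] R[of R] by simp
  also have "(\<Sum>r<R. wt r i (Y r)) = (\<Sum>r<R. wt r i (ground_column t r)) +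
      (\<Sum>r<R. relative_weight t i (ground_column t r) (Y r))"
    by (simp add: wt_relative[OF y] sum.distrib)
  also have "(\<Sum>r<R. relative_weight t i (ground_column t r) (Y r))
      = - (\<Sum>j\<in>index_set t. block_difference t j Y * cartan t i j)"
    by (rule sum_relative_weight[OF Y R])
  finally show ?thesis
    using sum_wt_ground[OF i, of R] i by (simp add: wall_wt_def coroot_pairing_simple_root)
qed

theorem affine_crystal_Z_Lambda0:
  "affine_crystal t (Z_Lambda0 t H \<iota>) (wall_e t \<iota>) (wall_f t \<iota>) (wall_eps t \<iota>) (wall_phi t \<iota>) (wall_wt t)"
proof -
  have W: "young_wall t Y" if "Y \<in> Z_Lambda0 t H \<iota>" for Y
    using that by (simp add: Z_Lambda0_def)
  have closed_f: "Y' \<in> Z_Lambda0 t H \<iota>"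
    if "i \<in> index_set t" "Y \<in> Z_Lambda0 t H \<iota>" "wall_f t \<iota> i Y = Some Y'" for i Y Y'
    using wall_f_SomeD(2)[OF that(1) W[OF that(2)] that(3)] that(2) by simp
  have closed_e: "Y' \<in> Z_Lambda0 t H \<iota>"
    if "i \<in> index_set t" "Y \<in> Z_Lambda0 t H \<iota>" "wall_e t \<iota> i Y = Some Y'" for i Y Y'
    using wall_e_SomeD[OF that(1) W[OF that(2)] that(3)] wall_f_SomeD(2)[OF that(1), of Y' Y] that(2)
    by simp
  have iff: "wall_f t \<iota> i Y = Some Y' \<longleftrightarrow> wall_e t \<iota> i Y' = Some Y"
    if "i \<in> index_set t" "Y \<in> Z_Lambda0 t H \<iota>" "Y' \<in> Z_Lambda0 t H \<iota>" for i Y Y'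
    using wall_e_SomeD(2)[OF that(1) W[OF that(3)]] wall_f_SomeD(1)[OF that(1) W[OF that(2)]] by blast
  have f_props: "wall_wt t Y' = wall_wt t Y - simple_root t i \<and>
      wall_eps t \<iota> i Y' = wall_eps t \<iota> i Y + Fin 1 \<and> wall_phi t \<iota> i Y' = wall_phi t \<iota> i Y - Fin 1"
    if "i \<in> index_set t" "Y \<in> Z_Lambda0 t H \<iota>" "wall_f t \<iota> i Y = Some Y'" for i Y Y'
    using wall_f_SomeD[OF that(1) W[OF that(2)] that(3)] by (simp add: wall_eps_def wall_phi_def)
  have e_props: "wall_wt t Y' = wall_wt t Y + simple_root t i \<and>
      wall_eps t \<iota> i Y' = wall_eps t \<iota> i Y - Fin 1 \<and> wall_phi t \<iota> i Y' = wall_phi t \<iota> i Y + Fin 1"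
    if "i \<in> index_set t" "Y \<in> Z_Lambda0 t H \<iota>" "wall_e t \<iota> i Y = Some Y'" for i Y Y'
    using wall_f_SomeD[OF that(1) W[OF closed_e[OF that]] wall_e_SomeD(2)[OF that(1) W[OF that(2)] that(3)]]
    by (simp add: wall_eps_def wall_phi_def)
  have pairing: "wall_phi t \<iota> i Y = wall_eps t \<iota> i Y + Fin (coroot_pairing i (wall_wt t Y))"
    if "i \<in> index_set t" "Y \<in> Z_Lambda0 t H \<iota>" for i Y
    using card_surviving_pairing[OF that(1) W[OF that(2)]] by (simp add: wall_eps_def wall_phi_def)
  have e_in: "wall_e t \<iota> i Y \<in> insert None (Some ` Z_Lambda0 t H \<iota>)"
    if "i \<in> index_set t" "Y \<in> Z_Lambda0 t H \<iota>" for i Y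
    using closed_e[OF that] by (cases "wall_e t \<iota> i Y") auto
  have f_in: "wall_f t \<iota> i Y \<in> insert None (Some ` Z_Lambda0 t H \<iota>)"
    if "i \<in> index_set t" "Y \<in> Z_Lambda0 t H \<iota>" for i Y
    using closed_f[OF that] by (cases "wall_f t \<iota> i Y") auto
  have fin: "wall_eps t \<iota> i Y \<noteq> Pinf" "wall_phi t \<iota> i Y \<noteq> Pinf" "wall_phi t \<iota> i Y \<noteq> Minf" for i Y
    by (simp_all add: wall_eps_def wall_phi_def)
  show ?thesis
    unfolding affine_crystal_def
    apply (intro conjI ballI)
             apply (rule wall_wt_in_lattice)
            apply (erule (1) e_in)
           apply (erule (1) f_in)
          apply (rule fin)
         apply (rule fin)
        apply (erule (1) pairing)
       apply (intro allI impI, erule (2) e_props)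
      apply (intro allI impI, erule (2) f_props)
     apply (erule (2) iff)
    apply (simp add: fin)
    done
qed

end

section \<open>Crystal operators on the columns of one pattern\<close>

text \<open>What a finite check can establish about blocks, stated without the operators. When all
  weights vanish, \<open>W_all_0\<close> asks that for one colour the choice rules on both
  neighbouring columns lead back to the column, and that for every other colour with blocks to add
  and remove they bypass it.\<close>

locale young_states =
  fixes t :: affine_type and p :: pattern and W :: "nat \<Rightarrow> block set \<Rightarrow> int"
  assumes colour_pattern: "b \<in> blocks p \<Longrightarrow> colour b \<in> index_set t"
    and W_insert: "young_column t p y \<Longrightarrow> young_column t p (insert b y) \<Longrightarrow> b \<notin> y \<Longrightarrow>
      W i (insert b y) = W i y - cartan t i (colour b)"
    and W_bound: "i \<in> index_set t \<Longrightarrow> young_column t p y \<Longrightarrow> \<bar>W i y\<bar> \<le> 2"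
    and W_1: "i \<in> index_set t \<Longrightarrow> young_column t p y \<Longrightarrow> W i y = 1 \<Longrightarrow>
      is_singleton (addable t p i y) \<and> removable t p i y = {}"
    and W_minus_1: "i \<in> index_set t \<Longrightarrow> young_column t p y \<Longrightarrow> W i y = -1 \<Longrightarrow>
      is_singleton (removable t p i y) \<and> addable t p i y = {}"
    and W_2: "i \<in> index_set t \<Longrightarrow> young_column t p y \<Longrightarrow> W i y = 2 \<Longrightarrow>
      block_to_add t p i y \<in> addable t p i y \<and> removable t p i y = {}"
    and W_minus_2: "i \<in> index_set t \<Longrightarrow> young_column t p y \<Longrightarrow> W i y = -2 \<Longrightarrow>
      block_to_remove t p i y \<in> removable t p i y \<and> addable t p i y = {}"
    and W_0: "i \<in> index_set t \<Longrightarrow> young_column t p y \<Longrightarrow> W i y = 0 \<Longrightarrow>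
      \<exists>k\<in>index_set t. W k y \<noteq> 0 \<Longrightarrow> addable t p i y = {} \<and> removable t p i y = {}"
    and W_all_0: "young_column t p y \<Longrightarrow> \<forall>k\<in>index_set t. W k y = 0 \<Longrightarrow>
      t = E8 \<and> (\<exists>j\<in>index_set t.
        (\<exists>b c. addable t p j y = {b} \<and> removable t p j y = {c} \<and>
           block_to_remove t p j (insert b y) = b \<and> block_to_add t p j (y - {c}) = c) \<and>
        (\<forall>i\<in>index_set t - {j}. addable t p i y = {} \<and> removable t p i y = {} \<or>
           (\<exists>b c. addable t p i y = {b} \<and> removable t p i y = {c} \<and>
              block_to_remove t p i (insert b y) \<noteq> b \<and> block_to_add t p i (y - {c}) \<noteq> c)))"
begin

abbreviation young :: "block set \<Rightarrow> bool" where "young \<equiv> young_column t p"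
abbreviation A :: "nat \<Rightarrow> block set \<Rightarrow> block set" where "A \<equiv> addable t p"
abbreviation Rm :: "nat \<Rightarrow> block set \<Rightarrow> block set" where "Rm \<equiv> removable t p"
abbreviation bta :: "nat \<Rightarrow> block set \<Rightarrow> block" where "bta \<equiv> block_to_add t p"
abbreviation btr :: "nat \<Rightarrow> block set \<Rightarrow> block" where "btr \<equiv> block_to_remove t p"

lemma addableD: "b \<in> A i y \<Longrightarrow> b \<in> blocks p \<and> colour b = i \<and> b \<notin> y \<and> young (insert b y)"
  by (simp add: addable_def)

lemma removableD: "b \<in> Rm i y \<Longrightarrow> b \<in> y \<and> colour b = i \<and> young (y - {b})"
  by (simp add: removable_def)

lemma young_subset: "young y \<Longrightarrow> y \<subseteq> blocks p"
  by (auto simp: young_column_def proper_column_def)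

lemma addable_index: "b \<in> A i y \<Longrightarrow> i \<in> index_set t"
  using addableD colour_pattern by blast

lemma removable_index: "young y \<Longrightarrow> b \<in> Rm i y \<Longrightarrow> i \<in> index_set t"
  using removableD colour_pattern young_subset by blast

lemma bta_singleton: "A i y = {b} \<Longrightarrow> bta i y = b"
  by (simp add: block_to_add_def)

lemma btr_singleton: "Rm i y = {b} \<Longrightarrow> btr i y = b"
  by (simp add: block_to_remove_def)

lemma W_cases:
  assumes "i \<in> index_set t" "young y"
  obtains "W i y = 1" | "W i y = 2" | "W i y = -1" | "W i y = -2" | "W i y = 0"
proof -
  have "W i y \<le> 2" "- 2 \<le> W i y" using W_bound[OF assms] by (simp_all add: abs_le_iff)
  then have "W i y = 1 \<or> W i y = 2 \<or> W i y = -1 \<or> W i y = -2 \<or> W i y = 0" by presburger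
  then show ?thesis using that by blast
qed

lemma all_0_singletons:
  assumes "young y" "\<forall>k\<in>index_set t. W k y = 0" "i \<in> index_set t"
  shows "A i y = {} \<and> Rm i y = {} \<or> is_singleton (A i y) \<and> is_singleton (Rm i y)"
proof -
  obtain j where j: "\<exists>b c. A j y = {b} \<and> Rm j y = {c} \<and> btr j (insert b y) = b \<and> bta j (y - {c}) = c"
    and other: "\<forall>i\<in>index_set t - {j}. A i y = {} \<and> Rm i y = {} \<or> (\<exists>b c. A i y = {b} \<and> Rm i y = {c} \<and>
       btr i (insert b y) \<noteq> b \<and> bta i (y - {c}) \<noteq> c)"
    using W_all_0[OF assms(1,2)] by (elim conjE bexE)
  show ?thesis
  proof (cases "i = j")
    case True
    from j obtain b c where "A j y = {b}" "Rm j y = {c}" by (elim exE conjE)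
    with True show ?thesis by (simp add: is_singleton_def)
  next
    case False
    with other assms(3) have "A i y = {} \<and> Rm i y = {} \<or> (\<exists>b c. A i y = {b} \<and> Rm i y = {c} \<and>
       btr i (insert b y) \<noteq> b \<and> bta i (y - {c}) \<noteq> c)" by simp
    then show ?thesis by (elim disjE exE conjE) (simp_all add: is_singleton_def)
  qed
qed

text \<open>\<open>block_to_add\<close> is an arbitrary choice, a maximum or a definite description
  and has to be shown to hit the set. Outside weight 2 the set has at most one element.\<close>

lemma bta_in: assumes "young y" "A i y \<noteq> {}" shows "bta i y \<in> A i y"
proof -
  have i: "i \<in> index_set t" using assms(2) addable_index by blast
  have single: "bta i y \<in> A i y" if "is_singleton (A i y)"
    using that bta_singleton by (auto simp: is_singleton_def)
  from i assms(1) show ?thesis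
  proof (cases rule: W_cases)
    case 5
    with W_0[OF i assms(1)] assms(2) have "\<forall>k\<in>index_set t. W k y = 0" by blast
    from all_0_singletons[OF assms(1) this i] assms(2) single show ?thesis by blast
  qed (use W_1 W_2 W_minus_1 W_minus_2 i assms single in auto)
qed

lemma btr_in: assumes "young y" "Rm i y \<noteq> {}" shows "btr i y \<in> Rm i y"
proof -
  have i: "i \<in> index_set t" using assms removable_index by blast
  have single: "btr i y \<in> Rm i y" if "is_singleton (Rm i y)"
    using that btr_singleton by (auto simp: is_singleton_def)
  from i assms(1) show ?thesis
  proof (cases rule: W_cases)
    case 5
    with W_0[OF i assms(1)] assms(2) have "\<forall>k\<in>index_set t. W k y = 0" by blast
    from all_0_singletons[OF assms(1) this i] assms(2) single show ?thesis by blast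
  qed (use W_1 W_2 W_minus_1 W_minus_2 i assms single in auto)
qed

text \<open>If the weight for \<open>i\<close> is nonzero, one of the two sets is empty; if it is 0
  while another weight is not, both are.\<close>

lemma both_imp_all_0:
  assumes "young y" "A i y \<noteq> {}" "Rm i y \<noteq> {}"
  shows "\<forall>k\<in>index_set t. W k y = 0"
proof -
  have i: "i \<in> index_set t" using assms(2) addable_index by blast
  have "W i y = 0"
    using W_cases[OF i assms(1)] W_1 W_2 W_minus_1 W_minus_2 i assms by metis
  with W_0[OF i assms(1)] assms(2) show ?thesis by blast
qed

text \<open>The column \<open>y'\<close> quantified in the definition must be \<open>y\<close>
  without a removable or with an addable block, so being interior becomes a condition on
  \<open>y\<close> and its immediate neighbours.\<close>

lemma string_interior_iff:
  assumes "young y"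
  shows "string_interior t p i y \<longleftrightarrow> t = E8 \<and> A i y \<noteq> {} \<and> Rm i y \<noteq> {} \<and>
    ((\<exists>c\<in>Rm i y. bta i (y - {c}) = c) \<or> (\<exists>b\<in>A i y. btr i (insert b y) = b))"
proof -
  have "(\<exists>y'. young y' \<and> add_block t p i y' = Some y) \<longleftrightarrow> (\<exists>c\<in>Rm i y. bta i (y - {c}) = c)" (is "?L \<longleftrightarrow> ?R")
  proof
    assume ?L
    then obtain y' where y': "young y'" "A i y' \<noteq> {}" "y = insert (bta i y') y'"
      by (auto simp: add_block_def split: if_splits)
    with addableD[OF bta_in[OF y'(1,2)]] have "y - {bta i y'} = y'" "bta i y' \<in> Rm i y"
      by (auto simp: removable_def)
    then show ?R by metis
  next
    assume ?R
    then obtain c where c: "c \<in> Rm i y" "bta i (y - {c}) = c" by blast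
    with removableD[OF c(1)] young_subset[OF assms] have "young (y - {c})" "c \<in> A i (y - {c})" "insert c (y - {c}) = y"
      using assms by (auto simp: addable_def insert_absorb)
    moreover from this(2) have "add_block t p i (y - {c}) = Some (insert (bta i (y - {c})) (y - {c}))"
      unfolding add_block_def by (metis empty_iff)
    ultimately show ?L using c(2) by metis
  qed
  moreover have "(\<exists>y'. young y' \<and> remove_block t p i y' = Some y) \<longleftrightarrow> (\<exists>b\<in>A i y. btr i (insert b y) = b)" (is "?L' \<longleftrightarrow> ?R'")
  proof
    assume ?L'
    then obtain y' where y': "young y'" "Rm i y' \<noteq> {}" "y = y' - {btr i y'}"
      by (auto simp: remove_block_def split: if_splits)
    with removableD[OF btr_in[OF y'(1,2)]] young_subset[OF y'(1)]
    have "insert (btr i y') y = y'" "btr i y' \<in> A i y"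
      by (auto simp: addable_def insert_absorb)
    then show ?R' by metis
  next
    assume ?R'
    then obtain b where b: "b \<in> A i y" "btr i (insert b y) = b" by blast
    with addableD[OF b(1)] have "young (insert b y)" "b \<in> Rm i (insert b y)" "insert b y - {b} = y"
      using assms by (auto simp: removable_def)
    moreover from this(2) have "remove_block t p i (insert b y) = Some (insert b y - {btr i (insert b y)})"
      unfolding remove_block_def by (metis empty_iff)
    ultimately show ?L' using b(2) by metis
  qed
  moreover have "A i y \<noteq> {}" if "\<exists>b\<in>A i y. btr i (insert b y) = b" using that by blast
  moreover have "Rm i y \<noteq> {}" if "\<exists>c\<in>Rm i y. bta i (y - {c}) = c" using that by blast
  moreover have "string_interior t p i y \<longleftrightarrow> t = E8 \<and>
    ((\<exists>y'. young y' \<and> add_block t p i y' = Some y) \<and> A i y \<noteq> {} \<or>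
     (\<exists>y'. young y' \<and> remove_block t p i y' = Some y) \<and> Rm i y \<noteq> {})"
    unfolding string_interior_def by blast
  ultimately show ?thesis by argo
qed

text \<open>Hence the suppression of the other colours concerns only columns all of whose weights
  are 0.\<close>

lemma string_interior_all_0:
  assumes "young y" "string_interior t p i y" "k \<in> index_set t"
  shows "W k y = 0"
proof -
  from assms(2) have "A i y \<noteq> {}" "Rm i y \<noteq> {}"
    unfolding string_interior_iff[OF assms(1)] by blast+
  from both_imp_all_0[OF assms(1) this] assms(3) show ?thesis by blast
qed

text \<open>A Young column of weight zero lies in the interior of the string of exactly one colour.\<close>
lemma all_0_interior:
  assumes y: "young y" and 0: "\<forall>k\<in>index_set t. W k y = 0"
  obtains j b c where "\<And>i. string_interior t p i y \<longleftrightarrow> i = j" "A j y = {b}" "Rm j y = {c}"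
    "btr j (insert b y) = b" "bta j (y - {c}) = c" "t = E8"
proof -
  obtain j where t: "t = E8"
    and ex: "\<exists>b c. A j y = {b} \<and> Rm j y = {c} \<and> btr j (insert b y) = b \<and> bta j (y - {c}) = c"
    and other: "\<forall>i\<in>index_set t - {j}. A i y = {} \<and> Rm i y = {} \<or> (\<exists>b c. A i y = {b} \<and> Rm i y = {c} \<and>
       btr i (insert b y) \<noteq> b \<and> bta i (y - {c}) \<noteq> c)"
    using W_all_0[OF y 0] by (elim conjE bexE)
  from ex obtain b c where *: "A j y = {b}" "Rm j y = {c}" "btr j (insert b y) = b" "bta j (y - {c}) = c"
    by (elim exE conjE)
  have "\<not> string_interior t p i y" if "i \<noteq> j" for i
  proof
    assume s: "string_interior t p i y"
    then have "i \<in> index_set t" using addable_index string_interior_iff[OF y] by blast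
    with other that have "A i y = {} \<and> Rm i y = {} \<or> (\<exists>b c. A i y = {b} \<and> Rm i y = {c} \<and>
       btr i (insert b y) \<noteq> b \<and> bta i (y - {c}) \<noteq> c)" by simp
    then show False using s unfolding string_interior_iff[OF y] by (elim disjE exE conjE) simp_all
  qed
  moreover have "string_interior t p j y"
    unfolding string_interior_iff[OF y] using * t by auto
  ultimately show ?thesis using that * t by blast
qed

lemma column_f_young:
  assumes "young y" "column_f t p i y = Some y'"
  shows "young y' \<and> (\<exists>b. b \<notin> y \<and> colour b = i \<and> y' = insert b y)"
  using assms bta_in[OF assms(1), of i] addableD[of "bta i y" i y]
  by (auto simp: column_f_def add_block_def split: if_splits)

lemma column_e_young:
  assumes "young y" "column_e t p i y = Some y'"
  shows "young y'"
  using assms btr_in[OF assms(1), of i] removableD[of "btr i y" i y]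
  by (auto simp: column_e_def remove_block_def split: if_splits)

lemma column_f_imp_e:
  assumes i: "i \<in> index_set t" and y: "young y" and f: "column_f t p i y = Some y'"
  shows "column_e t p i y' = Some y"
proof -
  define b where "b = bta i y"
  have no: "\<And>j. string_interior t p j y \<Longrightarrow> j = i" and A: "A i y \<noteq> {}" and y': "y' = insert b y"
    using f by (auto simp: column_f_def add_block_def b_def split: if_splits)
  have b: "b \<in> A i y" unfolding b_def by (rule bta_in[OF y A])
  note bD = addableD[OF b]
  have yy': "young y'" "y' - {b} = y" "b \<in> Rm i y'"
    using bD y y' by (auto simp: removable_def)
  have Wy': "W i y' = W i y - 2"
    using W_insert[OF y, of b i] bD y' by (simp add: cartan_def)
  have "btr i y' = b \<and> (\<forall>j. string_interior t p j y' \<longrightarrow> j = i)"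
  proof -
    consider "W i y = 1" | "W i y = 2" | "W i y = 0"
      using W_minus_1[OF i y] W_minus_2[OF i y] A W_bound[OF i y] by (rule_tac W_cases[OF i y]) auto
    then show ?thesis
    proof cases
      case 1
      then have "W i y' = -1" using Wy' by simp
      then have "Rm i y' = {b}" and "\<not> string_interior t p j y'" for j
        using W_minus_1[OF i yy'(1)] yy'(3) string_interior_all_0[OF yy'(1) _ i, of j]
        by (auto simp: is_singleton_def)
      then show ?thesis using btr_singleton by blast
    next
      case 2
      \<comment> \<open>A block can be removed although the weight for \<open>i\<close> is 0, which
        by \<open>W_0\<close> forces all weights to vanish; the new column is then the middle of the
        \<open>i\<close>-string.\<close>
      then have "W i y' = 0" using Wy' by simp
      with W_0[OF i yy'(1)] yy'(3) have 0: "\<forall>k\<in>index_set t. W k y' = 0" by blast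
      from all_0_singletons[OF yy'(1) 0 i] yy'(3) have s: "A i y' \<noteq> {}" "Rm i y' = {b}"
        by (auto simp: is_singleton_def)
      have "\<exists>j. \<forall>i. string_interior t p i y' \<longleftrightarrow> i = j" "t = E8"
        using all_0_interior[OF yy'(1) 0] by metis+
      moreover have "string_interior t p i y'"
        using string_interior_iff[OF yy'(1), of i] s \<open>t = E8\<close> yy'(2) b_def by auto
      ultimately show ?thesis using btr_singleton[OF s(2)] by metis
    next
      case 3
      with W_0[OF i y] A have 0: "\<forall>k\<in>index_set t. W k y = 0" by blast
      obtain j b' c where j: "\<And>i. string_interior t p i y \<longleftrightarrow> i = j" "A j y = {b'}" "btr j (insert b' y) = b'"
        using all_0_interior[OF y 0] by metis
      \<comment> \<open>The column is interior for colour \<open>j\<close>, and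
        \<open>column_f\<close> vanishes on it for every other colour.\<close>
      with no have "j = i" by blast
      with j b y' have "btr i y' = b" by auto
      moreover have "\<not> string_interior t p j y'" for j
        using string_interior_all_0[OF yy'(1) _ i, of j] Wy' 3 by auto
      ultimately show ?thesis by blast
    qed
  qed
  then show ?thesis
    using yy' by (auto simp: column_e_def remove_block_def)
qed

text \<open>The same three situations read upwards, with weights -1, -2 and 0.\<close>

lemma column_e_imp_f:
  assumes i: "i \<in> index_set t" and y: "young y" and e: "column_e t p i y = Some y'"
  shows "column_f t p i y' = Some y"
proof -
  define b where "b = btr i y"
  have no: "\<And>j. string_interior t p j y \<Longrightarrow> j = i" and R: "Rm i y \<noteq> {}" and y': "y' = y - {b}"
    using e by (auto simp: column_e_def remove_block_def b_def split: if_splits)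
  have b: "b \<in> Rm i y" unfolding b_def by (rule btr_in[OF y R])
  note bD = removableD[OF b]
  have yy': "young y'" "insert b y' = y" "b \<in> A i y'" "b \<notin> y'"
    using bD y y' young_subset[OF y] by (auto simp: addable_def insert_absorb)
  have Wy': "W i y' = W i y + 2"
    using W_insert[OF yy'(1), of b i] bD y y' yy' by (simp add: cartan_def)
  have "bta i y' = b \<and> (\<forall>j. string_interior t p j y' \<longrightarrow> j = i)"
  proof -
    consider "W i y = -1" | "W i y = -2" | "W i y = 0"
      using W_1[OF i y] W_2[OF i y] R W_bound[OF i y] by (rule_tac W_cases[OF i y]) auto
    then show ?thesis
    proof cases
      case 1
      then have "W i y' = 1" using Wy' by simp
      then have "A i y' = {b}" and "\<not> string_interior t p j y'" for j
        using W_1[OF i yy'(1)] yy'(3) string_interior_all_0[OF yy'(1) _ i, of j]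
        by (auto simp: is_singleton_def)
      then show ?thesis using bta_singleton by blast
    next
      case 2
      then have "W i y' = 0" using Wy' by simp
      with W_0[OF i yy'(1)] yy'(3) have 0: "\<forall>k\<in>index_set t. W k y' = 0" by blast
      from all_0_singletons[OF yy'(1) 0 i] yy'(3) have s: "Rm i y' \<noteq> {}" "A i y' = {b}"
        by (auto simp: is_singleton_def)
      have "\<exists>j. \<forall>i. string_interior t p i y' \<longleftrightarrow> i = j" "t = E8"
        using all_0_interior[OF yy'(1) 0] by metis+
      moreover have "string_interior t p i y'"
        using string_interior_iff[OF yy'(1), of i] s \<open>t = E8\<close> yy'(2) b_def by auto
      ultimately show ?thesis using bta_singleton[OF s(2)] by metis
    next
      case 3
      with W_0[OF i y] R have 0: "\<forall>k\<in>index_set t. W k y = 0" by blast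
      obtain j b' where j: "\<And>i. string_interior t p i y \<longleftrightarrow> i = j" "Rm j y = {b'}" "bta j (y - {b'}) = b'"
        using all_0_interior[OF y 0] by metis
      with no have "j = i" by blast
      with j b y' have "bta i y' = b" by auto
      moreover have "\<not> string_interior t p j y'" for j
        using string_interior_all_0[OF yy'(1) _ i, of j] Wy' 3 by auto
      ultimately show ?thesis by blast
    qed
  qed
  then show ?thesis
    using yy' by (auto simp: column_f_def add_block_def)
qed

lemma column_f_iff_e:
  assumes "i \<in> index_set t" "young y" "young y'"
  shows "column_f t p i y = Some y' \<longleftrightarrow> column_e t p i y' = Some y"
  using column_f_imp_e column_e_imp_f assms by blast

text \<open>Only when all weights vanish do the sets of blocks leave a doubt: both operators act for
  the one colour in whose string the column is interior, and neither acts for the other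
  colours.\<close>

lemma column_None:
  assumes i: "i \<in> index_set t" and y: "young y"
  shows "column_f t p i y = None \<longleftrightarrow> W i y < 0 \<or> W i y = 0 \<and> column_e t p i y = None" (is ?f)
    and "column_e t p i y = None \<longleftrightarrow> W i y > 0 \<or> W i y = 0 \<and> column_f t p i y = None" (is ?e)
proof -
  have f: "column_f t p i y = None \<longleftrightarrow> (\<exists>j. j \<noteq> i \<and> string_interior t p j y) \<or> A i y = {}"
    by (auto simp: column_f_def add_block_def)
  have e: "column_e t p i y = None \<longleftrightarrow> (\<exists>j. j \<noteq> i \<and> string_interior t p j y) \<or> Rm i y = {}"
    by (auto simp: column_e_def remove_block_def)
  have no: "\<not> string_interior t p j y" if "W i y \<noteq> 0" for j
    using string_interior_all_0[OF y _ i, of j] that by blast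
  from i y have "?f \<and> ?e"
  proof (cases rule: W_cases)
    case 5
    show ?thesis
    proof (cases "\<forall>k\<in>index_set t. W k y = 0")
      case True
      obtain j b c where j: "\<And>i. string_interior t p i y \<longleftrightarrow> i = j" "A j y = {b}" "Rm j y = {c}"
        using all_0_interior[OF y True] by metis
      then show ?thesis using 5 unfolding f e by (cases "i = j") auto
    next
      case False
      with W_0[OF i y 5] 5 show ?thesis unfolding f e by auto
    qed
  next
    case 1
    then have "A i y \<noteq> {}" "Rm i y = {}" using W_1[OF i y] by (auto simp: is_singleton_def)
    with 1 no show ?thesis unfolding f e by simp
  next
    case 2
    then have "A i y \<noteq> {}" "Rm i y = {}" using W_2[OF i y] by auto
    with 2 no show ?thesis unfolding f e by simp
  next
    case 3
    then have "A i y = {}" "Rm i y \<noteq> {}" using W_minus_1[OF i y] by (auto simp: is_singleton_def)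
    with 3 no show ?thesis unfolding f e by simp
  next
    case 4
    then have "A i y = {}" "Rm i y \<noteq> {}" using W_minus_2[OF i y] by auto
    with 4 no show ?thesis unfolding f e by simp
  qed
  then show ?f and ?e by (rule conjunct1, rule conjunct2)
qed

end

section \<open>An executable description of a column near its top\<close>

text \<open>The two 4-blocks of the cube \<open>444444\<close> of type E8 get the labels 4 and 9, so that a block is
  determined by its cube and its label.\<close>
fun labelled_cubes :: "affine_type \<Rightarrow> cross_section list" where
  "labelled_cubes E8 = (base_cubes E8)[5 := ([4,4,4,9,9,9], [4,4,4,9,9,9])]"
| "labelled_cubes t = base_cubes t"

definition label_colour :: "nat \<Rightarrow> nat" where
  "label_colour l = (if l = 9 then 4 else l)"

definition section_labels :: "cross_section \<Rightarrow> nat list" where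
  "section_labels s = remdups (fst s @ snd s)"

definition touching :: "cross_section \<Rightarrow> nat \<Rightarrow> cross_section \<Rightarrow> nat \<Rightarrow> bool" where
  "touching s' l' s l \<longleftrightarrow> (l', l) \<in> set (zip (fst s') (fst s)) \<union> set (zip (snd s') (snd s))"

definition period :: "affine_type \<Rightarrow> nat" where
  "period t = length (base_cubes t)"

text \<open>Below phase 0 the pattern continues with the last listed cube, rotated if the list is
  only half a period.\<close>

definition preceding_cube :: "affine_type \<Rightarrow> nat \<Rightarrow> cross_section" where
  "preceding_cube t s = (if s > 0 then labelled_cubes t ! (s - 1)
     else if t = E7 then last (labelled_cubes t) else rotate_section (last (labelled_cubes t)))"

text \<open>A cube is given by its phase and the list of its labels, each with the labels of the blocks
  that lie below it in the preceding cube.\<close>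
type_synonym cube_info = "nat \<times> (nat \<times> nat list) list"

definition phase_info :: "affine_type \<Rightarrow> nat \<Rightarrow> cube_info" where
  "phase_info t s = (s, map (\<lambda>l. (l, filter (\<lambda>l'. touching (preceding_cube t s) l' (labelled_cubes t ! s) l)
      (section_labels (preceding_cube t s)))) (section_labels (labelled_cubes t ! s)))"

definition cube_labels :: "cube_info \<Rightarrow> nat list" where
  "cube_labels d = map fst (snd d)"

definition labels_below :: "cube_info \<Rightarrow> nat \<Rightarrow> nat list" where
  "labels_below d l = (case map_of (snd d) l of None \<Rightarrow> [] | Some ps \<Rightarrow> ps)"

text \<open>Three full cubes, up to eleven further ones and two empty cubes on top; the ground state
  column of type E8 needs all of these. The check itself shows that no Young column is taller above
  its lowest incomplete cube. The same number serves as a depth at which the blocks supporting a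
  single block fill a whole cube.\<close>

definition window_size :: nat where
  "window_size = 16"

text \<open>Rotations are ignored: only labels and incidences enter, and adjacent cubes rotated
  together touch in the same way.\<close>

definition window :: "affine_type \<Rightarrow> nat \<Rightarrow> cube_info list" where
  "window t s = (let c = map (phase_info t) [0..<period t] in
     map (\<lambda>k. c ! ((s + k) mod period t)) [0..<window_size])"

definition row_closed :: "cube_info \<Rightarrow> nat list \<Rightarrow> nat list \<Rightarrow> bool" where
  "row_closed d prev r \<longleftrightarrow>
     list_all (\<lambda>(l, ps). if l \<in> set r then list_all (\<lambda>p. p \<in> set prev) ps else True) (snd d)"

definition closed_rows :: "cube_info list \<Rightarrow> nat list list \<Rightarrow> bool" where
  "closed_rows ds rows \<longleftrightarrow>
     list_all (\<lambda>(d, p, r). row_closed d p r) (zip (tl ds) (zip rows (tl rows)))"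

definition rows_match :: "(nat \<Rightarrow> nat \<Rightarrow> bool) \<Rightarrow> cube_info list \<Rightarrow> nat list list \<Rightarrow> bool" where
  "rows_match P ds rows \<longleftrightarrow> list_all (\<lambda>(k, d, r). list_all (\<lambda>l. (l \<in> set r) = P k l) (cube_labels d))
     (enumerate 0 (zip ds rows))"

text \<open>Phases count from 0, so phase 4 is cube 5 of the pattern, the lowest incomplete cube of
  the first exceptional shape; both shapes are described relative to its row
  \<open>k\<close>.\<close>

definition special_rows :: "cube_info list \<Rightarrow> nat list list \<Rightarrow> bool" where
  "special_rows ds rows \<longleftrightarrow>
     list_ex (\<lambda>k. if fst (ds ! k) = 4 then
       (if rows_match (\<lambda>i l. i < k \<or> i = k \<and> (l = 5 \<or> l = 3) \<or> i = Suc k \<and> l = 9) ds rows then True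
        else rows_match (\<lambda>i l. i < Suc k \<or> i = Suc k \<and> l = 9 \<or> i = Suc (Suc k) \<and> l = 2) ds rows)
       else False) [0..<window_size - 2]"

definition young_rows :: "affine_type \<Rightarrow> cube_info list \<Rightarrow> nat list list \<Rightarrow> bool" where
  "young_rows t ds rows \<longleftrightarrow> (if closed_rows ds rows then True
     else if t = E8 then special_rows ds rows else False)"

definition insert_label :: "nat list list \<Rightarrow> nat \<times> nat \<Rightarrow> nat list list" where
  "insert_label rows p = rows[fst p := snd p # rows ! fst p]"

definition delete_label :: "nat list list \<Rightarrow> nat \<times> nat \<Rightarrow> nat list list" where
  "delete_label rows p = rows[fst p := removeAll (snd p) (rows ! fst p)]"

text \<open>Row 0 is left out because it stays full; likewise \<open>nonmembers\<close> leaves out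
  the top row, which stays empty.\<close>

definition members :: "nat list list \<Rightarrow> (nat \<times> nat) list" where
  "members rows = concat (map (\<lambda>(k, r). map (Pair k) r) (enumerate 1 (tl rows)))"

definition nonmembers :: "cube_info list \<Rightarrow> nat list list \<Rightarrow> (nat \<times> nat) list" where
  "nonmembers ds rows = concat (map (\<lambda>(k, d, r). map (Pair k) (filter (\<lambda>l. l \<notin> set r) (cube_labels d)))
     (enumerate 0 (zip ds (butlast rows))))"

text \<open>For closed rows, only the neighbouring cubes matter, except for the few candidates that lead to
  one of the special columns; the latter are recognised by the cubes next to them.\<close>
definition local_adds :: "cube_info list \<Rightarrow> nat list list \<Rightarrow> (nat \<times> nat) list" where
  "local_adds ds rows = concat (map (\<lambda>(k, d, p, r). map (\<lambda>x. (k, fst x))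
     (filter (\<lambda>(l, ps). if l \<in> set r then False else list_all (\<lambda>l'. l' \<in> set p) ps) (snd d)))
     (enumerate 1 (zip (tl ds) (zip rows (tl rows)))))"

definition special_adds :: "cube_info list \<Rightarrow> nat list list \<Rightarrow> (nat \<times> nat) list" where
  "special_adds ds rows = filter (\<lambda>x. special_rows ds (insert_label rows x))
     (concat (map (\<lambda>(k, d, p, r). if r \<noteq> [] then []
       else if fst d = 5 \<and> 5 \<in> set p \<and> 2 \<notin> set p then [(k, 9)]
       else if fst d = 6 \<and> 9 \<in> set p \<and> 4 \<notin> set p then [(k, 2)] else [])
     (enumerate 1 (zip (tl ds) (zip rows (tl rows))))))"

definition add_list :: "affine_type \<Rightarrow> cube_info list \<Rightarrow> nat list list \<Rightarrow> (nat \<times> nat) list" where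
  "add_list t ds rows = (if closed_rows ds rows
     then local_adds ds rows @ (if t = E8 then special_adds ds rows else [])
     else filter (\<lambda>x. young_rows t ds (insert_label rows x)) (nonmembers ds rows))"

definition local_removes :: "cube_info list \<Rightarrow> nat list list \<Rightarrow> (nat \<times> nat) list" where
  "local_removes ds rows = concat (map (\<lambda>(k, d, r, q). map (Pair k)
     (filter (\<lambda>l. list_all (\<lambda>(l', ps). if l' \<in> set q then l \<notin> set ps else True) (snd d)) r))
     (enumerate 0 (zip (tl ds) (zip rows (tl rows)))))"

definition special_removes :: "cube_info list \<Rightarrow> nat list list \<Rightarrow> (nat \<times> nat) list" where
  "special_removes ds rows = filter (\<lambda>x. special_rows ds (delete_label rows x))
     (concat (map (\<lambda>(k, d, r, q).
       if fst d = 5 \<and> 9 \<in> set q \<and> 4 \<notin> set q \<and> 2 \<in> set r then [(k, 2)]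
       else if fst d = 6 \<and> 2 \<in> set q \<and> 3 \<notin> set q \<and> 4 \<in> set r then [(k, 4)] else [])
     (enumerate 0 (zip (tl ds) (zip rows (tl rows))))))"

definition remove_list :: "affine_type \<Rightarrow> cube_info list \<Rightarrow> nat list list \<Rightarrow> (nat \<times> nat) list" where
  "remove_list t ds rows = (if closed_rows ds rows
     then local_removes ds rows @ (if t = E8 then special_removes ds rows else [])
     else filter (\<lambda>x. young_rows t ds (delete_label rows x)) (members rows))"

definition of_colour :: "nat \<Rightarrow> (nat \<times> nat) list \<Rightarrow> (nat \<times> nat) list" where
  "of_colour i = filter (\<lambda>p. label_colour (snd p) = i)"

definition on_top :: "cube_info list \<Rightarrow> nat list list \<Rightarrow> nat \<Rightarrow> nat \<times> nat \<Rightarrow> bool" where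
  "on_top ds rows j p \<longleftrightarrow> 0 < fst p \<and> j \<in> set (rows ! (fst p - 1)) \<and> j \<in> set (labels_below (ds ! fst p) (snd p))"

text \<open>\<^const>\<open>None\<close> means that the rules do not single out an element of the list.\<close>
fun pick_add :: "affine_type \<Rightarrow> cube_info list \<Rightarrow> nat list list \<Rightarrow> nat \<Rightarrow> (nat \<times> nat) list \<Rightarrow> (nat \<times> nat) option" where
  "pick_add t ds rows i [x] = Some x"
| "pick_add t ds rows i [x, y] = (if t \<noteq> E8 then None else if i \<noteq> 4 then
     (if fst x < fst y then Some y else if fst y < fst x then Some x else None)
     else (case filter (on_top ds rows 5) [x, y] of [z] \<Rightarrow> Some z | _ \<Rightarrow> None))"
| "pick_add t ds rows i _ = None"

fun pick_remove :: "affine_type \<Rightarrow> cube_info list \<Rightarrow> nat list list \<Rightarrow> nat \<Rightarrow> (nat \<times> nat) list \<Rightarrow> (nat \<times> nat) option" where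
  "pick_remove t ds rows i [x] = Some x"
| "pick_remove t ds rows i [x, y] = (if t \<noteq> E8 then None else if i \<noteq> 4 then
     (if fst x < fst y then Some x else if fst y < fst x then Some y else None)
     else (case filter (on_top ds rows 3) [x, y] of [z] \<Rightarrow> Some z | _ \<Rightarrow> None))"
| "pick_remove t ds rows i _ = None"

text \<open>The weight of a column with flat top just below a cube of phase 0: 1 for each block that
  can be placed on top, -1 for each block of the cube just completed.\<close>

fun initial_levels :: "affine_type \<Rightarrow> int list" where
  "initial_levels E6 = [1, 0, -1, -1, 1, 0, 0]"
| "initial_levels E7 = [1, -1, 1, 1, -1, 0, 0, 0]"
| "initial_levels E8 = [1, 0, 1, 0, -1, 1, -1, 1, -1]"

fun neighbours :: "affine_type \<Rightarrow> nat list list" where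
  "neighbours E6 = [[2],[3],[4,0],[1,4],[3,5,2],[4,6],[5]]"
| "neighbours E7 = [[1],[0,3],[4],[1,4],[3,5,2],[4,6],[5,7],[6]]"
| "neighbours E8 = [[8],[3],[4],[4,1],[5,3,2],[6,4],[7,5],[8,6],[0,7]]"

text \<open>Subtracts the simple roots of all listed blocks at once: with the blocks counted by
  colour, the Cartan matrix acts through the neighbours in the Dynkin diagram.\<close>

definition lower_levels :: "affine_type \<Rightarrow> int list \<Rightarrow> nat list \<Rightarrow> int list" where
  "lower_levels t L ls = (let cs = map label_colour ls; n = map (\<lambda>i. int (count_list cs i)) [0..<length L] in
     map (\<lambda>(x, c, ns). x - 2 * c + sum_list (map ((!) n) ns)) (zip L (zip n (neighbours t))))"

text \<open>The weight of a column whose flat top lies just below a cube of phase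
  \<open>s\<close>.\<close>

definition phase_levels :: "affine_type \<Rightarrow> nat \<Rightarrow> int list" where
  "phase_levels t s = lower_levels t (initial_levels t)
     (concat (map (\<lambda>k. cube_labels (phase_info t k)) [0..<s]))"

definition is_interior :: "affine_type \<Rightarrow> cube_info list \<Rightarrow> nat list list \<Rightarrow> nat
    \<Rightarrow> (nat \<times> nat) list \<Rightarrow> (nat \<times> nat) list \<Rightarrow> bool" where
  "is_interior t ds rows i A R \<longleftrightarrow> (case (A, R) of ([b], [c]) \<Rightarrow>
     let S = insert_label rows b; T = delete_label rows c in
       pick_remove t ds S i (of_colour i (remove_list t ds S)) = Some b \<and>
       pick_add t ds T i (of_colour i (add_list t ds T)) = Some c
   | _ \<Rightarrow> False)"

text \<open>\<open>None\<close> is excluded: the rules must be seen to choose another block, not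
  merely fail to determine one.\<close>

definition not_interior :: "affine_type \<Rightarrow> cube_info list \<Rightarrow> nat list list \<Rightarrow> nat
    \<Rightarrow> (nat \<times> nat) list \<Rightarrow> (nat \<times> nat) list \<Rightarrow> bool" where
  "not_interior t ds rows i A R \<longleftrightarrow> (case (A, R) of ([], []) \<Rightarrow> True | ([b], [c]) \<Rightarrow>
     let S = insert_label rows b; T = delete_label rows c in
       pick_remove t ds S i (of_colour i (remove_list t ds S)) \<notin> {None, Some b} \<and>
       pick_add t ds T i (of_colour i (add_list t ds T)) \<notin> {None, Some c}
   | _ \<Rightarrow> False)"

text \<open>The assumptions of \<open>young_states\<close> for a column whose weights do not all
  vanish, one colour at a time.\<close>

definition colour_ok :: "affine_type \<Rightarrow> cube_info list \<Rightarrow> nat list list \<Rightarrow> nat \<Rightarrow> int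
    \<Rightarrow> (nat \<times> nat) list \<Rightarrow> (nat \<times> nat) list \<Rightarrow> bool" where
  "colour_ok t ds rows i x A R \<longleftrightarrow>
     (if x = 0 then A = [] \<and> R = []
      else if x = 1 then length A = 1 \<and> R = []
      else if x = -1 then A = [] \<and> length R = 1
      else if x = 2 then R = [] \<and> pick_add t ds rows i A \<noteq> None
      else x = -2 \<and> A = [] \<and> pick_remove t ds rows i R \<noteq> None)"

text \<open>The margins leave room for one addition or removal: nothing can be removed from row 0 or
  below, and an added block lands at most one row above the highest occupied one, so the top row
  stays empty.\<close>

definition rows_ok :: "affine_type \<Rightarrow> cube_info list \<Rightarrow> nat list list \<Rightarrow> bool" where
  "rows_ok t ds rows \<longleftrightarrow> length rows = window_size \<and> list_all distinct rows \<and>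
     list_all (\<lambda>(d, r). list_all (\<lambda>l. l \<in> set (cube_labels d)) r) (zip ds rows) \<and>
     list_all (\<lambda>(d, r). list_all (\<lambda>l. l \<in> set r) (cube_labels d)) (take 3 (zip ds rows)) \<and>
     list_all (\<lambda>r. r = []) (drop (window_size - 2) rows) \<and> young_rows t ds rows"

text \<open>A column whose weights all vanish must be interior for exactly one colour, hence the
  match on a list with one element.\<close>

definition state_ok :: "affine_type \<Rightarrow> cube_info list \<Rightarrow> int list \<Rightarrow> nat list list \<Rightarrow> bool" where
  "state_ok t ds L0 rows \<longleftrightarrow>
     (let A = add_list t ds rows; R = remove_list t ds rows; L = lower_levels t L0 (concat rows) in
       rows_ok t ds rows \<and>
       (if list_all (\<lambda>x. x = 0) L then t = E8 \<and>
          (case filter (\<lambda>j. is_interior t ds rows j (of_colour j A) (of_colour j R)) [0..<length L] of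
             [j] \<Rightarrow> list_all (\<lambda>i. if i = j then True
               else not_interior t ds rows i (of_colour i A) (of_colour i R)) [0..<length L]
           | _ \<Rightarrow> False)
        else list_all (\<lambda>(i, x). colour_ok t ds rows i x (of_colour i A) (of_colour i R)) (enumerate 0 L)))"

text \<open>Every block of a closed column rests on another one, so above an empty row all rows are
  empty; this keeps the enumeration short.\<close>

fun extend_rows :: "cube_info list \<Rightarrow> nat list \<Rightarrow> nat list list list" where
  "extend_rows [] prev = [[]]"
| "extend_rows (d # ds) prev = (if prev = [] then [replicate (Suc (length ds)) []]
     else concat (map (\<lambda>r. map ((#) r) (extend_rows ds r))
       (filter (row_closed d prev) (subseqs (cube_labels d)))))"

text \<open>The first three cubes are full and the fourth one is not.\<close>
definition states :: "affine_type \<Rightarrow> nat \<Rightarrow> nat list list list" where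
  "states t s = (let ds = window t s; full = map cube_labels ds in
     map ((@) (take 3 full)) (filter (\<lambda>rs. hd rs \<noteq> full ! 3) (extend_rows (drop 3 ds) (full ! 2)))
     @ (if t = E8 \<and> s = 1 then [take 3 full @ [[5, 3], [9]] @ replicate 11 []]
        else if t = E8 \<and> s = 2 then [take 3 full @ [[9], [2]] @ replicate 11 []] else []))"

fun descend :: "cube_info list \<Rightarrow> nat list \<Rightarrow> nat list" where
  "descend [] ls = ls"
| "descend (d # ds) ls = descend ds (remdups (concat (map (labels_below d) ls)))"

text \<open>Three facts about the pattern: every block rests on some block; the blocks that support
  a single block eventually fill a cube, so a closed set is full far down; every block lies below
  some block of the next cube, so fullness passes downwards. In the naturals,
  \<open>(n - 1) * k\<close> stands for \<open>- k\<close> modulo \<open>n\<close>.\<close>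

definition descent_ok :: "affine_type \<Rightarrow> bool" where
  "descent_ok t \<longleftrightarrow> (let c = map (phase_info t) [0..<period t]; n = period t in
     list_all (\<lambda>s. let d = c ! s; ds = map (\<lambda>k. c ! ((s + (n - 1) * k) mod n)) [0..<window_size];
         below = cube_labels (c ! ((s + (n - 1) * window_size) mod n));
         labels = cube_labels (c ! ((s + (n - 1)) mod n)) in
       list_all (\<lambda>l. labels_below d l \<noteq> [] \<and>
         (let ls = descend ds [l] in list_all (\<lambda>l'. l' \<in> set ls) below)) (cube_labels d) \<and>
       list_all (\<lambda>l'. list_ex (\<lambda>l. l' \<in> set (labels_below d l)) (cube_labels d)) labels) [0..<n])"

definition phase_ok :: "affine_type \<Rightarrow> nat \<Rightarrow> bool" where
  "phase_ok t s \<longleftrightarrow> (let ds = window t s; L = phase_levels t s in list_all (state_ok t ds L) (states t s))"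

section \<open>Evaluation of the finite checks\<close>

lemma phase_ok_E8_0: "phase_ok E8 0" by code_simp
lemma phase_ok_E8_1: "phase_ok E8 1" by code_simp
lemma phase_ok_E8_2: "phase_ok E8 2" by code_simp
lemma phase_ok_E8_3: "phase_ok E8 3" by code_simp
lemma phase_ok_E8_4: "phase_ok E8 4" by code_simp
lemma phase_ok_E8_5: "phase_ok E8 5" by code_simp
lemma phase_ok_E8_6: "phase_ok E8 6" by code_simp
lemma phase_ok_E8_7: "phase_ok E8 7" by code_simp
lemma phase_ok_E8_8: "phase_ok E8 8" by code_simp
lemma phase_ok_E8_9: "phase_ok E8 9" by code_simp
lemma phase_ok_E7_0: "phase_ok E7 0" by code_simp
lemma phase_ok_E7_1: "phase_ok E7 1" by code_simp
lemma phase_ok_E7_2: "phase_ok E7 2" by code_simp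
lemma phase_ok_E7_3: "phase_ok E7 3" by code_simp
lemma phase_ok_E7_4: "phase_ok E7 4" by code_simp
lemma phase_ok_E7_5: "phase_ok E7 5" by code_simp
lemma phase_ok_E7_6: "phase_ok E7 6" by code_simp
lemma phase_ok_E7_7: "phase_ok E7 7" by code_simp
lemma phase_ok_E6_0: "phase_ok E6 0" by code_simp
lemma phase_ok_E6_1: "phase_ok E6 1" by code_simp
lemma phase_ok_E6_2: "phase_ok E6 2" by code_simp
lemma phase_ok_E6_3: "phase_ok E6 3" by code_simp
lemma phase_ok_E6_4: "phase_ok E6 4" by code_simp
lemma phase_ok_E6_5: "phase_ok E6 5" by code_simp

lemma descent_ok_E6: "descent_ok E6" by code_simp
lemma descent_ok_E7: "descent_ok E7" by code_simp
lemma descent_ok_E8: "descent_ok E8" by code_simp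

section \<open>Index coordinates for the blocks\<close>

definition phase :: "affine_type \<Rightarrow> int \<Rightarrow> nat" where
  "phase t j = nat (j mod int (period t))"

definition info :: "affine_type \<Rightarrow> int \<Rightarrow> cube_info" where
  "info t j = phase_info t (phase t j)"

text \<open>Coordinates by cube and label, common to all columns of the wall. The columns differ
  only by the translation and the rotations in \<open>index_block\<close>, so a statement about
  indices applies to each of them.\<close>

definition idx :: "affine_type \<Rightarrow> (int \<times> nat) set" where
  "idx t = {(j, l). l \<in> set (cube_labels (info t j))}"

text \<open>In types E6 and E8 the listed cubes alternate with their rotations as the height grows;
  in type E7 they repeat unchanged, and it is every other column that is rotated.\<close>

definition flipped :: "affine_type \<Rightarrow> nat \<Rightarrow> int \<Rightarrow> bool" where
  "flipped t r j \<longleftrightarrow> (if t = E7 then odd r else odd (j div int (period t)))"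

definition index_section :: "affine_type \<Rightarrow> nat \<Rightarrow> int \<Rightarrow> cross_section" where
  "index_section t r j = (if flipped t r j then rotate_section (labelled_cubes t ! phase t j)
     else labelled_cubes t ! phase t j)"

text \<open>The translation in \<open>wall_pattern\<close>: in every column, index 0 is cube 1 of
  the Young column pattern up to rotation.\<close>

fun offset :: "affine_type \<Rightarrow> nat \<Rightarrow> int" where
  "offset E6 r = 8 * int r"
| "offset E7 r = (if even r then 0 else 4)"
| "offset E8 r = 0"

definition cells_of :: "cross_section \<Rightarrow> nat \<Rightarrow> cell set" where
  "cells_of s l = {c \<in> cells s. cell_colour s c = l}"

definition index_block :: "affine_type \<Rightarrow> nat \<Rightarrow> int \<times> nat \<Rightarrow> block" where
  "index_block t r x = Block (fst x + 1 - offset t r) (label_colour (snd x))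
     (cells_of (index_section t r (fst x)) (snd x))"

lemma height_index_block [simp]: "height (index_block t r x) = fst x + 1 - offset t r"
  and colour_index_block [simp]: "colour (index_block t r x) = label_colour (snd x)"
  and base_index_block [simp]: "base (index_block t r x) = cells_of (index_section t r (fst x)) (snd x)"
  by (simp_all add: index_block_def)

lemma cells_of_simps:
  "(Upper, c) \<in> cells_of (u, v) l \<longleftrightarrow> 1 \<le> c \<and> c \<le> length u \<and> u ! (c - 1) = l"
  "(Lower, c) \<in> cells_of (u, v) l \<longleftrightarrow> 1 \<le> c \<and> c \<le> length u \<and> v ! (c - 1) = l"
  by (auto simp: cells_of_def cells_def)

definition section_width :: "nat \<Rightarrow> cross_section \<Rightarrow> bool" where
  "section_width w s \<longleftrightarrow> length (fst s) = w \<and> length (snd s) = w"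

lemma ex_cell: "(\<exists>x. P x) \<longleftrightarrow> (\<exists>c. P (Upper, c)) \<or> (\<exists>c. P (Lower, c))"
proof
  assume "\<exists>x. P x"
  then obtain a c where "P (a, c)" by auto
  then show "(\<exists>c. P (Upper, c)) \<or> (\<exists>c. P (Lower, c))" by (cases a) auto
qed auto

lemma ex_index: "(\<exists>c. 1 \<le> c \<and> c \<le> n \<and> P (c - 1)) \<longleftrightarrow> (\<exists>c<n. P c)" for n :: nat
proof
  assume "\<exists>c<n. P c"
  then obtain c where "c < n" "P c" by blast
  then show "\<exists>c. 1 \<le> c \<and> c \<le> n \<and> P (c - 1)" by (intro exI[of _ "Suc c"]) simp
next
  assume "\<exists>c. 1 \<le> c \<and> c \<le> n \<and> P (c - 1)"
  then obtain c where "1 \<le> c" "c \<le> n" "P (c - 1)" by blast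
  then show "\<exists>c<n. P c" by (intro exI[of _ "c - 1"]) auto
qed

text \<open>Reduces incidence of sets of cells to a search in zipped lists, the form in which it is
  evaluated.\<close>

lemma cells_of_touching:
  assumes "section_width w s" "section_width w s'"
  shows "cells_of s' l' \<inter> cells_of s l \<noteq> {} \<longleftrightarrow> touching s' l' s l"
proof -
  obtain u v u' v' where s: "s = (u, v)" "s' = (u', v')" by (cases s, cases s') auto
  have len: "length u = w" "length v = w" "length u' = w" "length v' = w"
    using assms by (auto simp: section_width_def s)
  have "cells_of s' l' \<inter> cells_of s l \<noteq> {} \<longleftrightarrow> (\<exists>x. x \<in> cells_of s' l' \<and> x \<in> cells_of s l)" by blast
  also have "\<dots> \<longleftrightarrow> (\<exists>c. 1 \<le> c \<and> c \<le> w \<and> (u' ! (c - 1) = l' \<and> u ! (c - 1) = l)) \<or>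
      (\<exists>c. 1 \<le> c \<and> c \<le> w \<and> (v' ! (c - 1) = l' \<and> v ! (c - 1) = l))"
    unfolding ex_cell s cells_of_simps len by blast
  also have "\<dots> \<longleftrightarrow> touching s' l' s l"
    unfolding ex_index[of w "\<lambda>c. u' ! c = l' \<and> u ! c = l"] ex_index[of w "\<lambda>c. v' ! c = l' \<and> v ! c = l"]
    by (auto simp: touching_def s in_set_zip len)
  finally show ?thesis .
qed

lemma cells_of_nonempty:
  assumes "section_width w s"
  shows "cells_of s l \<noteq> {} \<longleftrightarrow> l \<in> set (section_labels s)"
proof -
  have "cells_of s l \<noteq> {} \<longleftrightarrow> touching s l s l"
    using cells_of_touching[OF assms assms, of l l] by simp
  also have "\<dots> \<longleftrightarrow> l \<in> set (section_labels s)"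
    using assms by (auto simp: touching_def section_labels_def section_width_def in_set_zip in_set_conv_nth)
  finally show ?thesis .
qed

lemma touching_rotate:
  assumes "section_width w s" "section_width w s'"
  shows "touching (rotate_section s') l' (rotate_section s) l \<longleftrightarrow> touching s' l' s l"
  using assms by (auto simp: touching_def rotate_section_def section_width_def case_prod_beta zip_rev)

lemma section_labels_rotate: "set (section_labels (rotate_section s)) = set (section_labels s)"
  by (auto simp: section_labels_def rotate_section_def case_prod_beta)

lemma section_width_rotate: "section_width w (rotate_section s) \<longleftrightarrow> section_width w s"
  by (auto simp: section_width_def rotate_section_def case_prod_beta)

lemma cells_of_rotate:
  assumes "section_width w s"
  shows "cells_of (rotate_section s) l = rotate_cell w ` cells_of s l"
proof -
  obtain u v where s: "s = (u, v)" by (cases s)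
  have len: "length u = w" "length v = w" using assms by (auto simp: section_width_def s)
  have rr: "rotate_cell w (rotate_cell w x) = x" if "x \<in> cells s" for x
    using that by (cases x; cases "fst x") (auto simp: cells_def s len)
  have in_rot: "rotate_cell w x \<in> cells_of (rotate_section s) l \<longleftrightarrow> x \<in> cells_of s l" if "x \<in> cells s" for x
  proof -
    obtain a c where "x = (a, c)" by (cases x)
    with that have x: "x = (a, c)" "1 \<le> c" "c \<le> w" by (auto simp: cells_def s len)
    then have "rev xs ! (w - c) = xs ! (c - 1)" if "length xs = w" for xs :: "nat list"
      using that by (simp add: rev_nth)
    then show ?thesis using x
      by (cases a) (auto simp: s rotate_section_def cells_of_simps len)
  qed
  have "x \<in> cells s" if "x \<in> cells_of (rotate_section s) l" for x
    using that by (auto simp: cells_of_def cells_def rotate_section_def s len)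
  moreover have "rotate_cell w x \<in> cells s" if "x \<in> cells s" for x
    using that by (cases x; cases "fst x") (auto simp: cells_def s len)
  moreover have "x \<in> cells s" if "x \<in> cells_of s l" for x
    using that by (simp add: cells_of_def)
  ultimately show ?thesis
  proof (intro subset_antisym subsetI)
    fix x assume x: "x \<in> cells_of (rotate_section s) l"
    then have c: "x \<in> cells s" by fact
    then have r: "rotate_cell w x \<in> cells s" by fact
    have "rotate_cell w x \<in> cells_of s l" using in_rot[OF r] rr[OF c] x by simp
    then show "x \<in> rotate_cell w ` cells_of s l" using rr[OF c] by (metis imageI)
  qed (use in_rot in blast)
qed

text \<open>The third claim isolates the cube \<open>444444\<close>, the only one whose labels are
  not all colours.\<close>

lemma labelled_cubes_facts:
  "s < period t \<Longrightarrow> section_width (width t) (labelled_cubes t ! s)"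
  "s < period t \<Longrightarrow> set (section_labels (labelled_cubes t ! s)) \<subseteq> {..rank t} \<union> (if t = E8 then {9} else {})"
  "s < period t \<Longrightarrow> labelled_cubes t ! s = base_cubes t ! s \<and> 9 \<notin> set (section_labels (base_cubes t ! s)) \<and>
     base_cubes t ! s \<noteq> (replicate 6 4, replicate 6 4) \<or>
     labelled_cubes t ! s = ([4,4,4,9,9,9], [4,4,4,9,9,9]) \<and> base_cubes t ! s = (replicate 6 4, replicate 6 4)"
proof -
  have "\<forall>s<period t. section_width (width t) (labelled_cubes t ! s) \<and>
     set (section_labels (labelled_cubes t ! s)) \<subseteq> {..rank t} \<union> (if t = E8 then {9} else {}) \<and>
     (labelled_cubes t ! s = base_cubes t ! s \<and> 9 \<notin> set (section_labels (base_cubes t ! s)) \<and>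
     base_cubes t ! s \<noteq> (replicate 6 4, replicate 6 4) \<or>
     labelled_cubes t ! s = ([4,4,4,9,9,9], [4,4,4,9,9,9]) \<and> base_cubes t ! s = (replicate 6 4, replicate 6 4))"
    by (cases t) (simp_all add: period_def All_less_Suc section_width_def section_labels_def
        numeral_eq_Suc nth_Cons')
  then show "s < period t \<Longrightarrow> section_width (width t) (labelled_cubes t ! s)"
  "s < period t \<Longrightarrow> set (section_labels (labelled_cubes t ! s)) \<subseteq> {..rank t} \<union> (if t = E8 then {9} else {})"
  "s < period t \<Longrightarrow> labelled_cubes t ! s = base_cubes t ! s \<and> 9 \<notin> set (section_labels (base_cubes t ! s)) \<and>
     base_cubes t ! s \<noteq> (replicate 6 4, replicate 6 4) \<or>
     labelled_cubes t ! s = ([4,4,4,9,9,9], [4,4,4,9,9,9]) \<and> base_cubes t ! s = (replicate 6 4, replicate 6 4)"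
    by blast+
qed

lemma period_pos: "0 < period t"
  by (cases t) (simp_all add: period_def)

lemma length_labelled_cubes: "length (labelled_cubes t) = period t"
  by (cases t) (simp_all add: period_def)

lemma last_labelled_cubes: "last (labelled_cubes t) = labelled_cubes t ! (period t - 1)"
  using length_labelled_cubes[of t] period_pos[of t] by (subst last_conv_nth) auto

lemma phase_less: "phase t j < period t"
  using period_pos[of t] by (simp add: phase_def nat_less_iff)

text \<open>A step down across phase 0 also lowers the number of the run of listed cubes, on whose
  parity the rotation depends.\<close>

lemma phase_Suc_period:
  "phase t (j - 1) = (if phase t j = 0 then period t - 1 else phase t j - 1)"
  "(j - 1) div int (period t) = (if phase t j = 0 then j div int (period t) - 1 else j div int (period t))"
proof -
  define n where "n = int (period t)"
  have n: "n > 0" using period_pos[of t] by (simp add: n_def)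
  define q where "q = j div n"
  define u where "u = j mod n"
  have j: "j = q * n + u" "0 \<le> u" "u < n" using n by (simp_all add: q_def u_def)
  have ph: "phase t j = nat u" by (simp add: phase_def u_def n_def)
  have "(j - 1) div n = (if u = 0 then q - 1 else q) \<and> (j - 1) mod n = (if u = 0 then n - 1 else u - 1)"
  proof (cases "u = 0")
    case True
    then have *: "j - 1 = (n - 1) + n * (q - 1)" using j by (simp add: algebra_simps)
    have "((n - 1) + n * (q - 1)) mod n = n - 1"
      unfolding mod_mult_self2 using n by (intro mod_pos_pos_trivial) auto
    then show ?thesis unfolding * using n True by simp
  next
    case False
    then have *: "j - 1 = (u - 1) + n * q" using j by (simp add: algebra_simps)
    show ?thesis unfolding * using n False j by simp
  qed
  moreover have "period t = nat n" by (simp add: n_def)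
  ultimately show "phase t (j - 1) = (if phase t j = 0 then period t - 1 else phase t j - 1)"
    "(j - 1) div int (period t) = (if phase t j = 0 then j div int (period t) - 1 else j div int (period t))"
    using j(2) n ph unfolding phase_def n_def[symmetric] q_def[symmetric] by (auto simp: nat_diff_distrib)
qed

lemma section_width_index_section: "section_width (width t) (index_section t r j)"
  using labelled_cubes_facts(1)[OF phase_less] by (simp add: index_section_def section_width_rotate)

lemma cube_labels_info: "cube_labels (info t j) = section_labels (labelled_cubes t ! phase t j)"
  by (simp add: cube_labels_def info_def phase_info_def comp_def)

lemma set_index_section_labels: "set (section_labels (index_section t r j)) = set (cube_labels (info t j))"
  by (simp add: cube_labels_info index_section_def section_labels_rotate)

lemma section_width_preceding: "s < period t \<Longrightarrow> section_width (width t) (preceding_cube t s)"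
proof (cases "s = 0")
  case True
  have "section_width (width t) (last (labelled_cubes t))"
    unfolding last_labelled_cubes using period_pos[of t] by (intro labelled_cubes_facts) simp
  moreover have "preceding_cube t 0 \<in> {last (labelled_cubes t), rotate_section (last (labelled_cubes t))}"
    by (simp add: preceding_cube_def)
  ultimately show ?thesis using True by (metis insertE section_width_rotate singletonD)
qed (simp add: preceding_cube_def labelled_cubes_facts(1))

text \<open>Adjacent cubes are rotated alike except across the boundary of two runs of listed cubes
  in types E6 and E8, where the rotation built into \<open>preceding_cube\<close> makes up for the
  difference. A common rotation does not affect incidence.\<close>

lemma touching_index_section:
  "touching (index_section t r (j - 1)) l' (index_section t r j) l \<longleftrightarrow>
   touching (preceding_cube t (phase t j)) l' (labelled_cubes t ! phase t j) l"
proof -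
  let ?s = "labelled_cubes t ! phase t j"
  have w: "section_width (width t) ?s" by (rule labelled_cubes_facts(1)[OF phase_less])
  have rr: "rotate_section (rotate_section s) = s" for s
    by (simp add: rotate_section_def case_prod_beta)
  have "index_section t r (j - 1) = (if flipped t r j then rotate_section (preceding_cube t (phase t j))
      else preceding_cube t (phase t j))"
  proof -
    define P where "P \<longleftrightarrow> t = E7"
    have "preceding_cube t s = (if s > 0 then labelled_cubes t ! (s - 1)
        else if P then labelled_cubes t ! (period t - 1)
        else rotate_section (labelled_cubes t ! (period t - 1)))" for s
      unfolding preceding_cube_def P_def last_labelled_cubes by (rule refl)
    moreover have "flipped t r j = (if P then odd r else odd (j div int (period t)))" for j
      by (simp add: flipped_def P_def)
    ultimately show ?thesis
      by (simp add: index_section_def phase_Suc_period rr)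
  qed
  then show ?thesis
    using touching_rotate[OF w section_width_preceding[OF phase_less]] by (simp add: index_section_def)
qed

lemma set_labels_below:
  assumes "l \<in> set (cube_labels (info t j))"
  shows "set (labels_below (info t j) l) =
    {l'. touching (preceding_cube t (phase t j)) l' (labelled_cubes t ! phase t j) l}"
proof -
  have "map_of (map (\<lambda>l. (l, f l)) xs) l = (if l \<in> set xs then Some (f l) else None)" for f :: "nat \<Rightarrow> nat list" and xs
    by (induction xs) auto
  moreover have "{l'. touching s' l' s l} \<subseteq> set (section_labels s')" for s' s
    by (auto simp: touching_def section_labels_def dest: set_zip_leftD)
  then have "{l'. touching s' l' s l} = {l' \<in> set (section_labels s'). touching s' l' s l}" for s' s
    by blast
  ultimately show ?thesis
    using assms by (simp add: labels_below_def info_def phase_info_def cube_labels_def comp_def)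
qed

lemma labels_below_in_idx:
  assumes "(j, l) \<in> idx t" "l' \<in> set (labels_below (info t j) l)"
  shows "(j - 1, l') \<in> idx t"
proof -
  have "touching (index_section t 0 (j - 1)) l' (index_section t 0 j) l"
    using assms set_labels_below by (simp add: idx_def touching_index_section)
  then have "l' \<in> set (section_labels (index_section t 0 (j - 1)))"
    by (auto simp: touching_def section_labels_def dest: set_zip_leftD)
  then show ?thesis by (simp add: idx_def set_index_section_labels)
qed

lemma lies_below_iff:
  assumes "x \<in> idx t" "y \<in> idx t"
  shows "lies_below (index_block t r x) (index_block t r y) \<longleftrightarrow>
    fst x = fst y - 1 \<and> snd x \<in> set (labels_below (info t (fst y)) (snd y))"
proof -
  have "cells_of (index_section t r (fst y - 1)) (snd x) \<inter> cells_of (index_section t r (fst y)) (snd y) \<noteq> {}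
      \<longleftrightarrow> snd x \<in> set (labels_below (info t (fst y)) (snd y))"
    using assms(2) cells_of_touching[OF section_width_index_section section_width_index_section]
    by (auto simp: idx_def set_labels_below touching_index_section)
  moreover have "lies_below (index_block t r x) (index_block t r y) \<longleftrightarrow> fst x = fst y - 1 \<and>
      cells_of (index_section t r (fst x)) (snd x) \<inter> cells_of (index_section t r (fst y)) (snd y) \<noteq> {}"
    unfolding lies_below_def height_index_block base_index_block by linarith
  ultimately show ?thesis by metis
qed

text \<open>Equal bases share a cell, and a cell carries only one label.\<close>

lemma inj_on_index_block: "inj_on (index_block t r) (idx t)"
proof (rule inj_onI)
  fix x y assume xy: "x \<in> idx t" "y \<in> idx t" "index_block t r x = index_block t r y"
  then have h: "fst x = fst y"
    using height_index_block[of t r x] height_index_block[of t r y] by simp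
  have b: "cells_of (index_section t r (fst x)) (snd x) = cells_of (index_section t r (fst x)) (snd y)"
    using xy(3) base_index_block[of t r x] base_index_block[of t r y] h by simp
  have "cells_of (index_section t r (fst x)) (snd x) \<noteq> {}"
    using xy(1) cells_of_nonempty[OF section_width_index_section]
    by (auto simp: idx_def set_index_section_labels)
  then obtain c where "c \<in> cells_of (index_section t r (fst x)) (snd x)" by blast
  moreover from this b have "c \<in> cells_of (index_section t r (fst x)) (snd y)" by simp
  ultimately have "snd x = snd y" by (simp add: cells_of_def)
  with h show "x = y" by (simp add: prod_eq_iff)
qed

lemma cube_blocks_eq:
  assumes "section_width w s" "9 \<notin> set (section_labels s)" "s \<noteq> (replicate 6 4, replicate 6 4)"
  shows "cube_blocks k s = (\<lambda>l. Block k (label_colour l) (cells_of s l)) ` set (section_labels s)"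
proof -
  have "cube_blocks k s = {Block k i (cells_of s i) |i. cells_of s i \<noteq> {}}"
    using assms(3) by (auto simp: cube_blocks_def cells_of_def)
  also have "\<dots> = (\<lambda>i. Block k i (cells_of s i)) ` set (section_labels s)"
    using cells_of_nonempty[OF assms(1)] by blast
  also have "\<dots> = (\<lambda>l. Block k (label_colour l) (cells_of s l)) ` set (section_labels s)"
  proof (rule image_cong)
    fix l assume "l \<in> set (section_labels s)"
    with assms(2) have "l \<noteq> 9" by blast
    then show "Block k l (cells_of s l) = Block k (label_colour l) (cells_of s l)"
      by (simp add: label_colour_def)
  qed simp
  finally show ?thesis .
qed

text \<open>In the rotated cube the labels 4 and 9 have exchanged their halves; as both stand for
  colour 4, the set of blocks is the same.\<close>

lemma cube_blocks_444444:
  assumes "s = ([4,4,4,9,9,9], [4,4,4,9,9,9]) \<or> s = ([9,9,9,4,4,4], [9,9,9,4,4,4])"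
  shows "cube_blocks k (replicate 6 4, replicate 6 4)
    = (\<lambda>l. Block k (label_colour l) (cells_of s l)) ` set (section_labels s)"
proof -
  have six: "1 \<le> c \<and> c \<le> 6 \<longleftrightarrow> c = 1 \<or> c = 2 \<or> c = 3 \<or> c = 4 \<or> c = 5 \<or> c = (6::nat)" for c
    by presburger
  have "cells_of s 4 = (if hd (fst s) = 4 then UNIV \<times> {1..3} else UNIV \<times> {4..6}) \<and>
      cells_of s 9 = (if hd (fst s) = 4 then UNIV \<times> {4..6} else UNIV \<times> {1..3})"
  proof -
    have "(a, c) \<in> cells_of s 4 \<longleftrightarrow> (a, c) \<in> (if hd (fst s) = 4 then UNIV \<times> {1..3} else UNIV \<times> {4..6})"
      "(a, c) \<in> cells_of s 9 \<longleftrightarrow> (a, c) \<in> (if hd (fst s) = 4 then UNIV \<times> {4..6} else UNIV \<times> {1..3})" for a c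
    proof -
      have a: "a = Upper \<or> a = Lower" by (cases a) auto
      have "c = 1 \<or> c = 2 \<or> c = 3 \<or> c = 4 \<or> c = 5 \<or> c = 6 \<or> \<not> (1 \<le> c \<and> c \<le> 6)"
        using six by blast
      then show "(a, c) \<in> cells_of s 4 \<longleftrightarrow> (a, c) \<in> (if hd (fst s) = 4 then UNIV \<times> {1..3} else UNIV \<times> {4..6})"
        "(a, c) \<in> cells_of s 9 \<longleftrightarrow> (a, c) \<in> (if hd (fst s) = 4 then UNIV \<times> {4..6} else UNIV \<times> {1..3})"
        using assms a by (elim disjE; simp add: cells_of_simps; linarith)+
    qed
    then show ?thesis by (intro conjI set_eqI) auto
  qed
  moreover have "set (section_labels s) = {4, 9}" using assms by (auto simp: section_labels_def)
  ultimately show ?thesis by (auto simp: cube_blocks_def label_colour_def)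
qed

lemma wall_pattern_section:
  "wall_pattern t r k = (let j = k - 1 + offset t r in
     if flipped t r j then rotate_section (base_cubes t ! phase t j) else base_cubes t ! phase t j)"
proof (cases t)
  case E6
  have eq: "k + 8 * int r - 1 = k - 1 + 8 * int r" by simp
  show ?thesis using E6
    by (simp add: eq column_pattern_def flipped_def phase_def period_def Let_def)
next
  case E7
  then show ?thesis
    by (cases "even r") (simp_all add: column_pattern_def flipped_def phase_def period_def Let_def)
next
  case E8
  then show ?thesis by (simp add: column_pattern_def flipped_def phase_def period_def Let_def)
qed

lemma cube_blocks_wall_pattern:
  "cube_blocks k (wall_pattern t r k) =
     (\<lambda>l. index_block t r (k - 1 + offset t r, l)) ` set (cube_labels (info t (k - 1 + offset t r)))"
proof -
  define j where "j = k - 1 + offset t r"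
  let ?b = "base_cubes t ! phase t j" and ?s = "labelled_cubes t ! phase t j"
  have "cube_blocks k (wall_pattern t r k) = (\<lambda>l. Block k (label_colour l) (cells_of (index_section t r j) l)) `
      set (section_labels (index_section t r j))"
    using labelled_cubes_facts(3)[OF phase_less, of t j]
  proof
    assume *: "?s = ?b \<and> 9 \<notin> set (section_labels ?b) \<and> ?b \<noteq> (replicate 6 4, replicate 6 4)"
    then have "wall_pattern t r k = index_section t r j"
      by (simp add: wall_pattern_section index_section_def j_def)
    moreover have "9 \<notin> set (section_labels (index_section t r j))"
      using * by (simp add: index_section_def section_labels_rotate)
    moreover have "rotate_section ?s = (replicate 6 4, replicate 6 4) \<Longrightarrow> ?s = (replicate 6 4, replicate 6 4)"
      by (cases ?s) (auto simp: rotate_section_def rev_swap)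
    then have "index_section t r j \<noteq> (replicate 6 4, replicate 6 4)"
      using * by (auto simp: index_section_def)
    ultimately show ?thesis
      using cube_blocks_eq[OF section_width_index_section] by simp
  next
    assume *: "?s = ([4,4,4,9,9,9], [4,4,4,9,9,9]) \<and> ?b = (replicate 6 4, replicate 6 4)"
    then have "wall_pattern t r k = (replicate 6 4, replicate 6 4)"
      by (simp add: wall_pattern_section j_def[symmetric] Let_def rotate_section_def)
    then show ?thesis
      using * by (simp add: cube_blocks_444444 index_section_def rotate_section_def)
  qed
  then show ?thesis
    unfolding set_index_section_labels j_def[symmetric]
    by (simp add: index_block_def j_def)
qed

lemma blocks_wall_pattern: "blocks (wall_pattern t r) = index_block t r ` idx t"
proof -
  have "(\<Union>k. F (k - 1 + offset t r)) = (\<Union>j. F j)" for F :: "int \<Rightarrow> block set"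
  proof -
    have "F j = F ((j + 1 - offset t r) - 1 + offset t r)" for j by simp
    then show ?thesis by blast
  qed
  from this[of "\<lambda>j. (\<lambda>l. index_block t r (j, l)) ` set (cube_labels (info t j))"]
  show ?thesis
    unfolding blocks_def cube_blocks_wall_pattern by (auto simp: idx_def)
qed

lemma label_colour_index:
  assumes "(j, l) \<in> idx t"
  shows "label_colour l \<in> index_set t"
  using labelled_cubes_facts(2)[OF phase_less, of t j] assms
  by (auto simp: idx_def cube_labels_info label_colour_def index_set_def split: if_splits)

section \<open>Young columns as sets of indices\<close>

definition index_ideal :: "affine_type \<Rightarrow> (int \<times> nat) set \<Rightarrow> bool" where
  "index_ideal t X \<longleftrightarrow> X \<noteq> {} \<and> X \<subseteq> idx t \<and> (\<exists>K. \<forall>x\<in>X. fst x \<le> K) \<and>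
     (\<forall>x\<in>X. \<forall>l\<in>set (labels_below (info t (fst x)) (snd x)). (fst x - 1, l) \<in> X)"

text \<open>The special columns; the cube with phase 4 that is not full is the origin.\<close>
definition shape1 :: "int \<Rightarrow> nat \<Rightarrow> bool" where
  "shape1 k l \<longleftrightarrow> k < 0 \<or> k = 0 \<and> (l = 5 \<or> l = 3) \<or> k = 1 \<and> l = 9"

definition shape2 :: "int \<Rightarrow> nat \<Rightarrow> bool" where
  "shape2 k l \<longleftrightarrow> k < 1 \<or> k = 1 \<and> l = 9 \<or> k = 2 \<and> l = 2"

text \<open>In type E8 the indices \<open>10 * m + 4\<close> are those of phase 4; consecutive ones
  are rotated against each other.\<close>

definition place :: "(int \<Rightarrow> nat \<Rightarrow> bool) \<Rightarrow> int \<Rightarrow> (int \<times> nat) set" where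
  "place P m = {x \<in> idx E8. P (fst x - (10 * m + 4)) (snd x)}"

definition index_young :: "affine_type \<Rightarrow> (int \<times> nat) set \<Rightarrow> bool" where
  "index_young t X \<longleftrightarrow> index_ideal t X \<or> t = E8 \<and> (\<exists>m. X = place shape1 m \<or> X = place shape2 m)"

lemma image_inj_mem:
  assumes "X \<subseteq> idx t" "x \<in> idx t"
  shows "index_block t r x \<in> index_block t r ` X \<longleftrightarrow> x \<in> X"
  using inj_on_image_mem_iff[OF inj_on_index_block] assms by blast

lemma proper_column_index_block:
  assumes "X \<subseteq> idx t"
  shows "proper_column (wall_pattern t r) (index_block t r ` X) \<longleftrightarrow> index_ideal t X"
proof -
  have "(\<exists>K. \<forall>b\<in>index_block t r ` X. height b \<le> K) \<longleftrightarrow> (\<exists>K. \<forall>x\<in>X. fst x \<le> K)"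
  proof
    assume "\<exists>K. \<forall>b\<in>index_block t r ` X. height b \<le> K"
    then obtain K where "\<forall>x\<in>X. fst x + 1 - offset t r \<le> K" by auto
    then have "\<forall>x\<in>X. fst x \<le> K - 1 + offset t r" by auto
    then show "\<exists>K. \<forall>x\<in>X. fst x \<le> K" by blast
  next
    assume "\<exists>K. \<forall>x\<in>X. fst x \<le> K"
    then obtain K where "\<forall>x\<in>X. fst x \<le> K" by blast
    then have "\<forall>b\<in>index_block t r ` X. height b \<le> K + 1 - offset t r" by auto
    then show "\<exists>K. \<forall>b\<in>index_block t r ` X. height b \<le> K" by blast
  qed
  moreover have "(\<forall>b\<in>index_block t r ` X. \<forall>b'\<in>blocks (wall_pattern t r). lies_below b' b \<longrightarrow> b' \<in> index_block t r ` X)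
     \<longleftrightarrow> (\<forall>x\<in>X. \<forall>l\<in>set (labels_below (info t (fst x)) (snd x)). (fst x - 1, l) \<in> X)" (is "?L \<longleftrightarrow> ?R")
  proof
    assume L: ?L
    show ?R
    proof (intro ballI)
      fix x l assume x: "x \<in> X" and l: "l \<in> set (labels_below (info t (fst x)) (snd x))"
      have xi: "x \<in> idx t" using x assms by blast
      have y: "(fst x - 1, l) \<in> idx t"
        using labels_below_in_idx[of "fst x" "snd x"] xi l by simp
      have "lies_below (index_block t r (fst x - 1, l)) (index_block t r x)"
        using lies_below_iff[OF y xi] l by simp
      with L x y have "index_block t r (fst x - 1, l) \<in> index_block t r ` X"
        unfolding blocks_wall_pattern by blast
      then show "(fst x - 1, l) \<in> X" using image_inj_mem[OF assms y] by blast
    qed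
  next
    assume R: ?R
    show ?L
    proof (intro ballI impI)
      fix b b' assume "b \<in> index_block t r ` X" "b' \<in> blocks (wall_pattern t r)" and lb: "lies_below b' b"
      then obtain x y where x: "x \<in> X" "b = index_block t r x" and y: "y \<in> idx t" "b' = index_block t r y"
        unfolding blocks_wall_pattern by blast
      with lies_below_iff[OF y(1), of x r] assms lb
      have "fst y = fst x - 1" "snd y \<in> set (labels_below (info t (fst x)) (snd x))" by auto
      with R x have "y \<in> X" by (metis prod.collapse)
      then show "b' \<in> index_block t r ` X" using y by blast
    qed
  qed
  moreover have "index_block t r ` X \<subseteq> blocks (wall_pattern t r)"
    using assms by (auto simp: blocks_wall_pattern)
  ultimately show ?thesis
    using assms by (simp add: proper_column_def index_ideal_def)
qed

definition shift :: "int \<Rightarrow> int \<times> nat \<Rightarrow> int \<times> nat" where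
  "shift n x = (fst x + n, snd x)"

lemma period_E8 [simp]: "period E8 = 10"
  by (simp add: period_def)

lemma info_shift: "info E8 (j + 10 * m) = info E8 j"
  by (simp add: info_def phase_def)

lemma shift_idx: "shift (10 * m) x \<in> idx E8 \<longleftrightarrow> x \<in> idx E8"
  by (auto simp: idx_def shift_def info_shift)

lemma shift_place: "shift (10 * m) ` place P 0 = place P m"
proof (intro subset_antisym subsetI)
  fix x assume x: "x \<in> place P m"
  define y where "y = shift (10 * (- m)) x"
  have "x = shift (10 * m) y" by (simp add: y_def shift_def)
  moreover have "y \<in> place P 0"
    using x unfolding place_def y_def mem_Collect_eq shift_idx by (simp add: shift_def algebra_simps)
  ultimately show "x \<in> shift (10 * m) ` place P 0" by (rule image_eqI)
next
  fix x assume "x \<in> shift (10 * m) ` place P 0"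
  then obtain y where "x = shift (10 * m) y" "y \<in> place P 0" by blast
  then show "x \<in> place P m"
    unfolding place_def mem_Collect_eq by (simp add: shift_idx) (simp add: shift_def algebra_simps)
qed

lemma index_section_shift:
  "index_section E8 r (j + 10 * m) = (if even m then index_section E8 r j else rotate_section (index_section E8 r j))"
proof -
  have rr: "rotate_section (rotate_section s) = s" for s
    by (simp add: rotate_section_def case_prod_beta)
  have "(j + 10 * m) div 10 = j div 10 + m" by simp
  then show ?thesis by (simp add: index_section_def flipped_def phase_def rr)
qed

text \<open>Ten cubes are half of the period 20, so an odd multiple of ten brings in the rotation
  besides the translation.\<close>

lemma index_block_shift:
  "index_block E8 r (shift (10 * m) x) = translate_block (10 * m)
     (if even m then index_block E8 r x else rotate_block (width E8) (index_block E8 r x))"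
  using cells_of_rotate[OF section_width_index_section[of E8 r "fst x"], of "snd x"]
  by (auto simp: index_block_def shift_def index_section_shift translate_block_def rotate_block_def)

lemma idx_E8_conv: "(j, l) \<in> idx E8 \<longleftrightarrow> l \<in> set (section_labels (labelled_cubes E8 ! phase E8 j))"
  by (simp add: idx_def cube_labels_info)

lemma wall_pattern_E8: "wall_pattern E8 r = column_pattern E8"
  by (rule ext) simp

text \<open>The 0-blocks of the pattern pin down the translation and the rotation.\<close>
lemma zero_block_E8:
  assumes "Block k 0 S \<in> blocks (column_pattern E8)"
  shows "(k - 1) mod 10 = 0"
    and "S = {(Lower, 1)} \<and> even ((k - 1) div 10) \<or> S = {(Upper, 6)} \<and> odd ((k - 1) div 10)"
proof -
  have "Block k 0 S \<in> index_block E8 0 ` idx E8"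
    using assms blocks_wall_pattern[of E8 0] by (simp add: wall_pattern_E8)
  then obtain j l where x: "(j, l) \<in> idx E8" "Block k 0 S = index_block E8 0 (j, l)"
    by auto
  have l: "l = 0" and j: "j = k - 1"
    using x(2) by (auto simp: index_block_def label_colour_def split: if_splits)
  have "\<forall>s<10. 0 \<in> set (section_labels (labelled_cubes E8 ! s)) \<longrightarrow> s = 0"
    by (simp add: All_less_Suc section_labels_def numeral_eq_Suc)
  with x(1) l have ph: "phase E8 j = 0"
    using phase_less[of E8 j] by (auto simp: idx_E8_conv)
  then show "(k - 1) mod 10 = 0" using j by (simp add: phase_def)
  have S: "S = cells_of (index_section E8 0 j) 0" using x(2) l by (simp add: index_block_def)
  have c: "cells_of (labelled_cubes E8 ! 0) 0 = {(Lower, 1)}"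
  proof (rule set_eqI)
    fix x :: cell
    obtain a c where x: "x = (a, c)" by (cases x)
    have "1 \<le> c \<and> c \<le> 6 \<Longrightarrow> c = 1 \<or> c = 2 \<or> c = 3 \<or> c = 4 \<or> c = 5 \<or> c = 6" by linarith
    then show "x \<in> cells_of (labelled_cubes E8 ! 0) 0 \<longleftrightarrow> x \<in> {(Lower, 1)}"
      by (cases a) (auto simp: x cells_of_simps)
  qed
  have w: "section_width 6 (labelled_cubes E8 ! 0)" by (simp add: section_width_def)
  have "cells_of (index_section E8 0 j) 0 = (if even (j div 10) then {(Lower, 1)} else {(Upper, 6)})"
    using c cells_of_rotate[OF w, of 0] by (simp add: index_section_def flipped_def ph)
  then show "S = {(Lower, 1)} \<and> even ((k - 1) div 10) \<or> S = {(Upper, 6)} \<and> odd ((k - 1) div 10)"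
    using S j by auto
qed

lemma index_block_E8: "index_block E8 r = index_block E8 0"
  by (rule ext) (simp add: index_block_def index_section_def flipped_def)

text \<open>A move that takes the 0-block at the origin off the pattern cannot lead to a set of
  blocks of the pattern. The remaining moves go by half periods, with the rotation exactly for the
  odd ones.\<close>

lemma special_column_index_block:
  assumes "X \<subseteq> idx E8" and S: "S = index_block E8 r ` Z" and Z: "Z \<subseteq> idx E8" and "(0, 0) \<in> Z"
  shows "column_equiv E8 S (index_block E8 r ` X) \<longleftrightarrow> (\<exists>m. X = shift (10 * m) ` Z)"
proof
  have sub: "shift (10 * m) ` Z \<subseteq> idx E8" for m using Z by (auto simp: shift_idx)
  have im: "index_block E8 r ` shift (10 * m) ` Z = translate_block (10 * m) `
      (if even m then S else rotate_block (width E8) ` S)" for m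
    unfolding S by (simp add: image_image index_block_shift)
  have eq: "X = shift (10 * m) ` Z" if "index_block E8 r ` X = index_block E8 r ` shift (10 * m) ` Z" for m
    using that inj_on_image_eq_iff[OF inj_on_index_block assms(1) sub] by blast
  {
    assume "\<exists>m. X = shift (10 * m) ` Z"
    then obtain m where "X = shift (10 * m) ` Z" ..
    then show "column_equiv E8 S (index_block E8 r ` X)"
      unfolding column_equiv_def using im[of m] by (cases "even m") auto
  }
  assume "column_equiv E8 S (index_block E8 r ` X)"
  then obtain n \<rho> where n: "index_block E8 r ` X = translate_block n ` (if \<rho> then rotate_block (width E8) ` S else S)"
    unfolding column_equiv_def by (metis (full_types))
  have "labelled_cubes E8 ! phase E8 0 = ([7,7,5,5,2,2], [0,7,5,5,5,2])" by (simp add: phase_def)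
  then have "index_block E8 r (0, 0) = Block 1 0 (cells_of ([7,7,5,5,2,2], [0,7,5,5,5,2]) 0)"
    by (simp add: index_block_def index_section_def flipped_def label_colour_def)
  moreover have "index_block E8 r (0, 0) \<in> blocks (column_pattern E8)"
    using assms(4) Z blocks_wall_pattern[of E8 r] by (auto simp: wall_pattern_E8)
  ultimately obtain T where T: "index_block E8 r (0, 0) = Block 1 0 T" "T = {(Lower, 1)}"
    using zero_block_E8(2)[of 1] by auto
  have "translate_block n (if \<rho> then rotate_block 6 (Block 1 0 T) else Block 1 0 T) \<in> index_block E8 r ` X"
    unfolding n using assms(4) T(1) S by (auto intro!: imageI simp flip: T(1))
  then have "translate_block n (if \<rho> then rotate_block 6 (Block 1 0 T) else Block 1 0 T) \<in> blocks (column_pattern E8)"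
    using assms(1) blocks_wall_pattern[of E8 r] by (auto simp: wall_pattern_E8)
  then have "Block (1 + n) 0 (if \<rho> then {(Upper, 6)} else {(Lower, 1)}) \<in> blocks (column_pattern E8)"
    by (cases \<rho>) (simp_all add: translate_block_def rotate_block_def T(2))
  from zero_block_E8[OF this] have nm: "n mod 10 = 0" "\<rho> \<longleftrightarrow> odd (n div 10)"
    by (auto split: if_splits)
  define m where "m = n div 10"
  have nn: "n = 10 * m" using mult_div_mod_eq[of 10 n] nm(1) by (simp add: m_def)
  have rm: "\<rho> \<longleftrightarrow> odd m" using nm(2) by (simp add: m_def)
  have "index_block E8 r ` X = index_block E8 r ` shift (10 * m) ` Z"
    unfolding im n nn rm by (cases "even m") simp_all
  with eq show "\<exists>m. X = shift (10 * m) ` Z" by blast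
qed


lemma cells_of_444999: "cells_of ([4,4,4,9,9,9], [4,4,4,9,9,9]) l = UNIV \<times> {4..6} \<longleftrightarrow> l = 9"
proof
  assume "cells_of ([4,4,4,9,9,9], [4,4,4,9,9,9]) l = UNIV \<times> {4..6}"
  then have "(Upper, 4) \<in> cells_of ([4,4,4,9,9,9], [4,4,4,9,9,9]) l" by simp
  then show "l = 9" by (simp add: cells_of_simps)
next
  assume l: "l = 9"
  have "(a, c) \<in> cells_of ([4,4,4,9,9,9], [4,4,4,9,9,9]) 9 \<longleftrightarrow> (a, c) \<in> UNIV \<times> {4..6}" for a c
  proof -
    have "a = Upper \<or> a = Lower" by (cases a) auto
    moreover have "c = 1 \<or> c = 2 \<or> c = 3 \<or> c = 4 \<or> c = 5 \<or> c = 6 \<or> \<not> (1 \<le> c \<and> c \<le> 6)"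
      by linarith
    ultimately show ?thesis by (elim disjE; simp add: cells_of_simps; linarith)
  qed
  then show "cells_of ([4,4,4,9,9,9], [4,4,4,9,9,9]) l = UNIV \<times> {4..6}" unfolding l by auto
qed

lemma base_phase_5: "base (index_block E8 0 (5, l)) = UNIV \<times> {4..6} \<longleftrightarrow> l = 9"
proof -
  have "index_section E8 0 5 = ([4,4,4,9,9,9], [4,4,4,9,9,9])"
    by (simp add: index_section_def flipped_def phase_def numeral_eq_Suc)
  then show ?thesis using cells_of_444999 by simp
qed

lemma special_columns_eq:
  "special_column1 = index_block E8 0 ` place shape1 0"
  "special_column2 = index_block E8 0 ` place shape2 0"
proof -
  have *: "{b \<in> blocks (column_pattern E8). P b} = index_block E8 0 ` {x \<in> idx E8. P (index_block E8 0 x)}" for P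
    using blocks_wall_pattern[of E8 0] by (auto simp: wall_pattern_E8)
  have c: "label_colour l = 5 \<longleftrightarrow> l = 5" "label_colour l = 3 \<longleftrightarrow> l = 3" "label_colour l = 2 \<longleftrightarrow> l = 2" for l
    by (auto simp: label_colour_def)
  have b: "j = 5 \<and> base (index_block E8 0 (j, l)) = UNIV \<times> {4..6} \<longleftrightarrow> j = 5 \<and> l = 9" for j l
    using base_phase_5 by auto
  have "(height (index_block E8 0 (j, l)) \<le> 4 \<or> height (index_block E8 0 (j, l)) = 5 \<and> colour (index_block E8 0 (j, l)) \<in> {5, 3} \<or>
     height (index_block E8 0 (j, l)) = 6 \<and> base (index_block E8 0 (j, l)) = UNIV \<times> {4..6}) \<longleftrightarrow> shape1 (j - (10 * 0 + 4)) l" for j l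
    using b[of j l] unfolding height_index_block colour_index_block shape1_def by (simp add: c del: base_index_block) linarith
  then show "special_column1 = index_block E8 0 ` place shape1 0"
    unfolding special_column1_def * place_def by (simp add: case_prod_beta)
  have "(height (index_block E8 0 (j, l)) \<le> 5 \<or> height (index_block E8 0 (j, l)) = 6 \<and> base (index_block E8 0 (j, l)) = UNIV \<times> {4..6} \<or>
     height (index_block E8 0 (j, l)) = 7 \<and> colour (index_block E8 0 (j, l)) = 2) \<longleftrightarrow> shape2 (j - (10 * 0 + 4)) l" for j l
    using b[of j l] unfolding height_index_block colour_index_block shape2_def by (simp add: c del: base_index_block) linarith
  then show "special_column2 = index_block E8 0 ` place shape2 0"
    unfolding special_column2_def * place_def by (simp add: case_prod_beta)
qed

text \<open>Which sets are Young columns thereby no longer depends on the column of the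
  wall.\<close>

lemma young_column_index_block:
  assumes "X \<subseteq> idx t"
  shows "young_column t (wall_pattern t r) (index_block t r ` X) \<longleftrightarrow> index_young t X"
proof -
  have "index_block t r ` X \<subseteq> blocks (wall_pattern t r)"
    using assms by (auto simp: blocks_wall_pattern)
  moreover have "column_equiv E8 special_column1 (index_block E8 r ` X) \<longleftrightarrow> (\<exists>m. X = place shape1 m)"
    "column_equiv E8 special_column2 (index_block E8 r ` X) \<longleftrightarrow> (\<exists>m. X = place shape2 m)" if "t = E8"
  proof -
    have z: "(0, 0) \<in> place shape1 0" "(0, 0) \<in> place shape2 0"
      by (simp_all add: place_def shape1_def shape2_def idx_E8_conv phase_def section_labels_def)
    have sub: "place P 0 \<subseteq> idx E8" for P by (auto simp: place_def)
    show "column_equiv E8 special_column1 (index_block E8 r ` X) \<longleftrightarrow> (\<exists>m. X = place shape1 m)"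
      "column_equiv E8 special_column2 (index_block E8 r ` X) \<longleftrightarrow> (\<exists>m. X = place shape2 m)"
      using special_column_index_block[OF _ special_columns_eq(1)[unfolded index_block_E8[of r, symmetric]] sub z(1), of X]
        special_column_index_block[OF _ special_columns_eq(2)[unfolded index_block_E8[of r, symmetric]] sub z(2), of X]
        assms that by (simp_all add: shift_place)
  qed
  ultimately show ?thesis
    unfolding young_column_def index_young_def proper_column_index_block[OF assms] by blast
qed

section \<open>Columns seen through a finite window\<close>

definition rep :: "affine_type \<Rightarrow> int \<Rightarrow> nat list list \<Rightarrow> (int \<times> nat) set" where
  "rep t j0 rows = {x \<in> idx t. fst x < j0 \<or>
     j0 \<le> fst x \<and> fst x < j0 + int (length rows) \<and> snd x \<in> set (rows ! nat (fst x - j0))}"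

definition at :: "int \<Rightarrow> nat \<times> nat \<Rightarrow> int \<times> nat" where
  "at j0 x = (j0 + int (fst x), snd x)"

lemma rep_subset: "rep t j0 rows \<subseteq> idx t"
  by (auto simp: rep_def)

lemma info_entry:
  "(l, ps) \<in> set (snd (info t j)) \<longleftrightarrow> l \<in> set (cube_labels (info t j)) \<and> ps = labels_below (info t j) l"
proof -
  have "map_of (map (\<lambda>l. (l, f l)) xs) l = (if l \<in> set xs then Some (f l) else None)" for f :: "nat \<Rightarrow> nat list" and xs
    by (induction xs) auto
  then show ?thesis
    by (auto simp: info_def phase_info_def labels_below_def cube_labels_def comp_def)
qed

lemma length_window [simp]: "length (window t s) = window_size"
  by (simp add: window_def Let_def)

lemma nth_window:
  assumes "k < window_size"
  shows "window t (phase t j0) ! k = info t (j0 + int k)"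
proof -
  have "int ((phase t j0 + k) mod period t) = (j0 + int k) mod int (period t)"
    using period_pos[of t] by (simp add: phase_def zmod_int mod_add_left_eq)
  then have "(phase t j0 + k) mod period t = phase t (j0 + int k)"
    by (simp add: phase_def) 
  then show ?thesis
    using assms period_pos[of t] by (simp add: window_def Let_def info_def)
qed

lemma fst_info: "fst (info t j) = phase t j"
  by (simp add: info_def phase_info_def)

lemma zip3_eq:
  assumes "length ds = n" "length rows = n"
  shows "zip (tl ds) (zip rows (tl rows)) = map (\<lambda>k. (ds ! Suc k, rows ! k, rows ! Suc k)) [0..<n - 1]"
  using assms by (intro nth_equalityI) (auto simp: nth_tl)

lemma enumerate_map_upt: "enumerate m (map g [0..<n]) = map (\<lambda>k. (m + k, g k)) [0..<n]"
  by (intro nth_equalityI) (auto simp: nth_enumerate_eq)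

lemma cube_labels_nonempty: "cube_labels (info t j) \<noteq> []"
proof -
  have "section_width (width t) (labelled_cubes t ! phase t j)"
    by (rule labelled_cubes_facts(1)[OF phase_less])
  moreover have "width t > 0" by (cases t) simp_all
  ultimately have "set (section_labels (labelled_cubes t ! phase t j)) \<noteq> {}"
    by (auto simp: section_width_def section_labels_def)
  then show ?thesis by (auto simp: cube_labels_info)
qed

locale window_frame =
  fixes t :: affine_type and j0 :: int
begin

definition ds :: "cube_info list" where
  "ds = window t (phase t j0)"

definition wf :: "nat list list \<Rightarrow> bool" where
  "wf rows \<longleftrightarrow> length rows = window_size \<and> (\<forall>k<window_size. set (rows ! k) \<subseteq> set (cube_labels (info t (j0 + int k))))"

definition full :: "nat list list \<Rightarrow> nat \<Rightarrow> bool" where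
  "full rows k \<longleftrightarrow> set (cube_labels (info t (j0 + int k))) \<subseteq> set (rows ! k)"

lemma ds_nth: "k < window_size \<Longrightarrow> ds ! k = info t (j0 + int k)"
  by (simp add: ds_def nth_window)

lemma length_ds [simp]: "length ds = window_size"
  by (simp add: ds_def)

abbreviation X :: "nat list list \<Rightarrow> (int \<times> nat) set" where
  "X rows \<equiv> rep t j0 rows"

lemma at_in_X:
  assumes "wf rows" "k < window_size"
  shows "at j0 (k, l) \<in> X rows \<longleftrightarrow> l \<in> set (rows ! k)"
  using assms by (auto simp: wf_def rep_def at_def idx_def)

lemma at_in_X': 
  assumes "wf rows" "k < window_size"
  shows "(j0 + int k, l) \<in> X rows \<longleftrightarrow> l \<in> set (rows ! k)"
  using at_in_X[OF assms] by (simp add: at_def)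

lemma X_cases:
  assumes "x \<in> X rows" "wf rows"
  obtains "fst x < j0" "x \<in> idx t" | k l where "x = at j0 (k, l)" "k < window_size" "l \<in> set (rows ! k)"
proof (cases "fst x < j0")
  case True
  with assms that show ?thesis by (auto simp: rep_def)
next
  case False
  then have "x = at j0 (nat (fst x - j0), snd x)" "nat (fst x - j0) < window_size" "snd x \<in> set (rows ! nat (fst x - j0))"
    using assms by (auto simp: rep_def at_def wf_def nat_less_iff)
  with that(2) show ?thesis by blast
qed

lemma below_in_X: "fst x < j0 \<Longrightarrow> x \<in> idx t \<Longrightarrow> x \<in> X rows"
  by (simp add: rep_def)

lemma row_closed_iff:
  "row_closed (info t j) p r \<longleftrightarrow>
    (\<forall>l\<in>set (cube_labels (info t j)). l \<in> set r \<longrightarrow> set (labels_below (info t j) l) \<subseteq> set p)"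
  by (auto simp: row_closed_def list_all_iff info_entry split: if_splits; blast)

lemma closed_rows_iff:
  assumes "wf rows"
  shows "closed_rows ds rows \<longleftrightarrow> (\<forall>n. Suc n < window_size \<longrightarrow> (\<forall>l\<in>set (rows ! Suc n).
     set (labels_below (info t (j0 + int (Suc n))) l) \<subseteq> set (rows ! n)))"
proof -
  have l: "length rows = window_size" using assms by (simp add: wf_def)
  have "closed_rows ds rows \<longleftrightarrow> (\<forall>n. Suc n < window_size \<longrightarrow> row_closed (ds ! Suc n) (rows ! n) (rows ! Suc n))"
    unfolding closed_rows_def zip3_eq[OF length_ds l] by (auto simp: list_all_iff)
  also have "\<dots> \<longleftrightarrow> (\<forall>n. Suc n < window_size \<longrightarrow> (\<forall>l\<in>set (rows ! Suc n).
     set (labels_below (info t (j0 + int (Suc n))) l) \<subseteq> set (rows ! n)))"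
  proof -
    have "row_closed (ds ! Suc n) (rows ! n) (rows ! Suc n) \<longleftrightarrow> (\<forall>l\<in>set (rows ! Suc n).
        set (labels_below (info t (j0 + int (Suc n))) l) \<subseteq> set (rows ! n))" if "Suc n < window_size" for n
      using assms that unfolding ds_nth[OF that] row_closed_iff wf_def by blast
    then show ?thesis by simp
  qed
  finally show ?thesis .
qed

text \<open>Everything below the window is present, so the blocks of row 0 need no test.\<close>

lemma index_ideal_X:
  assumes "wf rows"
  shows "index_ideal t (X rows) \<longleftrightarrow> closed_rows ds rows"
proof -
  have ne: "X rows \<noteq> {}"
  proof -
    obtain l where "l \<in> set (cube_labels (info t (j0 - 1)))"
      using cube_labels_nonempty[of t "j0 - 1"] by (cases "cube_labels (info t (j0 - 1))") auto
    then have "(j0 - 1, l) \<in> X rows" by (intro below_in_X) (auto simp: idx_def)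
    then show ?thesis by blast
  qed
  have "\<forall>x\<in>X rows. fst x \<le> j0 + int (length rows)" by (auto simp: rep_def)
  then have bd: "\<exists>K. \<forall>x\<in>X rows. fst x \<le> K" by blast
  have "(\<forall>x\<in>X rows. \<forall>l\<in>set (labels_below (info t (fst x)) (snd x)). (fst x - 1, l) \<in> X rows) \<longleftrightarrow>
    (\<forall>n. Suc n < window_size \<longrightarrow> (\<forall>l\<in>set (rows ! Suc n).
     set (labels_below (info t (j0 + int (Suc n))) l) \<subseteq> set (rows ! n)))" (is "?L \<longleftrightarrow> ?R")
  proof
    assume L: ?L
    show ?R
    proof (intro allI impI ballI subsetI)
      fix n l l' assume n: "Suc n < window_size" and l: "l \<in> set (rows ! Suc n)"
        and l': "l' \<in> set (labels_below (info t (j0 + int (Suc n))) l)"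
      have "(j0 + int (Suc n), l) \<in> X rows" using at_in_X'[OF assms n] l by simp
      with L l' have "(j0 + int (Suc n) - 1, l') \<in> X rows" by fastforce
      then have "(j0 + int n, l') \<in> X rows" by simp
      then show "l' \<in> set (rows ! n)" using at_in_X'[OF assms, of n] n by simp
    qed
  next
    assume R: ?R
    show ?L
    proof (intro ballI)
      fix x l' assume x: "x \<in> X rows" and l': "l' \<in> set (labels_below (info t (fst x)) (snd x))"
      have i: "(fst x - 1, l') \<in> idx t"
        using labels_below_in_idx[of "fst x" "snd x" t l'] subsetD[OF rep_subset x] l' by simp
      from x assms show "(fst x - 1, l') \<in> X rows"
      proof (cases rule: X_cases)
        case 1
        then show ?thesis using i by (intro below_in_X) auto
      next
        case (2 k l)
        show ?thesis
        proof (cases k)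
          case 0
          then show ?thesis using i 2 by (intro below_in_X) (auto simp: at_def)
        next
          case (Suc n)
          then have "l' \<in> set (rows ! n)" using R 2 l' by (auto simp: at_def)
          then have "(j0 + int n, l') \<in> X rows" using at_in_X'[OF assms, of n] Suc 2 by simp
          then show ?thesis using Suc 2 by (simp add: at_def)
        qed
      qed
    qed
  qed
  then show ?thesis
    unfolding index_ideal_def closed_rows_iff[OF assms] using ne bd rep_subset by blast
qed

lemma rows_match_iff:
  assumes "wf rows"
  shows "rows_match P ds rows \<longleftrightarrow>
    (\<forall>k<window_size. \<forall>l\<in>set (cube_labels (info t (j0 + int k))). l \<in> set (rows ! k) \<longleftrightarrow> P k l)"
proof -
  have l: "length rows = window_size" using assms by (simp add: wf_def)
  have z: "zip ds rows = map (\<lambda>k. (ds ! k, rows ! k)) [0..<window_size]"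
    by (intro nth_equalityI) (auto simp: l)
  have "rows_match P ds rows \<longleftrightarrow> (\<forall>k<window_size. \<forall>l\<in>set (cube_labels (ds ! k)). l \<in> set (rows ! k) \<longleftrightarrow> P k l)"
    unfolding rows_match_def z enumerate_map_upt by (auto simp: list_all_iff)
  then show ?thesis by (simp add: ds_nth)
qed

text \<open>The assumptions on \<open>P\<close> make the two sets agree outside the window.\<close>

lemma X_eq_place_iff:
  assumes wf: "wf rows" and t: "t = E8" and k: "k < window_size" "j0 + int k = 10 * m + 4"
    and P: "\<And>i l. i < 0 \<Longrightarrow> P i l" "\<And>i l. j0 + int window_size \<le> 10 * m + 4 + i \<Longrightarrow> \<not> P i l"
  shows "X rows = place P m \<longleftrightarrow> rows_match (\<lambda>i l. P (int i - int k) l) ds rows"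
proof -
  have "X rows = place P m \<longleftrightarrow> (\<forall>x\<in>idx t. x \<in> X rows \<longleftrightarrow> P (fst x - (10 * m + 4)) (snd x))"
    using rep_subset[of t j0 rows] t by (auto simp: place_def)
  also have "\<dots> \<longleftrightarrow> (\<forall>i<window_size. \<forall>l\<in>set (cube_labels (info t (j0 + int i))). l \<in> set (rows ! i) \<longleftrightarrow> P (int i - int k) l)"
      (is "?L \<longleftrightarrow> ?R")
  proof
    assume L: ?L
    show ?R
    proof (intro allI impI ballI)
      fix i l assume i: "i < window_size" "l \<in> set (cube_labels (info t (j0 + int i)))"
      then have "(j0 + int i, l) \<in> idx t" by (simp add: idx_def)
      with L at_in_X'[OF wf i(1), of l] have "l \<in> set (rows ! i) \<longleftrightarrow> P (j0 + int i - (10 * m + 4)) l" by fastforce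
      moreover have "j0 + int i - (10 * m + 4) = int i - int k" using k(2) by linarith
      ultimately show "l \<in> set (rows ! i) \<longleftrightarrow> P (int i - int k) l" by simp
    qed
  next
    assume R: ?R
    show ?L
    proof
    fix x assume x_idx: "x \<in> idx t"
    note * = R x_idx
    consider "fst x < j0" | "j0 + int window_size \<le> fst x" | "j0 \<le> fst x" "fst x < j0 + int window_size" by linarith
    then show "x \<in> X rows \<longleftrightarrow> P (fst x - (10 * m + 4)) (snd x)"
    proof cases
      case 1
      then show ?thesis using below_in_X[of x rows] *(2) P(1)[of "fst x - (10 * m + 4)"] k(2) by simp
    next
      case 2
      then have "x \<notin> X rows" using wf by (auto simp: rep_def wf_def)
      then show ?thesis using P(2)[of "fst x - (10 * m + 4)"] 2 by simp
    next
      case 3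
      define i where "i = nat (fst x - j0)"
      have i: "i < window_size" "fst x = j0 + int i" using 3 by (auto simp: i_def)
      have x: "x = (j0 + int i, snd x)" using i by (simp add: prod_eq_iff)
      have "snd x \<in> set (cube_labels (info t (j0 + int i)))" using *(2) i(2) by (auto simp: idx_def)
      with *(1) i(1) have "snd x \<in> set (rows ! i) \<longleftrightarrow> P (int i - int k) (snd x)" by blast
      moreover have "x \<in> X rows \<longleftrightarrow> snd x \<in> set (rows ! i)" using at_in_X'[OF wf i(1), of "snd x"] x by simp
      moreover have "int i - int k = fst x - (10 * m + 4)" using i(2) k(2) by simp
      ultimately show ?thesis by simp
    qed
    qed
  qed
  also have "\<dots> \<longleftrightarrow> rows_match (\<lambda>i l. P (int i - int k) l) ds rows"
    by (rule rows_match_iff[OF wf, symmetric])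
  finally show ?thesis .
qed

end

lemma place_props:
  "x \<in> place shape1 m \<longleftrightarrow> x \<in> idx E8 \<and> shape1 (fst x - (10 * m + 4)) (snd x)"
  "x \<in> place shape2 m \<longleftrightarrow> x \<in> idx E8 \<and> shape2 (fst x - (10 * m + 4)) (snd x)"
  by (simp_all add: place_def)

lemma phase_E8: "phase E8 (10 * m + int n) = n mod 10"
  using zmod_int[of n 10] by (simp add: phase_def)

lemma phase_E8_iff: "phase E8 j = 4 \<longleftrightarrow> (\<exists>m. j = 10 * m + 4)"
proof
  assume "phase E8 j = 4"
  then have "j mod 10 = 4" by (simp add: phase_def)
  then have "j = 10 * (j div 10) + 4" using mult_div_mod_eq[of 10 j] by simp
  then show "\<exists>m. j = 10 * m + 4" ..
qed (use phase_E8[of _ 4] in auto)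

lemma labels_E8:
  "set (cube_labels (info E8 (10 * m + 4))) = {5, 2, 3}"
  "set (cube_labels (info E8 (10 * m + 5))) = {4, 9}"
  "set (cube_labels (info E8 (10 * m + 6))) = {3, 2, 5}"
  using phase_E8[of m 4] phase_E8[of m 5] phase_E8[of m 6]
  by (auto simp: cube_labels_info section_labels_def)

lemma labels_below_E8:
  "2 \<in> set (labels_below (info E8 (10 * m + 5)) 9)"
  "4 \<in> set (labels_below (info E8 (10 * m + 6)) 2)"
proof -
  have "labelled_cubes E8 ! 5 = ([4,4,4,9,9,9], [4,4,4,9,9,9])" "labelled_cubes E8 ! 6 = ([3,3,2,5,5,5], [3,3,2,2,5,5])"
    "preceding_cube E8 5 = ([5,5,2,2,3,3], [5,5,5,2,3,3])" "preceding_cube E8 6 = ([4,4,4,9,9,9], [4,4,4,9,9,9])"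
    by (simp_all add: preceding_cube_def)
  then show "2 \<in> set (labels_below (info E8 (10 * m + 5)) 9)" "4 \<in> set (labels_below (info E8 (10 * m + 6)) 2)"
    using phase_E8[of m 5] phase_E8[of m 6] set_labels_below[of 9 E8 "10 * m + 5"] set_labels_below[of 2 E8 "10 * m + 6"]
    by (auto simp: labels_E8 touching_def)
qed

context window_frame
begin

text \<open>\<open>special_rows\<close> searches only inside the window. An exceptional column has a
  missing block under a present one: the full row 0 bounds the former from below, the empty top row
  the latter from above.\<close>

lemma special_rows_iff:
  assumes wf: "wf rows" and t: "t = E8" and top: "rows ! (window_size - 1) = []"
    and full: "full rows 0"
  shows "special_rows ds rows \<longleftrightarrow> (\<exists>m. X rows = place shape1 m \<or> X rows = place shape2 m)"
proof -
  have s1: "(\<lambda>i l. shape1 (int i - int k) l) = (\<lambda>i l. i < k \<or> i = k \<and> (l = 5 \<or> l = 3) \<or> i = Suc k \<and> l = 9)" for k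
    by (intro ext) (auto simp: shape1_def)
  have s2: "(\<lambda>i l. shape2 (int i - int k) l) = (\<lambda>i l. i < Suc k \<or> i = Suc k \<and> l = 9 \<or> i = Suc (Suc k) \<and> l = 2)" for k
    by (intro ext) (auto simp: shape2_def)
  have eqs: "X rows = place shape1 m \<longleftrightarrow> rows_match (\<lambda>i l. i < k \<or> i = k \<and> (l = 5 \<or> l = 3) \<or> i = Suc k \<and> l = 9) ds rows"
     "X rows = place shape2 m \<longleftrightarrow> rows_match (\<lambda>i l. i < Suc k \<or> i = Suc k \<and> l = 9 \<or> i = Suc (Suc k) \<and> l = 2) ds rows"
    if "k < window_size - 2" "j0 + int k = 10 * m + 4" for k m
  proof -
    have "k < window_size" and le: "int k + 2 < int window_size" using that(1) by (auto simp: window_size_def)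
    have f: "\<not> shape1 i l" "\<not> shape2 i l" if "j0 + int window_size \<le> 10 * m + 4 + i" for i l
      using that \<open>j0 + int k = 10 * m + 4\<close> le by (auto simp: shape1_def shape2_def)
    show "X rows = place shape1 m \<longleftrightarrow> rows_match (\<lambda>i l. i < k \<or> i = k \<and> (l = 5 \<or> l = 3) \<or> i = Suc k \<and> l = 9) ds rows"
      using X_eq_place_iff[OF wf t \<open>k < window_size\<close> that(2), of shape1] f unfolding s1 by (auto simp: shape1_def)
    show "X rows = place shape2 m \<longleftrightarrow> rows_match (\<lambda>i l. i < Suc k \<or> i = Suc k \<and> l = 9 \<or> i = Suc (Suc k) \<and> l = 2) ds rows"
      using X_eq_place_iff[OF wf t \<open>k < window_size\<close> that(2), of shape2] f unfolding s2 by (auto simp: shape2_def)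
  qed
  have "\<exists>k<window_size - 2. j0 + int k = 10 * m + 4"
    if e: "X rows = place shape1 m \<or> X rows = place shape2 m" for m
  proof -
    \<comment> \<open>The height of the hole above the cube of phase 4: block 2 of that cube is
      missing under block 9 in the first shape, block 4 of the next cube under block 2 in the
      second.\<close>
    define b :: int where "b = (if X rows = place shape1 m then 0 else 1)"
    have b: "(10 * m + 4 + b, if b = 0 then 2 else 4) \<in> idx E8" "(10 * m + 5 + b, if b = 0 then 9 else 2) \<in> idx E8"
      using labels_E8[of m] by (auto simp: idx_def b_def add.assoc)
    have "(10 * m + 4 + b, if b = 0 then 2 else 4) \<notin> X rows" "(10 * m + 5 + b, if b = 0 then 9 else 2) \<in> X rows"
      using e b by (auto simp: place_props shape1_def shape2_def b_def split: if_splits)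
    then have "j0 < 10 * m + 4 + b" "10 * m + 5 + b < j0 + int window_size - 1"
    proof -
      let ?x = "(10 * m + 4 + b, if b = 0 then 2 else 4) :: int \<times> nat"
      assume x: "?x \<notin> X rows" and y: "(10 * m + 5 + b, if b = 0 then 9 else 2) \<in> X rows"
      have "\<not> fst ?x < j0" using below_in_X[of ?x rows] b(1) t x by blast
      moreover have "fst ?x \<noteq> j0"
      proof
        assume "fst ?x = j0"
        then have "?x = (j0 + int 0, snd ?x)" "snd ?x \<in> set (rows ! 0)"
          using full[unfolded full_def] b(1) t by (auto simp: idx_def)
        with x at_in_X'[OF wf, of 0 "snd ?x"] show False by (auto simp: window_size_def)
      qed
      ultimately show "j0 < 10 * m + 4 + b" by simp
      show "10 * m + 5 + b < j0 + int window_size - 1"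
        using y wf
      proof (cases rule: X_cases)
        case (2 k l)
        then have "k \<noteq> window_size - 1" using top by auto
        then show ?thesis using 2 by (auto simp: at_def)
      qed (use \<open>j0 < 10 * m + 4 + b\<close> in \<open>simp add: window_size_def\<close>)
    qed
    then show ?thesis
      by (intro exI[of _ "nat (10 * m + 4 - j0)"]) (auto simp: b_def window_size_def split: if_splits)
  qed
  then have "(\<exists>m. X rows = place shape1 m \<or> X rows = place shape2 m) \<longleftrightarrow>
      (\<exists>k m. k < window_size - 2 \<and> j0 + int k = 10 * m + 4 \<and> (X rows = place shape1 m \<or> X rows = place shape2 m))"
    by blast
  also have "\<dots> \<longleftrightarrow> (\<exists>k<window_size - 2. fst (ds ! k) = 4 \<and>
      (rows_match (\<lambda>i l. i < k \<or> i = k \<and> (l = 5 \<or> l = 3) \<or> i = Suc k \<and> l = 9) ds rows \<or>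
       rows_match (\<lambda>i l. i < Suc k \<or> i = Suc k \<and> l = 9 \<or> i = Suc (Suc k) \<and> l = 2) ds rows))"
  proof -
    have "fst (ds ! k) = 4 \<longleftrightarrow> (\<exists>m. j0 + int k = 10 * m + 4)" if "k < window_size - 2" for k
    proof -
      have "fst (ds ! k) = phase t (j0 + int k)" using that by (simp add: ds_nth fst_info)
      then show ?thesis using phase_E8_iff[of "j0 + int k"] t by simp
    qed
    then show ?thesis using eqs by meson
  qed
  also have "\<dots> \<longleftrightarrow> special_rows ds rows"
    unfolding special_rows_def list_ex_iff by auto
  finally show ?thesis by blast
qed

lemma index_young_X:
  assumes "wf rows" "rows ! (window_size - 1) = []" "full rows 0"
  shows "index_young t (X rows) \<longleftrightarrow> young_rows t ds rows"
proof (cases "t = E8")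
  case True
  then show ?thesis
    using special_rows_iff[OF assms(1) True assms(2,3)] index_ideal_X[OF assms(1)]
    by (simp add: index_young_def young_rows_def)
next
  case False
  then show ?thesis
    using index_ideal_X[OF assms(1)] by (simp add: index_young_def young_rows_def)
qed

lemma wf_insert:
  assumes "wf rows" "k < window_size" "at j0 (k, l) \<in> idx t"
  shows "wf (insert_label rows (k, l))" "X (insert_label rows (k, l)) = insert (at j0 (k, l)) (X rows)"
    "set (insert_label rows (k, l) ! i) = (if i = k then insert l (set (rows ! i)) else set (rows ! i))"
proof -
  have len: "length rows = window_size" using assms(1) by (simp add: wf_def)
  show s: "set (insert_label rows (k, l) ! i) = (if i = k then insert l (set (rows ! i)) else set (rows ! i))" for i
    using assms(2) len by (simp add: insert_label_def)
  have lab: "l \<in> set (cube_labels (info t (j0 + int k)))" using assms(3) by (simp add: idx_def at_def)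
  show w: "wf (insert_label rows (k, l))"
    unfolding wf_def s using assms(1) lab by (auto simp: wf_def insert_label_def)
  show "X (insert_label rows (k, l)) = insert (at j0 (k, l)) (X rows)"
  proof (rule set_eqI)
    fix x
    show "x \<in> X (insert_label rows (k, l)) \<longleftrightarrow> x \<in> insert (at j0 (k, l)) (X rows)"
    proof (cases "j0 \<le> fst x \<and> fst x < j0 + int window_size")
      case True
      define i where "i = nat (fst x - j0)"
      have i: "i < window_size" "x = (j0 + int i, snd x)" using True by (auto simp: i_def prod_eq_iff)
      have "x \<in> X (insert_label rows (k, l)) \<longleftrightarrow> snd x \<in> set (insert_label rows (k, l) ! i)"
        using at_in_X'[OF w i(1), of "snd x"] i(2) by simp
      moreover have "x \<in> X rows \<longleftrightarrow> snd x \<in> set (rows ! i)"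
        using at_in_X'[OF assms(1) i(1), of "snd x"] i(2) by simp
      moreover have "x = at j0 (k, l) \<longleftrightarrow> i = k \<and> snd x = l"
        using i(2) by (auto simp: at_def prod_eq_iff)
      ultimately show ?thesis unfolding s by auto
    next
      case False
      have "length (insert_label rows (k, l)) = window_size" using w by (simp add: wf_def)
      then show ?thesis using False len assms(2) by (auto simp: rep_def at_def)
    qed
  qed
qed

lemma wf_delete:
  assumes "wf rows" "k < window_size"
  shows "wf (delete_label rows (k, l))" "X (delete_label rows (k, l)) = X rows - {at j0 (k, l)}"
    "set (delete_label rows (k, l) ! i) = (if i = k then set (rows ! i) - {l} else set (rows ! i))"
proof -
  have len: "length rows = window_size" using assms(1) by (simp add: wf_def)
  show s: "set (delete_label rows (k, l) ! i) = (if i = k then set (rows ! i) - {l} else set (rows ! i))" for i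
    using assms(2) len by (simp add: delete_label_def)
  show w: "wf (delete_label rows (k, l))"
    unfolding wf_def s using assms(1) by (auto simp: wf_def delete_label_def)
  show "X (delete_label rows (k, l)) = X rows - {at j0 (k, l)}"
  proof (rule set_eqI)
    fix x
    show "x \<in> X (delete_label rows (k, l)) \<longleftrightarrow> x \<in> X rows - {at j0 (k, l)}"
    proof (cases "j0 \<le> fst x \<and> fst x < j0 + int window_size")
      case True
      define i where "i = nat (fst x - j0)"
      have i: "i < window_size" "x = (j0 + int i, snd x)" using True by (auto simp: i_def prod_eq_iff)
      have "x \<in> X (delete_label rows (k, l)) \<longleftrightarrow> snd x \<in> set (delete_label rows (k, l) ! i)"
        using at_in_X'[OF w i(1), of "snd x"] i(2) by simp
      moreover have "x \<in> X rows \<longleftrightarrow> snd x \<in> set (rows ! i)"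
        using at_in_X'[OF assms(1) i(1), of "snd x"] i(2) by simp
      moreover have "x = at j0 (k, l) \<longleftrightarrow> i = k \<and> snd x = l"
        using i(2) by (auto simp: at_def prod_eq_iff)
      ultimately show ?thesis unfolding s by auto
    next
      case False
      have "length (delete_label rows (k, l)) = window_size" using w by (simp add: wf_def)
      then show ?thesis using False len assms(2) by (auto simp: rep_def at_def)
    qed
  qed
qed

end

lemma phase_minus: "phase t (j - int k) = (phase t j + (period t - 1) * k) mod period t"
proof -
  have "int ((phase t j + (period t - 1) * k) mod period t) = (j - int k) mod int (period t)"
  proof -
    have "j - int k + int (period t) * int k = j + int (period t - 1) * int k"
      using period_pos[of t] by (simp add: of_nat_diff algebra_simps)
    then have "(j - int k) mod int (period t) = (j + int (period t - 1) * int k) mod int (period t)"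
      by (metis mod_mult_self2)
    then show ?thesis
      using period_pos[of t] by (simp add: phase_def zmod_int mod_add_left_eq)
  qed
  then show ?thesis by (metis nat_int phase_def)
qed

lemma descent_ok: "descent_ok t"
  using descent_ok_E6 descent_ok_E7 descent_ok_E8 by (cases t) auto

lemma
  shows labels_below_nonempty: "(j, l) \<in> idx t \<Longrightarrow> labels_below (info t j) l \<noteq> []"
    and labels_below_cover: "(j - 1, l') \<in> idx t \<Longrightarrow> \<exists>l. (j, l) \<in> idx t \<and> l' \<in> set (labels_below (info t j) l)"
    and descend_info: "(j, l) \<in> idx t \<Longrightarrow> (j - int window_size, l') \<in> idx t \<Longrightarrow>
      l' \<in> set (descend (map (\<lambda>k. info t (j - int k)) [0..<window_size]) [l])"
proof -
  define n where "n = period t"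
  define c where "c = map (phase_info t) [0..<n]"
  have c: "c ! ((phase t j + (n - 1) * k) mod n) = info t (j - int k)" for k
    using phase_minus[of t j k] period_pos[of t] by (simp add: c_def n_def info_def)
  have c0: "c ! phase t j = info t j" using c[of 0] phase_less[of t j] by (simp add: n_def)
  have c1: "c ! ((phase t j + (n - 1)) mod n) = info t (j - 1)" using c[of 1] by simp
  have "phase t j \<in> set [0..<n]" using phase_less by (simp add: n_def)
  with descent_ok[of t] have "list_all (\<lambda>l. labels_below (c ! phase t j) l \<noteq> [] \<and>
         (let ls = descend (map (\<lambda>k. c ! ((phase t j + (n - 1) * k) mod n)) [0..<window_size]) [l] in
          list_all (\<lambda>l'. l' \<in> set ls) (cube_labels (c ! ((phase t j + (n - 1) * window_size) mod n)))))
       (cube_labels (c ! phase t j)) \<and>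
     list_all (\<lambda>l'. list_ex (\<lambda>l. l' \<in> set (labels_below (c ! phase t j) l)) (cube_labels (c ! phase t j)))
       (cube_labels (c ! ((phase t j + (n - 1)) mod n)))"
    unfolding descent_ok_def Let_def n_def[symmetric] c_def[symmetric] list_all_iff[of _ "[0..<n]"] by blast
  then have *: "list_all (\<lambda>l. labels_below (info t j) l \<noteq> [] \<and>
         (let ls = descend (map (\<lambda>k. info t (j - int k)) [0..<window_size]) [l] in
          list_all (\<lambda>l'. l' \<in> set ls) (cube_labels (info t (j - int window_size)))))
       (cube_labels (info t j)) \<and>
     list_all (\<lambda>l'. list_ex (\<lambda>l. l' \<in> set (labels_below (info t j) l)) (cube_labels (info t j)))
       (cube_labels (info t (j - 1)))"
    unfolding c c0 c1 .
  show "(j, l) \<in> idx t \<Longrightarrow> labels_below (info t j) l \<noteq> []"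
    using * by (simp add: idx_def list_all_iff)
  show "(j - 1, l') \<in> idx t \<Longrightarrow> \<exists>l. (j, l) \<in> idx t \<and> l' \<in> set (labels_below (info t j) l)"
    using * by (auto simp add: idx_def list_all_iff list_ex_iff)
  show "(j, l) \<in> idx t \<Longrightarrow> (j - int window_size, l') \<in> idx t \<Longrightarrow>
      l' \<in> set (descend (map (\<lambda>k. info t (j - int k)) [0..<window_size]) [l])"
    using * by (simp add: idx_def list_all_iff Let_def)
qed

section \<open>Adding and removing a single block\<close>

lemma labels_E8_nonempty: "\<exists>l. (j, l) \<in> idx t"
  using cube_labels_nonempty[of t j] by (auto simp: idx_def neq_Nil_conv) 

lemma index_young_subset: "index_young t X \<Longrightarrow> X \<subseteq> idx t"
  by (auto simp: index_young_def index_ideal_def place_def)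

text \<open>Even in an exceptional column every block rests at least partly on another one. This
  bounds the height of an added block and shows that a removal never empties a column.\<close>

lemma index_young_below:
  assumes "index_young t Y" "y \<in> Y"
  shows "\<exists>l. (fst y - 1, l) \<in> Y"
proof -
  have yi: "y \<in> idx t" using assms index_young_subset by blast
  from assms(1) consider "index_ideal t Y" | m where "t = E8" "Y = place shape1 m" | m where "t = E8" "Y = place shape2 m"
    by (auto simp: index_young_def)
  then show ?thesis
  proof cases
    case 1
    have "labels_below (info t (fst y)) (snd y) \<noteq> []" using labels_below_nonempty[of "fst y" "snd y"] yi by simp
    then obtain l where "l \<in> set (labels_below (info t (fst y)) (snd y))" by (meson hd_in_set)
    with 1 assms(2) show ?thesis by (auto simp: index_ideal_def)
  next
    case 2
    have le: "fst y \<le> 10 * m + 5" using assms(2) 2 by (auto simp: place_props shape1_def)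
    show ?thesis
    proof (cases "fst y = 10 * m + 5")
      case True
      have "(10 * m + 4, 5) \<in> idx E8" using labels_E8(1) by (simp add: idx_def)
      then have "(10 * m + 4, 5) \<in> Y" unfolding 2 by (simp add: place_props shape1_def)
      moreover have "fst y - 1 = 10 * m + 4" using True by simp
      ultimately show ?thesis by metis
    next
      case False
      with le show ?thesis using labels_E8_nonempty[of "fst y - 1" E8] 2 by (auto simp: place_props shape1_def)
    qed
  next
    case 3
    have le: "fst y \<le> 10 * m + 6" using assms(2) 3 by (auto simp: place_props shape2_def)
    show ?thesis
    proof (cases "fst y = 10 * m + 6")
      case True
      have "(10 * m + 5, 9) \<in> idx E8" using labels_E8(2) by (simp add: idx_def)
      then have "(10 * m + 5, 9) \<in> Y" unfolding 3 by (simp add: place_props shape2_def)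
      moreover have "fst y - 1 = 10 * m + 5" using True by simp
      ultimately show ?thesis by metis
    next
      case False
      with le show ?thesis using labels_E8_nonempty[of "fst y - 1" E8] 3 by (auto simp: place_props shape2_def)
    qed
  qed
qed

lemma index_ideal_insert:
  assumes "index_ideal t X" "x \<in> idx t"
  shows "index_ideal t (insert x X) \<longleftrightarrow> (\<forall>l\<in>set (labels_below (info t (fst x)) (snd x)). (fst x - 1, l) \<in> X)"
proof -
  have "(fst x - 1, l) \<noteq> x" for l by (metis diff_add_cancel fst_conv less_irrefl zless_add1_eq)
  moreover obtain K where "\<forall>y\<in>X. fst y \<le> K" using assms(1) by (auto simp: index_ideal_def)
  then have "\<forall>y\<in>insert x X. fst y \<le> max K (fst x)" by auto
  then have "\<exists>K. \<forall>y\<in>insert x X. fst y \<le> K" by blast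
  ultimately show ?thesis using assms unfolding index_ideal_def by blast
qed

lemma index_ideal_remove:
  assumes "index_ideal t X" "x \<in> X"
  shows "index_ideal t (X - {x}) \<longleftrightarrow> (\<forall>y\<in>X. fst x = fst y - 1 \<longrightarrow> snd x \<notin> set (labels_below (info t (fst y)) (snd y)))"
proof -
  have ne: "(fst x - 1, l) \<noteq> x" for l by (metis diff_add_cancel fst_conv less_irrefl zless_add1_eq)
  have iy: "index_young t X" using assms(1) by (simp add: index_young_def)
  from index_young_below[OF this assms(2)] ne have "X - {x} \<noteq> {}" by blast
  moreover have "(\<forall>y\<in>X - {x}. \<forall>l\<in>set (labels_below (info t (fst y)) (snd y)). (fst y - 1, l) \<in> X - {x}) \<longleftrightarrow>
     (\<forall>y\<in>X. fst x = fst y - 1 \<longrightarrow> snd x \<notin> set (labels_below (info t (fst y)) (snd y)))" (is "?L \<longleftrightarrow> ?R")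
  proof
    assume L: ?L
    show ?R
    proof (intro ballI impI notI)
      fix y assume y: "y \<in> X" "fst x = fst y - 1" "snd x \<in> set (labels_below (info t (fst y)) (snd y))"
      then have "y \<noteq> x" by auto
      with L y have "(fst y - 1, snd x) \<in> X - {x}" by blast
      with y(2) show False by (metis DiffD2 insertI1 prod.collapse)
    qed
  next
    assume R: ?R
    have "\<forall>y\<in>X. \<forall>l\<in>set (labels_below (info t (fst y)) (snd y)). (fst y - 1, l) \<in> X"
      using assms(1) by (simp add: index_ideal_def)
    with R show ?L by (metis DiffD1 DiffI fst_conv singletonD snd_conv)
  qed
  ultimately show ?thesis using assms unfolding index_ideal_def by (simp; blast)
qed

text \<open>Only two blocks turn a closed set into a special column when added, and only two when
  removed.\<close>
lemma insert_eq_place: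
  assumes "index_ideal E8 X"
  shows "insert x X = place shape1 m \<Longrightarrow> x \<notin> X \<Longrightarrow> x = (10 * m + 5, 9)"
    and "insert x X = place shape2 m \<Longrightarrow> x \<notin> X \<Longrightarrow> x = (10 * m + 6, 2)"
proof -
  have closed: "(j - 1, l') \<in> X" if "(j, l) \<in> X" "l' \<in> set (labels_below (info E8 j) l)" for j l l'
    using assms that by (fastforce simp: index_ideal_def)
  have minus: "10 * m + 5 - 1 = 10 * m + 4" "10 * m + 6 - 1 = 10 * m + 5" by simp_all
  {
    assume *: "insert x X = place shape1 m" "x \<notin> X"
    show "x = (10 * m + 5, 9)"
    proof (rule ccontr)
      assume ne: "x \<noteq> (10 * m + 5, 9)"
      have "(10 * m + 5, 9) \<in> place shape1 m" using labels_E8 by (simp add: place_props shape1_def idx_def)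
      with * ne have "(10 * m + 5, 9) \<in> X" by (metis insertE)
      \<comment> \<open>If block 9 was there before, closedness puts block 2 under it, which is the
        hole of the shape.\<close>
      from closed[OF this labels_below_E8(1)] have "(10 * m + 4, 2) \<in> insert x X" unfolding minus by (rule insertI2)
      then show False unfolding *(1) by (simp add: place_props shape1_def)
    qed
  }
  {
    assume *: "insert x X = place shape2 m" "x \<notin> X"
    show "x = (10 * m + 6, 2)"
    proof (rule ccontr)
      assume ne: "x \<noteq> (10 * m + 6, 2)"
      have "(10 * m + 6, 2) \<in> place shape2 m" using labels_E8 by (simp add: place_props shape2_def idx_def)
      with * ne have "(10 * m + 6, 2) \<in> X" by (metis insertE)
      from closed[OF this labels_below_E8(2)] have "(10 * m + 5, 4) \<in> insert x X" unfolding minus by (rule insertI2)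
      then show False unfolding *(1) by (simp add: place_props shape2_def)
    qed
  }
qed

lemma remove_eq_place:
  assumes "index_ideal E8 X"
  shows "X - {x} = place shape1 m \<Longrightarrow> x \<in> X \<Longrightarrow> x = (10 * m + 4, 2)"
    and "X - {x} = place shape2 m \<Longrightarrow> x \<in> X \<Longrightarrow> x = (10 * m + 5, 4)"
proof -
  have closed: "(j - 1, l') \<in> X" if "(j, l) \<in> X" "l' \<in> set (labels_below (info E8 j) l)" for j l l'
    using assms that by (fastforce simp: index_ideal_def)
  have minus: "10 * m + 5 - 1 = 10 * m + 4" "10 * m + 6 - 1 = 10 * m + 5" by simp_all
  {
    assume *: "X - {x} = place shape1 m" "x \<in> X"
    have "(10 * m + 5, 9) \<in> place shape1 m" using labels_E8 by (simp add: place_props shape1_def idx_def)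
    then have "(10 * m + 5, 9) \<in> X" using * by (metis DiffD1)
    from closed[OF this labels_below_E8(1)] have "(10 * m + 4, 2) \<in> X" unfolding minus .
    moreover have "(10 * m + 4, 2) \<notin> X - {x}" unfolding *(1) by (simp add: place_props shape1_def)
    ultimately show "x = (10 * m + 4, 2)" by blast
  }
  {
    assume *: "X - {x} = place shape2 m" "x \<in> X"
    have "(10 * m + 6, 2) \<in> place shape2 m" using labels_E8 by (simp add: place_props shape2_def idx_def)
    then have "(10 * m + 6, 2) \<in> X" using * by (metis DiffD1)
    from closed[OF this labels_below_E8(2)] have "(10 * m + 5, 4) \<in> X" unfolding minus .
    moreover have "(10 * m + 5, 4) \<notin> X - {x}" unfolding *(1) by (simp add: place_props shape2_def)
    ultimately show "x = (10 * m + 5, 4)" by blast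
  }
qed

context window_frame
begin

lemma set_local_adds:
  assumes "wf rows"
  shows "p \<in> set (local_adds ds rows) \<longleftrightarrow> 0 < fst p \<and> fst p < window_size \<and> at j0 p \<in> idx t \<and>
    snd p \<notin> set (rows ! fst p) \<and> set (labels_below (info t (j0 + int (fst p))) (snd p)) \<subseteq> set (rows ! (fst p - 1))"
proof -
  have l: "length rows = window_size" using assms by (simp add: wf_def)
  have "p \<in> set (local_adds ds rows) \<longleftrightarrow> (\<exists>n. fst p = Suc n \<and> Suc n < window_size \<and>
     (\<exists>ps. (snd p, ps) \<in> set (snd (ds ! Suc n)) \<and> snd p \<notin> set (rows ! Suc n) \<and> set ps \<subseteq> set (rows ! n)))"
    unfolding local_adds_def zip3_eq[OF length_ds l] enumerate_map_upt
    by (cases p) (force simp: list_all_iff split: if_splits)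
  also have "\<dots> \<longleftrightarrow> (\<exists>n. fst p = Suc n \<and> Suc n < window_size \<and> at j0 p \<in> idx t \<and> snd p \<notin> set (rows ! Suc n) \<and>
      set (labels_below (info t (j0 + int (Suc n))) (snd p)) \<subseteq> set (rows ! n))"
  proof -
    have "(\<exists>ps. (snd p, ps) \<in> set (snd (ds ! Suc n)) \<and> snd p \<notin> set (rows ! Suc n) \<and> set ps \<subseteq> set (rows ! n)) \<longleftrightarrow>
       at j0 p \<in> idx t \<and> snd p \<notin> set (rows ! Suc n) \<and>
      set (labels_below (info t (j0 + int (Suc n))) (snd p)) \<subseteq> set (rows ! n)" if "Suc n < window_size" "fst p = Suc n" for n
      unfolding ds_nth[OF that(1)] info_entry using that(2) by (auto simp: at_def idx_def)
    then show ?thesis by blast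
  qed
  also have "\<dots> \<longleftrightarrow> 0 < fst p \<and> fst p < window_size \<and> at j0 p \<in> idx t \<and>
    snd p \<notin> set (rows ! fst p) \<and> set (labels_below (info t (j0 + int (fst p))) (snd p)) \<subseteq> set (rows ! (fst p - 1))"
    by (cases "fst p") auto
  finally show ?thesis .
qed

lemma set_local_removes:
  assumes "wf rows"
  shows "p \<in> set (local_removes ds rows) \<longleftrightarrow> Suc (fst p) < window_size \<and> snd p \<in> set (rows ! fst p) \<and>
    (\<forall>l\<in>set (rows ! Suc (fst p)). snd p \<notin> set (labels_below (info t (j0 + int (Suc (fst p)))) l))"
proof -
  have l: "length rows = window_size" using assms by (simp add: wf_def)
  have "p \<in> set (local_removes ds rows) \<longleftrightarrow> Suc (fst p) < window_size \<and> snd p \<in> set (rows ! fst p) \<and>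
     (\<forall>(l, ps)\<in>set (snd (ds ! Suc (fst p))). l \<in> set (rows ! Suc (fst p)) \<longrightarrow> snd p \<notin> set ps)"
    unfolding local_removes_def zip3_eq[OF length_ds l] enumerate_map_upt
    by (cases p) (force simp: list_all_iff split: if_splits)
  also have "\<dots> \<longleftrightarrow> Suc (fst p) < window_size \<and> snd p \<in> set (rows ! fst p) \<and>
    (\<forall>l\<in>set (rows ! Suc (fst p)). snd p \<notin> set (labels_below (info t (j0 + int (Suc (fst p)))) l))"
  proof -
    have "(\<forall>(l, ps)\<in>set (snd (ds ! Suc (fst p))). l \<in> set (rows ! Suc (fst p)) \<longrightarrow> snd p \<notin> set ps) \<longleftrightarrow>
      (\<forall>l\<in>set (rows ! Suc (fst p)). snd p \<notin> set (labels_below (info t (j0 + int (Suc (fst p)))) l))"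
      if k: "Suc (fst p) < window_size"
    proof -
      have "set (rows ! Suc (fst p)) \<subseteq> set (cube_labels (info t (j0 + int (Suc (fst p)))))"
        using assms k unfolding wf_def by blast
      moreover have "(\<forall>(l, ps)\<in>set (snd (info t j)). l \<in> A \<longrightarrow> b \<notin> set ps) \<longleftrightarrow>
          (\<forall>l ps. (l, ps) \<in> set (snd (info t j)) \<longrightarrow> l \<in> A \<longrightarrow> b \<notin> set ps)" for j A b by blast
      ultimately show ?thesis unfolding ds_nth[OF k] info_entry by blast
    qed
    then show ?thesis by blast
  qed
  finally show ?thesis .
qed


text \<open>Weaker than \<open>rows_ok\<close>: it survives one addition or removal, after which the
  choice rules have to be evaluated once more.\<close>

definition admissible :: "nat list list \<Rightarrow> bool" where
  "admissible rows \<longleftrightarrow> wf rows \<and> full rows 0 \<and> rows ! (window_size - 1) = [] \<and> young_rows t ds rows"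

lemma admissibleD:
  assumes "admissible rows"
  shows "wf rows" "full rows 0" "rows ! (window_size - 1) = []" "index_young t (X rows)"
  using assms index_young_X by (auto simp: admissible_def)

lemma at_cases:
  assumes "x \<in> idx t" "j0 \<le> fst x" "fst x < j0 + int window_size"
  obtains k l where "x = at j0 (k, l)" "k < window_size"
  using that[of "nat (fst x - j0)" "snd x"] assms by (auto simp: at_def prod_eq_iff nat_less_iff)

text \<open>Row 0 is full, and the row under a new block is occupied; as the two top rows are empty,
  the block stays below the top row.\<close>

lemma addable_candidate:
  assumes adm: "admissible rows" and top: "rows ! (window_size - 2) = []"
    and x: "x \<in> idx t" "x \<notin> X rows" "index_young t (insert x (X rows))"
  obtains k l where "x = at j0 (k, l)" "0 < k" "k < window_size - 1" "l \<notin> set (rows ! k)"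
proof -
  note wf = admissibleD(1)[OF adm]
  obtain l' where "(fst x - 1, l') \<in> insert x (X rows)"
    using index_young_below[OF x(3), of x] by blast
  moreover have "(fst x - 1, l') \<noteq> x" by (metis diff_add_cancel fst_conv less_irrefl zless_add1_eq)
  ultimately have below: "(fst x - 1, l') \<in> X rows" by blast
  have lo: "j0 \<le> fst x" using x below_in_X[of x rows] by (meson not_le)
  have up: "fst x < j0 + int window_size - 1"
  proof (rule ccontr)
    assume nup: "\<not> fst x < j0 + int window_size - 1"
    from below wf show False
    proof (cases rule: X_cases)
      case 1
      then show False using nup by (simp add: window_size_def)
    next
      case (2 k l)
      then have "k = window_size - 2 \<or> k = window_size - 1"
        using nup by (auto simp: at_def window_size_def)
      then show False using 2 top admissibleD(3)[OF adm] by auto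
    qed
  qed
  obtain k l where k: "x = at j0 (k, l)" "k < window_size"
  proof (rule at_cases[OF x(1) lo])
    show "fst x < j0 + int window_size" using up by simp
  qed
  have "l \<notin> set (rows ! k)" using at_in_X[OF wf k(2)] x(2) k(1) by blast
  moreover from this have "k \<noteq> 0"
    using admissibleD(2)[OF adm, unfolded full_def] x(1) k by (cases k) (auto simp: idx_def at_def)
  moreover have "k < window_size - 1" using up k by (auto simp: at_def)
  ultimately show ?thesis using that k(1) by blast
qed

lemma index_young_insert:
  assumes adm: "admissible rows" and k: "0 < k" "k < window_size - 1" and x: "at j0 (k, l) \<in> idx t"
  shows "index_young t (insert (at j0 (k, l)) (X rows)) \<longleftrightarrow> young_rows t ds (insert_label rows (k, l))"
proof -
  have k': "k < window_size" using k by simp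
  note w = wf_insert[OF admissibleD(1)[OF adm] k' x]
  have "set (insert_label rows (k, l) ! (window_size - 1)) = {}"
    unfolding w(3) using admissibleD(3)[OF adm] k by simp
  then have "insert_label rows (k, l) ! (window_size - 1) = []" by simp
  moreover have "full (insert_label rows (k, l)) 0"
    using admissibleD(2)[OF adm] unfolding full_def w(3) by auto
  ultimately show ?thesis using index_young_X[OF w(1)] w(2) by simp
qed

lemma index_young_delete:
  assumes adm: "admissible rows" and k: "0 < k" "k < window_size"
  shows "index_young t (X rows - {at j0 (k, l)}) \<longleftrightarrow> young_rows t ds (delete_label rows (k, l))"
proof -
  note w = wf_delete[OF admissibleD(1)[OF adm] k(2), of l]
  have "set (delete_label rows (k, l) ! (window_size - 1)) = {}"
    unfolding w(3) using admissibleD(3)[OF adm] by auto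
  then have "delete_label rows (k, l) ! (window_size - 1) = []" by simp
  moreover have "full (delete_label rows (k, l)) 0"
    using admissibleD(2)[OF adm] k unfolding full_def w(3) by auto
  ultimately show ?thesis using index_young_X[OF w(1)] w(2) by simp
qed

lemma set_nonmembers:
  assumes "wf rows"
  shows "p \<in> set (nonmembers ds rows) \<longleftrightarrow> fst p < window_size - 1 \<and> at j0 p \<in> idx t \<and> snd p \<notin> set (rows ! fst p)"
proof -
  have l: "length rows = window_size" using assms by (simp add: wf_def)
  have z: "zip ds (butlast rows) = map (\<lambda>k. (ds ! k, rows ! k)) [0..<window_size - 1]"
    by (intro nth_equalityI) (auto simp: l nth_butlast)
  have "p \<in> set (nonmembers ds rows) \<longleftrightarrow> fst p < window_size - 1 \<and> snd p \<in> set (cube_labels (ds ! fst p)) \<and> snd p \<notin> set (rows ! fst p)"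
    unfolding nonmembers_def z enumerate_map_upt by (cases p) force
  also have "\<dots> \<longleftrightarrow> fst p < window_size - 1 \<and> at j0 p \<in> idx t \<and> snd p \<notin> set (rows ! fst p)"
  proof -
    have "ds ! fst p = info t (j0 + int (fst p))" if "fst p < window_size - 1"
      using that by (intro ds_nth) simp
    then show ?thesis by (auto simp: idx_def at_def)
  qed
  finally show ?thesis .
qed

lemma set_members:
  assumes "wf rows"
  shows "p \<in> set (members rows) \<longleftrightarrow> 0 < fst p \<and> fst p < window_size \<and> snd p \<in> set (rows ! fst p)"
proof -
  have l: "length rows = window_size" using assms by (simp add: wf_def)
  have z: "tl rows = map (\<lambda>k. rows ! Suc k) [0..<window_size - 1]"
    by (intro nth_equalityI) (auto simp: l nth_tl)
  have "p \<in> set (members rows) \<longleftrightarrow> (\<exists>n. fst p = Suc n \<and> n < window_size - 1 \<and> snd p \<in> set (rows ! Suc n))"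
    unfolding members_def z enumerate_map_upt by (cases p) force
  then show ?thesis by (cases "fst p") auto
qed

lemma idx_E8_simps:
  "(10 * m + 4, l) \<in> idx E8 \<longleftrightarrow> l = 5 \<or> l = 2 \<or> l = 3"
  "(10 * m + 5, l) \<in> idx E8 \<longleftrightarrow> l = 4 \<or> l = 9"
  "(10 * m + 6, l) \<in> idx E8 \<longleftrightarrow> l = 3 \<or> l = 2 \<or> l = 5"
  using labels_E8[of m] by (auto simp: idx_def)

lemma young_rows_special: "t = E8 \<Longrightarrow> special_rows ds' rows \<Longrightarrow> young_rows t ds' rows"
  by (simp add: young_rows_def)

text \<open>Two halves in place of an equivalence: what the list contains can be added, and whatever
  completes an exceptional column is in the list.\<close>

lemma set_special_adds:
  assumes adm: "admissible rows" and t: "t = E8" and top: "rows ! (window_size - 2) = []"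
    and cl: "closed_rows ds rows" 
  shows "p \<in> set (special_adds ds rows) \<Longrightarrow> 0 < fst p \<and> fst p < window_size - 1 \<and> at j0 p \<in> idx t \<and> snd p \<notin> set (rows ! fst p) \<and>
      index_young t (insert (at j0 p) (X rows))"
    and "0 < fst p \<Longrightarrow> fst p < window_size - 1 \<Longrightarrow> at j0 p \<in> idx t \<Longrightarrow> snd p \<notin> set (rows ! fst p) \<Longrightarrow>
      insert (at j0 p) (X rows) = place shape1 m \<or> insert (at j0 p) (X rows) = place shape2 m \<Longrightarrow>
      p \<in> set (special_adds ds rows)"
proof -
  note wf = admissibleD(1)[OF adm]
  have l: "length rows = window_size" using wf by (simp add: wf_def)
  have sp: "p \<in> set (special_adds ds rows) \<longleftrightarrow> (\<exists>n. fst p = Suc n \<and> Suc n < window_size \<and> rows ! Suc n = [] \<and>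
     (phase t (j0 + int (Suc n)) = 5 \<and> 5 \<in> set (rows ! n) \<and> 2 \<notin> set (rows ! n) \<and> snd p = 9 \<or>
      phase t (j0 + int (Suc n)) = 6 \<and> 9 \<in> set (rows ! n) \<and> 4 \<notin> set (rows ! n) \<and> snd p = 2) \<and>
      special_rows ds (insert_label rows p))" for p
    unfolding special_adds_def zip3_eq[OF length_ds l] enumerate_map_upt
    by (cases p) (force simp: ds_nth fst_info split: if_splits)
  {
    assume "p \<in> set (special_adds ds rows)"
    then obtain n where n: "fst p = Suc n" "Suc n < window_size" "rows ! Suc n = []" "rows ! n \<noteq> []"
      and ph: "phase t (j0 + int (Suc n)) = 5 \<and> snd p = 9 \<or> phase t (j0 + int (Suc n)) = 6 \<and> snd p = 2"
      and s: "special_rows ds (insert_label rows p)"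
      unfolding sp by fastforce
    have i: "at j0 p \<in> idx t"
      using ph n(1) t by (auto simp: at_def idx_E8_conv section_labels_def)
    moreover have k: "fst p < window_size - 1" using n top by (cases "n = window_size - 2") auto
    moreover have "index_young t (insert (at j0 p) (X rows))"
    proof -
      have "young_rows t ds (insert_label rows p)" by (rule young_rows_special[OF t s])
      moreover have "0 < fst p" using n by simp
      ultimately show ?thesis
        using index_young_insert[OF adm, of "fst p" "snd p", unfolded prod.collapse] k i by blast
    qed
    ultimately show "0 < fst p \<and> fst p < window_size - 1 \<and> at j0 p \<in> idx t \<and> snd p \<notin> set (rows ! fst p) \<and>
      index_young t (insert (at j0 p) (X rows))" using n by simp
  }
  assume k: "0 < fst p" "fst p < window_size - 1" and i: "at j0 p \<in> idx t" and nm: "snd p \<notin> set (rows ! fst p)"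
    and pl: "insert (at j0 p) (X rows) = place shape1 m \<or> insert (at j0 p) (X rows) = place shape2 m"
  obtain n where n: "fst p = Suc n" using k(1) by (cases "fst p") auto
  have nx: "at j0 p \<notin> X rows" using at_in_X[OF wf, of "fst p" "snd p"] k(2) nm by simp
  have id: "index_ideal E8 (X rows)" using index_ideal_X[OF wf] cl t by simp
  have kk: "Suc n < window_size" using k(2) n by simp
  have row: "l \<in> set (rows ! n) \<longleftrightarrow> (j0 + int n, l) \<in> X rows" "l \<in> set (rows ! Suc n) \<longleftrightarrow> (j0 + int (Suc n), l) \<in> X rows" for l
    using at_in_X'[OF wf, of n l] at_in_X'[OF wf kk, of l] kk by auto
  have young: "index_young t (insert (at j0 p) (X rows))" using pl t by (auto simp: index_young_def)
  have y: "young_rows t ds (insert_label rows p)"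
    using index_young_insert[OF adm k, of "snd p"] i young by simp
  have sr: "special_rows ds (insert_label rows p)"
  proof -
    have k': "fst p < window_size" using k by simp
    have i': "at j0 (fst p, snd p) \<in> idx t" using i by simp
    note w = wf_insert[OF wf k' i']
    have "set (insert_label rows (fst p, snd p) ! (window_size - 1)) = {}"
      unfolding w(3) using admissibleD(3)[OF adm] k by simp
    then have e: "insert_label rows (fst p, snd p) ! (window_size - 1) = []" by simp
    have f: "full (insert_label rows (fst p, snd p)) 0"
      using admissibleD(2)[OF adm] unfolding full_def w(3) by auto
    show ?thesis using special_rows_iff[OF w(1) t e f] w(2) pl by auto
  qed
  from pl show "p \<in> set (special_adds ds rows)"
  proof
    assume e: "insert (at j0 p) (X rows) = place shape1 m"
    from insert_eq_place(1)[OF id e nx] n have p: "j0 + int (Suc n) = 10 * m + 5" "snd p = 9" by (auto simp: at_def)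
    have mem: "x \<in> X rows \<longleftrightarrow> x \<in> place shape1 m \<and> x \<noteq> at j0 p" for x using e nx by auto
    have "rows ! Suc n = []"
    proof -
      have "l \<notin> set (rows ! Suc n)" for l
        unfolding row mem using p n by (auto simp: place_props shape1_def at_def)
      then show ?thesis by (meson hd_in_set)
    qed
    moreover have "j0 + int n = 10 * m + 4" using p(1) by simp
    then have "5 \<in> set (rows ! n)" "2 \<notin> set (rows ! n)"
      unfolding row mem using p(2) by (auto simp: place_props shape1_def at_def idx_E8_simps)
    moreover have "phase t (j0 + int (Suc n)) = 5" unfolding p(1) t using phase_E8[of m 5] by simp
    ultimately show ?thesis unfolding sp using n kk p(2) sr by blast
  next
    assume e: "insert (at j0 p) (X rows) = place shape2 m"
    from insert_eq_place(2)[OF id e nx] n have p: "j0 + int (Suc n) = 10 * m + 6" "snd p = 2" by (auto simp: at_def)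
    have mem: "x \<in> X rows \<longleftrightarrow> x \<in> place shape2 m \<and> x \<noteq> at j0 p" for x using e nx by auto
    have "rows ! Suc n = []"
    proof -
      have "l \<notin> set (rows ! Suc n)" for l
        unfolding row mem using p n by (auto simp: place_props shape2_def at_def)
      then show ?thesis by (meson hd_in_set)
    qed
    moreover have "j0 + int n = 10 * m + 5" using p(1) by simp
    then have "9 \<in> set (rows ! n)" "4 \<notin> set (rows ! n)"
      unfolding row mem using p(2) by (auto simp: place_props shape2_def at_def idx_E8_simps)
    moreover have "phase t (j0 + int (Suc n)) = 6" unfolding p(1) t using phase_E8[of m 6] by simp
    ultimately show ?thesis unfolding sp using n kk p(2) sr by blast
  qed
qed


text \<open>A hole in row 0 or below would lie under the full rows 1 and 2. A closed set admits no
  hole under a full row, and an exceptional column reaches at most one cube above its hole.\<close>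

lemma removable_candidate:
  assumes adm: "admissible rows" and full: "full rows 1" "full rows 2"
    and x: "x \<in> X rows" "index_young t (X rows - {x})"
  obtains k l where "x = at j0 (k, l)" "0 < k" "k < window_size" "l \<in> set (rows ! k)"
proof -
  note wf = admissibleD(1)[OF adm]
  have xi: "x \<in> idx t" using x(1) rep_subset by blast
  have low: "y \<in> X rows" if "y \<in> idx t" "fst y \<le> j0 + 2" for y
  proof (cases "fst y < j0")
    case True
    then show ?thesis using below_in_X that by blast
  next
    case False
    then have "fst y = j0 + int 0 \<or> fst y = j0 + int 1 \<or> fst y = j0 + int 2" using that(2) by auto
    then obtain k where k: "fst y = j0 + int k" "k = 0 \<or> k = 1 \<or> k = 2" by blast
    have "full rows k" using k(2) full admissibleD(2)[OF adm] by blast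
    then have "snd y \<in> set (rows ! k)" using that(1) k(1) by (auto simp: full_def idx_def case_prod_beta)
    moreover have "k < window_size" using k(2) by (auto simp: window_size_def)
    moreover have "y = (j0 + int k, snd y)" using k(1) by (simp add: prod_eq_iff)
    ultimately show ?thesis using at_in_X'[OF wf] by metis
  qed
  have "\<not> fst x \<le> j0"
  proof
    assume xle: "fst x \<le> j0"
    have ins: "y \<in> X rows - {x}" if "y \<in> idx t" "fst y \<le> j0 + 2" "fst x < fst y" for y
      using low that by auto
    \<comment> \<open>Relative to the cube of phase 4, nothing is missing below height
      \<open>c\<close> and nothing is present above \<open>c + 1\<close>; the full row 2 is too high
      for that.\<close>
    have place_False: False if "t = E8" "\<And>k l. P k l \<Longrightarrow> k \<le> c + 1" "\<And>k l. \<not> P k l \<Longrightarrow> k \<ge> c" "X rows - {x} = place P m"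
      for P m c
    proof -
      have "x \<notin> place P m" using that(4) by blast
      then have "\<not> P (fst x - (10 * m + 4)) (snd x)" using xi that(1) by (simp add: place_def)
      from that(3)[OF this] have c: "c \<le> fst x - (10 * m + 4)" .
      obtain l where "(j0 + 2, l) \<in> idx t" using labels_E8_nonempty by blast
      then have "(j0 + 2, l) \<in> place P m" using ins[of "(j0 + 2, l)"] xle that(4) by simp
      then have "P (j0 + 2 - (10 * m + 4)) l" by (simp add: place_def)
      from that(2)[OF this] c xle show False by simp
    qed
    from x(2) consider "index_ideal t (X rows - {x})" | m where "t = E8" "X rows - {x} = place shape1 m"
      | m where "t = E8" "X rows - {x} = place shape2 m" by (auto simp: index_young_def)
    then show False
    proof cases
      case 1
      obtain l where l: "(fst x + 1, l) \<in> idx t" "snd x \<in> set (labels_below (info t (fst x + 1)) l)"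
        using labels_below_cover[of "fst x + 1" "snd x" t] xi by auto
      then have a: "(fst x + 1, l) \<in> X rows - {x}" using ins[of "(fst x + 1, l)"] xle by simp
      have "\<forall>y\<in>X rows - {x}. \<forall>l\<in>set (labels_below (info t (fst y)) (snd y)). (fst y - 1, l) \<in> X rows - {x}"
        using 1 unfolding index_ideal_def by blast
      from bspec[OF bspec[OF this a], of "snd x"] l(2) show False by simp
    next
      case 2
      show False
        by (rule place_False[OF 2(1) _ _ 2(2), of 0]) (auto simp: shape1_def)
    next
      case 3
      show False
        by (rule place_False[OF 3(1) _ _ 3(2), of 1]) (auto simp: shape2_def)
    qed
  qed
  note nle = this
  from x(1) wf show ?thesis
  proof (cases rule: X_cases)
    case 1
    with nle show ?thesis by simp
  next
    case (2 k l)
    with nle have "0 < k" by (cases k) (auto simp: at_def)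
    with 2 that show ?thesis by blast
  qed
qed

lemma set_special_removes:
  assumes adm: "admissible rows" and full: "full rows 1" and t: "t = E8" and cl: "closed_rows ds rows" 
  shows "p \<in> set (special_removes ds rows) \<Longrightarrow> 0 < fst p \<and> fst p < window_size \<and> snd p \<in> set (rows ! fst p) \<and>
      index_young t (X rows - {at j0 p})"
    and "0 < fst p \<Longrightarrow> fst p < window_size \<Longrightarrow> snd p \<in> set (rows ! fst p) \<Longrightarrow>
      X rows - {at j0 p} = place shape1 m \<or> X rows - {at j0 p} = place shape2 m \<Longrightarrow>
      p \<in> set (special_removes ds rows)"
proof -
  note wf = admissibleD(1)[OF adm]
  have l: "length rows = window_size" using wf by (simp add: wf_def)
  have sp: "p \<in> set (special_removes ds rows) \<longleftrightarrow> (Suc (fst p) < window_size \<and>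
     (phase t (j0 + int (Suc (fst p))) = 5 \<and> 9 \<in> set (rows ! Suc (fst p)) \<and> 4 \<notin> set (rows ! Suc (fst p)) \<and> 2 \<in> set (rows ! fst p) \<and> snd p = 2 \<or>
      phase t (j0 + int (Suc (fst p))) = 6 \<and> 2 \<in> set (rows ! Suc (fst p)) \<and> 3 \<notin> set (rows ! Suc (fst p)) \<and> 4 \<in> set (rows ! fst p) \<and> snd p = 4) \<and>
      special_rows ds (delete_label rows p))" for p
    unfolding special_removes_def zip3_eq[OF length_ds l] enumerate_map_upt
    by (cases p) (force simp: ds_nth fst_info split: if_splits)
  have sr: "special_rows ds (delete_label rows p) \<longleftrightarrow> (\<exists>m. X rows - {at j0 p} = place shape1 m \<or> X rows - {at j0 p} = place shape2 m)"
    if k: "0 < fst p" "fst p < window_size" for p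
  proof -
    note w = wf_delete[OF wf k(2), of "snd p", unfolded prod.collapse]
    have "set (delete_label rows p ! (window_size - 1)) = {}"
      unfolding w(3) using admissibleD(3)[OF adm] by auto
    then have e: "delete_label rows p ! (window_size - 1) = []" by simp
    have f: "window_frame.full t j0 (delete_label rows p) 0"
      using admissibleD(2)[OF adm] k unfolding full_def w(3) by auto
    show ?thesis using special_rows_iff[OF w(1) t e f] w(2) by auto
  qed
  {
    assume p: "p \<in> set (special_removes ds rows)"
    have "fst p \<noteq> 0"
    proof
      assume 0: "fst p = 0"
      have f: "set (cube_labels (info t (j0 + int 1))) \<subseteq> set (rows ! 1)" using full by (simp add: full_def)
      have "phase t (j0 + int 1) = 5 \<and> 4 \<notin> set (rows ! 1) \<or> phase t (j0 + int 1) = 6 \<and> 3 \<notin> set (rows ! 1)"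
        using p 0 unfolding sp by auto
      then show False using f t by (auto simp: cube_labels_info section_labels_def)
    qed
    then have k: "0 < fst p" "fst p < window_size" and m: "snd p \<in> set (rows ! fst p)"
      and s: "special_rows ds (delete_label rows p)" using p unfolding sp by auto
    have "index_young t (X rows - {at j0 p})" using s sr[OF k] t by (auto simp: index_young_def)
    then show "0 < fst p \<and> fst p < window_size \<and> snd p \<in> set (rows ! fst p) \<and> index_young t (X rows - {at j0 p})"
      using k m by simp
  }
  assume k: "0 < fst p" "fst p < window_size" and mm: "snd p \<in> set (rows ! fst p)"
    and pl: "X rows - {at j0 p} = place shape1 m \<or> X rows - {at j0 p} = place shape2 m"
  have nx: "at j0 p \<in> X rows" using at_in_X[OF wf, of "fst p" "snd p"] k(2) mm by simp
  have id: "index_ideal E8 (X rows)" using index_ideal_X[OF wf] cl t by simp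
  have s: "special_rows ds (delete_label rows p)" using sr[OF k] pl by blast
  have k1: "Suc (fst p) < window_size"
  proof (rule ccontr)
    assume "\<not> Suc (fst p) < window_size"
    then have "fst p = window_size - 1" using k by simp
    then show False using mm admissibleD(3)[OF adm] by simp
  qed
  have row: "l \<in> set (rows ! Suc (fst p)) \<longleftrightarrow> (j0 + int (Suc (fst p)), l) \<in> X rows" for l
    using at_in_X'[OF wf k1, of l] by auto
  from pl show "p \<in> set (special_removes ds rows)"
  proof
    assume e: "X rows - {at j0 p} = place shape1 m"
    from remove_eq_place(1)[OF id e nx] have p: "j0 + int (Suc (fst p)) = 10 * m + 5" "snd p = 2" by (auto simp: at_def)
    have mem: "x \<in> X rows \<longleftrightarrow> x \<in> place shape1 m \<or> x = at j0 p" for x using e nx by auto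
    have "9 \<in> set (rows ! Suc (fst p))" "4 \<notin> set (rows ! Suc (fst p))"
      unfolding row mem p(1) using p(2) by (auto simp: place_props shape1_def at_def idx_E8_simps)
    moreover have "phase t (j0 + int (Suc (fst p))) = 5" unfolding p(1) t using phase_E8[of m 5] by simp
    ultimately show ?thesis unfolding sp using k1 p(2) s mm by auto
  next
    assume e: "X rows - {at j0 p} = place shape2 m"
    from remove_eq_place(2)[OF id e nx] have p: "j0 + int (Suc (fst p)) = 10 * m + 6" "snd p = 4" by (auto simp: at_def)
    have mem: "x \<in> X rows \<longleftrightarrow> x \<in> place shape2 m \<or> x = at j0 p" for x using e nx by auto
    have "2 \<in> set (rows ! Suc (fst p))" "3 \<notin> set (rows ! Suc (fst p))"
      unfolding row mem p(1) using p(2) by (auto simp: place_props shape2_def at_def idx_E8_simps)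
    moreover have "phase t (j0 + int (Suc (fst p))) = 6" unfolding p(1) t using phase_E8[of m 6] by simp
    ultimately show ?thesis unfolding sp using k1 p(2) s mm by auto
  qed
qed

text \<open>Below, only row 0 has to be full, so the statement also covers columns after a removal;
  dually, \<open>remove_list_correct\<close> asks for only one empty row on top and covers columns
  after an addition.\<close>

lemma add_list_correct:
  assumes adm: "admissible rows" and top: "rows ! (window_size - 2) = []"
  shows "p \<in> set (add_list t ds rows) \<longleftrightarrow> 0 < fst p \<and> fst p < window_size - 1 \<and> at j0 p \<in> idx t \<and> at j0 p \<notin> X rows \<and>
    index_young t (insert (at j0 p) (X rows))" (is "?L \<longleftrightarrow> ?R")
proof -
  note wf = admissibleD(1)[OF adm]
  have memX: "at j0 p \<in> X rows \<longleftrightarrow> snd p \<in> set (rows ! fst p)" if "fst p < window_size"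
    using at_in_X[OF wf that, of "snd p"] by simp
  have memX': "at j0 p \<in> X rows \<longleftrightarrow> snd p \<in> set (rows ! fst p)" if "fst p < window_size - 1"
    using memX that by linarith
  show ?thesis
  proof (cases "closed_rows ds rows")
    case True
    have id: "index_ideal t (X rows)" using index_ideal_X[OF wf] True by simp
    have loc: "p \<in> set (local_adds ds rows) \<longleftrightarrow> 0 < fst p \<and> fst p < window_size - 1 \<and> at j0 p \<in> idx t \<and> at j0 p \<notin> X rows \<and>
       index_ideal t (insert (at j0 p) (X rows))"
    proof -
      have ideal: "index_ideal t (insert (at j0 p) (X rows)) \<longleftrightarrow>
          set (labels_below (info t (j0 + int (fst p))) (snd p)) \<subseteq> set (rows ! (fst p - 1))"
        if "0 < fst p" "fst p < window_size" "at j0 p \<in> idx t"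
      proof -
        have "(fst (at j0 p) - 1, l) \<in> X rows \<longleftrightarrow> l \<in> set (rows ! (fst p - 1))" for l
          using at_in_X'[OF wf, of "fst p - 1" l] that by (auto simp: at_def of_nat_diff algebra_simps)
        then show ?thesis using index_ideal_insert[OF id that(3)] by (auto simp: at_def)
      qed
      \<comment> \<open>A block in the top row would have to rest on the empty row below it.\<close>
      moreover have "fst p \<noteq> window_size - 1"
        if "at j0 p \<in> idx t" "set (labels_below (info t (j0 + int (fst p))) (snd p)) \<subseteq> set (rows ! (fst p - 1))"
      proof
        assume "fst p = window_size - 1"
        then have "fst p - 1 = window_size - 2" by (simp add: window_size_def)
        then have "labels_below (info t (j0 + int (fst p))) (snd p) = []" using top that(2) by simp
        then show False using labels_below_nonempty[of "j0 + int (fst p)" "snd p" t] that(1) by (simp add: at_def)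
      qed
      ultimately show ?thesis unfolding set_local_adds[OF wf] using memX by (auto simp: window_size_def)
    qed
    have "?L \<longleftrightarrow> p \<in> set (local_adds ds rows) \<or> t = E8 \<and> p \<in> set (special_adds ds rows)"
      using True by (simp add: add_list_def)
    also have "\<dots> \<longleftrightarrow> ?R"
    proof
      assume "p \<in> set (local_adds ds rows) \<or> t = E8 \<and> p \<in> set (special_adds ds rows)"
      then show ?R
      proof
        assume "p \<in> set (local_adds ds rows)"
        then show ?R unfolding loc by (simp add: index_young_def)
      next
        assume a: "t = E8 \<and> p \<in> set (special_adds ds rows)"
        have "0 < fst p \<and> fst p < window_size - 1 \<and> at j0 p \<in> idx t \<and> snd p \<notin> set (rows ! fst p) \<and>
            index_young t (insert (at j0 p) (X rows))"
          by (rule set_special_adds(1)[OF adm conjunct1[OF a] top True conjunct2[OF a]])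
        moreover from this have "fst p < window_size" by linarith
        ultimately show ?R using memX by simp
      qed
    next
      assume R: ?R
      then have "index_ideal t (insert (at j0 p) (X rows)) \<or> t = E8 \<and> (\<exists>m. insert (at j0 p) (X rows) = place shape1 m \<or> insert (at j0 p) (X rows) = place shape2 m)"
        by (simp add: index_young_def)
      then show "p \<in> set (local_adds ds rows) \<or> t = E8 \<and> p \<in> set (special_adds ds rows)"
      proof
        assume "index_ideal t (insert (at j0 p) (X rows))"
        then show ?thesis unfolding loc using R by blast
      next
        assume a: "t = E8 \<and> (\<exists>m. insert (at j0 p) (X rows) = place shape1 m \<or> insert (at j0 p) (X rows) = place shape2 m)"
        then obtain m where "insert (at j0 p) (X rows) = place shape1 m \<or> insert (at j0 p) (X rows) = place shape2 m" by blast
        moreover from R have "fst p < window_size" by linarith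
        with R have "snd p \<notin> set (rows ! fst p)" using memX by simp
        ultimately have "p \<in> set (special_adds ds rows)"
          using set_special_adds(2)[OF adm conjunct1[OF a] top True] R by blast
        then show ?thesis using a by blast
      qed
    qed
    finally show ?thesis .
  next
    case False
    have "?L \<longleftrightarrow> p \<in> set (nonmembers ds rows) \<and> young_rows t ds (insert_label rows p)"
      using False by (simp add: add_list_def)
    also have "\<dots> \<longleftrightarrow> ?R"
    proof (cases "fst p < window_size - 1 \<and> at j0 p \<in> idx t \<and> snd p \<notin> set (rows ! fst p)")
      case True
      have "fst p \<noteq> 0"
      proof
        assume "fst p = 0"
        with True have "snd p \<in> set (cube_labels (info t (j0 + int 0)))" "snd p \<notin> set (rows ! 0)"
          by (auto simp: idx_def at_def)
        with admissibleD(2)[OF adm] show False by (auto simp: full_def)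
      qed
      then show ?thesis
        using index_young_insert[OF adm, of "fst p" "snd p", unfolded prod.collapse] True memX'
        unfolding set_nonmembers[OF wf] by auto
    next
      case False
      then show ?thesis unfolding set_nonmembers[OF wf] using memX' by auto
    qed
    finally show ?thesis .
  qed
qed

lemma remove_list_correct:
  assumes adm: "admissible rows" and full: "full rows 1" "full rows 2"
  shows "p \<in> set (remove_list t ds rows) \<longleftrightarrow> 0 < fst p \<and> fst p < window_size \<and> at j0 p \<in> X rows \<and>
    index_young t (X rows - {at j0 p})" (is "?L \<longleftrightarrow> ?R")
proof -
  note wf = admissibleD(1)[OF adm]
  have memX: "at j0 p \<in> X rows \<longleftrightarrow> snd p \<in> set (rows ! fst p)" if "fst p < window_size"
    using at_in_X[OF wf that, of "snd p"] by simp
  show ?thesis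
  proof (cases "closed_rows ds rows")
    case True
    have id: "index_ideal t (X rows)" using index_ideal_X[OF wf] True by simp
    have loc: "p \<in> set (local_removes ds rows) \<longleftrightarrow> fst p < window_size \<and> at j0 p \<in> X rows \<and>
       index_ideal t (X rows - {at j0 p})"
    proof -
      have ideal: "index_ideal t (X rows - {at j0 p}) \<longleftrightarrow>
          (\<forall>l\<in>set (rows ! Suc (fst p)). snd p \<notin> set (labels_below (info t (j0 + int (Suc (fst p)))) l))"
        if "Suc (fst p) < window_size" "at j0 p \<in> X rows"
      proof -
        have "index_ideal t (X rows - {at j0 p}) \<longleftrightarrow> (\<forall>l. (j0 + int (Suc (fst p)), l) \<in> X rows \<longrightarrow>
           snd p \<notin> set (labels_below (info t (j0 + int (Suc (fst p)))) l))"
          unfolding index_ideal_remove[OF id that(2)] by (auto simp: at_def algebra_simps)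
        then show ?thesis using at_in_X'[OF wf that(1)] by blast
      qed
      moreover have "Suc (fst p) < window_size" if "fst p < window_size" "at j0 p \<in> X rows"
      proof (rule ccontr)
        assume "\<not> ?thesis"
        then have "fst p = window_size - 1" using that by simp
        then show False using that memX admissibleD(3)[OF adm] by simp
      qed
      ultimately show ?thesis unfolding set_local_removes[OF wf] using memX by auto
    qed
    have pos: "0 < fst p" if r: "at j0 p \<in> X rows" "index_young t (X rows - {at j0 p})"
    proof -
      obtain k l where "at j0 p = at j0 (k, l)" "0 < k"
        using removable_candidate[OF adm full r] by blast
      then show ?thesis by (simp add: at_def)
    qed
    have "?L \<longleftrightarrow> p \<in> set (local_removes ds rows) \<or> t = E8 \<and> p \<in> set (special_removes ds rows)"
      using True by (simp add: remove_list_def)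
    also have "\<dots> \<longleftrightarrow> ?R"
    proof
      assume "p \<in> set (local_removes ds rows) \<or> t = E8 \<and> p \<in> set (special_removes ds rows)"
      then show ?R
      proof
        assume "p \<in> set (local_removes ds rows)"
        then show ?R unfolding loc using pos by (simp add: index_young_def)
      next
        assume a: "t = E8 \<and> p \<in> set (special_removes ds rows)"
        have "0 < fst p \<and> fst p < window_size \<and> snd p \<in> set (rows ! fst p) \<and> index_young t (X rows - {at j0 p})"
          by (rule set_special_removes(1)[OF adm full(1) conjunct1[OF a] True conjunct2[OF a]])
        then show ?R using memX by simp
      qed
    next
      assume R: ?R
      then have "index_ideal t (X rows - {at j0 p}) \<or> t = E8 \<and> (\<exists>m. X rows - {at j0 p} = place shape1 m \<or> X rows - {at j0 p} = place shape2 m)"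
        by (simp add: index_young_def)
      then show "p \<in> set (local_removes ds rows) \<or> t = E8 \<and> p \<in> set (special_removes ds rows)"
      proof
        assume "index_ideal t (X rows - {at j0 p})"
        then show ?thesis unfolding loc using R by blast
      next
        assume a: "t = E8 \<and> (\<exists>m. X rows - {at j0 p} = place shape1 m \<or> X rows - {at j0 p} = place shape2 m)"
        then obtain m where "X rows - {at j0 p} = place shape1 m \<or> X rows - {at j0 p} = place shape2 m" by blast
        moreover have "snd p \<in> set (rows ! fst p)" using R memX by simp
        ultimately have "p \<in> set (special_removes ds rows)"
          using set_special_removes(2)[OF adm full(1) conjunct1[OF a] True] R by blast
        then show ?thesis using a by blast
      qed
    qed
    finally show ?thesis .
  next
    case False
    have "?L \<longleftrightarrow> p \<in> set (members rows) \<and> young_rows t ds (delete_label rows p)"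
      using False by (simp add: remove_list_def)
    also have "\<dots> \<longleftrightarrow> ?R"
      using index_young_delete[OF adm, of "fst p" "snd p", unfolded prod.collapse] memX
      unfolding set_members[OF wf] by blast
    finally show ?thesis .
  qed
qed

end

section \<open>The choice rules in terms of rows\<close>

lemma addable_block_unique_max:
  assumes "A = {b, c}" "height b < height c"
  shows "arg_max height (\<lambda>x. x \<in> A) = c"
proof -
  have "is_arg_max height (\<lambda>x. x \<in> A) x \<longleftrightarrow> x = c" for x
    using assms by (auto simp: is_arg_max_def)
  then show ?thesis by (simp add: arg_max_def)
qed

lemma removable_block_unique_min:
  assumes "A = {b, c}" "height b < height c"
  shows "arg_min height (\<lambda>x. x \<in> A) = b"
proof -
  have "is_arg_min height (\<lambda>x. x \<in> A) x \<longleftrightarrow> x = b" for x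
    using assms by (auto simp: is_arg_min_def)
  then show ?thesis by (simp add: arg_min_def)
qed

lemma filter_pair_singleton:
  assumes "(case filter P [x, y] of [z] \<Rightarrow> Some z | _ \<Rightarrow> None) = Some z"
  shows "z \<in> {x, y} \<and> P z \<and> (\<forall>w\<in>{x, y}. P w \<longrightarrow> w = z) \<and> x \<noteq> y"
  using assms by (auto split: if_splits)

locale wall_frame = window_frame +
  fixes r :: nat
begin

abbreviation Bk :: "int \<times> nat \<Rightarrow> block" where "Bk \<equiv> index_block t r"
abbreviation pat :: pattern where "pat \<equiv> wall_pattern t r"
abbreviation B :: "nat \<times> nat \<Rightarrow> block" where "B q \<equiv> Bk (at j0 q)"

lemma Bk_eq_iff: "x \<in> idx t \<Longrightarrow> y \<in> idx t \<Longrightarrow> Bk x = Bk y \<longleftrightarrow> x = y"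
  using inj_on_index_block by (auto simp: inj_on_def)

lemma Bk_mem: "x \<in> idx t \<Longrightarrow> Bk x \<in> Bk ` X rows \<longleftrightarrow> x \<in> X rows"
  by (rule image_inj_mem[OF rep_subset])

lemma addable_eq:
  assumes adm: "admissible rows" and top: "rows ! (window_size - 2) = []"
  shows "addable t pat i (Bk ` X rows) = B ` set (of_colour i (add_list t ds rows))"
proof (intro subset_antisym subsetI)
  fix b assume "b \<in> addable t pat i (Bk ` X rows)"
  then obtain x where x: "x \<in> idx t" "b = Bk x" "label_colour (snd x) = i" "b \<notin> Bk ` X rows"
      "young_column t pat (insert b (Bk ` X rows))"
    unfolding addable_def blocks_wall_pattern by auto
  have nx: "x \<notin> X rows" using x(2,4) by blast
  have "insert b (Bk ` X rows) = Bk ` (insert x (X rows))" using x(2) by simp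
  then have y: "index_young t (insert x (X rows))"
    using x(5) young_column_index_block[of "insert x (X rows)" t r] x(1) rep_subset by simp
  obtain k l where k: "x = at j0 (k, l)" "0 < k" "k < window_size - 1"
    using addable_candidate[OF adm top x(1) nx y] by metis
  have "(k, l) \<in> set (add_list t ds rows)"
    unfolding add_list_correct[OF adm top] using k x(1) nx y by simp
  moreover have "label_colour l = i" using x(3) k(1) by (simp add: at_def)
  ultimately show "b \<in> B ` set (of_colour i (add_list t ds rows))"
    using x(2) k(1) by (auto simp: of_colour_def)
next
  fix b assume "b \<in> B ` set (of_colour i (add_list t ds rows))"
  then obtain q where q: "q \<in> set (add_list t ds rows)" "label_colour (snd q) = i" "b = B q"
    by (auto simp: of_colour_def)
  from q(1) have a: "at j0 q \<in> idx t" "at j0 q \<notin> X rows" "index_young t (insert (at j0 q) (X rows))"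
    unfolding add_list_correct[OF adm top] by auto
  have "insert b (Bk ` X rows) = Bk ` (insert (at j0 q) (X rows))" using q(3) by simp
  then have "young_column t pat (insert b (Bk ` X rows))"
    using young_column_index_block[of "insert (at j0 q) (X rows)" t r] a rep_subset by simp
  moreover have "b \<notin> Bk ` X rows" using Bk_mem[OF a(1)] a(2) q(3) by simp
  moreover have "snd (at j0 q) = snd q" by (simp add: at_def)
  ultimately show "b \<in> addable t pat i (Bk ` X rows)"
    unfolding addable_def blocks_wall_pattern using q a(1) by auto
qed

lemma removable_eq:
  assumes adm: "admissible rows" and full: "full rows 1" "full rows 2"
  shows "removable t pat i (Bk ` X rows) = B ` set (of_colour i (remove_list t ds rows))"
proof -
  have diff: "Bk ` X rows - {Bk x} = Bk ` (X rows - {x})" if "x \<in> X rows" for x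
    using that inj_on_image_set_diff[OF inj_on_index_block[of t r], of "X rows" "{x}"] rep_subset[of t j0 rows] by auto
  show ?thesis
  proof (intro subset_antisym subsetI)
    fix b assume "b \<in> removable t pat i (Bk ` X rows)"
    then obtain x where x: "x \<in> X rows" "b = Bk x" "label_colour (snd x) = i" "young_column t pat (Bk ` X rows - {b})"
      unfolding removable_def by auto
    then have y: "index_young t (X rows - {x})"
      using young_column_index_block[of "X rows - {x}" t r] rep_subset[of t j0 rows] diff[OF x(1)] by auto
    obtain k l where k: "x = at j0 (k, l)" "0 < k" "k < window_size"
      using removable_candidate[OF adm full x(1) y] by metis
    have "(k, l) \<in> set (remove_list t ds rows)"
      unfolding remove_list_correct[OF adm full] using k x(1) y by simp
    moreover have "label_colour l = i" using x(3) k(1) by (simp add: at_def)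
    ultimately show "b \<in> B ` set (of_colour i (remove_list t ds rows))"
      using x(2) k(1) by (auto simp: of_colour_def)
  next
    fix b assume "b \<in> B ` set (of_colour i (remove_list t ds rows))"
    then obtain q where q: "q \<in> set (remove_list t ds rows)" "label_colour (snd q) = i" "b = B q"
      by (auto simp: of_colour_def)
    from q(1) have a: "at j0 q \<in> X rows" "index_young t (X rows - {at j0 q})"
      unfolding remove_list_correct[OF adm full] by auto
    have "young_column t pat (Bk ` X rows - {b})"
      using young_column_index_block[of "X rows - {at j0 q}" t r] a rep_subset[of t j0 rows] diff[OF a(1)] q(3) by auto
    moreover have "snd (at j0 q) = snd q" by (simp add: at_def)
    ultimately show "b \<in> removable t pat i (Bk ` X rows)"
      unfolding removable_def using q a(1) by auto
  qed
qed

text \<open>Colour and label may differ only for 4 and 9; the rules ask for the colours 5 and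
  3.\<close>

lemma on_top_iff:
  assumes wf: "wf rows" and q: "0 < fst q" "fst q < window_size" "at j0 q \<in> idx t" and c: "c \<noteq> 4" "c \<noteq> 9"
  shows "on_top_of_colour (Bk ` X rows) c (B q) \<longleftrightarrow> on_top ds rows c q"
proof -
  have lc: "label_colour l = c \<longleftrightarrow> l = c" for l using c by (auto simp: label_colour_def)
  have e: "fst (at j0 q) - 1 = j0 + int (fst q - 1)" using q(1) by (simp add: at_def of_nat_diff)
  have "on_top_of_colour (Bk ` X rows) c (B q) \<longleftrightarrow> (\<exists>y\<in>X rows. snd y = c \<and> lies_below (Bk y) (B q))"
    by (auto simp: on_top_of_colour_def lc)
  also have "\<dots> \<longleftrightarrow> (\<exists>y\<in>X rows. snd y = c \<and> fst y = j0 + int (fst q - 1) \<and> snd y \<in> set (labels_below (info t (fst (at j0 q))) (snd (at j0 q))))"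
    using lies_below_iff[OF _ q(3), of _ r] rep_subset[of t j0 rows] unfolding e by blast
  also have "\<dots> \<longleftrightarrow> (j0 + int (fst q - 1), c) \<in> X rows \<and> c \<in> set (labels_below (info t (j0 + int (fst q))) (snd q))"
    by (auto simp: at_def intro!: bexI[of _ "(j0 + int (fst q - Suc 0), c)"])
  also have "\<dots> \<longleftrightarrow> on_top ds rows c q"
    using at_in_X'[OF wf, of "fst q - 1" c] q by (simp add: on_top_def ds_nth)
  finally show ?thesis .
qed

text \<open>A value \<open>Some z\<close> certifies that the maximum or the definite description in
  the rule is well determined and equal to \<open>z\<close>; between two blocks the arbitrary choice
  by \<open>SOME\<close> is never left to decide.\<close>

lemma pick_add_correct:
  assumes wf: "wf rows" and A: "addable t pat i (Bk ` X rows) = B ` set A"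
    and q: "\<forall>q\<in>set A. 0 < fst q \<and> fst q < window_size \<and> at j0 q \<in> idx t"
    and p: "pick_add t ds rows i A = Some z"
  shows "block_to_add t pat i (Bk ` X rows) = B z \<and> z \<in> set A"
proof -
  consider x where "A = [x]" | x y where "A = [x, y]"
    using p by (cases "(t, ds, rows, i, A)" rule: pick_add.cases) auto
  then show ?thesis
  proof cases
    case 1
    then show ?thesis using p by (simp add: block_to_add_def A)
  next
    case (2 x y)
    have t: "t = E8" using p 2 by (auto split: if_splits)
    have xy: "at j0 x \<in> idx t" "at j0 y \<in> idx t" using q 2 by auto
    have AA: "addable t pat i (Bk ` X rows) = {B x, B y}" using A 2 by simp
    have neq: "B x \<noteq> B y" if "x \<noteq> y"
      using Bk_eq_iff[OF xy] that by (auto simp: at_def prod_eq_iff)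
    show ?thesis
    proof (cases "i = 4")
      case False
      have "fst x < fst y \<and> z = y \<or> fst y < fst x \<and> z = x" using p 2 False t by (auto split: if_splits)
      then show ?thesis
      proof
        assume z: "fst x < fst y \<and> z = y"
        then have "x \<noteq> y" by auto
        then have "card {B x, B y} = 2" using neq by simp
        moreover have "arg_max height (\<lambda>b. b \<in> {B x, B y}) = B y"
          by (rule addable_block_unique_max) (use z in \<open>auto simp: at_def\<close>)
        ultimately show ?thesis using z False t 2 unfolding block_to_add_def AA by (auto simp: Let_def)
      next
        assume z: "fst y < fst x \<and> z = x"
        then have "x \<noteq> y" by auto
        then have "card {B x, B y} = 2" using neq by simp
        moreover have "arg_max height (\<lambda>b. b \<in> {B x, B y}) = B x"
          by (rule addable_block_unique_max[of _ "B y"]) (use z in \<open>auto simp: at_def\<close>)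
        ultimately show ?thesis using z False t 2 unfolding block_to_add_def AA by (auto simp: Let_def)
      qed
    next
      case True
      then have "(case filter (on_top ds rows 5) [x, y] of [z] \<Rightarrow> Some z | _ \<Rightarrow> None) = Some z"
        using p 2 t by simp
      from filter_pair_singleton[OF this]
      have z: "z \<in> {x, y}" "on_top ds rows 5 z" "\<forall>w\<in>{x, y}. on_top ds rows 5 w \<longrightarrow> w = z" "x \<noteq> y" by auto
      have o: "on_top_of_colour (Bk ` X rows) 5 (B w) \<longleftrightarrow> on_top ds rows 5 w" if "w \<in> {x, y}" for w
        using on_top_iff[OF wf, of w 5] q 2 that by auto
      have "(THE b. b \<in> {B x, B y} \<and> on_top_of_colour (Bk ` X rows) 5 b) = B z"
        using z o[of x] o[of y] by (intro the_equality) auto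
      moreover have "card {B x, B y} = 2" using neq z(4) by auto
      ultimately show ?thesis using True t 2 z(1) unfolding block_to_add_def AA by (auto simp: Let_def)
    qed
  qed
qed

lemma pick_remove_correct:
  assumes wf: "wf rows" and A: "removable t pat i (Bk ` X rows) = B ` set A"
    and q: "\<forall>q\<in>set A. 0 < fst q \<and> fst q < window_size \<and> at j0 q \<in> idx t"
    and p: "pick_remove t ds rows i A = Some z"
  shows "block_to_remove t pat i (Bk ` X rows) = B z \<and> z \<in> set A"
proof -
  consider x where "A = [x]" | x y where "A = [x, y]"
    using p by (cases "(t, ds, rows, i, A)" rule: pick_remove.cases) auto
  then show ?thesis
  proof cases
    case 1
    then show ?thesis using p by (simp add: block_to_remove_def A)
  next
    case (2 x y)
    have t: "t = E8" using p 2 by (auto split: if_splits)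
    have xy: "at j0 x \<in> idx t" "at j0 y \<in> idx t" using q 2 by auto
    have AA: "removable t pat i (Bk ` X rows) = {B x, B y}" using A 2 by simp
    have neq: "B x \<noteq> B y" if "x \<noteq> y"
      using Bk_eq_iff[OF xy] that by (auto simp: at_def prod_eq_iff)
    show ?thesis
    proof (cases "i = 4")
      case False
      have "fst x < fst y \<and> z = x \<or> fst y < fst x \<and> z = y" using p 2 False t by (auto split: if_splits)
      then show ?thesis
      proof
        assume z: "fst x < fst y \<and> z = x"
        then have "x \<noteq> y" by auto
        then have "card {B x, B y} = 2" using neq by simp
        moreover have "arg_min height (\<lambda>b. b \<in> {B x, B y}) = B x"
          by (rule removable_block_unique_min) (use z in \<open>auto simp: at_def\<close>)
        ultimately show ?thesis using z False t 2 unfolding block_to_remove_def AA by (auto simp: Let_def)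
      next
        assume z: "fst y < fst x \<and> z = y"
        then have "x \<noteq> y" by auto
        then have "card {B x, B y} = 2" using neq by simp
        moreover have "arg_min height (\<lambda>b. b \<in> {B x, B y}) = B y"
          by (rule removable_block_unique_min[of _ _ "B x"]) (use z in \<open>auto simp: at_def\<close>)
        ultimately show ?thesis using z False t 2 unfolding block_to_remove_def AA by (auto simp: Let_def)
      qed
    next
      case True
      then have "(case filter (on_top ds rows 3) [x, y] of [z] \<Rightarrow> Some z | _ \<Rightarrow> None) = Some z"
        using p 2 t by simp
      from filter_pair_singleton[OF this]
      have z: "z \<in> {x, y}" "on_top ds rows 3 z" "\<forall>w\<in>{x, y}. on_top ds rows 3 w \<longrightarrow> w = z" "x \<noteq> y" by auto
      have o: "on_top_of_colour (Bk ` X rows) 3 (B w) \<longleftrightarrow> on_top ds rows 3 w" if "w \<in> {x, y}" for w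
        using on_top_iff[OF wf, of w 3] q 2 that by auto
      have "(THE b. b \<in> {B x, B y} \<and> on_top_of_colour (Bk ` X rows) 3 b) = B z"
        using z o[of x] o[of y] by (intro the_equality) auto
      moreover have "card {B x, B y} = 2" using neq z(4) by auto
      ultimately show ?thesis using True t 2 z(1) unfolding block_to_remove_def AA by (auto simp: Let_def)
    qed
  qed
qed

lemma rows_ok_D:
  assumes "rows_ok t ds rows"
  shows "admissible rows" "full rows 1" "full rows 2" "rows ! (window_size - 2) = []"
    "\<And>k. k < window_size \<Longrightarrow> distinct (rows ! k)" "length rows = window_size"
proof -
  show len: "length rows = window_size" using assms by (simp add: rows_ok_def)
  have z: "zip ds rows = map (\<lambda>k. (ds ! k, rows ! k)) [0..<window_size]"
    by (intro nth_equalityI) (auto simp: len)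
  show "distinct (rows ! k)" if "k < window_size" for k
    using assms that len by (simp add: rows_ok_def list_all_length)
  have "\<forall>k<window_size. set (rows ! k) \<subseteq> set (cube_labels (ds ! k))"
    using assms unfolding rows_ok_def z by (auto simp: list_all_iff)
  then have wf: "wf rows" using len by (auto simp: wf_def ds_nth)
  have "take 3 (map (\<lambda>k. (ds ! k, rows ! k)) [0..<window_size]) = map (\<lambda>k. (ds ! k, rows ! k)) [0..<3]"
    by (simp add: take_map window_size_def)
  then have "\<forall>k<3. set (cube_labels (ds ! k)) \<subseteq> set (rows ! k)"
    using assms unfolding rows_ok_def z by (auto simp: list_all_iff)
  then have f: "full rows k" if "k < 3" for k
    using that by (auto simp: full_def ds_nth window_size_def)
  from f show "full rows 1" "full rows 2" by auto
  have e: "rows ! k = []" if "window_size - 2 \<le> k" "k < window_size" for k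
  proof -
    have "list_all (\<lambda>r. r = []) (drop (window_size - 2) rows)" using assms by (simp add: rows_ok_def)
    then have "\<forall>n<window_size - (window_size - 2). rows ! (window_size - 2 + n) = []"
      by (simp add: list_all_length len)
    moreover have "k - (window_size - 2) < window_size - (window_size - 2)" using that by linarith
    ultimately have "rows ! (window_size - 2 + (k - (window_size - 2))) = []" by blast
    then show ?thesis using that(1) by simp
  qed
  from e show "rows ! (window_size - 2) = []" by (simp add: window_size_def)
  show "admissible rows"
    using wf f[of 0] e[of "window_size - 1"] assms by (simp add: admissible_def rows_ok_def window_size_def)
qed

context
  fixes rows assumes ok: "rows_ok t ds rows"
begin

lemma A_eq: "addable t pat i (Bk ` X rows) = B ` set (of_colour i (add_list t ds rows))"
  by (rule addable_eq[OF rows_ok_D(1,4)[OF ok]])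

lemma R_eq: "removable t pat i (Bk ` X rows) = B ` set (of_colour i (remove_list t ds rows))"
  by (rule removable_eq[OF rows_ok_D(1,2,3)[OF ok]])

lemma A_range: "\<forall>q\<in>set (of_colour i (add_list t ds rows)). 0 < fst q \<and> fst q < window_size \<and> at j0 q \<in> idx t"
  unfolding of_colour_def set_filter
  using add_list_correct[OF rows_ok_D(1,4)[OF ok]] by (auto simp: window_size_def)

lemma R_range: "\<forall>q\<in>set (of_colour i (remove_list t ds rows)). 0 < fst q \<and> fst q < window_size \<and> at j0 q \<in> idx t"
  unfolding of_colour_def set_filter
  using remove_list_correct[OF rows_ok_D(1,2,3)[OF ok]] rep_subset[of t j0 rows] by auto

text \<open>After the addition \<open>rows_ok\<close> may fail, as the row below the top one may be
  occupied; \<open>admissible\<close> and the full rows at the bottom are enough to list the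
  removable blocks anew.\<close>

lemma pick_insert:
  assumes b: "b \<in> set (add_list t ds rows)"
    and p: "pick_remove t ds (insert_label rows b) i (of_colour i (remove_list t ds (insert_label rows b))) = Some z"
  shows "block_to_remove t pat i (insert (B b) (Bk ` X rows)) = B z \<and> at j0 z \<in> idx t"
proof -
  let ?S = "insert_label rows b"
  note adm = rows_ok_D(1)[OF ok]
  note wf = admissibleD(1)[OF adm]
  from b have b': "0 < fst b" "fst b < window_size - 1" "at j0 b \<in> idx t" "index_young t (insert (at j0 b) (X rows))"
    unfolding add_list_correct[OF rows_ok_D(1,4)[OF ok]] by auto
  have k: "fst b < window_size" and i: "at j0 (fst b, snd b) \<in> idx t" using b' by auto
  note w = wf_insert[OF wf k i, unfolded prod.collapse]
  have "set (?S ! (window_size - 1)) = {}"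
    unfolding w(3) using admissibleD(3)[OF adm] b'(2) by auto
  then have "?S ! (window_size - 1) = []" by simp
  moreover have f: "full ?S k" if "full rows k" for k using that unfolding full_def w(3) by auto
  moreover have "young_rows t ds ?S"
    using index_young_insert[OF adm b'(1,2) i, unfolded prod.collapse] b'(4) by simp
  ultimately have "admissible ?S" using w(1) admissibleD(2)[OF adm] by (simp add: admissible_def)
  then have R: "removable t pat i (Bk ` X ?S) = B ` set (of_colour i (remove_list t ds ?S))"
    and c: "\<And>q. q \<in> set (remove_list t ds ?S) \<longleftrightarrow> 0 < fst q \<and> fst q < window_size \<and> at j0 q \<in> X ?S \<and>
      index_young t (X ?S - {at j0 q})"
    using removable_eq remove_list_correct f rows_ok_D(2,3)[OF ok] by blast+
  have rg: "\<forall>q\<in>set (of_colour i (remove_list t ds ?S)). 0 < fst q \<and> fst q < window_size \<and> at j0 q \<in> idx t"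
    unfolding of_colour_def set_filter using c rep_subset[of t j0 ?S] by auto
  from pick_remove_correct[OF w(1) R rg p] rg show ?thesis using w(2) by auto
qed

lemma pick_delete:
  assumes b: "b \<in> set (remove_list t ds rows)"
    and p: "pick_add t ds (delete_label rows b) i (of_colour i (add_list t ds (delete_label rows b))) = Some z"
  shows "block_to_add t pat i (Bk ` X rows - {B b}) = B z \<and> at j0 z \<in> idx t"
proof -
  let ?S = "delete_label rows b"
  note adm = rows_ok_D(1)[OF ok]
  note wf = admissibleD(1)[OF adm]
  from b have b': "0 < fst b" "fst b < window_size" "at j0 b \<in> X rows" "index_young t (X rows - {at j0 b})"
    unfolding remove_list_correct[OF rows_ok_D(1,2,3)[OF ok]] by auto
  note w = wf_delete[OF wf b'(2), of "snd b", unfolded prod.collapse]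
  have "set (?S ! k) = {}" if "rows ! k = []" for k
    unfolding w(3) using that by auto
  then have e: "?S ! k = []" if "rows ! k = []" for k using that by simp
  moreover have "full ?S 0" using admissibleD(2)[OF adm] b'(1) unfolding full_def w(3) by auto
  moreover have "young_rows t ds ?S"
    using index_young_delete[OF adm b'(1,2), of "snd b", unfolded prod.collapse] b'(4) by simp
  ultimately have a: "admissible ?S" using w(1) admissibleD(3)[OF adm] by (simp add: admissible_def)
  have top: "?S ! (window_size - 2) = []" using e rows_ok_D(4)[OF ok] by blast
  have A: "addable t pat i (Bk ` X ?S) = B ` set (of_colour i (add_list t ds ?S))"
    by (rule addable_eq[OF a top])
  have rg: "\<forall>q\<in>set (of_colour i (add_list t ds ?S)). 0 < fst q \<and> fst q < window_size \<and> at j0 q \<in> idx t"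
    unfolding of_colour_def set_filter using add_list_correct[OF a top] by (auto simp: window_size_def)
  from pick_add_correct[OF w(1) A rg p] rg
  have "block_to_add t pat i (Bk ` (X rows - {at j0 b})) = B z \<and> at j0 z \<in> idx t" using w(2) by auto
  moreover have "Bk ` (X rows - {at j0 b}) = Bk ` X rows - {B b}"
    using inj_on_image_set_diff[OF inj_on_index_block[of t r], of "X rows" "{at j0 b}"] rep_subset[of t j0 rows] b'(3) by auto
  ultimately show ?thesis by simp
qed

end

end

section \<open>Weights of columns\<close>

lemma relative_weight_Union:
  assumes "finite F" "F \<inter> A = {}" "finite (A - g)" "finite (g - A)"
  shows "relative_weight t i g (A \<union> F) = relative_weight t i g A - (\<Sum>b\<in>F. cartan t i (colour b))"
  using assms(1,2)
proof (induction F)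
  case (insert b F)
  have "finite ((A \<union> F) - g)" "finite (g - (A \<union> F))"
    using insert.hyps assms(3,4) by (auto simp: Un_Diff intro: finite_subset[OF _ assms(4)])
  with relative_weight_insert[of b "A \<union> F" g t i] insert show ?case by simp
qed simp

text \<open>Inside a finite set \<open>F\<close> that contains all differences, each relative weight
  is a difference of two finite sums, and these telescope.\<close>

lemma relative_weight_cocycle:
  assumes "finite (A - B)" "finite (B - A)" "finite (B - C)" "finite (C - B)"
  shows "relative_weight t i A C = relative_weight t i A B + relative_weight t i B C"
proof -
  define F where "F = (A - B) \<union> (B - A) \<union> (B - C) \<union> (C - B)"
  let ?s = "\<lambda>M. \<Sum>b\<in>M. cartan t i (colour b)"
  have F: "finite F" using assms by (simp add: F_def)
  have *: "relative_weight t i M N = ?s (F \<inter> M) - ?s (F \<inter> N)" if "M - N \<subseteq> F" "N - M \<subseteq> F" for M N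
  proof -
    have "?s (F \<inter> M) = ?s (M - N) + ?s (F \<inter> M \<inter> N)"
      using that F by (subst sum.union_disjoint[symmetric]) (auto intro: finite_subset[OF _ F] arg_cong2[where f = sum])
    moreover have "?s (F \<inter> N) = ?s (N - M) + ?s (F \<inter> M \<inter> N)"
      using that F by (subst sum.union_disjoint[symmetric]) (auto intro: finite_subset[OF _ F] arg_cong2[where f = sum])
    ultimately show ?thesis by (simp add: relative_weight_def)
  qed
  show ?thesis by (subst (1 2 3) *) (auto simp: F_def)
qed

text \<open>Certifies the adjacency lists used in the evaluation against the Dynkin
  diagrams.\<close>

lemma cartan_neighbours:
  assumes "i \<le> rank t" "c \<le> rank t"
  shows "sum_list (map (\<lambda>n. if n = c then 1 else 0) (neighbours t ! i)) - 2 * (if i = c then 1 else 0) = - cartan t i c"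
proof -
  have "\<forall>i<Suc (rank t). \<forall>c<Suc (rank t).
      sum_list (map (\<lambda>n. if n = c then 1 else 0) (neighbours t ! i)) - 2 * (if i = c then 1 else 0) = - cartan t i c"
    by (cases t) (simp_all add: All_less_Suc cartan_def doubleton_eq_iff numeral_eq_Suc)
  then show ?thesis using assms by (auto simp: less_Suc_eq_le)
qed

lemma neighbours_facts: "length (neighbours t) = Suc (rank t)" "\<forall>ns\<in>set (neighbours t). \<forall>n\<in>set ns. n \<le> rank t"
  by (cases t; simp)+

lemma count_neighbours:
  assumes "i \<le> rank t" "\<forall>c\<in>set cs. c \<le> rank t"
  shows "sum_list (map (\<lambda>n. int (count_list cs n)) (neighbours t ! i)) - 2 * int (count_list cs i) = - sum_list (map (cartan t i) cs)"
  using assms(2)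
proof (induction cs)
  case (Cons c cs)
  have "sum_list (map (\<lambda>n. int (count_list (c # cs) n)) ns) = sum_list (map (\<lambda>n. int (count_list cs n)) ns)
      + sum_list (map (\<lambda>n. if n = c then 1 else 0) ns)" for ns
    by (induction ns) auto
  then show ?case using Cons cartan_neighbours[OF assms(1), of c] by auto
qed simp

lemma lower_levels_nth:
  assumes "length L = Suc (rank t)" "i \<le> rank t" "\<forall>l\<in>set ls. label_colour l \<le> rank t"
  shows "lower_levels t L ls ! i = L ! i - sum_list (map (\<lambda>l. cartan t i (label_colour l)) ls)"
    and "length (lower_levels t L ls) = Suc (rank t)"
proof -
  let ?cs = "map label_colour ls"
  let ?n = "map (\<lambda>i. int (count_list ?cs i)) [0..<length L]"
  have nb: "map ((!) ?n) ns = map (\<lambda>n. int (count_list ?cs n)) ns" if "ns \<in> set (neighbours t)" for ns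
    using neighbours_facts(2) that assms(1) by (auto simp: less_Suc_eq_le simp del: upt_Suc)
  have "neighbours t ! i \<in> set (neighbours t)"
    using assms(2) neighbours_facts(1)[of t] by (intro nth_mem) simp
  then have "sum_list (map ((!) ?n) (neighbours t ! i)) = sum_list (map (\<lambda>n. int (count_list ?cs n)) (neighbours t ! i))"
    by (simp only: nb)
  moreover have "lower_levels t L ls ! i = L ! i - 2 * int (count_list ?cs i) + sum_list (map ((!) ?n) (neighbours t ! i))"
    using assms(1,2) neighbours_facts(1)[of t] by (simp add: lower_levels_def Let_def less_Suc_eq_le del: upt_Suc)
  ultimately have "lower_levels t L ls ! i = L ! i - 2 * int (count_list ?cs i) + sum_list (map (\<lambda>n. int (count_list ?cs n)) (neighbours t ! i))"
    by (simp only:)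
  then show "lower_levels t L ls ! i = L ! i - sum_list (map (\<lambda>l. cartan t i (label_colour l)) ls)"
    using count_neighbours[OF assms(2), of ?cs] assms(3) by (simp add: comp_def)
  show "length (lower_levels t L ls) = Suc (rank t)"
    using assms(1) neighbours_facts(1)[of t] by (simp add: lower_levels_def Let_def)
qed

definition cube_weight :: "affine_type \<Rightarrow> nat \<Rightarrow> int \<Rightarrow> int" where
  "cube_weight t i j = sum_list (map (\<lambda>l. cartan t i (label_colour l)) (cube_labels (info t j)))"

lemma label_colour_rank: "l \<in> set (cube_labels (info t j)) \<Longrightarrow> label_colour l \<le> rank t"
  using label_colour_index[of j l t] by (auto simp: idx_def index_set_def)

lemma distinct_cube_labels: "distinct (cube_labels (info t j))"
  by (simp add: cube_labels_info section_labels_def)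

lemma length_initial_levels: "length (initial_levels t) = Suc (rank t)"
  by (cases t) simp_all

lemma info_of_phase: "s < period t \<Longrightarrow> phase_info t s = info t (int s)"
  by (simp add: info_def phase_def)

lemma phase_levels_nth:
  assumes "s \<le> period t" "i \<le> rank t"
  shows "phase_levels t s ! i = initial_levels t ! i - (\<Sum>k<s. cube_weight t i (int k))"
    and "length (phase_levels t s) = Suc (rank t)"
proof -
  let ?ls = "concat (map (\<lambda>k. cube_labels (phase_info t k)) [0..<s])"
  have "\<forall>l\<in>set ?ls. label_colour l \<le> rank t"
    using label_colour_rank assms(1) by (fastforce simp: info_of_phase)
  note * = lower_levels_nth[OF length_initial_levels assms(2) this]
  have "sum_list (map (\<lambda>l. cartan t i (label_colour l)) ?ls) = (\<Sum>k<s. cube_weight t i (int k))"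
    using assms(1) by (induction s) (auto simp: cube_weight_def info_of_phase)
  then show "phase_levels t s ! i = initial_levels t ! i - (\<Sum>k<s. cube_weight t i (int k))"
    using * by (simp add: phase_levels_def)
  show "length (phase_levels t s) = Suc (rank t)" using * by (simp add: phase_levels_def)
qed

text \<open>The listed cubes contain each colour as often as \<open>\<delta>\<close> contains its
  simple root, and \<open>\<delta>\<close> pairs to 0 with every coroot.\<close>

lemma phase_levels_period: "phase_levels t (period t) = initial_levels t"
proof -
  have "phase_levels E6 (period E6) = initial_levels E6" by code_simp
  moreover have "phase_levels E7 (period E7) = initial_levels E7" by code_simp
  moreover have "phase_levels E8 (period E8) = initial_levels E8" by code_simp
  ultimately show ?thesis by (cases t) simp_all
qed

lemma phase_Suc: "phase t (j + 1) = (if Suc (phase t j) = period t then 0 else Suc (phase t j))"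
  using phase_Suc_period(1)[of t "j + 1"] phase_less[of t j] phase_less[of t "j + 1"] by (auto split: if_splits)

lemma phase_levels_step:
  assumes "i \<le> rank t"
  shows "phase_levels t (phase t (j + 1)) ! i = phase_levels t (phase t j) ! i - cube_weight t i j"
proof -
  have c: "cube_weight t i (int (phase t j)) = cube_weight t i j"
    using info_of_phase[OF phase_less[of t j]] by (simp add: cube_weight_def info_def)
  have *: "phase_levels t (Suc (phase t j)) ! i = phase_levels t (phase t j) ! i - cube_weight t i j"
    using phase_levels_nth(1)[OF _ assms, of "Suc (phase t j)"] phase_levels_nth(1)[OF _ assms, of "phase t j"]
      phase_less[of t j] c by simp
  show ?thesis
  proof (cases "Suc (phase t j) = period t")
    case True
    have "phase_levels t 0 ! i = initial_levels t ! i"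
      using phase_levels_nth(1)[OF _ assms, of 0] by simp
    then show ?thesis using True * phase_levels_period[of t] by (simp add: phase_Suc)
  qed (simp add: phase_Suc *)
qed

text \<open>The reference column has its flat top just below index 0, and its weight is
  \<open>initial_levels\<close>.\<close>

definition column_wt :: "affine_type \<Rightarrow> nat \<Rightarrow> nat \<Rightarrow> block set \<Rightarrow> int" where
  "column_wt t r i y = initial_levels t ! i + relative_weight t i (index_block t r ` rep t 0 []) y"

lemma finite_rep_diff: "finite (rep t j rows - rep t j' rows')"
proof (rule finite_subset)
  show "rep t j rows - rep t j' rows' \<subseteq> (SIGMA k:{j'..<j + int (length rows)}. set (cube_labels (info t k)))"
    by (auto simp: rep_def idx_def)
qed auto

lemma finite_block_diff:
  "finite (index_block t r ` rep t j rows - index_block t r ` rep t j' rows')"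
  by (rule finite_subset[OF _ finite_imageI[OF finite_rep_diff[of t j rows j' rows'], of "index_block t r"]]) auto

text \<open>The difference \<open>d\<close> of the two sides does not change when a whole cube is
  filled and vanishes at 0; the induction runs in both directions.\<close>

lemma column_wt_below:
  assumes "i \<le> rank t"
  shows "column_wt t r i (index_block t r ` rep t j []) = phase_levels t (phase t j) ! i"
proof -
  define d where "d j = column_wt t r i (index_block t r ` rep t j []) - phase_levels t (phase t j) ! i" for j
  have step: "d (j + 1) = d j" for j
  proof -
    let ?F = "index_block t r ` ({j} \<times> set (cube_labels (info t j)))"
    have e: "rep t (j + 1) [] = rep t j [] \<union> {j} \<times> set (cube_labels (info t j))"
      by (auto simp: rep_def idx_def)
    have sub: "{j} \<times> set (cube_labels (info t j)) \<subseteq> idx t" by (auto simp: idx_def)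
    have "?F \<inter> index_block t r ` rep t j [] = index_block t r ` ({j} \<times> set (cube_labels (info t j)) \<inter> rep t j [])"
      using inj_on_image_Int[OF inj_on_index_block sub rep_subset] by simp
    also have "\<dots> = {}" by (auto simp: rep_def)
    finally have disj: "?F \<inter> index_block t r ` rep t j [] = {}" .
    have "(\<Sum>b\<in>?F. cartan t i (colour b)) = (\<Sum>x\<in>{j} \<times> set (cube_labels (info t j)). cartan t i (label_colour (snd x)))"
      by (subst sum.reindex[OF inj_on_subset[OF inj_on_index_block sub]]) simp
    also have "\<dots> = (\<Sum>l\<in>set (cube_labels (info t j)). cartan t i (label_colour l))"
      by (subst sum.cartesian_product[symmetric, of "\<lambda>j l. cartan t i (label_colour l)", unfolded case_prod_beta]) simp
    also have "\<dots> = cube_weight t i j"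
      unfolding cube_weight_def by (rule sum_list_distinct_conv_sum_set[OF distinct_cube_labels, symmetric])
    finally have "column_wt t r i (index_block t r ` rep t (j + 1) []) = column_wt t r i (index_block t r ` rep t j []) - cube_weight t i j"
      using relative_weight_Union[OF _ disj finite_block_diff[of t r j "[]" 0 "[]"] finite_block_diff[of t r 0 "[]" j "[]"]]
      unfolding e image_Un column_wt_def by simp
    then show ?thesis using phase_levels_step[OF assms, of j] by (simp add: d_def)
  qed
  have "d 0 = 0"
    using phase_levels_nth(1)[OF _ assms, of 0] by (simp add: d_def column_wt_def relative_weight_def phase_def)
  moreover have "d j = d 0"
  proof (induction j rule: int_induct[of _ 0])
    case (step2 i)
    then show ?case using step[of "i - 1"] by simp
  qed (use step in auto)
  ultimately show ?thesis by (simp add: d_def)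
qed

context wall_frame
begin

lemma column_wt_rows:
  assumes ok: "rows_ok t ds rows" and i: "i \<le> rank t"
  shows "column_wt t r i (Bk ` X rows) = lower_levels t (phase_levels t (phase t j0)) (concat rows) ! i"
    and "length (lower_levels t (phase_levels t (phase t j0)) (concat rows)) = Suc (rank t)"
proof -
  note wf = admissibleD(1)[OF rows_ok_D(1)[OF ok]]
  note len = rows_ok_D(6)[OF ok]
  define F where "F = (SIGMA k:{..<window_size}. set (rows ! k))"
  have e: "X rows = rep t j0 [] \<union> at j0 ` F"
  proof (intro subset_antisym subsetI)
    fix x assume "x \<in> X rows"
    then show "x \<in> rep t j0 [] \<union> at j0 ` F"
      using wf by (cases rule: X_cases) (auto simp: rep_def F_def)
  next
    fix x assume "x \<in> rep t j0 [] \<union> at j0 ` F"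
    then show "x \<in> X rows" using at_in_X[OF wf] by (auto simp: F_def) (auto simp: rep_def)
  qed
  have inj: "inj_on (at j0) F" by (auto simp: inj_on_def at_def prod_eq_iff)
  have sub: "at j0 ` F \<subseteq> idx t" using e rep_subset by blast
  have "Bk ` (at j0 ` F) \<inter> Bk ` rep t j0 [] = Bk ` (at j0 ` F \<inter> rep t j0 [])"
    using inj_on_image_Int[OF inj_on_index_block sub rep_subset] by simp
  also have "\<dots> = {}" by (auto simp: rep_def at_def)
  finally have disj: "Bk ` at j0 ` F \<inter> Bk ` rep t j0 [] = {}" .
  have fin: "finite F" by (simp add: F_def)
  have "(\<Sum>b\<in>Bk ` at j0 ` F. cartan t i (colour b)) = (\<Sum>q\<in>F. cartan t i (label_colour (snd q)))"
    by (subst sum.reindex[OF inj_on_subset[OF inj_on_index_block sub]], subst sum.reindex[OF inj]) (simp add: at_def)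
  also have "\<dots> = (\<Sum>k<window_size. \<Sum>l\<in>set (rows ! k). cartan t i (label_colour l))"
    unfolding F_def by (subst sum.Sigma) (auto simp: case_prod_beta)
  also have "\<dots> = (\<Sum>k<window_size. sum_list (map (\<lambda>l. cartan t i (label_colour l)) (rows ! k)))"
    using rows_ok_D(5)[OF ok] by (intro sum.cong) (auto simp: sum_list_distinct_conv_sum_set)
  also have "\<dots> = sum_list (map (\<lambda>l. cartan t i (label_colour l)) (concat rows))"
  proof -
    have "sum_list (map g (concat xs)) = sum_list (map (\<lambda>x. sum_list (map g x)) xs)" for g :: "nat \<Rightarrow> int" and xs
      by (induction xs) auto
    then show ?thesis by (simp add: sum_list_sum_nth[of "map _ rows"] len atLeast0LessThan)
  qed
  finally have s: "(\<Sum>b\<in>Bk ` at j0 ` F. cartan t i (colour b)) = sum_list (map (\<lambda>l. cartan t i (label_colour l)) (concat rows))" .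
  have "column_wt t r i (Bk ` X rows) = column_wt t r i (Bk ` rep t j0 []) - sum_list (map (\<lambda>l. cartan t i (label_colour l)) (concat rows))"
    using relative_weight_Union[OF _ disj finite_block_diff[of t r j0 "[]" 0 "[]"] finite_block_diff[of t r 0 "[]" j0 "[]"]] fin
    unfolding e image_Un column_wt_def s[symmetric] by simp
  moreover have "\<forall>l\<in>set (concat rows). label_colour l \<le> rank t"
    using wf label_colour_rank len by (fastforce simp: wf_def in_set_conv_nth)
  note lower_levels_nth[OF phase_levels_nth(2)[OF less_imp_le[OF phase_less] i] i this]
  ultimately show "column_wt t r i (Bk ` X rows) = lower_levels t (phase_levels t (phase t j0)) (concat rows) ! i"
    and "length (lower_levels t (phase_levels t (phase t j0)) (concat rows)) = Suc (rank t)"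
    using column_wt_below[OF i] by simp_all
qed

end

section \<open>Every Young column is a checked state\<close>

lemma phase_ok_all:
  assumes "s < period t"
  shows "phase_ok t s"
proof (cases t)
  case E6
  with assms have "s = 0 \<or> s = 1 \<or> s = 2 \<or> s = 3 \<or> s = 4 \<or> s = 5" by (simp add: period_def) linarith
  then show ?thesis unfolding E6
    using phase_ok_E6_0 phase_ok_E6_1 phase_ok_E6_2 phase_ok_E6_3 phase_ok_E6_4 phase_ok_E6_5 by (elim disjE) simp_all
next
  case E7
  with assms have "s = 0 \<or> s = 1 \<or> s = 2 \<or> s = 3 \<or> s = 4 \<or> s = 5 \<or> s = 6 \<or> s = 7" by (simp add: period_def) linarith
  then show ?thesis unfolding E7
    using phase_ok_E7_0 phase_ok_E7_1 phase_ok_E7_2 phase_ok_E7_3 phase_ok_E7_4 phase_ok_E7_5 phase_ok_E7_6 phase_ok_E7_7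
    by (elim disjE) simp_all
next
  case E8
  with assms have "s = 0 \<or> s = 1 \<or> s = 2 \<or> s = 3 \<or> s = 4 \<or> s = 5 \<or> s = 6 \<or> s = 7 \<or> s = 8 \<or> s = 9"
    by simp presburger
  then show ?thesis unfolding E8
    using phase_ok_E8_0 phase_ok_E8_1 phase_ok_E8_2 phase_ok_E8_3 phase_ok_E8_4 phase_ok_E8_5 phase_ok_E8_6 phase_ok_E8_7
      phase_ok_E8_8 phase_ok_E8_9
    by (elim disjE) simp_all
qed

lemma states_ok:
  assumes "rows \<in> set (states t (phase t j0))"
  shows "state_ok t (window t (phase t j0)) (phase_levels t (phase t j0)) rows"
  using phase_ok_all[OF phase_less[of t j0]] assms by (simp add: phase_ok_def Let_def list_all_iff)

lemma filter_in_subseqs: "filter P xs \<in> set (subseqs xs)"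
  by (induction xs) (auto simp: Let_def)

lemma window_eq: "window t (phase t j0) = map (\<lambda>k. info t (j0 + int k)) [0..<window_size]"
  by (intro nth_equalityI) (auto simp: nth_window)

text \<open>One block forces a full cube \<open>window_size\<close> below it, fullness passes
  downwards, and the column is bounded above; hence there is a lowest incomplete cube.\<close>

lemma index_ideal_frontier:
  assumes "index_ideal t X"
  obtains j1 where "\<And>x. x \<in> idx t \<Longrightarrow> fst x < j1 \<Longrightarrow> x \<in> X" "\<exists>l. (j1, l) \<in> idx t - X"
proof -
  define F where "F j \<longleftrightarrow> (\<forall>l. (j, l) \<in> idx t \<longrightarrow> (j, l) \<in> X)" for j
  have sub: "X \<subseteq> idx t" and closed: "\<And>j l l'. (j, l) \<in> X \<Longrightarrow> l' \<in> set (labels_below (info t j) l) \<Longrightarrow> (j - 1, l') \<in> X"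
    using assms unfolding index_ideal_def by fastforce+
  have down: "F (j - 1)" if "F j" for j
    unfolding F_def
  proof (intro allI impI)
    fix l' assume "(j - 1, l') \<in> idx t"
    from labels_below_cover[OF this] obtain l where "(j, l) \<in> idx t" "l' \<in> set (labels_below (info t j) l)" by blast
    with that closed show "(j - 1, l') \<in> X" by (auto simp: F_def)
  qed
  have desc: "\<forall>l\<in>set ls. (j, l) \<in> X \<Longrightarrow> \<forall>l\<in>set (descend (map (\<lambda>k. info t (j - int k)) [0..<n]) ls). (j - int n, l) \<in> X" for n j ls
  proof (induction n arbitrary: j ls)
    case (Suc n)
    have "[0..<Suc n] = 0 # map Suc [0..<n]" by (simp add: map_Suc_upt upt_conv_Cons del: upt_Suc)
    then have "map (\<lambda>k. info t (j - int k)) [0..<Suc n] = info t j # map (\<lambda>k. info t (j - 1 - int k)) [0..<n]"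
      by (simp add: comp_def algebra_simps del: upt_Suc)
    moreover have "\<forall>l\<in>set (remdups (concat (map (labels_below (info t j)) ls))). (j - 1, l) \<in> X"
      using Suc.prems closed by auto
    from Suc.IH[OF this] show ?case unfolding calculation by (simp add: algebra_simps)
  qed simp
  obtain x where x: "x \<in> X" using assms by (auto simp: index_ideal_def)
  define a where "a = fst x - int window_size"
  have a: "F a"
    unfolding F_def a_def
    using desc[of "[snd x]" "fst x" window_size] x descend_info[of "fst x" "snd x" t] sub by auto
  obtain K where K: "\<forall>x\<in>X. fst x \<le> K" using assms by (auto simp: index_ideal_def)
  have notF: "\<not> F j" if "j > K" for j
    using labels_E8_nonempty[of j t] K that by (force simp: F_def)
  have "\<exists>j. F (j - 1) \<and> \<not> F j"
  proof (rule ccontr)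
    assume "\<not> ?thesis"
    then have up: "F (j + 1)" if "F j" for j using that by (metis add_diff_cancel_right')
    have "F j" if "a \<le> j" for j using that by (induction rule: int_ge_induct) (use a up in auto)
    then have "F (max a (K + 1))" by simp
    moreover have "K < max a (K + 1)" by linarith
    ultimately show False using notF by blast
  qed
  then obtain j1 where j1: "F (j1 - 1)" "\<not> F j1" by blast
  have "F j" if "j \<le> j1 - 1" for j
    using that by (induction rule: int_le_induct) (use j1 down in auto)
  then have "x \<in> X" if "x \<in> idx t" "fst x < j1" for x
    using that by (metis F_def prod.collapse zle_diff1_eq)
  moreover have "\<exists>l. (j1, l) \<in> idx t - X" using j1(2) by (auto simp: F_def)
  ultimately show ?thesis by (rule that)
qed

lemma index_ideal_states:
  assumes X: "index_ideal t X"
  shows "\<exists>j0 rows. rows \<in> set (states t (phase t j0)) \<and> X = rep t j0 rows"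
proof -
  obtain j1 where lo: "\<And>x. x \<in> idx t \<Longrightarrow> fst x < j1 \<Longrightarrow> x \<in> X" and nf: "\<exists>l. (j1, l) \<in> idx t - X"
    using index_ideal_frontier[OF X] by metis
  \<comment> \<open>The window starts with three full cubes under the lowest incomplete one.\<close>
  define j0 where "j0 = j1 - 3"
  interpret window_frame t j0 .
  have sub: "X \<subseteq> idx t" and closed: "\<And>j l l'. (j, l) \<in> X \<Longrightarrow> l' \<in> set (labels_below (info t j) l) \<Longrightarrow> (j - 1, l') \<in> X"
    using X unfolding index_ideal_def by fastforce+
  define row where "row k = filter (\<lambda>l. (j0 + int k, l) \<in> X) (cube_labels (info t (j0 + int k)))" for k
  have row: "l \<in> set (row k) \<longleftrightarrow> (j0 + int k, l) \<in> X" for k l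
    using sub by (auto simp: row_def idx_def)
  define rows where "rows = map row [0..<window_size]"
  have full_row: "row k = cube_labels (info t (j0 + int k))" if "k < 3" for k
    using lo that by (auto simp: row_def filter_id_conv idx_def j0_def)
  have empty_Suc: "row (Suc k) = []" if "row k = []" for k
  proof (rule ccontr)
    assume "row (Suc k) \<noteq> []"
    then obtain l where "l \<in> set (row (Suc k))" by (meson hd_in_set)
    then have l: "(j0 + int (Suc k), l) \<in> X" by (simp add: row)
    then have "labels_below (info t (j0 + int (Suc k))) l \<noteq> []" using labels_below_nonempty sub by blast
    then have "hd (labels_below (info t (j0 + int (Suc k))) l) \<in> set (labels_below (info t (j0 + int (Suc k))) l)" by simp
    from closed[OF l this] have "hd (labels_below (info t (j0 + int (Suc k))) l) \<in> set (row k)"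
      by (simp add: row)
    with that show False by simp
  qed
  have empty_ge: "row k = []" if "n \<le> k" "row n = []" for n k
    using that by (induction rule: dec_induct) (auto intro: empty_Suc)
  have ext: "n \<le> window_size \<Longrightarrow> 0 < n \<Longrightarrow> map row [n..<window_size] \<in> set (extend_rows (map (\<lambda>k. info t (j0 + int k)) [n..<window_size]) (row (n - 1)))" for n
  proof (induction rule: inc_induct)
    case base
    then show ?case by simp
  next
    case (step n)
    have u: "[n..<window_size] = n # [Suc n..<window_size]" using step.hyps by (simp add: upt_conv_Cons)
    show ?case
    proof (cases "row (n - 1) = []")
      case True
      have "map row [n..<window_size] = replicate (window_size - n) []"
      proof -
        have "map row [n..<window_size] = map (\<lambda>_. []) [n..<window_size]"
        proof (rule map_cong[OF refl])
          fix k assume "k \<in> set [n..<window_size]"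
          then have "n - 1 \<le> k" by auto
          then show "row k = []" by (rule empty_ge[OF _ True])
        qed
        then show ?thesis by (simp add: map_replicate_const)
      qed
      moreover have "extend_rows (map (\<lambda>k. info t (j0 + int k)) [n..<window_size]) (row (n - 1)) = [replicate (window_size - n) []]"
        using True step.hyps unfolding u by (simp add: Suc_diff_Suc)
      ultimately show ?thesis by simp
    next
      case False
      have "row_closed (info t (j0 + int n)) (row (n - 1)) (row n)"
        unfolding row_closed_iff
      proof (intro ballI impI subsetI)
        fix l l' assume l: "l \<in> set (row n)" "l' \<in> set (labels_below (info t (j0 + int n)) l)"
        have "j0 + int n - 1 = j0 + int (n - 1)" using step.prems by (simp add: of_nat_diff)
        then show "l' \<in> set (row (n - 1))" using closed[of "j0 + int n" l l'] l row by metis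
      qed
      moreover have "row n \<in> set (subseqs (cube_labels (info t (j0 + int n))))"
        unfolding row_def by (rule filter_in_subseqs)
      moreover have "map row [Suc n..<window_size] \<in> set (extend_rows (map (\<lambda>k. info t (j0 + int k)) [Suc n..<window_size]) (row n))"
        using step.IH by simp
      ultimately show ?thesis using False unfolding u by auto
    qed
  qed
  have mem: "rows \<in> set (states t (phase t j0))"
  proof -
    let ?full = "map cube_labels (window t (phase t j0))"
    have w3: "(3::nat) < window_size" by (simp add: window_size_def)
    have up: "[0..<window_size] = [0..<3] @ [3..<window_size]" using w3 upt_add_eq_append[of 0 3 "window_size - 3"] by simp
    have t3: "take 3 ?full = map row [0..<3]"
      unfolding window_eq up using full_row by simp
    have f2: "?full ! 2 = row 2" "?full ! 3 = cube_labels (info t (j0 + int 3))"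
      using nth_window[of 2 t j0] nth_window[of 3 t j0] full_row[of 2] by (auto simp: window_size_def)
    have d3: "drop 3 (window t (phase t j0)) = map (\<lambda>k. info t (j0 + int k)) [3..<window_size]"
      unfolding window_eq up by simp
    have "row 3 \<noteq> ?full ! 3"
    proof
      assume "row 3 = ?full ! 3"
      then have "set (row 3) = set (cube_labels (info t (j0 + int 3)))" using f2 by simp
      with nf show False unfolding j0_def by (auto simp: row idx_def j0_def set_eq_iff)
    qed
    moreover have "hd (map row [3..<window_size]) = row 3" using w3 by (simp add: hd_map)
    moreover have "map row [3..<window_size] \<in> set (extend_rows (drop 3 (window t (phase t j0))) (?full ! 2))"
      unfolding d3 f2 using ext[of 3] w3 by simp
    moreover have "rows = take 3 ?full @ map row [3..<window_size]" unfolding rows_def up t3 by simp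
    ultimately show ?thesis unfolding states_def Let_def by auto
  qed
  \<comment> \<open>That the window reaches the top of the column is not known beforehand. The rows
    cut off at its upper end form a checked state, and all of these have empty top rows; emptiness
    then continues upwards.\<close>
  from states_ok[OF mem] have "rows_ok t ds rows" by (simp add: state_ok_def Let_def ds_def)
  then have "rows ! (window_size - 1) = []"
    using wall_frame.rows_ok_D(1)[of t j0 rows] by (simp add: admissible_def)
  then have last: "row (window_size - 1) = []" by (simp add: rows_def window_size_def)
  have "X = rep t j0 rows"
  proof (intro subset_antisym subsetI)
    fix x assume x: "x \<in> X"
    then have xi: "x \<in> idx t" using sub by blast
    show "x \<in> rep t j0 rows"
    proof (cases "fst x < j0")
      case True
      then show ?thesis using xi by (simp add: rep_def)
    next
      case False
      define k where "k = nat (fst x - j0)"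
      have xk: "x = (j0 + int k, snd x)" using False by (simp add: k_def prod_eq_iff)
      have sx: "snd x \<in> set (row k)" using x xk row by metis
      moreover have "k < window_size"
      proof (rule ccontr)
        assume "\<not> k < window_size"
        then have "window_size - 1 \<le> k" by simp
        from empty_ge[OF this last] sx show False by simp
      qed
      ultimately show ?thesis using xi False by (auto simp: rep_def rows_def k_def)
    qed
  next
    fix x assume "x \<in> rep t j0 rows"
    then consider "fst x < j0" "x \<in> idx t" | "j0 \<le> fst x" "fst x < j0 + int window_size" "snd x \<in> set (rows ! nat (fst x - j0))"
      by (auto simp: rep_def rows_def)
    then show "x \<in> X"
    proof cases
      case 1
      then show ?thesis using lo by (simp add: j0_def)
    next
      case 2
      then have "snd x \<in> set (row (nat (fst x - j0)))" by (auto simp: rows_def nat_less_iff)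
      then show ?thesis using 2 row[of "snd x" "nat (fst x - j0)"] by simp
    qed
  qed
  with mem show ?thesis by blast
qed

text \<open>The lowest incomplete cube has phase 4 in the first shape and phase 5 in the second;
  three cubes below it the windows start, hence phases 1 and 2.\<close>

lemma place_states:
  "\<exists>rows\<in>set (states E8 (phase E8 (10 * m + 1))). place shape1 m = rep E8 (10 * m + 1) rows"
  "\<exists>rows\<in>set (states E8 (phase E8 (10 * m + 2))). place shape2 m = rep E8 (10 * m + 2) rows"
proof -
  have ph: "phase E8 (10 * m + 1) = 1" "phase E8 (10 * m + 2) = 2"
    using phase_E8[of m 1] phase_E8[of m 2] by simp_all
  define R1 where "R1 = take 3 (map cube_labels (window E8 1)) @ [[5, 3], [9]] @ replicate 11 []"
  define R2 where "R2 = take 3 (map cube_labels (window E8 2)) @ [[9], [2]] @ replicate 11 []"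
  have m1: "R1 \<in> set (states E8 1)" and m2: "R2 \<in> set (states E8 2)"
    by (simp_all add: states_def R1_def R2_def Let_def)
  have "rows_match (\<lambda>i l. shape1 (int i - int 3) l) (window E8 1) (take 3 (map cube_labels (window E8 1)) @ [[5, 3], [9]] @ replicate 11 [])"
    by code_simp
  then have r1: "rows_match (\<lambda>i l. shape1 (int i - int 3) l) (window E8 1) R1" by (simp only: R1_def)
  have "rows_match (\<lambda>i l. shape2 (int i - int 2) l) (window E8 2) (take 3 (map cube_labels (window E8 2)) @ [[9], [2]] @ replicate 11 [])"
    by code_simp
  then have r2: "rows_match (\<lambda>i l. shape2 (int i - int 2) l) (window E8 2) R2" by (simp only: R2_def)
  interpret w1: wall_frame E8 "10 * m + 1" 0 .
  interpret w2: wall_frame E8 "10 * m + 2" 0 .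
  have "rows_ok E8 w1.ds R1" "rows_ok E8 w2.ds R2"
    using states_ok[of R1 E8 "10 * m + 1"] states_ok[of R2 E8 "10 * m + 2"] m1 m2
    by (simp_all add: ph w1.ds_def w2.ds_def state_ok_def Let_def)
  then have wf: "w1.wf R1" "w2.wf R2"
    using w1.rows_ok_D(1) w2.rows_ok_D(1) by (auto simp: w1.admissible_def w2.admissible_def)
  have "rep E8 (10 * m + 1) R1 = place shape1 m"
    using w1.X_eq_place_iff[OF wf(1) refl, of 3 m shape1] r1
    by (simp add: w1.ds_def ph window_size_def shape1_def)
  moreover have "rep E8 (10 * m + 2) R2 = place shape2 m"
    using w2.X_eq_place_iff[OF wf(2) refl, of 2 m shape2] r2
    by (simp add: w2.ds_def ph window_size_def shape2_def)
  ultimately show "\<exists>rows\<in>set (states E8 (phase E8 (10 * m + 1))). place shape1 m = rep E8 (10 * m + 1) rows"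
    "\<exists>rows\<in>set (states E8 (phase E8 (10 * m + 2))). place shape2 m = rep E8 (10 * m + 2) rows"
    using m1 m2 by (auto simp: ph)
qed

text \<open>All claims about single columns are reduced here to the evaluated check.\<close>

lemma young_column_state:
  assumes "young_column t (wall_pattern t r) y"
  obtains j0 rows where "y = index_block t r ` rep t j0 rows"
    "state_ok t (window t (phase t j0)) (phase_levels t (phase t j0)) rows"
proof -
  have "y \<subseteq> index_block t r ` idx t"
    using assms unfolding young_column_def proper_column_def blocks_wall_pattern by auto
  then obtain X where X: "X \<subseteq> idx t" "y = index_block t r ` X" by (auto simp: subset_image_iff)
  then have "index_young t X" using assms young_column_index_block by simp
  then have "\<exists>j0 rows. rows \<in> set (states t (phase t j0)) \<and> X = rep t j0 rows"
    unfolding index_young_def using index_ideal_states place_states by blast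
  then show ?thesis using that states_ok X(2) by blast
qed

context wall_frame
begin

context
  fixes rows assumes st: "state_ok t ds (phase_levels t (phase t j0)) rows"
begin

abbreviation "yy \<equiv> Bk ` X rows"
abbreviation "Al i \<equiv> of_colour i (add_list t ds rows)"
abbreviation "Rl i \<equiv> of_colour i (remove_list t ds rows)"
abbreviation "Wt i \<equiv> column_wt t r i yy"

lemma rok: "rows_ok t ds rows"
  using st by (simp add: state_ok_def Let_def)

lemma young_state: "young_column t pat yy"
  using young_column_index_block[OF rep_subset] admissibleD(4)[OF rows_ok_D(1)[OF rok]] by blast

lemma levels_all_zero_iff:
  "list_all (\<lambda>x. x = 0) (lower_levels t (phase_levels t (phase t j0)) (concat rows)) \<longleftrightarrow> (\<forall>i\<le>rank t. Wt i = 0)"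
  using column_wt_rows(1)[OF rok] column_wt_rows(2)[OF rok, of 0] by (auto simp: list_all_length less_Suc_eq_le)

lemma state_colour_ok:
  assumes "\<not> (\<forall>i\<le>rank t. Wt i = 0)" "i \<le> rank t"
  shows "colour_ok t ds rows i (Wt i) (Al i) (Rl i)"
proof -
  let ?L = "lower_levels t (phase_levels t (phase t j0)) (concat rows)"
  have "\<not> list_all (\<lambda>x. x = 0) ?L" using assms(1) levels_all_zero_iff by blast
  then have "list_all (\<lambda>(i, x). colour_ok t ds rows i x (Al i) (Rl i)) (enumerate 0 ?L)"
    using st unfolding state_ok_def Let_def by argo
  moreover have "(i, ?L ! i) \<in> set (enumerate 0 ?L)"
    using column_wt_rows(2)[OF rok assms(2)] assms(2) by (simp add: in_set_enumerate_eq)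
  ultimately show ?thesis using column_wt_rows(1)[OF rok assms(2)] by (auto simp: list_all_iff)
qed

lemma state_zero:
  assumes "\<forall>i\<le>rank t. Wt i = 0"
  shows "t = E8" and "\<exists>j\<le>rank t. is_interior t ds rows j (Al j) (Rl j) \<and>
    (\<forall>i\<le>rank t. i \<noteq> j \<longrightarrow> not_interior t ds rows i (Al i) (Rl i))"
proof -
  let ?L = "lower_levels t (phase_levels t (phase t j0)) (concat rows)"
  let ?f = "filter (\<lambda>j. is_interior t ds rows j (Al j) (Rl j)) [0..<length ?L]"
  have "list_all (\<lambda>x. x = 0) ?L" using assms levels_all_zero_iff by blast
  then have *: "t = E8 \<and> (case ?f of [j] \<Rightarrow> list_all (\<lambda>i. if i = j then True
       else not_interior t ds rows i (Al i) (Rl i)) [0..<length ?L] | _ \<Rightarrow> False)"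
    using st unfolding state_ok_def Let_def by argo
  then show "t = E8" by (rule conjunct1)
  obtain j where j: "?f = [j]" "list_all (\<lambda>i. if i = j then True else not_interior t ds rows i (Al i) (Rl i)) [0..<length ?L]"
    using * by (auto split: list.splits simp del: upt_Suc)
  have len: "length ?L = Suc (rank t)" using column_wt_rows(2)[OF rok, of 0] by simp
  have "j \<in> set ?f" unfolding j(1) by simp
  then have "j \<le> rank t" "is_interior t ds rows j (Al j) (Rl j)" using len by (auto simp del: upt_Suc)
  moreover have "\<forall>i\<le>rank t. i \<noteq> j \<longrightarrow> not_interior t ds rows i (Al i) (Rl i)"
    using j(2) len by (auto simp: list_all_iff less_Suc_eq_le split: if_splits simp del: upt_Suc)
  ultimately show "\<exists>j\<le>rank t. is_interior t ds rows j (Al j) (Rl j) \<and>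
    (\<forall>i\<le>rank t. i \<noteq> j \<longrightarrow> not_interior t ds rows i (Al i) (Rl i))" by blast
qed

lemma colour_ok_nonzero: "i \<le> rank t \<Longrightarrow> Wt i \<noteq> 0 \<Longrightarrow> colour_ok t ds rows i (Wt i) (Al i) (Rl i)"
  using state_colour_ok[of i] by blast

lemma state_bound: "i \<le> rank t \<Longrightarrow> \<bar>Wt i\<bar> \<le> 2"
  using state_colour_ok[of i] by (cases "\<forall>i\<le>rank t. Wt i = 0") (auto simp: colour_ok_def split: if_splits)

lemma A_state: "addable t pat i yy = B ` set (Al i)" and R_state: "removable t pat i yy = B ` set (Rl i)"
  using A_eq[OF rok] R_eq[OF rok] by auto

lemma state_1: "i \<le> rank t \<Longrightarrow> Wt i = 1 \<Longrightarrow> is_singleton (addable t pat i yy) \<and> removable t pat i yy = {}"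
  using colour_ok_nonzero[of i] unfolding A_state R_state
  by (auto simp: colour_ok_def is_singleton_def length_Suc_conv)

lemma state_minus_1: "i \<le> rank t \<Longrightarrow> Wt i = -1 \<Longrightarrow> is_singleton (removable t pat i yy) \<and> addable t pat i yy = {}"
  using colour_ok_nonzero[of i] unfolding A_state R_state
  by (auto simp: colour_ok_def is_singleton_def length_Suc_conv)

lemma state_2:
  assumes "i \<le> rank t" "Wt i = 2"
  shows "block_to_add t pat i yy \<in> addable t pat i yy \<and> removable t pat i yy = {}"
proof -
  have "Rl i = [] \<and> pick_add t ds rows i (Al i) \<noteq> None"
    using colour_ok_nonzero[of i] assms by (auto simp: colour_ok_def)
  then obtain z where "pick_add t ds rows i (Al i) = Some z" "Rl i = []" by auto
  with pick_add_correct[OF admissibleD(1)[OF rows_ok_D(1)[OF rok]] A_eq[OF rok] A_range[OF rok]]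
  show ?thesis unfolding A_state R_state by auto
qed

lemma state_minus_2:
  assumes "i \<le> rank t" "Wt i = -2"
  shows "block_to_remove t pat i yy \<in> removable t pat i yy \<and> addable t pat i yy = {}"
proof -
  have "Al i = [] \<and> pick_remove t ds rows i (Rl i) \<noteq> None"
    using colour_ok_nonzero[of i] assms by (auto simp: colour_ok_def)
  then obtain z where "pick_remove t ds rows i (Rl i) = Some z" "Al i = []" by auto
  with pick_remove_correct[OF admissibleD(1)[OF rows_ok_D(1)[OF rok]] R_eq[OF rok] R_range[OF rok]]
  show ?thesis unfolding A_state R_state by auto
qed

lemma state_0:
  "i \<le> rank t \<Longrightarrow> Wt i = 0 \<Longrightarrow> \<exists>k\<le>rank t. Wt k \<noteq> 0 \<Longrightarrow> addable t pat i yy = {} \<and> removable t pat i yy = {}"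
  using state_colour_ok[of i] unfolding A_state R_state by (auto simp: colour_ok_def)

lemma B_inj:
  assumes "at j0 b \<in> idx t" "at j0 c \<in> idx t"
  shows "B b = B c \<longleftrightarrow> b = c"
  using Bk_eq_iff[OF assms] by (auto simp: at_def prod_eq_iff)

lemma interior_state:
  assumes "is_interior t ds rows i (Al i) (Rl i)"
  shows "\<exists>b c. addable t pat i yy = {b} \<and> removable t pat i yy = {c} \<and>
     block_to_remove t pat i (insert b yy) = b \<and> block_to_add t pat i (yy - {c}) = c"
proof -
  obtain b c where bc: "Al i = [b]" "Rl i = [c]"
      "pick_remove t ds (insert_label rows b) i (of_colour i (remove_list t ds (insert_label rows b))) = Some b"
      "pick_add t ds (delete_label rows c) i (of_colour i (add_list t ds (delete_label rows c))) = Some c"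
    using assms by (auto simp: is_interior_def Let_def split: list.splits)
  have "b \<in> set (Al i)" "c \<in> set (Rl i)" using bc by simp_all
  then have "b \<in> set (add_list t ds rows)" "c \<in> set (remove_list t ds rows)" by (auto simp: of_colour_def)
  with pick_insert[OF rok, of b i b] pick_delete[OF rok, of c i c] bc show ?thesis
    unfolding A_state R_state by auto
qed

lemma not_interior_state:
  assumes "not_interior t ds rows i (Al i) (Rl i)"
  shows "addable t pat i yy = {} \<and> removable t pat i yy = {} \<or>
    (\<exists>b c. addable t pat i yy = {b} \<and> removable t pat i yy = {c} \<and>
     block_to_remove t pat i (insert b yy) \<noteq> b \<and> block_to_add t pat i (yy - {c}) \<noteq> c)"
proof (cases "Al i = [] \<and> Rl i = []")
  case True
  then show ?thesis unfolding A_state R_state by simp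
next
  case False
  then obtain b c z w where bc: "Al i = [b]" "Rl i = [c]" "z \<noteq> b" "w \<noteq> c"
      "pick_remove t ds (insert_label rows b) i (of_colour i (remove_list t ds (insert_label rows b))) = Some z"
      "pick_add t ds (delete_label rows c) i (of_colour i (add_list t ds (delete_label rows c))) = Some w"
    using assms by (auto simp: not_interior_def Let_def split: list.splits)
  have m: "b \<in> set (Al i)" "c \<in> set (Rl i)" using bc by simp_all
  then have m': "b \<in> set (add_list t ds rows)" "c \<in> set (remove_list t ds rows)" by (auto simp: of_colour_def)
  have "at j0 b \<in> idx t" "at j0 c \<in> idx t" using m A_range[OF rok] R_range[OF rok] by blast+
  with pick_insert[OF rok m'(1) bc(5)] pick_delete[OF rok m'(2) bc(6)] B_inj bc
  have "block_to_remove t pat i (insert (B b) yy) \<noteq> B b" "block_to_add t pat i (yy - {B c}) \<noteq> B c" by metis+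
  then show ?thesis unfolding A_state R_state using bc by auto
qed

end

end

lemma index_set_iff: "i \<in> index_set t \<longleftrightarrow> i \<le> rank t"
  by (simp add: index_set_def)

lemma young_finite_diff:
  assumes "young_column t (wall_pattern t r) y" "young_column t (wall_pattern t r) z"
  shows "finite (y - z)"
  using assms by (metis young_column_state finite_block_diff)

lemma below_diff:
  assumes "young_column t (wall_pattern t r) y"
  shows "finite (y - index_block t r ` rep t 0 [])" "finite (index_block t r ` rep t 0 [] - y)"
  using assms by (metis young_column_state finite_block_diff)+

lemma young_states_wall_pattern: "young_states t (wall_pattern t r) (column_wt t r)"
proof
  show "colour b \<in> index_set t" if "b \<in> blocks (wall_pattern t r)" for b
    using that label_colour_index unfolding blocks_wall_pattern by auto
next
  fix y b i assume y: "young_column t (wall_pattern t r) y" and "young_column t (wall_pattern t r) (insert b y)" "b \<notin> y"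
  show "column_wt t r i (insert b y) = column_wt t r i y - cartan t i (colour b)"
    using relative_weight_insert[OF \<open>b \<notin> y\<close> below_diff[OF y]] by (simp add: column_wt_def)
next
  fix i y assume i: "i \<in> index_set t" and y: "young_column t (wall_pattern t r) y"
  note i' = i[unfolded index_set_iff]
  obtain j0 rows where yr: "y = index_block t r ` rep t j0 rows"
    and st: "state_ok t (window t (phase t j0)) (phase_levels t (phase t j0)) rows"
    by (rule young_column_state[OF y])
  interpret wall_frame t j0 r .
  note st' = st[folded ds_def]
  show "\<bar>column_wt t r i y\<bar> \<le> 2" unfolding yr by (rule state_bound[OF st' i'])
  show "column_wt t r i y = 1 \<Longrightarrow> is_singleton (addable t (wall_pattern t r) i y) \<and> removable t (wall_pattern t r) i y = {}"
    unfolding yr by (rule state_1[OF st' i'])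
  show "column_wt t r i y = -1 \<Longrightarrow> is_singleton (removable t (wall_pattern t r) i y) \<and> addable t (wall_pattern t r) i y = {}"
    unfolding yr by (rule state_minus_1[OF st' i'])
  show "column_wt t r i y = 2 \<Longrightarrow> block_to_add t (wall_pattern t r) i y \<in> addable t (wall_pattern t r) i y \<and> removable t (wall_pattern t r) i y = {}"
    unfolding yr by (rule state_2[OF st' i'])
  show "column_wt t r i y = -2 \<Longrightarrow> block_to_remove t (wall_pattern t r) i y \<in> removable t (wall_pattern t r) i y \<and> addable t (wall_pattern t r) i y = {}"
    unfolding yr by (rule state_minus_2[OF st' i'])
  show "column_wt t r i y = 0 \<Longrightarrow> \<exists>k\<in>index_set t. column_wt t r k y \<noteq> 0 \<Longrightarrow>
      addable t (wall_pattern t r) i y = {} \<and> removable t (wall_pattern t r) i y = {}"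
    unfolding yr by (rule state_0[OF st' i']) (auto simp: index_set_iff)
next
  fix y assume y: "young_column t (wall_pattern t r) y" and 0: "\<forall>k\<in>index_set t. column_wt t r k y = 0"
  obtain j0 rows where yr: "y = index_block t r ` rep t j0 rows"
    and st: "state_ok t (window t (phase t j0)) (phase_levels t (phase t j0)) rows"
    by (rule young_column_state[OF y])
  interpret wall_frame t j0 r .
  note st' = st[folded ds_def]
  have 0: "\<forall>i\<le>rank t. column_wt t r i (index_block t r ` rep t j0 rows) = 0"
    using 0 by (simp add: index_set_iff yr)
  obtain j where j: "j \<le> rank t" "is_interior t ds rows j (of_colour j (add_list t ds rows)) (of_colour j (remove_list t ds rows))"
    and other: "\<And>i. i \<le> rank t \<Longrightarrow> i \<noteq> j \<Longrightarrow> not_interior t ds rows i (of_colour i (add_list t ds rows)) (of_colour i (remove_list t ds rows))"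
    using state_zero(2)[OF st' 0] by blast
  note jj = interior_state[OF st' j(2)]
  have oo: "addable t pat i y = {} \<and> removable t pat i y = {} \<or>
           (\<exists>b c. addable t pat i y = {b} \<and> removable t pat i y = {c} \<and>
              block_to_remove t pat i (insert b y) \<noteq> b \<and> block_to_add t pat i (y - {c}) \<noteq> c)"
    if "i \<in> index_set t - {j}" for i
    unfolding yr using not_interior_state[OF st' other] that by (simp add: index_set_iff)
  have jI: "j \<in> index_set t" using j(1) by (simp add: index_set_iff)
  show "t = E8 \<and> (\<exists>j\<in>index_set t.
        (\<exists>b c. addable t pat j y = {b} \<and> removable t pat j y = {c} \<and>
           block_to_remove t pat j (insert b y) = b \<and> block_to_add t pat j (y - {c}) = c) \<and>
        (\<forall>i\<in>index_set t - {j}. addable t pat i y = {} \<and> removable t pat i y = {} \<or>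
           (\<exists>b c. addable t pat i y = {b} \<and> removable t pat i y = {c} \<and>
              block_to_remove t pat i (insert b y) \<noteq> b \<and> block_to_add t pat i (y - {c}) \<noteq> c)))"
    using state_zero(1)[OF st' 0] jj[folded yr] oo jI by blast
qed

section \<open>The ground state wall\<close>

text \<open>An enumerated form of \<open>cells_of\<close>, on which the sizes and positions of the
  ground state blocks can be evaluated.\<close>

definition cell_list :: "cross_section \<Rightarrow> nat \<Rightarrow> cell list" where
  "cell_list s l = filter (\<lambda>c. cell_colour s c = l)
     (map (Pair Upper) [1..<Suc (length (fst s))] @ map (Pair Lower) [1..<Suc (length (fst s))])"

lemma set_cell_list: "set (cell_list s l) = cells_of s l"
proof -
  have "x \<in> set (cell_list s l) \<longleftrightarrow> x \<in> cells_of s l" for x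
  proof (cases x)
    case (Pair a c)
    then show ?thesis by (cases a) (auto simp: cell_list_def cells_of_def cells_def image_iff simp del: upt_Suc)
  qed
  then show ?thesis by blast
qed

lemma distinct_cell_list: "distinct (cell_list s l)"
  by (auto simp: cell_list_def distinct_map inj_on_def simp del: upt_Suc)

text \<open>\<open>k\<close> counts the cubes above height 0 starting from 0, so it is one less than
  the height in \<open>ground_extra\<close>.\<close>

fun ground_label :: "affine_type \<Rightarrow> nat \<Rightarrow> cross_section \<Rightarrow> nat \<Rightarrow> bool" where
  "ground_label E6 k s l \<longleftrightarrow> k = 0 \<and> length (cell_list s l) = 3 \<or>
     k = 1 \<and> set (cell_list s l) = {(Upper, 2), (Lower, 2)} \<or> k = 2 \<and> length (cell_list s l) = 1"
| "ground_label E7 k s l \<longleftrightarrow> k = 0 \<and> length (cell_list s l) \<noteq> 1 \<or>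
     k = 1 \<and> set (cell_list s l) = {(Upper, 2), (Lower, 2), (Upper, 3), (Lower, 3)} \<or>
     k = 2 \<and> {(Upper, 3), (Lower, 3)} \<subseteq> set (cell_list s l) \<or>
     k = 3 \<and> set (cell_list s l) = {(Upper, 3), (Lower, 3)} \<or> k = 4 \<and> length (cell_list s l) = 1"
| "ground_label E8 k s l \<longleftrightarrow> k = 0 \<and> (l = 7 \<or> l = 5 \<or> l = 2) \<or> k = 1 \<and> (l = 6 \<or> l = 4) \<or>
     k = 2 \<and> (l = 5 \<or> l = 3) \<or> k = 3 \<and> (l = 4 \<or> l = 1) \<or> k = 4 \<and> (l = 2 \<or> l = 3) \<or>
     k = 5 \<and> set (cell_list s l) = {(Upper, 4), (Upper, 5), (Upper, 6), (Lower, 4), (Lower, 5), (Lower, 6)} \<or>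
     k = 6 \<and> l = 5 \<or> k = 7 \<and> l = 6 \<or> k = 8 \<and> l = 7 \<or> k = 9 \<and> l = 8 \<or> k = 10 \<and> l = 0"

lemma UNIV_row: "(UNIV :: row set) = {Upper, Lower}"
proof -
  have "a = Upper \<or> a = Lower" for a by (cases a) auto
  then show ?thesis by auto
qed

text \<open>\<open>phase_section t s f k\<close> is the section \<open>k\<close> cubes above a cube of phase \<open>s\<close>, which is rotated iff \<open>f\<close>.\<close>
definition phase_section :: "affine_type \<Rightarrow> nat \<Rightarrow> bool \<Rightarrow> nat \<Rightarrow> cross_section" where
  "phase_section t s f k = (let u = labelled_cubes t ! ((s + k) mod period t) in
     if f \<noteq> (t \<noteq> E7 \<and> odd ((s + k) div period t)) then rotate_section u else u)"

lemma phase_add: "phase t (j + int k) = (phase t j + k) mod period t"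
proof -
  have "int ((phase t j + k) mod period t) = (j + int k) mod int (period t)"
    using period_pos[of t] by (simp add: phase_def zmod_int mod_add_left_eq)
  then show ?thesis by (simp add: phase_def)
qed

lemma index_section_phase:
  "index_section t r (j + int k) = phase_section t (phase t j) (flipped t r j) k"
proof -
  have j: "j = int (period t) * (j div int (period t)) + int (phase t j)"
    using period_pos[of t] by (simp add: phase_def)
  have "(j + int k) div int (period t) = j div int (period t) + int ((phase t j + k) div period t)"
  proof -
    have "j + int k = int (phase t j + k) + int (period t) * (j div int (period t))" using j by simp
    then have "(j + int k) div int (period t) = (int (phase t j + k) + int (period t) * (j div int (period t))) div int (period t)"
      by (simp only:)
    also have "\<dots> = j div int (period t) + int (phase t j + k) div int (period t)"
      using period_pos[of t] by (intro div_mult_self2) simp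
    finally show ?thesis by (simp add: zdiv_int)
  qed
  then have fl: "flipped t r (j + int k) \<longleftrightarrow> flipped t r j \<noteq> (t \<noteq> E7 \<and> odd ((phase t j + k) div period t))"
    by (auto simp: flipped_def)
  show ?thesis unfolding index_section_def phase_section_def Let_def phase_add fl ..
qed

text \<open>Three full rows, reached by counting 3 backwards modulo the period, and then 13 rows,
  which complete the window.\<close>

definition ground_rows :: "affine_type \<Rightarrow> nat \<Rightarrow> bool \<Rightarrow> nat list list" where
  "ground_rows t s f = map (\<lambda>k. cube_labels (phase_info t ((s + ((period t - 1) * 3 + k)) mod period t))) [0..<3] @
     map (\<lambda>k. filter (ground_label t k (phase_section t s f k)) (cube_labels (phase_info t ((s + k) mod period t)))) [0..<13]"

text \<open>In type E8 the ground state names the colour 4 only in cubes 2 and 4, where no block has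
  the label 9; the last assumption expresses this.\<close>

lemma ground_extra_label:
  assumes h: "height b = int k + 1" and b: "base b = set (cell_list s l)" and co: "colour b = label_colour l"
    and l4: "t = E8 \<Longrightarrow> k = 1 \<or> k = 3 \<Longrightarrow> label_colour l = 4 \<longleftrightarrow> l = 4"
  shows "ground_extra t b \<longleftrightarrow> ground_label t k s l"
proof -
  have c: "card (set (cell_list s l)) = length (cell_list s l)" by (rule distinct_card[OF distinct_cell_list])
  have hk: "int k + 1 = 1 \<longleftrightarrow> k = 0" "int k + 1 = 2 \<longleftrightarrow> k = 1" "int k + 1 = 3 \<longleftrightarrow> k = 2" "int k + 1 = 4 \<longleftrightarrow> k = 3"
    "int k + 1 = 5 \<longleftrightarrow> k = 4" "int k + 1 = 6 \<longleftrightarrow> k = 5" "int k + 1 = 7 \<longleftrightarrow> k = 6" "int k + 1 = 8 \<longleftrightarrow> k = 7"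
    "int k + 1 = 9 \<longleftrightarrow> k = 8" "int k + 1 = 10 \<longleftrightarrow> k = 9" "int k + 1 = 11 \<longleftrightarrow> k = 10"
    by arith+
  have n: "{2..3::nat} = {2, 3}" "{4..6::nat} = {4, 5, 6}" by auto
  have u: "UNIV \<times> {2} = {(Upper, 2), (Lower, 2::nat)}" "UNIV \<times> {3} = {(Upper, 3), (Lower, 3::nat)}"
    "UNIV \<times> {2, 3} = {(Upper, 2), (Lower, 2), (Upper, 3), (Lower, 3::nat)}"
    "UNIV \<times> {4, 5, 6} = {(Upper, 4), (Upper, 5), (Upper, 6), (Lower, 4), (Lower, 5), (Lower, 6::nat)}"
    unfolding UNIV_row by blast+
  have lc: "label_colour l = 7 \<longleftrightarrow> l = 7" "label_colour l = 5 \<longleftrightarrow> l = 5" "label_colour l = 2 \<longleftrightarrow> l = 2"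
    "label_colour l = 6 \<longleftrightarrow> l = 6" "label_colour l = 3 \<longleftrightarrow> l = 3" "label_colour l = 1 \<longleftrightarrow> l = 1"
    "label_colour l = 8 \<longleftrightarrow> l = 8" "label_colour l = 0 \<longleftrightarrow> l = 0"
    by (simp_all add: label_colour_def)
  show ?thesis
  proof (cases t)
    case E6
    show ?thesis unfolding E6 ground_extra.simps ground_label.simps h b c hk u ..
  next
    case E7
    show ?thesis unfolding E7 ground_extra.simps ground_label.simps h b c hk n u ..
  next
    case E8
    have "k = 1 \<Longrightarrow> label_colour l = 4 \<longleftrightarrow> l = 4" "k = 3 \<Longrightarrow> label_colour l = 4 \<longleftrightarrow> l = 4"
      using l4[OF E8] by simp_all
    then show ?thesis unfolding E8 ground_extra.simps ground_label.simps h b co c hk n u insert_iff empty_iff lc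
      by (cases "k = 1"; cases "k = 3") simp_all
  qed
qed

lemma ground_extra_index_block:
  assumes "(offset t r + int k, l) \<in> idx t"
  shows "ground_extra t (index_block t r (offset t r + int k, l)) \<longleftrightarrow>
    ground_label t k (phase_section t (phase t (offset t r)) (flipped t r (offset t r)) k) l"
proof (rule ground_extra_label)
  show "label_colour l = 4 \<longleftrightarrow> l = 4" if "t = E8" "k = 1 \<or> k = 3"
    using assms that(2) unfolding that(1)
    by (auto simp: idx_def cube_labels_info phase_def period_def section_labels_def label_colour_def split: if_splits)
qed (simp_all add: set_cell_list index_section_phase)

lemma ground_column_index:
  "ground_column t r = index_block t r ` rep t (offset t r - 3) (ground_rows t (phase t (offset t r)) (flipped t r (offset t r)))"
  (is "_ = _ ` rep t (?o - 3) ?rows")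
proof -
  have len: "length ?rows = 16" by (simp add: ground_rows_def)
  have "(height (index_block t r (j, l)) \<le> 0 \<or> ground_extra t (index_block t r (j, l))) \<longleftrightarrow> (j, l) \<in> rep t (?o - 3) ?rows"
    if jl: "(j, l) \<in> idx t" for j l
  proof -
    consider "j < ?o - 3" | n where "n < 3" "j = ?o - 3 + int n" | k where "j = ?o + int k"
    proof -
      assume 1: "j < ?o - 3 \<Longrightarrow> thesis" and 2: "\<And>n. n < 3 \<Longrightarrow> j = ?o - 3 + int n \<Longrightarrow> thesis"
        and 3: "\<And>k. j = ?o + int k \<Longrightarrow> thesis"
      show thesis
      proof (cases "j < ?o")
        case False
        then show thesis by (intro 3[of "nat (j - ?o)"]) simp
      next
        case j: True
        show thesis
        proof (cases "j < ?o - 3")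
          case False
          with j show thesis by (intro 2[of "nat (j - ?o + 3)"]) auto
        qed (rule 1)
      qed
    qed
    then show ?thesis
    proof cases
      case 1
      with jl show ?thesis by (simp add: rep_def)
    next
      case (2 n)
      have "phase t j = (phase t ?o + ((period t - 1) * 3 + n)) mod period t"
      proof -
        have e: "j + int (period t) * 3 = ?o + int ((period t - 1) * 3 + n)"
          using 2(2) period_pos[of t] by (simp add: of_nat_diff algebra_simps)
        have "phase t j = phase t (j + int (period t) * 3)" by (simp add: phase_def)
        then show ?thesis unfolding e phase_add .
      qed
      moreover have "?rows ! n = cube_labels (phase_info t ((phase t ?o + ((period t - 1) * 3 + n)) mod period t))"
        using 2(1) unfolding ground_rows_def by (simp add: nth_append)
      ultimately have "?rows ! n = cube_labels (info t j)" by (simp add: info_def)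
      moreover have "l \<in> set (cube_labels (info t j))" using jl by (simp add: idx_def)
      ultimately have "l \<in> set (?rows ! n)" by simp
      with 2 jl show ?thesis by (simp add: rep_def len)
    next
      case (3 k)
      have "height (index_block t r (j, l)) > 0" using 3 by simp
      then have L: "(height (index_block t r (j, l)) \<le> 0 \<or> ground_extra t (index_block t r (j, l)))
          \<longleftrightarrow> ground_label t k (phase_section t (phase t ?o) (flipped t r ?o) k) l"
        using ground_extra_index_block[of t r k l] jl 3 by simp
      have small: "ground_label t k s l \<Longrightarrow> k < 13" for s by (cases t) auto
      show ?thesis
      proof (cases "k < 13")
        case True
        then have "?rows ! (k + 3) = filter (ground_label t k (phase_section t (phase t ?o) (flipped t r ?o) k))
            (cube_labels (phase_info t ((phase t ?o + k) mod period t)))"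
          unfolding ground_rows_def by (simp add: nth_append del: upt_Suc)
        then have R: "?rows ! (k + 3) = filter (ground_label t k (phase_section t (phase t ?o) (flipped t r ?o) k)) (cube_labels (info t j))"
          using 3 phase_add[of t ?o k] by (simp add: info_def)
        have l: "l \<in> set (cube_labels (info t j))" using jl by (simp add: idx_def)
        have "nat (j - (?o - 3)) = k + 3" "?o - 3 \<le> j" "\<not> j < ?o - 3" "j < ?o - 3 + int 16" using 3 True by simp_all
        then have "(j, l) \<in> rep t (?o - 3) ?rows \<longleftrightarrow> l \<in> set (?rows ! (k + 3))"
          using jl by (simp add: rep_def len)
        then show ?thesis unfolding L R using l by simp
      next
        case False
        then have "(j, l) \<notin> rep t (?o - 3) ?rows" using 3 by (simp add: rep_def len)
        moreover have "\<not> ground_label t k (phase_section t (phase t ?o) (flipped t r ?o) k) l" using small False by blast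
        ultimately show ?thesis unfolding L by simp
      qed
    qed
  qed
  then have "{x \<in> idx t. height (index_block t r x) \<le> 0 \<or> ground_extra t (index_block t r x)} = rep t (?o - 3) ?rows"
    using rep_subset[of t "?o - 3" ?rows] by (auto simp del: height_index_block)
  moreover have "ground_column t r = index_block t r ` {x \<in> idx t. height (index_block t r x) \<le> 0 \<or> ground_extra t (index_block t r x)}"
    unfolding ground_column_def blocks_wall_pattern by blast
  ultimately show ?thesis by simp
qed

text \<open>The ground state wall repeats after three, two and one columns; an entry gives the phase
  and the rotation of the cube of height 1.\<close>

fun ground_phases :: "affine_type \<Rightarrow> (nat \<times> bool) list" where
  "ground_phases E6 = [(0, False), (2, True), (4, False)]"
| "ground_phases E7 = [(0, False), (4, True)]"
| "ground_phases E8 = [(0, False)]"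

lemma ground_phases_nth:
  "ground_phases t ! (r mod length (ground_phases t)) = (phase t (offset t r), flipped t r (offset t r))"
proof (cases t)
  case E6
  define q c where "q = r div 3" and "c = r mod 3"
  have r: "r = 3 * q + c" and c: "c = 0 \<or> c = 1 \<or> c = 2" unfolding q_def c_def by auto
  \<comment> \<open>Three columns shift the pattern by 24, a multiple of its full period 12, so
    phase and rotation depend only on \<open>c\<close>.\<close>
  have r8: "8 * int r = 8 * int c + (4 * int q) * 6" using r by simp
  have "8 * int r mod 6 = 8 * int c mod 6" unfolding r8 by (rule mod_mult_self1)
  moreover have "8 * int r div 6 = 4 * int q + 8 * int c div 6" unfolding r8 by (rule div_mult_self1) simp
  moreover have "r mod 3 = c" by (simp add: c_def)
  ultimately show ?thesis using c unfolding E6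
    by (elim disjE) (simp_all add: phase_def flipped_def period_def)
next
  case E7
  have "r mod Suc (Suc 0) = (if even r then 0 else 1)" by presburger
  then show ?thesis unfolding E7 by (simp add: phase_def flipped_def period_def)
next
  case E8
  show ?thesis unfolding E8 by (simp add: phase_def flipped_def)
qed

definition ground_level :: "affine_type \<Rightarrow> nat \<times> bool \<Rightarrow> int list" where
  "ground_level t = (\<lambda>(s, f). lower_levels t (phase_levels t ((s + (period t - 1) * 3) mod period t))
     (concat (ground_rows t s f)))"

lemma ground_rows_simps:
  "ground_rows E6 0 False = [[3, 5], [1, 4], [3, 2], [4], [5], [6], [], [], [], [], [], [], [], [], [], []]"
  "ground_rows E6 2 True = [[3, 2], [0, 4], [2, 5], [4], [3], [1], [], [], [], [], [], [], [], [], [], []]"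
  "ground_rows E6 4 False = [[2, 5], [6, 4], [3, 5], [4], [2], [0], [], [], [], [], [], [], [], [], [], []]"
  "ground_rows E7 0 False = [[4, 6], [3, 5], [1, 4], [3, 2], [4], [5], [6], [7], [], [], [], [], [], [], [], []]"
  "ground_rows E7 4 True = [[1, 4], [3, 5], [4, 6], [2, 5], [4], [3], [1], [0], [], [], [], [], [], [], [], []]"
  "ground_rows E8 0 False = [[1, 4, 6], [3, 5, 7], [4, 6, 8], [7, 5, 2], [6, 4], [5, 3], [4, 1], [2, 3], [9], [5], [6], [7], [8], [0], [], []]"
  by code_simp+

text \<open>In type E6 these are \<open>\<Lambda>\<^sub>0 - \<Lambda>\<^sub>6\<close> and its images
  under the diagram automorphism of order 3, in type E7
  \<open>\<Lambda>\<^sub>0 - \<Lambda>\<^sub>7\<close> and its negative, in type E8 the weight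
  0.\<close>

lemma ground_level_simps:
  "ground_level E6 (0, False) = [1, 0, 0, 0, 0, 0, -1]"
  "ground_level E6 (2, True) = [0, -1, 0, 0, 0, 0, 1]"
  "ground_level E6 (4, False) = [-1, 1, 0, 0, 0, 0, 0]"
  "ground_level E7 (0, False) = [1, 0, 0, 0, 0, 0, 0, -1]"
  "ground_level E7 (4, True) = [-1, 0, 0, 0, 0, 0, 0, 1]"
  "ground_level E8 (0, False) = [0, 0, 0, 0, 0, 0, 0, 0, 0]"
  unfolding ground_level_def prod.case ground_rows_simps by code_simp+

text \<open>The windows begin three cubes lower, so their phases are those of
  \<open>ground_phases\<close> lowered by 3 modulo the period.\<close>

lemma ground_state_checks:
  "state_ok E6 (window E6 3) (phase_levels E6 3) (ground_rows E6 0 False)"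
  "state_ok E6 (window E6 5) (phase_levels E6 5) (ground_rows E6 2 True)"
  "state_ok E6 (window E6 1) (phase_levels E6 1) (ground_rows E6 4 False)"
  "state_ok E7 (window E7 5) (phase_levels E7 5) (ground_rows E7 0 False)"
  "state_ok E7 (window E7 1) (phase_levels E7 1) (ground_rows E7 4 True)"
  "state_ok E8 (window E8 7) (phase_levels E8 7) (ground_rows E8 0 False)"
  unfolding ground_rows_simps by code_simp+

text \<open>When all weights vanish, they do not tell in which string the column lies; the colours
  of the blocks that can be added do.\<close>

lemma ground_adds_E8: "list_all (\<lambda>x. snd x = 0) (add_list E8 (window E8 7) (ground_rows E8 0 False))"
  unfolding ground_rows_simps by code_simp

text \<open>Compared as whole lists, so that one evaluation per column of the period covers all
  colours.\<close>

lemma ground_level_Suc: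
  assumes "k < length (ground_phases t)" "i \<le> rank t"
  shows "max 0 (ground_level t (ground_phases t ! (Suc k mod length (ground_phases t))) ! i) =
    max 0 (- (ground_level t (ground_phases t ! k) ! i))"
proof -
  let ?L = "ground_level t (ground_phases t ! (Suc k mod length (ground_phases t)))"
  let ?L' = "ground_level t (ground_phases t ! k)"
  have "map (max 0) ?L = map (\<lambda>x. max 0 (- x)) ?L' \<and> length ?L = Suc (rank t) \<and> length ?L' = Suc (rank t)"
  proof (cases t)
    case E6
    with assms(1) have "k = 0 \<or> k = 1 \<or> k = 2" by auto
    then show ?thesis unfolding E6 by (elim disjE) (simp_all add: ground_level_simps)
  next
    case E7
    with assms(1) have "k = 0 \<or> k = 1" by auto
    then show ?thesis unfolding E7 by (elim disjE) (simp_all add: ground_level_simps)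
  next
    case E8
    with assms(1) show ?thesis by (simp add: ground_level_simps)
  qed
  then have m: "map (max 0) ?L = map (\<lambda>x. max 0 (- x)) ?L'" and i: "i < length ?L" "i < length ?L'"
    using assms(2) by simp_all
  have "map (max 0) ?L ! i = map (\<lambda>x. max 0 (- x)) ?L' ! i" by (simp only: m)
  then show ?thesis unfolding nth_map[OF i(1)] nth_map[OF i(2)] .
qed

lemma ground_level_0:
  assumes "i \<le> rank t"
  shows "if i = 0 then ground_level t (ground_phases t ! 0) ! i = (if t = E8 then 0 else 1)
      else ground_level t (ground_phases t ! 0) ! i \<le> 0"
    and "t = E8 \<Longrightarrow> ground_level t (ground_phases t ! 0) ! i = 0"
proof -
  have "hd (ground_level t (ground_phases t ! 0)) = (if t = E8 then 0 else 1) \<and>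
      (\<forall>x\<in>set (tl (ground_level t (ground_phases t ! 0))). x \<le> 0 \<and> (t = E8 \<longrightarrow> x = 0)) \<and>
      length (ground_level t (ground_phases t ! 0)) = Suc (rank t)"
    by (cases t) (simp_all add: ground_level_simps)
  then obtain L where L: "ground_level t (ground_phases t ! 0) = (if t = E8 then 0 else 1) # L"
      "\<forall>x\<in>set L. x \<le> 0 \<and> (t = E8 \<longrightarrow> x = 0)" "length L = rank t"
    by (cases "ground_level t (ground_phases t ! 0)") auto
  have "i = 0 \<or> (\<exists>j<length L. i = Suc j)" using assms L(3) by (cases i) auto
  then show "if i = 0 then ground_level t (ground_phases t ! 0) ! i = (if t = E8 then 0 else 1)
      else ground_level t (ground_phases t ! 0) ! i \<le> 0"
    "t = E8 \<Longrightarrow> ground_level t (ground_phases t ! 0) ! i = 0"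
    unfolding L(1) using L(2) nth_mem[of _ L] by auto
qed

lemma ground_base_phase: "phase t (offset t r - 3) = (phase t (offset t r) + (period t - 1) * 3) mod period t"
proof -
  have e: "offset t r - 3 + int (period t) * 3 = offset t r + int ((period t - 1) * 3)"
    using period_pos[of t] by (simp add: of_nat_diff algebra_simps)
  have "phase t (offset t r - 3) = phase t (offset t r - 3 + int (period t) * 3)" by (simp add: phase_def)
  then show ?thesis unfolding e phase_add .
qed

lemma ground_state:
  "state_ok t (window t (phase t (offset t r - 3))) (phase_levels t (phase t (offset t r - 3)))
     (ground_rows t (phase t (offset t r)) (flipped t r (offset t r)))"
proof -
  let ?P = "\<lambda>(s, f). state_ok t (window t ((s + (period t - 1) * 3) mod period t))
    (phase_levels t ((s + (period t - 1) * 3) mod period t)) (ground_rows t s f)"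
  have "?P (ground_phases t ! k)" if "k < length (ground_phases t)" for k
  proof (cases t)
    case E6
    with that have "k = 0 \<or> k = 1 \<or> k = 2" by auto
    moreover have "period E6 = 6" by (simp add: period_def)
    ultimately show ?thesis unfolding E6 using ground_state_checks by (elim disjE) simp_all
  next
    case E7
    with that have "k = 0 \<or> k = 1" by auto
    moreover have "period E7 = 8" by (simp add: period_def)
    ultimately show ?thesis unfolding E7 using ground_state_checks by (elim disjE) simp_all
  next
    case E8
    with that have "k = 0" by simp
    moreover have "period E8 = 10" by (simp add: period_def)
    ultimately show ?thesis unfolding E8 using ground_state_checks by simp
  qed
  moreover have "0 < length (ground_phases t)" by (cases t) simp_all
  ultimately have "?P (ground_phases t ! (r mod length (ground_phases t)))" by simp
  then show ?thesis unfolding ground_phases_nth ground_base_phase by simp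
qed

lemma young_ground_column: "young_column t (wall_pattern t r) (ground_column t r)"
proof -
  interpret wall_frame t "offset t r - 3" r .
  show ?thesis unfolding ground_column_index by (rule young_state[OF ground_state[of t r, folded ds_def]])
qed

lemma column_wt_ground:
  assumes "i \<le> rank t"
  shows "column_wt t r i (ground_column t r) = ground_level t (ground_phases t ! (r mod length (ground_phases t))) ! i"
proof -
  interpret wall_frame t "offset t r - 3" r .
  show ?thesis
    unfolding ground_phases_nth ground_level_def prod.case ground_column_index ground_base_phase[symmetric]
    by (rule column_wt_rows(1)[OF rok[OF ground_state[of t r, folded ds_def]] assms])
qed

text \<open>In these types the weights of a column never all vanish, so the sign of the weight alone
  decides whether an operator acts.\<close>

lemma column_None_E67:
  assumes t: "t \<noteq> E8" and i: "i \<in> index_set t" and y: "young_column t (wall_pattern t r) y"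
  shows "column_f t (wall_pattern t r) i y \<noteq> None \<longleftrightarrow> 0 < column_wt t r i y"
    and "column_e t (wall_pattern t r) i y \<noteq> None \<longleftrightarrow> column_wt t r i y < 0"
proof -
  note Y = young_states_wall_pattern[of t r]
  have nz: "\<exists>k\<in>index_set t. column_wt t r k y \<noteq> 0"
    using young_states.W_all_0[OF Y y] t by blast
  have "column_f t (wall_pattern t r) i y = None" "column_e t (wall_pattern t r) i y = None" if "column_wt t r i y = 0"
    using young_states.W_0[OF Y i y that nz] by (simp_all add: column_f_def column_e_def add_block_def remove_block_def)
  then show "column_f t (wall_pattern t r) i y \<noteq> None \<longleftrightarrow> 0 < column_wt t r i y"
    "column_e t (wall_pattern t r) i y \<noteq> None \<longleftrightarrow> column_wt t r i y < 0"
    using young_states.column_None[OF Y i y] by linarith+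
qed

text \<open>The column lies in the interior of the string of exactly one colour, and for that colour
  a block can be added; this leaves only colour 0.\<close>

lemma ground_column_None_E8:
  assumes i: "i \<in> index_set E8"
  shows "column_f E8 (wall_pattern E8 r) i (ground_column E8 r) \<noteq> None \<longleftrightarrow> i = 0"
    and "column_e E8 (wall_pattern E8 r) i (ground_column E8 r) \<noteq> None \<longleftrightarrow> i = 0"
proof -
  let ?p = "wall_pattern E8 r" and ?g = "ground_column E8 r"
  note Y = young_states_wall_pattern[of E8 r]
  interpret wall_frame E8 "offset E8 r - 3" r .
  have 0: "\<forall>k\<in>index_set E8. column_wt E8 r k ?g = 0"
    using ground_level_0(2)[of _ E8] column_wt_ground[of _ E8 r] by (simp add: index_set_iff)
  have ph: "phase E8 0 = 0" "flipped E8 r 0 \<longleftrightarrow> False" "phase E8 (- 3) = 7"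
    by (simp_all add: phase_def flipped_def period_def)
  have A: "addable E8 ?p k ?g = {}" if "k \<in> index_set E8" "k \<noteq> 0" for k
  proof -
    have "of_colour k (add_list E8 (window E8 7) (ground_rows E8 0 False)) = []"
      using ground_adds_E8 that(2) by (auto simp: of_colour_def list_all_iff filter_empty_conv label_colour_def)
    then have "of_colour k (add_list E8 ds (ground_rows E8 (phase E8 (offset E8 r)) (flipped E8 r (offset E8 r)))) = []"
      unfolding ds_def by (simp only: offset.simps ph diff_0)
    then show ?thesis unfolding ground_column_index A_state[OF ground_state[of E8 r, folded ds_def]] by simp
  qed
  obtain j b c where j: "\<And>i. string_interior E8 ?p i ?g \<longleftrightarrow> i = j" "addable E8 ?p j ?g = {b}" "removable E8 ?p j ?g = {c}"
    using young_states.all_0_interior[OF Y young_ground_column 0] by metis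
  have "b \<in> addable E8 ?p j ?g" using j(2) by simp
  then have "j \<in> index_set E8" by (rule young_states.addable_index[OF Y])
  then have j0: "j = 0" using A j(2) by blast
  show "column_f E8 ?p i ?g \<noteq> None \<longleftrightarrow> i = 0" "column_e E8 ?p i ?g \<noteq> None \<longleftrightarrow> i = 0"
    using j(2,3) unfolding column_f_def column_e_def j(1) j0 add_block_def remove_block_def by auto
qed

lemma column_crystals_column_wt: "column_crystals t (column_wt t)"
proof
  fix r y i assume y: "young_column t (wall_pattern t r) y"
  note d = young_finite_diff
  show "column_wt t r i y = column_wt t r i (ground_column t r) + relative_weight t i (ground_column t r) y"
    unfolding column_wt_def
    using relative_weight_cocycle[OF below_diff(2)[OF young_ground_column] below_diff(1)[OF young_ground_column]
        d[OF young_ground_column y] d[OF y young_ground_column]]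
    by simp
  show "finite (y - ground_column t r) \<and> finite (ground_column t r - y)"
    using d[OF young_ground_column y] d[OF y young_ground_column] by simp
next
  fix r show "young_column t (wall_pattern t r) (ground_column t r)" by (rule young_ground_column)
next
  fix r y b assume "young_column t (wall_pattern t r) y" "b \<in> y"
  then show "colour b \<in> index_set t"
    using young_states.colour_pattern[OF young_states_wall_pattern] young_states.young_subset[OF young_states_wall_pattern] by blast
next
  fix r y i y' assume y: "young_column t (wall_pattern t r) y"
  show "column_f t (wall_pattern t r) i y = Some y' \<Longrightarrow>
      young_column t (wall_pattern t r) y' \<and> (\<exists>b. b \<notin> y \<and> colour b = i \<and> y' = insert b y)"
    by (rule young_states.column_f_young[OF young_states_wall_pattern y])
  show "column_e t (wall_pattern t r) i y = Some y' \<Longrightarrow> young_column t (wall_pattern t r) y'"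
    by (rule young_states.column_e_young[OF young_states_wall_pattern y])
next
  fix i r y y'
  assume i: "i \<in> index_set t" and y: "young_column t (wall_pattern t r) y"
  show "column_f t (wall_pattern t r) i y = Some y' \<longleftrightarrow> column_e t (wall_pattern t r) i y' = Some y"
    if "young_column t (wall_pattern t r) y'"
    by (rule young_states.column_f_iff_e[OF young_states_wall_pattern i y that])
  show "\<bar>column_wt t r i y\<bar> \<le> 2"
    by (rule young_states.W_bound[OF young_states_wall_pattern i y])
  show "column_f t (wall_pattern t r) i y = None \<longleftrightarrow>
      column_wt t r i y < 0 \<or> column_wt t r i y = 0 \<and> column_e t (wall_pattern t r) i y = None"
    by (rule young_states.column_None(1)[OF young_states_wall_pattern i y])
  show "column_e t (wall_pattern t r) i y = None \<longleftrightarrow>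
      column_wt t r i y > 0 \<or> column_wt t r i y = 0 \<and> column_f t (wall_pattern t r) i y = None"
    by (rule young_states.column_None(2)[OF young_states_wall_pattern i y])
next
  fix i r assume i: "i \<in> index_set t"
  note i' = i[unfolded index_set_iff]
  have c0: "if i = 0 then column_wt t 0 i (ground_column t 0) = (if t = E8 then 0 else 1) else column_wt t 0 i (ground_column t 0) \<le> 0"
    unfolding column_wt_ground[OF i'] mod_0 by (rule ground_level_0(1)[OF i'])
  then show "column_wt t 0 i (ground_column t 0) \<le> 0 \<or> i = 0 \<and> column_wt t 0 i (ground_column t 0) = 1"
    by (auto split: if_splits)
  show "column_f t (wall_pattern t 0) i (ground_column t 0) \<noteq> None \<longleftrightarrow> i = 0"
  proof (cases "t = E8")
    case True
    then show ?thesis using ground_column_None_E8(1) i by blast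
  next
    case False
    show ?thesis unfolding column_None_E67(1)[OF False i young_ground_column] using c0 False by (auto split: if_splits)
  qed
  have "0 < length (ground_phases t)" by (cases t) simp_all
  then show m: "max 0 (column_wt t (Suc r) i (ground_column t (Suc r))) = max 0 (- column_wt t r i (ground_column t r))"
    unfolding column_wt_ground[OF i'] using ground_level_Suc[OF _ i', of "r mod length (ground_phases t)"]
    by (simp add: mod_Suc_eq)
  show "column_f t (wall_pattern t (Suc r)) i (ground_column t (Suc r)) \<noteq> None \<longleftrightarrow>
      column_e t (wall_pattern t r) i (ground_column t r) \<noteq> None"
  proof (cases "t = E8")
    case True
    then show ?thesis using ground_column_None_E8 i by blast
  next
    case False
    show ?thesis unfolding column_None_E67[OF False i young_ground_column] using m by linarith
  qed
qed

theorem theorem5p2: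
  fixes t :: affine_type
    and H :: "block set set \<times> block set set \<Rightarrow> int"
    and m :: "nat \<Rightarrow> int"
    and \<iota> :: "nat \<Rightarrow> block set \<Rightarrow> int \<times> block set set"
  assumes "energy_function t H"
    and "ground_exponents t H m"
    and "column_identification t m \<iota>"
  shows "affine_crystal t (Z_Lambda0 t H \<iota>) (wall_e t \<iota>) (wall_f t \<iota>)
           (wall_eps t \<iota>) (wall_phi t \<iota>) (wall_wt t)"
proof -
  interpret column_crystals t "column_wt t" by (rule column_crystals_column_wt)
  interpret wall_crystal t "column_wt t" H m \<iota> by unfold_locales (rule assms(1) assms(3))+
  show ?thesis by (rule affine_crystal_Z_Lambda0)
qed

end
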